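(* Let $\gamma\in\mathbb{R}$ and let $V\in C^\infty([0,\infty))$ be real-valued with $\int_0^\infty(1+x)|V(x)|\,dx<\infty$ and such that for some $\rho\in(1,2]$ and constants $C_j$ one has $|V^{(j)}(x)|\le C_j(1+x)^{-\rho-j}$ for all $x\ge0$ and $j=0,1,2,\dots$. Let $\lambda_1,\dots,\lambda_N$ be the negative eigenvalues of the operator $H=-\frac{d^2}{dx^2}+V$ in $L_2(0,\infty)$ with boundary condition $u'(0)=\gamma u(0)$, let $a(k)$ and $\eta(k)$ be the limit amplitude and limit phase, and let $\ell_n$ and $M_s(\gamma)$ be as defined in the context. Then $$\sum_{j=1}^N|\lambda_j|^{1/2}-M_{1/2}(\gamma)-\frac1\pi\int_0^\infty\ln a(k)\,dk=\frac14\ell_1,$$ and for every integer $n\ge1$, $$\sum_{j=1}^N|\lambda_j|^n-M_n(\gamma)+(-1)^n\frac{2n}{\pi}\int_0^\infty\Big(\eta(k)-\sum_{j=0}^{n-1}(-1)^{j+1}\ell_{2j+1}(2k)^{-2j-1}\Big)k^{2n-1}\,dk=-\frac{n}{2^{2n}}\ell_{2n},$$ $$\sum_{j=1}^N|\lambda_j|^{n+1/2}-M_{n+1/2}(\gamma)+(-1)^{n+1}\frac{2n+1}{\pi}\int_0^\infty\Big(\ln a(k)-\sum_{j=1}^{n}(-1)^j\ell_{2j}(2k)^{-2j}\Big)k^{2n}\,dk=\frac{2n+1}{2^{2n+2}}\ell_{2n+1}.$$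
   Context: The operator $H$ is defined through the quadratic form $\int_0^\infty(|u'|^2+V|u|^2)\,dx+\gamma|u(0)|^2$ with form domain $H^1(0,\infty)$; under the moment condition it has only finitely many ($N$) negative eigenvalues. For $\zeta\neq0$, $\operatorname{Im}\zeta\ge0$, the Jost solution $\theta(x,\zeta)$ is the unique solution of $-u''+Vu=\zeta^2u$ on $x>0$ with $\theta(x,\zeta)=e^{i\zeta x}(1+o(1))$, $\theta'(x,\zeta)=i\zeta e^{i\zeta x}(1+o(1))$ as $x\to\infty$ (prime $=d/dx$). The Jost function is $w(\zeta)=\gamma\theta(0,\zeta)-\theta'(0,\zeta)$; it does not vanish at real $k>0$ and $w(\zeta)/(\gamma-i\zeta)\to1$ as $|\zeta|\to\infty$. The limit amplitude $a(k)>0$ and limit phase $\eta(k)\in\mathbb{R}$, $k>0$, are defined by $w(k)=a(k)e^{i\eta(k)}(\gamma-ik)$, i.e. $a(k)=|w(k)|/\sqrt{\gamma^2+k^2}$, where $\eta$ is the continuous branch on $(0,\infty)$ with $\eta(k)\to0$ as $k\to\infty$. Define $b_0(x)=1$, $b_{n+1}(x)=-b_n'(x)-\int_x^\infty V(y)b_n(y)\,dy$; then $d_0=1$, $d_n=b_n(0)+2\sum_{m=1}^{n-1}b_m'(0)(2\gamma)^{n-m-1}$ for $n\ge1$ (with $(2\gamma)^0=1$); then $\ell_1=d_1$ and $\ell_n=d_n-n^{-1}\sum_{j=1}^{n-1}j\,d_{n-j}\,\ell_j$ for $n\ge2$. For $s\in\mathbb{C}$ set $M_s(\gamma)=(-\gamma)^{2s}$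 if $\gamma<0$ and $M_s(\gamma)=0$ if $\gamma\ge0$. *)

theory Defs
  imports "HOL-Analysis.Analysis"
begin

text \<open>Functions on the closed half-line are represented by functions on all of \<open>real\<close>; their values
  at negative arguments are irrelevant. Derivatives are relative to \<open>{0..}\<close>, hence one-sided at \<open>0\<close>
  and two-sided at \<open>x > 0\<close>.\<close>

definition half_deriv :: "(real \<Rightarrow> 'a::real_normed_vector) \<Rightarrow> real \<Rightarrow> 'a" where
  "half_deriv f x = vector_derivative f (at x within {0..})"

definition smooth_half :: "(real \<Rightarrow> real) \<Rightarrow> bool" where
  "smooth_half f \<longleftrightarrow> (\<forall>j. (half_deriv ^^ j) f differentiable_on {0..})"


subsection \<open>The operator\<close>

definition L2_half :: "(real \<Rightarrow> complex) \<Rightarrow> bool" where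
  "L2_half f \<longleftrightarrow> set_borel_measurable lborel {0..} f \<and>
     set_integrable lborel {0..} (\<lambda>x. (cmod (f x))\<^sup>2)"

definition L2_inner :: "(real \<Rightarrow> complex) \<Rightarrow> (real \<Rightarrow> complex) \<Rightarrow> complex" where
  "L2_inner f g = (LINT x:{0..}|lborel. f x * cnj (g x))"

text \<open>\<open>H1_half u u'\<close>: \<open>u\<close> is the continuous representative of an element of the Sobolev space
  \<open>H^1(0,\<infinity>)\<close>, and \<open>u'\<close> (determined almost everywhere by \<open>u\<close>) is its weak derivative.\<close>

definition H1_half :: "(real \<Rightarrow> complex) \<Rightarrow> (real \<Rightarrow> complex) \<Rightarrow> bool" where
  "H1_half u u' \<longleftrightarrow> L2_half u \<and> L2_half u' \<and>
     (\<forall>x\<ge>0. u x = u 0 + (LINT t:{0..x}|lborel. u' t))"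

text \<open>The sesquilinear form whose diagonal is
  \<open>\<integral>(|u'|^2 + V |u|^2) dx + \<gamma> |u(0)|^2\<close>.\<close>

definition schr_form ::
  "(real \<Rightarrow> real) \<Rightarrow> real \<Rightarrow> (real \<Rightarrow> complex) \<Rightarrow> (real \<Rightarrow> complex) \<Rightarrow>
   (real \<Rightarrow> complex) \<Rightarrow> (real \<Rightarrow> complex) \<Rightarrow> complex" where
  "schr_form V \<gamma> u u' v v' =
     (LINT x:{0..}|lborel. u' x * cnj (v' x) + of_real (V x) * u x * cnj (v x))
     + of_real \<gamma> * u 0 * cnj (v 0)"

text \<open>The graph of the operator \<open>H\<close> associated with the form: \<open>u\<close> is in the domain and \<open>H u = f\<close>.
  The boundary condition \<open>u'(0) = \<gamma> u(0)\<close> is the natural one of the form.\<close>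

definition schr_op ::
  "(real \<Rightarrow> real) \<Rightarrow> real \<Rightarrow> (real \<Rightarrow> complex) \<Rightarrow> (real \<Rightarrow> complex) \<Rightarrow> bool" where
  "schr_op V \<gamma> u f \<longleftrightarrow> L2_half f \<and>
     (\<exists>u'. H1_half u u' \<and> (\<forall>v v'. H1_half v v' \<longrightarrow> schr_form V \<gamma> u u' v v' = L2_inner f v))"

definition neg_eigenvalues :: "(real \<Rightarrow> real) \<Rightarrow> real \<Rightarrow> real set" where
  "neg_eigenvalues V \<gamma> =
     {ev. ev < 0 \<and> (\<exists>u. (\<exists>x\<ge>0. u x \<noteq> 0) \<and> schr_op V \<gamma> u (\<lambda>x. of_real ev * u x))}"


subsection \<open>Jost solution, Jost function, limit amplitude and phase\<close>

definition is_jost_solution :: "(real \<Rightarrow> real) \<Rightarrow> complex \<Rightarrow> (real \<Rightarrow> complex) \<Rightarrow> bool" where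
  "is_jost_solution V \<zeta> \<theta> \<longleftrightarrow>
     \<theta> differentiable_on {0..} \<and> half_deriv \<theta> differentiable_on {0..} \<and>
     (\<forall>x>0. - half_deriv (half_deriv \<theta>) x + of_real (V x) * \<theta> x = \<zeta>\<^sup>2 * \<theta> x) \<and>
     ((\<lambda>x. \<theta> x / exp (\<i> * \<zeta> * of_real x)) \<longlongrightarrow> 1) at_top \<and>
     ((\<lambda>x. half_deriv \<theta> x / (\<i> * \<zeta> * exp (\<i> * \<zeta> * of_real x))) \<longlongrightarrow> 1) at_top"

text \<open>Meaningful for \<open>\<zeta> \<noteq> 0\<close>, \<open>Im \<zeta> \<ge> 0\<close>. Here and in \<open>limit_phase\<close> the value \<open>0\<close> outside the
  domain only serves to make the function of type \<open>real \<Rightarrow> _\<close> unique.\<close>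

definition jost_solution :: "(real \<Rightarrow> real) \<Rightarrow> complex \<Rightarrow> real \<Rightarrow> complex" where
  "jost_solution V \<zeta> = (THE \<theta>. is_jost_solution V \<zeta> \<theta> \<and> (\<forall>x<0. \<theta> x = 0))"

definition jost_function :: "(real \<Rightarrow> real) \<Rightarrow> real \<Rightarrow> complex \<Rightarrow> complex" where
  "jost_function V \<gamma> \<zeta> =
     of_real \<gamma> * jost_solution V \<zeta> 0 - half_deriv (jost_solution V \<zeta>) 0"

definition limit_amplitude :: "(real \<Rightarrow> real) \<Rightarrow> real \<Rightarrow> real \<Rightarrow> real" where
  "limit_amplitude V \<gamma> k = cmod (jost_function V \<gamma> (of_real k)) / sqrt (\<gamma>\<^sup>2 + k\<^sup>2)"

definition limit_phase :: "(real \<Rightarrow> real) \<Rightarrow> real \<Rightarrow> real \<Rightarrow> real" where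
  "limit_phase V \<gamma> = (THE \<eta>.
     continuous_on {0<..} \<eta> \<and> (\<eta> \<longlongrightarrow> 0) at_top \<and>
     (\<forall>k>0. jost_function V \<gamma> (of_real k) =
        of_real (limit_amplitude V \<gamma> k) * exp (\<i> * of_real (\<eta> k)) *
        (of_real \<gamma> - \<i> * of_real k)) \<and>
     (\<forall>k\<le>0. \<eta> k = 0))"


subsection \<open>Asymptotic coefficients\<close>

primrec b_coeff :: "(real \<Rightarrow> real) \<Rightarrow> nat \<Rightarrow> real \<Rightarrow> real" where
  "b_coeff V 0 = (\<lambda>x. 1)"
| "b_coeff V (Suc n) =
     (\<lambda>x. - half_deriv (b_coeff V n) x - (LINT y:{x..}|lborel. V y * b_coeff V n y))"

definition d_coeff :: "(real \<Rightarrow> real) \<Rightarrow> real \<Rightarrow> nat \<Rightarrow> real" where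
  "d_coeff V \<gamma> n = (if n = 0 then 1 else
     b_coeff V n 0 + 2 * (\<Sum>m=1..n-1. half_deriv (b_coeff V m) 0 * (2 * \<gamma>) ^ (n - m - 1)))"

text \<open>The value at \<open>n = 0\<close> is a dummy; for \<open>n = 1\<close> the sum is empty.\<close>

fun l_coeff :: "(real \<Rightarrow> real) \<Rightarrow> real \<Rightarrow> nat \<Rightarrow> real" where
  "l_coeff V \<gamma> n = (if n = 0 then 0 else
     d_coeff V \<gamma> n - (\<Sum>j\<in>{1..<n}. real j * d_coeff V \<gamma> (n - j) * l_coeff V \<gamma> j) / real n)"

declare l_coeff.simps [simp del]

text \<open>Polymorphic in the exponent, which may be complex or real.\<close>

definition M_term :: "'a::ln \<Rightarrow> real \<Rightarrow> 'a" where
  "M_term s \<gamma> = (if \<gamma> < 0 then of_real (- \<gamma>) powr (2 * s) else 0)"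

end

(* Remove from w(z) / (gamma - i z) the zeros i kappa of w (kappa^2 = |lambda_j|) and, if gamma < 0,
   the zero i |gamma| of gamma - i z by Blaschke factors.  The quotient has no zeros in the upper
   half-plane, and its logarithm G vanishing at infinity extends continuously to the real line without 0,
   with G(-k) = cnj (G k) and an asymptotic expansion in powers of (2 i z)^(-1) whose coefficients are
   l_n plus power sums of the kappa and of |gamma|.  On the real line Re G = ln a, and Im G is eta plus
   arctangents coming from the Blaschke factors, whose subtracted moments are elementary.  Cauchy's
   theorem for z^(m-1) G minus the leading part of its expansion, on large half-discs, turns the m-th
   coefficient into the m-th moment of Re G (m odd) or Im G (m even).  If w(0) = 0, a Wronskian identity
   still bounds |w(z)| below by a multiple of |Re z| near 0, so G has at most a logarithmic singularity
   there. *)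

theory Submission
  imports Defs "HOL-Complex_Analysis.Complex_Analysis"
begin

text \<open>The first moment of V is what reaches z = 0: with theta = exp (i z x) b, the function b
  solves a Volterra equation whose kernel (exp (2 i z (y - x)) - 1) / (2 i z) is bounded by y - x on
  the whole closed half-plane, and by 1 / |z|, which governs large z. The threshold z = 0 is the
  obstacle. Zeros of w on the imaginary axis might accumulate there; two eigenfunctions with small
  decay rates would both be positive far out, and their overlap would be too large for
  orthogonality. The argument of w must stay bounded near 0 even if w(0) = 0; on each quarter-disc w
  is a constant times a quotient of continuous functions with positive real part. The contour runs
  at height epsilon and is lowered under a majorant 1 / sqrt |k|. Eigenvalues are those of the
  quadratic form, so zeros of w are matched with weak eigenfunctions, in both directions. Blaschke
  factors are unimodular on the real line, so they leave ln a alone and enter the half-integer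
  identities through the odd coefficients; the even coefficients do not contain them, and in the
  integer identities the eigenvalues come from arctangent moments.\<close>

section \<open>Calculus on half-lines and integrals depending on a parameter\<close>

lemma set_integral_split_halfline:
  fixes g :: "real \<Rightarrow> 'a::euclidean_space"
  assumes g: "set_integrable lborel {a..} g" and "a \<le> x"
  shows "(LINT y:{a..}|lborel. g y) = integral {a..x} g + (LINT y:{x..}|lborel. g y)"
proof -
  have 1: "set_integrable lborel {x..} g" "set_integrable lborel {a..x} g"
    using \<open>a \<le> x\<close> by (auto intro: set_integrable_subset[OF g])
  have un: "{a..} = {a..x} \<union> {x..}" using \<open>a \<le> x\<close> by auto
  have "integral ({a..x} \<union> {x..}) g = integral {a..x} g + integral {x..} g"
  proof (rule integral_Un)
    have "{a..x} \<inter> {x..} = {x}" using \<open>a \<le> x\<close> by auto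
    then show "negligible ({a..x} \<inter> {x..})" by simp
  qed (use 1 set_borel_integral_eq_integral in auto)
  then show ?thesis
    using set_borel_integral_eq_integral(2)[OF 1(1)] set_borel_integral_eq_integral(2)[OF g]
    unfolding un by simp
qed

lemma tail_integral_has_vector_derivative:
  fixes g :: "real \<Rightarrow> 'a::euclidean_space"
  assumes cont: "continuous_on {0..} g" and g: "set_integrable lborel {0..} g" and "0 \<le> x"
  shows "((\<lambda>x. LINT y:{x..}|lborel. g y) has_vector_derivative - g x) (at x within {0..})"
proof -
  have "((\<lambda>u. integral {0..u} g) has_vector_derivative g x) (at x within {0..x+1})"
    by (rule integral_has_vector_derivative) (use \<open>0 \<le> x\<close> in \<open>auto intro: continuous_on_subset[OF cont]\<close>)
  moreover have "at x within {0..x+1} = at x within {0..}"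
    by (rule at_within_nhd[of x "{..<x+1}"]) auto
  ultimately have "((\<lambda>u. (LINT y:{0..}|lborel. g y) - integral {0..u} g) has_vector_derivative 0 - g x) (at x within {0..})"
    by (intro has_vector_derivative_diff) auto
  then have "((\<lambda>u. (LINT y:{0..}|lborel. g y) - integral {0..u} g) has_vector_derivative - g x) (at x within {0..})"
    by simp
  then show ?thesis
    by (rule has_vector_derivative_transform[rotated 2])
       (use \<open>0 \<le> x\<close> set_integral_split_halfline[OF g] in auto)
qed

lemma tail_integral_tendsto_0:
  fixes g :: "real \<Rightarrow> 'a::euclidean_space"
  assumes g: "set_integrable lborel {a..} g"
  shows "((\<lambda>x. LINT y:{x..}|lborel. g y) \<longlongrightarrow> 0) at_top"
proof -
  have "((\<lambda>x. LINT y:{a..x}|lborel. g y) \<longlongrightarrow> (LINT y:{a..}|lborel. g y)) at_top"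
    by (rule tendsto_set_lebesgue_integral_at_top) (use g in auto)
  then have "((\<lambda>x. (LINT y:{a..}|lborel. g y) - (LINT y:{a..x}|lborel. g y)) \<longlongrightarrow>
      (LINT y:{a..}|lborel. g y) - (LINT y:{a..}|lborel. g y)) at_top"
    by (intro tendsto_intros)
  then have *: "((\<lambda>x. (LINT y:{a..}|lborel. g y) - (LINT y:{a..x}|lborel. g y)) \<longlongrightarrow> 0) at_top"
    by simp
  show ?thesis
  proof (rule Lim_transform_eventually[OF *])
    show "\<forall>\<^sub>F x in at_top. (LINT y:{a..}|lborel. g y) - (LINT y:{a..x}|lborel. g y) = (LINT y:{x..}|lborel. g y)"
      using eventually_ge_at_top[of a]
    proof eventually_elim
      case (elim x)
      have "(LINT y:{a..x}|lborel. g y) = integral {a..x} g"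
        by (rule set_borel_integral_eq_integral(2)) (rule set_integrable_subset[OF g], auto)
      then show ?case using set_integral_split_halfline[OF g elim] by simp
    qed
  qed
qed

text \<open>Solutions here are known at infinity rather than at 0, so estimates run backwards: the
  increment over \<open>{a..X}\<close> is at most the integral of g, and the value at X dies out as
  X grows.\<close>

lemma norm_le_tail_integral:
  fixes f :: "real \<Rightarrow> 'a::euclidean_space"
  assumes d: "\<And>x. a \<le> x \<Longrightarrow> (f has_vector_derivative f' x) (at x within {a..})"
    and le: "\<And>x. a \<le> x \<Longrightarrow> norm (f' x) \<le> g x"
    and g: "set_integrable lborel {a..} g"
    and lim: "(f \<longlongrightarrow> 0) at_top"
  shows "norm (f a) \<le> (LINT y:{a..}|lborel. g y)"
proof -
  let ?G = "LINT y:{a..}|lborel. g y"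
  have *: "norm (f a) \<le> norm (f X) + ?G" if "a \<le> X" for X
  proof -
    have f': "(f' has_integral (f X - f a)) {a..X}"
      using that by (intro fundamental_theorem_of_calculus)
        (auto intro: has_vector_derivative_within_subset[OF d])
    have gi: "g integrable_on {a..X}"
      by (intro set_borel_integral_eq_integral(1) set_integrable_subset[OF g]) auto
    have "norm (integral {a..X} f') \<le> integral {a..X} g"
      by (rule integral_norm_bound_integral) (use f' gi le in auto)
    then have "norm (f X - f a) \<le> integral {a..X} g"
      using f' by (simp add: integral_unique)
    also have "\<dots> \<le> ?G"
    proof -
      have "0 \<le> g x" if "x \<ge> a" for x using le[OF that] norm_ge_zero order_trans by blast
      then have "0 \<le> (LINT y:{X..}|lborel. g y)"
        using that unfolding set_lebesgue_integral_def
        by (intro integral_nonneg_AE) (auto simp: indicator_def)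
      then show ?thesis using set_integral_split_halfline[OF g that] by simp
    qed
    finally have 1: "norm (f X - f a) \<le> ?G" .
    have "norm (f a) = norm (f X - (f X - f a))" by simp
    also have "\<dots> \<le> norm (f X) + norm (f X - f a)" by (rule norm_triangle_ineq4)
    finally show ?thesis using 1 by simp
  qed
  have "((\<lambda>X. norm (f X) + ?G) \<longlongrightarrow> 0 + ?G) at_top"
    by (intro tendsto_intros tendsto_norm_zero lim)
  then have "norm (f a) \<le> 0 + ?G"
    by (rule tendsto_lowerbound) (use * in \<open>auto simp: eventually_at_top_linorder intro!: exI[of _ a]\<close>)
  then show ?thesis by simp
qed

text \<open>Comparison from infinity. Applied to a difference whose derivative has a sign, it yields
  the one-sided bounds for weighted tails, Wronskians and remainders of the arctangent.\<close>

lemma nonpos_if_increasing_to_0: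
  fixes f :: "real \<Rightarrow> real"
  assumes d: "\<And>x. a \<le> x \<Longrightarrow> (f has_vector_derivative f' x) (at x within {a..})"
    and le: "\<And>x. a \<le> x \<Longrightarrow> 0 \<le> f' x"
    and lim: "(f \<longlongrightarrow> 0) at_top"
  shows "f a \<le> 0"
proof -
  have *: "f a \<le> f X" if "a \<le> X" for X
  proof -
    have "(f' has_integral (f X - f a)) {a..X}"
      using that by (intro fundamental_theorem_of_calculus)
        (auto intro: has_vector_derivative_within_subset[OF d])
    then have "0 \<le> f X - f a" by (rule has_integral_nonneg) (use le in auto)
    then show ?thesis by simp
  qed
  show ?thesis
    by (rule tendsto_lowerbound[OF lim]) (use * in \<open>auto simp: eventually_at_top_linorder intro!: exI[of _ a]\<close>)
qed

text \<open>A nonzero limit keeps the norm above half of it from some point on, so its integral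
  would grow linearly. This discards boundary terms at infinity when a factor is known only to be
  square integrable.\<close>

lemma integrable_halfline_limit_eq_0:
  fixes f :: "real \<Rightarrow> 'a::euclidean_space"
  assumes f: "set_integrable lborel {a..} f" and lim: "(f \<longlongrightarrow> L) at_top"
  shows "L = 0"
proof (rule ccontr)
  assume "L \<noteq> 0"
  have "((\<lambda>x. norm (f x)) \<longlongrightarrow> norm L) at_top" by (intro tendsto_intros lim)
  then have "\<forall>\<^sub>F x in at_top. norm (f x) > norm L / 2"
    by (rule order_tendstoD) (use \<open>L \<noteq> 0\<close> in simp)
  then obtain X where X: "\<And>x. x \<ge> X \<Longrightarrow> norm (f x) > norm L / 2"
    by (auto simp: eventually_at_top_linorder)
  let ?c = "norm L / 2" let ?Y = "max a X"
  have nf: "set_integrable lborel {a..} (\<lambda>x. norm (f x))"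
    using f by (simp add: set_integrable_norm)
  have "((\<lambda>x. LINT y:{?Y..x}|lborel. norm (f y)) \<longlongrightarrow> (LINT y:{?Y..}|lborel. norm (f y))) at_top"
    by (rule tendsto_set_lebesgue_integral_at_top)
       (use set_integrable_subset[OF nf] in auto)
  moreover have "filterlim (\<lambda>x. LINT y:{?Y..x}|lborel. norm (f y)) at_top at_top"
  proof (rule filterlim_at_top_mono)
    show "filterlim (\<lambda>x. ?c * (x - ?Y)) at_top at_top"
      using \<open>L \<noteq> 0\<close> filterlim_tendsto_add_at_top[OF tendsto_const[of "-?Y" at_top] filterlim_ident]
      by (intro filterlim_tendsto_pos_mult_at_top[OF tendsto_const]) auto
    show "\<forall>\<^sub>F x in at_top. ?c * (x - ?Y) \<le> (LINT y:{?Y..x}|lborel. norm (f y))"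
      using eventually_ge_at_top[of ?Y]
    proof eventually_elim
      case (elim x)
      have "(LINT y:{?Y..x}|lborel. ?c) \<le> (LINT y:{?Y..x}|lborel. norm (f y))"
      proof (rule set_integral_mono)
        show "set_integrable lborel {?Y..x} (\<lambda>y. ?c)"
          by (intro borel_integrable_atLeastAtMost' continuous_intros)
        show "set_integrable lborel {?Y..x} (\<lambda>y. norm (f y))"
          by (rule set_integrable_subset[OF nf]) auto
      qed (use X in \<open>auto simp: less_imp_le\<close>)
      moreover have "(LINT y:{?Y..x}|lborel. ?c) = ?c * (x - ?Y)"
        using elim by (subst set_integral_const) (auto simp: mult.commute)
      ultimately show ?case by simp
    qed
  qed
  ultimately show False
    using not_tendsto_and_filterlim_at_infinity[OF _ _ filterlim_at_top_imp_at_infinity]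
    by (metis trivial_limit_at_top_linorder)
qed

lemma second_order_ode_unique:
  fixes u u' q :: "real \<Rightarrow> complex"
  assumes u: "\<And>x. 0 \<le> x \<Longrightarrow> (u has_vector_derivative u' x) (at x within {0..})"
    and u': "\<And>x. 0 \<le> x \<Longrightarrow> (u' has_vector_derivative q x * u x) (at x within {0..})"
    and q: "continuous_on {0..} q" and "u 0 = 0" "u' 0 = 0" "0 \<le> X"
  shows "u X = 0"
proof -
  have "bounded (q ` {0..X})"
    by (intro compact_imp_bounded compact_continuous_image continuous_on_subset[OF q]) auto
  then obtain B where "\<forall>x\<in>q ` {0..X}. norm x \<le> B" by (auto simp only: bounded_iff)
  then have B: "\<And>x. x \<in> {0..X} \<Longrightarrow> norm (q x) \<le> B" by simp
  \<comment> \<open>Gronwall's argument: since \<open>norm (q x) \<le> B\<close>, Cauchy-Schwarz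
    bounds the derivative of |u|^2 + |u'|^2 by 1 + B times that quantity, so the weight
    \<open>exp (- M * x)\<close> makes E nonincreasing from its value 0 at the origin.\<close>
  define M where "M = 1 + B"
  define E where "E x = (u x \<bullet> u x + u' x \<bullet> u' x) * exp (- M * x)" for x
  define E' where "E' x = (2 * (u x \<bullet> u' x) + 2 * (u' x \<bullet> (q x * u x)) - M * (u x \<bullet> u x + u' x \<bullet> u' x)) * exp (- M * x)" for x
  have inner: "((\<lambda>x. f x \<bullet> f x) has_vector_derivative 2 * (f x \<bullet> d)) (at x within {0..})"
    if "(f has_vector_derivative d) (at x within {0..})" for f :: "real \<Rightarrow> complex" and d x
    using has_derivative_inner[OF that[unfolded has_vector_derivative_def] that[unfolded has_vector_derivative_def]]
    unfolding has_vector_derivative_def by (simp add: inner_commute algebra_simps)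
  have E: "(E has_vector_derivative E' x) (at x within {0..})" if "0 \<le> x" for x
  proof -
    have "((\<lambda>x. exp (- M * x)) has_vector_derivative - M * exp (- M * x)) (at x within {0..})"
      unfolding has_real_derivative_iff_has_vector_derivative[symmetric]
      by (auto intro!: derivative_eq_intros)
    from has_vector_derivative_mult[OF has_vector_derivative_add[OF inner[OF u[OF that]] inner[OF u'[OF that]]] this]
    show ?thesis unfolding E_def E'_def by (simp add: algebra_simps)
  qed
  have E'le: "E' x \<le> 0" if "x \<in> {0..X}" for x
  proof -
    have 1: "2 * (u x \<bullet> u' x) \<le> (norm (u x))\<^sup>2 + (norm (u' x))\<^sup>2"
      using norm_cauchy_schwarz[of "u x" "u' x"] sum_squares_bound[of "norm (u x)" "norm (u' x)"] by linarith
    have "u' x \<bullet> (q x * u x) \<le> norm (u' x) * (norm (q x) * norm (u x))"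
      using norm_cauchy_schwarz[of "u' x" "q x * u x"] by (simp add: norm_mult)
    also have "\<dots> \<le> norm (u' x) * (B * norm (u x))"
      by (intro mult_left_mono mult_right_mono B that) auto
    finally have "2 * (u' x \<bullet> (q x * u x)) \<le> B * (2 * norm (u' x) * norm (u x))" by (simp add: algebra_simps)
    also have "\<dots> \<le> B * ((norm (u' x))\<^sup>2 + (norm (u x))\<^sup>2)"
      using order_trans[OF norm_ge_zero B[OF that]]
      by (intro mult_left_mono sum_squares_bound) auto
    finally show ?thesis
      using 1 unfolding E'_def M_def
      by (intro mult_nonpos_nonneg) (auto simp: dot_square_norm algebra_simps)
  qed
  have "(E' has_integral (E X - E 0)) {0..X}"
    using \<open>0 \<le> X\<close> by (intro fundamental_theorem_of_calculus)
      (auto intro: has_vector_derivative_within_subset[OF E])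
  then have "0 \<le> - (E X - E 0)"
    by (rule has_integral_nonneg[OF has_integral_neg]) (use E'le in auto)
  moreover have "E 0 = 0" unfolding E_def using assms by simp
  ultimately have "u X \<bullet> u X + u' X \<bullet> u' X \<le> 0"
    unfolding E_def by (simp add: mult_le_0_iff)
  then show ?thesis
    by (metis add_nonneg_eq_0_iff antisym inner_eq_zero_iff inner_ge_zero add_nonneg_nonneg)
qed

text \<open>Only the functions are dominated, not their derivatives. Cauchy's inequality on discs of
  radius s = r / 2 around the points of \<open>ball z s\<close>, which stay inside
  \<open>cball z r\<close>, turns the majorant g into g / s for the derivatives and so for the
  difference quotients; then dominated convergence applies.\<close>

lemma holomorphic_on_lebesgue_integral:
  fixes f :: "'a \<Rightarrow> complex \<Rightarrow> complex"
  assumes "open U"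
    and hol: "\<And>y. y \<in> space M \<Longrightarrow> f y holomorphic_on U"
    and meas: "\<And>z. z \<in> U \<Longrightarrow> (\<lambda>y. f y z) \<in> borel_measurable M"
    and bnd: "\<And>y z. y \<in> space M \<Longrightarrow> z \<in> U \<Longrightarrow> norm (f y z) \<le> g y"
    and g: "integrable M g"
  shows "(\<lambda>z. \<integral>y. f y z \<partial>M) holomorphic_on U"
proof -
  have int: "integrable M (\<lambda>y. f y z)" if "z \<in> U" for z
  proof (rule Bochner_Integration.integrable_bound[OF g meas[OF that]])
    show "AE y in M. norm (f y z) \<le> norm (g y)"
      by (intro AE_I2) (auto intro!: order_trans[OF bnd[OF _ that]])
  qed
  have "\<exists>D. ((\<lambda>z. \<integral>y. f y z \<partial>M) has_field_derivative D) (at z)" if zU: "z \<in> U" for z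
  proof -
    obtain r where "r > 0" and r: "cball z r \<subseteq> U"
      using open_contains_cball[THEN iffD1, rule_format, OF \<open>open U\<close> zU] by auto
    define s where "s = r / 2"
    have "s > 0" using \<open>r > 0\<close> by (simp add: s_def)
    have db: "norm (deriv (f y) w) \<le> g y / s" if y: "y \<in> space M" and w: "w \<in> ball z s" for y w
    proof -
      have sub: "cball w s \<subseteq> cball z r"
        using w by (intro cball_subset_cball_iff[THEN iffD2]) (auto simp: s_def dist_commute)
      have "norm ((deriv ^^ 1) (f y) w) \<le> fact 1 * g y / s ^ 1"
      proof (rule Cauchy_inequality)
        show "f y holomorphic_on ball w s"
          using sub r ball_subset_cball by (intro holomorphic_on_subset[OF hol[OF y]]) blast
        show "continuous_on (cball w s) (f y)"
          using sub r by (intro holomorphic_on_imp_continuous_on holomorphic_on_subset[OF hol[OF y]]) blast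
        show "norm (f y x) \<le> g y" if "norm (w - x) = s" for x
          using sub r that by (intro bnd y) (auto simp: dist_norm subset_eq)
      qed (use \<open>s > 0\<close> in auto)
      then show ?thesis by simp
    qed
    define D where "D = (\<integral>y. deriv (f y) z \<partial>M)"
    have "((\<lambda>w. ((\<integral>y. f y w \<partial>M) - (\<integral>y. f y z \<partial>M)) / (w - z)) \<longlongrightarrow> D) (at z within ball z s)"
      unfolding tendsto_at_iff_sequentially
    proof (intro allI impI)
      fix X assume X: "\<forall>i. X i \<in> ball z s - {z}" "X \<longlonglongrightarrow> z"
      have XU: "X i \<in> U" "X i \<in> ball z s" "X i \<noteq> z" for i
      proof -
      have "dist z (X i) < r / 2" using X(1) by (auto simp: s_def)
      then have "X i \<in> cball z r" using \<open>r > 0\<close> by simp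
      then show "X i \<in> U" using r by blast
    qed (use X(1) in auto)
      have "(\<lambda>i. \<integral>y. (f y (X i) - f y z) / (X i - z) \<partial>M) \<longlonglongrightarrow> D"
        unfolding D_def
      proof (rule integral_dominated_convergence)
        have *: "(\<lambda>i. (f y (X i) - f y z) / (X i - z)) \<longlonglongrightarrow> deriv (f y) z" if y: "y \<in> space M" for y
        proof -
          have "(f y has_field_derivative deriv (f y) z) (at z)"
            using holomorphic_derivI[OF hol[OF y] \<open>open U\<close> \<open>z \<in> U\<close>] .
          then have "((\<lambda>w. (f y w - f y z) / (w - z)) \<longlongrightarrow> deriv (f y) z) (at z)"
            by (simp add: has_field_derivative_iff)
          then show ?thesis
            using XU X(2) unfolding tendsto_at_iff_sequentially comp_def by auto
        qed
        show "AE y in M. (\<lambda>i. (f y (X i) - f y z) / (X i - z)) \<longlonglongrightarrow> deriv (f y) z"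
          using * by auto
        show "integrable M (\<lambda>y. g y / s)" using g by auto
        show meas': "(\<lambda>y. (f y (X i) - f y z) / (X i - z)) \<in> borel_measurable M" for i
          using meas[OF XU(1)] meas[OF \<open>z \<in> U\<close>] by measurable
        show "(\<lambda>y. deriv (f y) z) \<in> borel_measurable M"
          by (rule borel_measurable_LIMSEQ_metric[OF meas' *])
        show "AE y in M. norm ((f y (X i) - f y z) / (X i - z)) \<le> g y / s" for i
        proof (intro AE_I2)
          fix y assume y: "y \<in> space M"
          have "norm (f y (X i) - f y z) \<le> g y / s * norm (X i - z)"
          proof (rule field_differentiable_bound[of "ball z s" "f y" "deriv (f y)"])
            show "(f y has_field_derivative deriv (f y) w) (at w within ball z s)" if "w \<in> ball z s" for w
            proof -
              have "w \<in> cball z r" using that \<open>r > 0\<close> by (simp add: s_def)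
              then have "w \<in> U" using r by blast
              show ?thesis
                by (rule has_field_derivative_at_within[OF holomorphic_derivI[OF hol[OF y] \<open>open U\<close> \<open>w \<in> U\<close>]])
            qed
          qed (use db[OF y] XU \<open>s > 0\<close> in auto)
          then show "norm ((f y (X i) - f y z) / (X i - z)) \<le> g y / s"
            using XU by (simp add: norm_divide divide_le_eq)
        qed
      qed
      moreover have "(\<integral>y. (f y (X i) - f y z) / (X i - z) \<partial>M) = ((\<integral>y. f y (X i) \<partial>M) - (\<integral>y. f y z \<partial>M)) / (X i - z)" for i
        using int XU \<open>z \<in> U\<close> by (simp add: Bochner_Integration.integral_diff)
      ultimately show "((\<lambda>w. ((\<integral>y. f y w \<partial>M) - (\<integral>y. f y z \<partial>M)) / (w - z)) \<circ> X) \<longlonglongrightarrow> D"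
        by (simp add: comp_def XU(3))
    qed
    moreover have "at z within ball z s = at z" using \<open>s > 0\<close> by (intro at_within_open) auto
    ultimately show ?thesis by (auto simp: has_field_derivative_iff)
  qed
  then show ?thesis using \<open>open U\<close> by (simp add: holomorphic_on_open)
qed

lemma integral_by_parts_AC:
  fixes p p' v v' :: "real \<Rightarrow> complex"
  assumes "0 \<le> X" and v': "set_integrable lborel {0..X} v'"
    and v: "\<And>x. x \<in> {0..X} \<Longrightarrow> v x = v 0 + (LINT t:{0..x}|lborel. v' t)"
    and p: "\<And>x. x \<in> {0..X} \<Longrightarrow> (p has_vector_derivative p' x) (at x within {0..X})"
    and p': "continuous_on {0..X} p'"
  shows "(LINT t:{0..X}|lborel. p t * v' t) = p X * v X - p 0 * v 0 - (LINT t:{0..X}|lborel. p' t * v t)"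
proof -
  define P where "P t = indicator {0..X} t *\<^sub>R p' t" for t
  define W where "W t = indicator {0..X} t *\<^sub>R v' t" for t
  have P: "integrable lborel P"
    unfolding P_def using borel_integrable_atLeastAtMost'[OF p'] by (simp add: set_integrable_def)
  have W: "integrable lborel W"
    unfolding W_def using v' by (simp add: set_integrable_def)
  have [measurable]: "P \<in> borel_measurable borel" "W \<in> borel_measurable borel"
    using P W by auto
  define F where "F s t = (if s \<le> t then W s * P t else 0)" for s t
  have F1: "integrable lborel (\<lambda>t. norm (F s t))" for s
    by (rule Bochner_Integration.integrable_bound[of _ "\<lambda>t. norm (W s) * norm (P t)"])
       (use P in \<open>auto simp: F_def norm_mult\<close>)
  have Fint: "integrable (lborel \<Otimes>\<^sub>M lborel) (case_prod F)"
  proof (rule lborel_pair.Fubini_integrable)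
    show "case_prod F \<in> borel_measurable (lborel \<Otimes>\<^sub>M lborel)"
      unfolding F_def by measurable
    show "AE s in lborel. integrable lborel (\<lambda>t. case_prod F (s, t))"
      using F1 by (auto simp: integrable_norm_iff F_def)
    have "integrable lborel (\<lambda>s. \<integral>t. norm (F s t) \<partial>lborel)"
    proof (rule Bochner_Integration.integrable_bound[of _ "\<lambda>s. norm (W s) * (\<integral>t. norm (P t) \<partial>lborel)"])
      show "integrable lborel (\<lambda>s. norm (W s) * (\<integral>t. norm (P t) \<partial>lborel))" using W by simp
      show "(\<lambda>s. \<integral>t. norm (F s t) \<partial>lborel) \<in> borel_measurable lborel"
        unfolding F_def by measurable
      have "(\<integral>t. norm (F s t) \<partial>lborel) \<le> (\<integral>t. norm (W s) * norm (P t) \<partial>lborel)" for s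
        using F1 P by (intro integral_mono) (auto simp: F_def norm_mult)
      then show "AE s in lborel. norm (\<integral>t. norm (F s t) \<partial>lborel) \<le> norm (norm (W s) * (\<integral>t. norm (P t) \<partial>lborel))"
        by (intro AE_I2) auto
    qed
    then show "integrable lborel (\<lambda>s. \<integral>t. norm (case_prod F (s, t)) \<partial>lborel)" by simp
  qed
  have Fub: "(\<integral>t. (\<integral>s. F s t \<partial>lborel) \<partial>lborel) = (\<integral>s. (\<integral>t. F s t \<partial>lborel) \<partial>lborel)"
    by (rule lborel_pair.Fubini_integral[OF Fint])
  have 1: "(\<integral>s. F s t \<partial>lborel) = indicator {0..X} t *\<^sub>R (p' t * (v t - v 0))" for t
  proof (cases "t \<in> {0..X}")
    case True
    have "(\<integral>s. F s t \<partial>lborel) = (\<integral>s. p' t * (indicator {0..t} s *\<^sub>R v' s) \<partial>lborel)"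
      using True by (intro Bochner_Integration.integral_cong) (auto simp: F_def W_def P_def indicator_def)
    also have "\<dots> = p' t * (\<integral>s. indicator {0..t} s *\<^sub>R v' s \<partial>lborel)"
      by (rule integral_mult_right_zero)
    also have "\<dots> = p' t * (v t - v 0)"
      by (subst v[OF True]) (simp add: set_lebesgue_integral_def)
    finally show ?thesis using True by simp
  next
    case False
    then have "F s t = 0" for s by (auto simp: F_def P_def)
    then show ?thesis using False by simp
  qed
  have ftc: "(\<integral>t. indicator {s..X} t *\<^sub>R p' t \<partial>lborel) = p X - p s" if "s \<in> {0..X}" for s
    by (rule integral_FTC_atLeastAtMost)
       (use that in \<open>auto intro: continuous_on_subset[OF p'] has_vector_derivative_within_subset[OF p]\<close>)
  have 2: "(\<integral>t. F s t \<partial>lborel) = indicator {0..X} s *\<^sub>R ((p X - p s) * v' s)" for s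
  proof (cases "s \<in> {0..X}")
    case True
    have "(\<integral>t. F s t \<partial>lborel) = (\<integral>t. v' s * (indicator {s..X} t *\<^sub>R p' t) \<partial>lborel)"
      using True by (intro Bochner_Integration.integral_cong) (auto simp: F_def W_def P_def indicator_def)
    also have "\<dots> = v' s * (\<integral>t. indicator {s..X} t *\<^sub>R p' t \<partial>lborel)"
      by (rule integral_mult_right_zero)
    also have "\<dots> = (p X - p s) * v' s" by (simp only: ftc[OF True] mult.commute)
    finally show ?thesis using True by simp
  next
    case False
    then have "F s t = 0" for t by (auto simp: F_def W_def)
    then show ?thesis using False by simp
  qed
  have pc: "continuous_on {0..X} p"
    by (auto simp: continuous_on_eq_continuous_within intro!: has_vector_derivative_continuous[OF p])
  have vc: "continuous_on {0..X} v"
  proof -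
    have "continuous_on {0..X} (\<lambda>x. v 0 + integral {0..x} v')"
      by (intro continuous_intros indefinite_integral_continuous_1 set_borel_integral_eq_integral(1) v')
    moreover have "v x = v 0 + integral {0..x} v'" if "x \<in> {0..X}" for x
      using v[OF that] that set_borel_integral_eq_integral(2)[OF set_integrable_subset[OF v', of "{0..x}"]] by auto
    ultimately show ?thesis using continuous_on_cong by (metis (no_types, lifting))
  qed
  have i1: "set_integrable lborel {0..X} (\<lambda>t. p' t * v t)" "set_integrable lborel {0..X} (\<lambda>t. p' t * v 0)"
    by (intro borel_integrable_atLeastAtMost' continuous_intros p' vc)+
  have i2: "set_integrable lborel {0..X} (\<lambda>t. p t * v' t)"
  proof -
    have "bounded (p ` {0..X})" by (intro compact_imp_bounded compact_continuous_image pc) auto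
    then obtain B where "\<forall>x\<in>p ` {0..X}. norm x \<le> B" by (auto simp only: bounded_iff)
    then have B: "\<And>x. x \<in> {0..X} \<Longrightarrow> norm (p x) \<le> B" by simp
    have pm: "(\<lambda>t. indicator {0..X} t *\<^sub>R p t) \<in> borel_measurable borel"
      using borel_measurable_continuous_on_indicator[OF _ pc] by simp
    have "(\<lambda>t. (indicator {0..X} t *\<^sub>R p t) * W t) \<in> borel_measurable borel"
      using pm by measurable
    moreover have "(\<lambda>t. (indicator {0..X} t *\<^sub>R p t) * W t) = (\<lambda>t. indicator {0..X} t *\<^sub>R (p t * v' t))"
      by (auto simp: W_def indicator_def fun_eq_iff)
    ultimately have m: "(\<lambda>t. indicator {0..X} t *\<^sub>R (p t * v' t)) \<in> borel_measurable lborel"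
      by (simp only: measurable_lborel2)
    show ?thesis
      unfolding set_integrable_def
      by (rule Bochner_Integration.integrable_bound[OF integrable_norm[OF W, THEN integrable_mult_right, of B] m])
         (auto simp: W_def indicator_def norm_mult intro!: AE_I2 order_trans[OF mult_right_mono[OF B] abs_ge_self])
  qed
  have "(LINT t:{0..X}|lborel. p' t * v t) - (LINT t:{0..X}|lborel. p' t * v 0)
      = (LINT t:{0..X}|lborel. p' t * (v t - v 0))"
    using i1 by (subst set_integral_diff(2)[symmetric]) (auto simp: algebra_simps)
  also have "\<dots> = (LINT s:{0..X}|lborel. (p X - p s) * v' s)"
    using Fub unfolding 1 2 by (simp add: set_lebesgue_integral_def)
  also have "\<dots> = (LINT s:{0..X}|lborel. p X * v' s) - (LINT s:{0..X}|lborel. p s * v' s)"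
    using i2 v' by (subst set_integral_diff(2)[symmetric]) (auto simp: algebra_simps)
  also have "(LINT s:{0..X}|lborel. p X * v' s) = p X * (v X - v 0)"
    using v[of X] \<open>0 \<le> X\<close> by simp
  finally show ?thesis
    using ftc[of 0] \<open>0 \<le> X\<close> by (simp add: set_lebesgue_integral_def algebra_simps)
qed

lemma continuous_on_lebesgue_integral:
  fixes f :: "'b::metric_space \<Rightarrow> 'a \<Rightarrow> 'c::{banach,second_countable_topology}"
  assumes meas: "\<And>p. p \<in> S \<Longrightarrow> f p \<in> borel_measurable M"
    and cont: "\<And>y. y \<in> space M \<Longrightarrow> continuous_on S (\<lambda>p. f p y)"
    and bnd: "\<And>p y. p \<in> S \<Longrightarrow> y \<in> space M \<Longrightarrow> norm (f p y) \<le> g y"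
    and g: "integrable M g"
  shows "continuous_on S (\<lambda>p. \<integral>y. f p y \<partial>M)"
  unfolding continuous_on_sequentially
proof (intro allI ballI impI)
  fix X a assume a: "a \<in> S" and X: "(\<forall>n. X n \<in> S) \<and> X \<longlonglongrightarrow> a"
  have "(\<lambda>n. \<integral>y. f (X n) y \<partial>M) \<longlonglongrightarrow> (\<integral>y. f a y \<partial>M)"
  proof (rule integral_dominated_convergence[OF _ _ g])
    show "AE y in M. (\<lambda>n. f (X n) y) \<longlonglongrightarrow> f a y"
      using cont a X unfolding continuous_on_sequentially comp_def by auto
  qed (use meas a X bnd in auto)
  then show "((\<lambda>p. \<integral>y. f p y \<partial>M) \<circ> X) \<longlonglongrightarrow> (\<integral>y. f a y \<partial>M)" by (simp add: comp_def)
qed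

section \<open>The kernel of the Volterra equation\<close>

abbreviation upper_closed :: "complex set" where "upper_closed \<equiv> {z. 0 \<le> Im z}"
abbreviation upper_open :: "complex set" where "upper_open \<equiv> {z. 0 < Im z}"

lemma open_upper_open: "open upper_open"
  by (rule open_halfspace_Im_gt)

text \<open>The removable singularity at 0 is filled in so that the kernel built from it is
  continuous across z = 0 and the Jost solution is controlled at the threshold.\<close>

definition expdiv :: "complex \<Rightarrow> complex" where
  "expdiv s = (if s = 0 then 1 else (exp s - 1) / s)"

lemma continuous_on_expdiv: "continuous_on A expdiv"
proof -
  have "isCont expdiv s" for s
  proof (cases "s = 0")
    case True
    have "(expdiv \<longlongrightarrow> 1) (at 0)"
      by (rule Lim_transform_eventually[OF lim_exp_minus_1])
         (auto simp: expdiv_def eventually_at_filter)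
    then show ?thesis using True by (simp add: isCont_def expdiv_def)
  next
    case False
    have "isCont (\<lambda>s. (exp s - 1) / s) s" using False by (intro continuous_intros) auto
    moreover have e: "\<forall>\<^sub>F t in nhds s. expdiv t = (exp t - 1) / t"
      using t1_space_nhds[OF False] by eventually_elim (auto simp: expdiv_def)
    ultimately show ?thesis using isCont_cong[OF e] by simp
  qed
  then show ?thesis using continuous_at_imp_continuous_on by blast
qed

lemma holomorphic_on_expdiv: "0 \<notin> A \<Longrightarrow> expdiv holomorphic_on A"
proof -
  assume "0 \<notin> A"
  then have "(\<lambda>s. (exp s - 1) / s) holomorphic_on A"
    by (intro holomorphic_intros) auto
  then show ?thesis
    by (rule holomorphic_transform) (use \<open>0 \<notin> A\<close> in \<open>auto simp: expdiv_def\<close>)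
qed

text \<open>On the convex half-plane Re s \<le> 0 the derivative of exp has modulus at most 1; the
  mean value inequality between 0 and s gives the bound.\<close>

lemma norm_expdiv_le_1:
  assumes "Re s \<le> 0" shows "norm (expdiv s) \<le> 1"
proof -
  have "norm (exp s - exp 0) \<le> 1 * norm (s - 0)"
  proof (rule field_differentiable_bound[of "{s. Re s \<le> 0}" exp exp])
    show "convex {s. Re s \<le> 0}" by (rule convex_halfspace_Re_le)
    show "(exp has_field_derivative exp z) (at z within {s. Re s \<le> 0})" for z
      by (rule has_field_derivative_at_within[OF DERIV_exp])
  qed (use assms in auto)
  then show ?thesis by (auto simp: expdiv_def norm_divide divide_le_eq)
qed

lemma cnj_expdiv: "cnj (expdiv s) = expdiv (cnj s)"
  by (simp add: expdiv_def exp_cnj)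

text \<open>The kernel \<open>\<integral>\<^bsub>0\<^esub>\<^bsup>y - x\<^esup> e\<^bsup>2 i z t\<^esup> dt\<close> for \<open>x \<le> y\<close>, extended by \<open>0\<close>.\<close>

definition volterra_kernel :: "real \<Rightarrow> real \<Rightarrow> complex \<Rightarrow> complex" where
  "volterra_kernel x y z = of_real (max (y - x) 0) * expdiv (2 * \<i> * z * of_real (y - x))"

lemma volterra_kernel_eq_0: "y \<le> x \<Longrightarrow> volterra_kernel x y z = 0"
  by (simp add: volterra_kernel_def max_def)

text \<open>The bound is uniform in z up to and including z = 0; its linear growth in y - x is what
  the first moment of V pays for.\<close>

lemma norm_volterra_kernel:
  assumes "z \<in> upper_closed" shows "norm (volterra_kernel x y z) \<le> max (y - x) 0"
proof (cases "x \<le> y")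
  case True
  then have "Re (2 * \<i> * z * of_real (y - x)) \<le> 0" using assms by (simp add: mult_nonneg_nonneg)
  then show ?thesis
    using mult_left_mono[OF norm_expdiv_le_1, of "2 * \<i> * z * of_real (y - x)" "y - x"] True
    by (simp add: volterra_kernel_def norm_mult max_def)
qed (simp add: volterra_kernel_eq_0)

text \<open>The reflection \<open>- cnj z\<close> in the imaginary axis conjugates
  \<open>\<i> * z\<close>. The symmetries of \<open>jb\<close>, of \<open>jw\<close> and of the
  logarithm on the real line all descend from this.\<close>

lemma volterra_kernel_cnj: "volterra_kernel x y (- cnj z) = cnj (volterra_kernel x y z)"
  by (simp add: volterra_kernel_def cnj_expdiv)

lemma continuous_on_volterra_kernel:
  assumes "continuous_on S f" "continuous_on S g" "continuous_on S h"
  shows "continuous_on S (\<lambda>p. volterra_kernel (f p) (g p) (h p))"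
  unfolding volterra_kernel_def
  by (intro continuous_intros assms continuous_on_compose2[OF continuous_on_expdiv[of UNIV]]) auto

lemma holomorphic_on_volterra_kernel: "0 \<notin> A \<Longrightarrow> volterra_kernel x y holomorphic_on A"
proof (cases "y \<le> x")
  case True
  then have "volterra_kernel x y = (\<lambda>z. 0)" by (simp add: fun_eq_iff volterra_kernel_eq_0)
  then show ?thesis by simp
next
  case False
  assume "0 \<notin> A"
  then have "(expdiv \<circ> (\<lambda>z. 2 * \<i> * z * of_real (y - x))) holomorphic_on A"
    using False by (intro holomorphic_on_compose holomorphic_intros holomorphic_on_expdiv) auto
  then show ?thesis unfolding volterra_kernel_def comp_def by (intro holomorphic_intros) auto
qed

section \<open>The Jost solution by successive approximation\<close>

locale jost_potential =
  fixes V :: "real \<Rightarrow> real"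
  assumes contV: "continuous_on {0..} V"
    and moment: "set_integrable lborel {0..} (\<lambda>x. (1 + x) * \<bar>V x\<bar>)"
begin

definition mom :: "real \<Rightarrow> real" where "mom x = (1 + x) * \<bar>V x\<bar>"
definition Q :: "real \<Rightarrow> real" where "Q x = (LINT y:{x..}|lborel. mom y)"
text \<open>The uniform bound for \<open>jb\<close>: the n-th iterate is at most
  \<open>(1/2)^n * exp (2 * Q 0)\<close>, and the geometric series contributes the factor 2.\<close>

definition bnd :: real where "bnd = 2 * exp (2 * Q 0)"

lemma bnd_pos: "bnd > 0" by (simp add: bnd_def)

lemma mom_nonneg: "0 \<le> x \<Longrightarrow> 0 \<le> mom x" by (simp add: mom_def)

lemma V_le_mom: "0 \<le> x \<Longrightarrow> \<bar>V x\<bar> \<le> mom x"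
  by (simp add: mom_def algebra_simps)

lemma cont_mom: "continuous_on {0..} mom"
  unfolding mom_def by (intro continuous_intros contV)

lemma int_mom: "set_integrable lborel {0..} mom"
  using moment by (simp add: mom_def[abs_def])

lemma set_integrable_halfline_bound:
  fixes f :: "real \<Rightarrow> 'b::euclidean_space"
  assumes "continuous_on {0..} f" "\<And>y. 0 \<le> y \<Longrightarrow> norm (f y) \<le> c * mom y"
  shows "set_integrable lborel {0..} f"
proof (rule set_integrable_bound[of _ _ "\<lambda>y. c * mom y"])
  show "set_integrable lborel {0..} (\<lambda>y. c * mom y)" using int_mom by simp
  show "set_borel_measurable lborel {0..} f"
    unfolding set_borel_measurable_def
    using borel_measurable_continuous_on_indicator[OF _ assms(1)] by simp
  show "AE x in lborel. x \<in> {0..} \<longrightarrow> norm (f x) \<le> norm (c * mom x)"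
    by (intro AE_I2) (auto intro!: order_trans[OF assms(2) abs_ge_self])
qed

lemma Q_deriv: "0 \<le> x \<Longrightarrow> (Q has_vector_derivative - mom x) (at x within {0..})"
  unfolding Q_def using tail_integral_has_vector_derivative[OF cont_mom int_mom] by blast

lemma Q_lim: "(Q \<longlongrightarrow> 0) at_top"
  unfolding Q_def using tail_integral_tendsto_0[OF int_mom] by blast

lemma Q_nonneg: "0 \<le> x \<Longrightarrow> 0 \<le> Q x"
  unfolding Q_def set_lebesgue_integral_def using mom_nonneg
  by (intro integral_nonneg_AE) (auto simp: indicator_def)

lemma Q_antimono: "0 \<le> x \<Longrightarrow> x \<le> y \<Longrightarrow> Q y \<le> Q x"
proof -
  assume xy: "0 \<le> x" "x \<le> y"
  have "set_integrable lborel {x..} mom" using xy by (auto intro: set_integrable_subset[OF int_mom])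
  from set_integral_split_halfline[OF this xy(2)]
  have "Q x = integral {x..y} mom + Q y" by (simp add: Q_def)
  moreover have "0 \<le> integral {x..y} mom"
    by (intro integral_nonneg integrable_continuous_real continuous_on_subset[OF cont_mom] mom_nonneg) (use xy in auto)
  ultimately show ?thesis by simp
qed

lemma cont_Q: "continuous_on {0..} Q"
  by (auto simp: continuous_on_eq_continuous_within intro!: has_vector_derivative_continuous[OF Q_deriv])

lemma mom_exp_int: "set_integrable lborel {0..} (\<lambda>y. mom y * exp (2 * Q y))"
proof (rule set_integrable_halfline_bound)
  show "continuous_on {0..} (\<lambda>y. mom y * exp (2 * Q y))" by (intro continuous_intros cont_mom cont_Q)
  fix y :: real assume y: "0 \<le> y"
  have "exp (2 * Q y) * mom y \<le> exp (2 * Q 0) * mom y"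
    using y Q_antimono[of 0 y] mom_nonneg[OF y] by (intro mult_right_mono) auto
  then show "norm (mom y * exp (2 * Q y)) \<le> exp (2 * Q 0) * mom y"
    using mom_nonneg[OF y] by (simp add: abs_mult mult.commute)
qed

text \<open>Since Q has derivative \<open>- mom\<close>, the integrand is minus the derivative of
  \<open>(exp (2 * Q x) - 1) / 2\<close>. The 2 in the exponent produces the factor 1/2 by which the
  Volterra operator contracts in the weight \<open>exp (2 * Q x)\<close>.\<close>

lemma tail_exp_Q:
  assumes "0 \<le> x"
  shows "(LINT y:{x..}|lborel. mom y * exp (2 * Q y)) \<le> (exp (2 * Q x) - 1) / 2"
proof -
  let ?f = "\<lambda>y. mom y * exp (2 * Q y)"
  define h where "h x = (LINT y:{x..}|lborel. ?f y) - (exp (2 * Q x) - 1) / 2" for x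
  have c: "continuous_on {0..} ?f" by (intro continuous_intros cont_mom cont_Q)
  note i = mom_exp_int
  have Qd: "(Q has_vector_derivative - mom y) (at y within {x..})" if "x \<le> y" for y
    using that assms by (auto intro: has_vector_derivative_within_subset[OF Q_deriv])
  have hd: "(h has_vector_derivative 0) (at y within {x..})" if y: "x \<le> y" for y
  proof -
    have 1: "((\<lambda>x. LINT y:{x..}|lborel. ?f y) has_vector_derivative - ?f y) (at y within {x..})"
      using y assms by (intro has_vector_derivative_within_subset[OF tail_integral_has_vector_derivative[OF c i]]) auto
    have 2: "((\<lambda>x. (exp (2 * Q x) - 1) / 2) has_vector_derivative - ?f y) (at y within {x..})"
      using Qd[OF y] unfolding has_real_derivative_iff_has_vector_derivative[symmetric]
      by (auto intro!: derivative_eq_intros)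
    show ?thesis
      unfolding h_def[abs_def] by (rule has_vector_derivative_eq_rhs[OF has_vector_derivative_diff[OF 1 2]]) simp
  qed
  have "h x \<le> 0"
  proof (rule nonpos_if_increasing_to_0[where f' = "\<lambda>_. 0", OF hd])
    have "((\<lambda>x. (LINT y:{x..}|lborel. ?f y) - (exp (2 * Q x) - 1) / 2) \<longlongrightarrow> 0 - (exp (2 * 0) - 1) / 2) at_top"
      by (intro tendsto_intros tail_integral_tendsto_0[OF i] Q_lim) auto
    then show "(h \<longlongrightarrow> 0) at_top" by (simp add: h_def[abs_def])
  qed auto
  then show ?thesis by (simp add: h_def)
qed

text \<open>The kernel vanishes for y \<le> x, so integrating over the whole half-line changes
  nothing, and the domain stays independent of x: continuity in x then follows by dominated
  convergence.\<close>

definition volterra :: "(real \<Rightarrow> complex \<Rightarrow> complex) \<Rightarrow> real \<Rightarrow> complex \<Rightarrow> complex" where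
  "volterra f x z = (LINT y:{0..}|lborel. volterra_kernel x y z * of_real (V y) * f y z)"

lemma kernel_bound:
  assumes "0 \<le> x" "z \<in> upper_closed" "0 \<le> y" "norm (f y z) \<le> c"
  shows "norm (volterra_kernel x y z * of_real (V y) * f y z) \<le> mom y * c"
proof -
  have "norm (volterra_kernel x y z) \<le> 1 + y"
    using norm_volterra_kernel[OF assms(2), of x y] assms by (auto simp: max_def split: if_splits)
  then have "norm (volterra_kernel x y z) * \<bar>V y\<bar> \<le> (1 + y) * \<bar>V y\<bar>"
    by (intro mult_right_mono) auto
  then show ?thesis
    using mult_mono[OF _ assms(4), of "norm (volterra_kernel x y z) * \<bar>V y\<bar>" "(1 + y) * \<bar>V y\<bar>"] assms(3)
    by (simp add: norm_mult mom_def)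
qed

lemma cont_slice:
  assumes "continuous_on ({0..} \<times> upper_closed) (\<lambda>(x, z). f x z)" "z \<in> upper_closed"
  shows "continuous_on {0..} (\<lambda>x. f x z)"
  using continuous_on_compose2[OF assms(1) continuous_on_Pair[OF continuous_on_id continuous_on_const[of _ z]], of "{0..}"] assms(2)
  by auto

lemma volterra_integrand:
  assumes f: "continuous_on ({0..} \<times> upper_closed) (\<lambda>(x, z). f x z)" "z \<in> upper_closed"
  shows "continuous_on {0..} (\<lambda>y. volterra_kernel x y z * of_real (V y) * f y z)"
  by (intro continuous_intros continuous_on_volterra_kernel contV cont_slice f)

lemma volterra_meas:
  assumes f: "continuous_on ({0..} \<times> upper_closed) (\<lambda>(x, z). f x z)" "z \<in> upper_closed"
  shows "(\<lambda>y. indicator {0..} y *\<^sub>R (volterra_kernel x y z * of_real (V y) * f y z)) \<in> borel_measurable lborel"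
  using borel_measurable_continuous_on_indicator[OF _ volterra_integrand[OF assms]] by simp

text \<open>In the weight \<open>exp (2 * Q x)\<close> one application halves the bound, uniformly
  in the closed half-plane. Joint continuity reaches the real axis and z = 0, holomorphy only the
  open half-plane; both pass under the integral with the single majorant
  \<open>mom y * (c * exp (2 * Q 0))\<close>.\<close>

lemma volterra_props:
  assumes f: "continuous_on ({0..} \<times> upper_closed) (\<lambda>(x, z). f x z)"
    and fb: "\<And>x z. 0 \<le> x \<Longrightarrow> z \<in> upper_closed \<Longrightarrow> norm (f x z) \<le> c * exp (2 * Q x)"
    and fh: "\<And>x. 0 \<le> x \<Longrightarrow> f x holomorphic_on upper_open"
    and "0 \<le> c"
  shows "\<And>x z. 0 \<le> x \<Longrightarrow> z \<in> upper_closed \<Longrightarrow> norm (volterra f x z) \<le> c / 2 * exp (2 * Q x)"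
    and "continuous_on ({0..} \<times> upper_closed) (\<lambda>(x, z). volterra f x z)"
    and "\<And>x. 0 \<le> x \<Longrightarrow> volterra f x holomorphic_on upper_open"
proof -
  let ?g = "\<lambda>y. indicator {0..} y *\<^sub>R (mom y * (c * exp (2 * Q 0)))"
  have g: "integrable lborel ?g"
    using int_mom unfolding set_integrable_def[symmetric] by simp
  have fb0: "norm (f y z) \<le> c * exp (2 * Q 0)" if "0 \<le> y" "z \<in> upper_closed" for y z
    using fb[OF that] Q_antimono[of 0 y] that \<open>0 \<le> c\<close>
    by (elim order_trans) (auto intro!: mult_left_mono)
  have dom: "norm (indicator {0..} y *\<^sub>R (volterra_kernel x y z * of_real (V y) * f y z)) \<le> ?g y"
    if "0 \<le> x" "z \<in> upper_closed" for x y z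
    using kernel_bound[of x z y f, OF that _ fb0] that by (auto simp: indicator_def)
  show "norm (volterra f x z) \<le> c / 2 * exp (2 * Q x)" if x: "0 \<le> x" and z: "z \<in> upper_closed" for x z
  proof -
    have i: "set_integrable lborel {x..} (\<lambda>y. mom y * exp (2 * Q y))"
      using x by (intro set_integrable_subset[OF mom_exp_int]) auto
    have "norm (volterra f x z) \<le> (\<integral>y. norm (indicator {0..} y *\<^sub>R (volterra_kernel x y z * of_real (V y) * f y z)) \<partial>lborel)"
      unfolding volterra_def set_lebesgue_integral_def by (rule integral_norm_bound)
    also have "\<dots> \<le> (\<integral>y. indicator {x..} y *\<^sub>R (c * (mom y * exp (2 * Q y))) \<partial>lborel)"
    proof (rule integral_mono)
      show "integrable lborel (\<lambda>y. norm (indicator {0..} y *\<^sub>R (volterra_kernel x y z * of_real (V y) * f y z)))"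
        by (rule integrable_norm, rule Bochner_Integration.integrable_bound[OF g volterra_meas[OF f z]])
           (use dom[OF x z] in \<open>auto intro!: AE_I2 order_trans[OF _ abs_ge_self]\<close>)
      show "integrable lborel (\<lambda>y. indicator {x..} y *\<^sub>R (c * (mom y * exp (2 * Q y))))"
        using set_integrable_mult_right[of c, OF i] by (simp add: set_integrable_def)
      show "norm (indicator {0..} y *\<^sub>R (volterra_kernel x y z * of_real (V y) * f y z))
          \<le> indicator {x..} y *\<^sub>R (c * (mom y * exp (2 * Q y)))" for y
      proof (cases "x \<le> y")
        case True
        then show ?thesis
          using kernel_bound[of x z y f, OF x z _ fb] x z by (auto simp: algebra_simps)
      next
        case False
        then show ?thesis by (simp add: volterra_kernel_eq_0)
      qed
    qed
    also have "\<dots> = (LINT y:{x..}|lborel. c * (mom y * exp (2 * Q y)))"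
      by (simp only: set_lebesgue_integral_def)
    also have "\<dots> = c * (LINT y:{x..}|lborel. mom y * exp (2 * Q y))"
      by (rule set_integral_mult_right)
    also have "\<dots> \<le> c * ((exp (2 * Q x) - 1) / 2)"
      by (intro mult_left_mono tail_exp_Q x \<open>0 \<le> c\<close>)
    also have "\<dots> \<le> c / 2 * exp (2 * Q x)"
      using \<open>0 \<le> c\<close> by (simp add: algebra_simps)
    finally show ?thesis .
  qed
  show "continuous_on ({0..} \<times> upper_closed) (\<lambda>(x, z). volterra f x z)"
    unfolding volterra_def set_lebesgue_integral_def case_prod_unfold
  proof (rule continuous_on_lebesgue_integral[OF _ _ _ g])
    fix y :: real
    show "continuous_on ({0..} \<times> upper_closed) (\<lambda>p. indicator {0..} y *\<^sub>R (volterra_kernel (fst p) y (snd p) * of_real (V y) * f y (snd p)))"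
    proof (cases "0 \<le> y")
      case True
      have "continuous_on ({0..} \<times> upper_closed) (\<lambda>p. f y (snd p))"
        using continuous_on_compose2[OF f, of "{0..} \<times> upper_closed" "\<lambda>p. (y, snd p)"] True
        by (force intro!: continuous_intros)
      then show ?thesis
        using True by (intro continuous_intros continuous_on_volterra_kernel) auto
    qed auto
  qed (use dom volterra_meas[OF f] in auto)
  show "volterra f x holomorphic_on upper_open" if x: "0 \<le> x" for x
    unfolding volterra_def[abs_def] set_lebesgue_integral_def
  proof (rule holomorphic_on_lebesgue_integral[OF open_upper_open _ _ _ g])
    fix y :: real
    show "(\<lambda>z. indicator {0..} y *\<^sub>R (volterra_kernel x y z * of_real (V y) * f y z)) holomorphic_on upper_open"
    proof (cases "0 \<le> y")
      case True
      then show ?thesis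
        by (auto intro!: holomorphic_intros holomorphic_on_volterra_kernel fh)
    qed auto
  qed (use dom[OF x] volterra_meas[OF f] in auto)
qed

primrec jost_iter :: "nat \<Rightarrow> real \<Rightarrow> complex \<Rightarrow> complex" where
  "jost_iter 0 = (\<lambda>x z. 1)"
| "jost_iter (Suc n) = volterra (jost_iter n)"

lemma jost_iter_props:
  "(\<forall>x\<ge>0. \<forall>z\<in>upper_closed. norm (jost_iter n x z) \<le> (1/2)^n * exp (2 * Q x)) \<and>
   continuous_on ({0..} \<times> upper_closed) (\<lambda>(x, z). jost_iter n x z) \<and>
   (\<forall>x\<ge>0. jost_iter n x holomorphic_on upper_open)"
proof (induction n)
  case 0
  then show ?case using Q_nonneg by (auto simp: case_prod_unfold)
next
  case (Suc n)
  note p = volterra_props[of "jost_iter n" "(1/2)^n"]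
  show ?case using p Suc.IH by (auto simp: field_simps)
qed

lemmas jost_iter_bound = jost_iter_props[THEN conjunct1, rule_format]
lemmas jost_iter_cont = jost_iter_props[THEN conjunct2, THEN conjunct1]
lemmas jost_iter_holo = jost_iter_props[THEN conjunct2, THEN conjunct2, rule_format]

text \<open>\<open>jb x z\<close> is \<open>exp (- i z x) \<theta>(x, z)\<close>, regular also at \<open>z = 0\<close>; \<open>jbp\<close> is its derivative in \<open>x\<close>.\<close>

definition jb :: "real \<Rightarrow> complex \<Rightarrow> complex" where
  "jb x z = (\<Sum>n. jost_iter n x z)"

lemma jost_iter_bound0:
  assumes "0 \<le> x" "z \<in> upper_closed"
  shows "norm (jost_iter n x z) \<le> (1/2)^n * exp (2 * Q 0)"
  using jost_iter_bound[OF assms, of n] Q_antimono[of 0 x] assms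
  by (elim order_trans) (auto intro!: mult_left_mono)

lemma jb_uniform:
  "uniform_limit ({0..} \<times> upper_closed) (\<lambda>n (x, z). \<Sum>i<n. jost_iter i x z) (\<lambda>(x, z). jb x z) sequentially"
proof -
  have "uniform_limit ({0..} \<times> upper_closed) (\<lambda>n p. \<Sum>i<n. (\<lambda>(x, z). jost_iter i x z) p)
      (\<lambda>p. suminf (\<lambda>i. (\<lambda>(x, z). jost_iter i x z) p)) sequentially"
  proof (rule Weierstrass_m_test)
    show "norm ((\<lambda>(x, z). jost_iter n x z) p) \<le> (1/2)^n * exp (2 * Q 0)" if "p \<in> {0..} \<times> upper_closed" for n p
      using that jost_iter_bound0 by auto
    show "summable (\<lambda>n. (1/2)^n * exp (2 * Q 0))" by (intro summable_mult2 summable_geometric) auto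
  qed
  then show ?thesis by (simp add: case_prod_unfold jb_def)
qed

lemma jb_cont: "continuous_on ({0..} \<times> upper_closed) (\<lambda>(x, z). jb x z)"
proof (rule uniform_limit_theorem[OF _ jb_uniform])
  have "continuous_on ({0..} \<times> upper_closed) (\<lambda>p. \<Sum>i<n. (\<lambda>(x, z). jost_iter i x z) p)" for n
    by (intro continuous_on_sum jost_iter_cont)
  then show "\<forall>\<^sub>F n in sequentially. continuous_on ({0..} \<times> upper_closed) (\<lambda>(x, z). \<Sum>i<n. jost_iter i x z)"
    by (simp add: case_prod_unfold)
qed simp

lemma jb_lim:
  assumes "0 \<le> x" "z \<in> upper_closed"
  shows "(\<lambda>n. \<Sum>i<n. jost_iter i x z) \<longlonglongrightarrow> jb x z"
  using tendsto_uniform_limitI[OF jb_uniform, of "(x, z)"] assms by simp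

lemma partial_bound:
  assumes "0 \<le> x" "z \<in> upper_closed"
  shows "norm (\<Sum>i<n. jost_iter i x z) \<le> bnd"
proof -
  have "norm (\<Sum>i<n. jost_iter i x z) \<le> (\<Sum>i<n. (1/2)^i * exp (2 * Q 0))"
    by (intro sum_norm_le jost_iter_bound0 assms)
  also have "\<dots> = (\<Sum>i<n. (1/2)^i) * exp (2 * Q 0)" by (simp add: sum_distrib_right)
  also have "(\<Sum>i<n. (1/2::real)^i) \<le> 2"
    by (subst sum_gp_strict) auto
  then have "(\<Sum>i<n. (1/2::real)^i) * exp (2 * Q 0) \<le> bnd"
    unfolding bnd_def by (intro mult_right_mono) auto
  finally show ?thesis .
qed

lemma jb_bound:
  assumes "0 \<le> x" "z \<in> upper_closed" shows "norm (jb x z) \<le> bnd"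
  by (rule Lim_bounded[OF tendsto_norm[OF jb_lim[OF assms]], of 0]) (use partial_bound[OF assms] in auto)

lemma jb_holo: assumes "0 \<le> x" shows "jb x holomorphic_on upper_open"
proof (rule holomorphic_uniform_sequence[OF open_upper_open])
  show "(\<lambda>z. \<Sum>i<n. jost_iter i x z) holomorphic_on upper_open" for n
    by (intro holomorphic_intros jost_iter_holo assms)
  fix z assume "z \<in> upper_open"
  then obtain d where d: "d > 0" "cball z d \<subseteq> upper_open"
    using open_contains_cball[THEN iffD1, rule_format, OF open_upper_open] by blast
  have "uniform_limit (cball z d) (\<lambda>n z. \<Sum>i<n. jost_iter i x z) (jb x) sequentially"
    unfolding uniform_limit_iff
  proof (intro allI impI)
    fix e :: real assume "e > 0"
    then have "\<forall>\<^sub>F n in sequentially. \<forall>p\<in>{0..} \<times> upper_closed. dist ((\<lambda>(x, z). \<Sum>i<n. jost_iter i x z) p) ((\<lambda>(x, z). jb x z) p) < e"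
      using uniform_limitD[OF jb_uniform] by blast
    then show "\<forall>\<^sub>F n in sequentially. \<forall>w\<in>cball z d. dist (\<Sum>i<n. jost_iter i x w) (jb x w) < e"
      by eventually_elim (use assms d(2) in \<open>force simp: less_imp_le\<close>)
  qed
  then show "\<exists>d>0. cball z d \<subseteq> upper_open \<and> uniform_limit (cball z d) (\<lambda>n z. \<Sum>i<n. jost_iter i x z) (jb x) sequentially"
    using d by blast
qed

text \<open>The partial sums satisfy the equation with the index shifted by one,
  \<open>S (Suc n) = 1 + volterra (S n)\<close>; their common bound \<open>bnd\<close> lets n tend
  to infinity under the integral.\<close>

lemma jb_eq:
  assumes x: "0 \<le> x" and z: "z \<in> upper_closed"
  shows "jb x z = 1 + volterra jb x z"
proof -
  define S where "S n y w = (\<Sum>i<n. jost_iter i y w)" for n y w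
  have Sc: "continuous_on ({0..} \<times> upper_closed) (\<lambda>(x, z). S n x z)" for n
  proof -
    have "continuous_on ({0..} \<times> upper_closed) (\<lambda>p. \<Sum>i<n. (\<lambda>(x, z). jost_iter i x z) p)"
      by (intro continuous_on_sum jost_iter_cont)
    then show ?thesis by (simp add: case_prod_unfold S_def)
  qed
  have gi: "integrable lborel (\<lambda>y. indicator {0..} y *\<^sub>R (mom y * bnd))"
    using int_mom unfolding set_integrable_def[symmetric] by simp
  have dom: "norm (indicator {0..} y *\<^sub>R (volterra_kernel x y z * of_real (V y) * f y z)) \<le> indicator {0..} y *\<^sub>R (mom y * bnd)"
    if "0 \<le> y \<Longrightarrow> norm (f y z) \<le> bnd" for f y
    using kernel_bound[of x z y f, OF x z _ that] by (auto simp: indicator_def)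
  have ii: "set_integrable lborel {0..} (\<lambda>y. volterra_kernel x y z * of_real (V y) * jost_iter i y z)" for i
    using kernel_bound[where f = "jost_iter i", OF x z _ jost_iter_bound0[OF _ z]]
    by (intro set_integrable_halfline_bound[OF volterra_integrand[OF jost_iter_cont z], of _ _ "(1/2)^i * exp (2 * Q 0)"])
       (auto simp: mult.commute)
  have *: "S (Suc n) x z = 1 + volterra (S n) x z" for n
  proof (induction n)
    case 0 then show ?case by (simp add: S_def volterra_def)
  next
    case (Suc n)
    have "set_integrable lborel {0..} (\<lambda>y. volterra_kernel x y z * of_real (V y) * S n y z)"
      using kernel_bound[where f = "S n", OF x z _ partial_bound[OF _ z, of _ n, folded S_def]]
      by (intro set_integrable_halfline_bound[OF volterra_integrand[OF Sc z], of _ _ bnd]) (auto simp: mult.commute S_def)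
    then have "volterra (S (Suc n)) x z = volterra (S n) x z + volterra (jost_iter n) x z"
      unfolding volterra_def using ii[of n]
      by (subst set_integral_add(2)[symmetric]) (auto simp: S_def algebra_simps)
    moreover have "S (Suc (Suc n)) x z = S (Suc n) x z + jost_iter (Suc n) x z" by (simp add: S_def)
    ultimately show ?case using Suc.IH by (simp only: jost_iter.simps add.assoc)
  qed
  have "(\<lambda>n. volterra (S n) x z) \<longlonglongrightarrow> volterra jb x z"
    unfolding volterra_def set_lebesgue_integral_def
  proof (rule integral_dominated_convergence[OF _ _ gi])
    show "AE y in lborel. (\<lambda>n. indicator {0..} y *\<^sub>R (volterra_kernel x y z * of_real (V y) * S n y z))
        \<longlonglongrightarrow> indicator {0..} y *\<^sub>R (volterra_kernel x y z * of_real (V y) * jb y z)"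
    proof (intro AE_I2)
      fix y :: real
      show "(\<lambda>n. indicator {0..} y *\<^sub>R (volterra_kernel x y z * of_real (V y) * S n y z))
        \<longlonglongrightarrow> indicator {0..} y *\<^sub>R (volterra_kernel x y z * of_real (V y) * jb y z)"
        unfolding S_def by (cases "0 \<le> y") (auto intro!: tendsto_intros jb_lim z)
    qed
    show "AE y in lborel. norm (indicator {0..} y *\<^sub>R (volterra_kernel x y z * of_real (V y) * S n y z))
        \<le> indicator {0..} y *\<^sub>R (mom y * bnd)" for n
      by (intro AE_I2 dom) (simp add: S_def partial_bound[OF _ z])
  qed (use volterra_meas[OF Sc z] volterra_meas[OF jb_cont z] in auto)
  then have "(\<lambda>n. S (Suc n) x z) \<longlonglongrightarrow> 1 + volterra jb x z"
    unfolding * by (intro tendsto_intros)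
  moreover have "(\<lambda>n. S (Suc n) x z) \<longlonglongrightarrow> jb x z"
    unfolding S_def using jb_lim[OF x z] by (rule LIMSEQ_Suc)
  ultimately show ?thesis using LIMSEQ_unique by blast
qed

lemma jost_iter_cnj: "0 \<le> x \<Longrightarrow> jost_iter n x (- cnj z) = cnj (jost_iter n x z)"
proof (induction n arbitrary: x)
  case (Suc n)
  have "volterra (jost_iter n) x (- cnj z) = (\<integral>y. cnj (indicator {0..} y *\<^sub>R (volterra_kernel x y z * of_real (V y) * jost_iter n y z)) \<partial>lborel)"
    unfolding volterra_def set_lebesgue_integral_def
    by (intro Bochner_Integration.integral_cong) (auto simp: indicator_def volterra_kernel_cnj Suc.IH)
  also have "\<dots> = cnj (volterra (jost_iter n) x z)"
    unfolding volterra_def set_lebesgue_integral_def by (rule Bochner_Integration.integral_cnj)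
  finally show ?case by simp
qed simp

lemma jb_cnj:
  assumes "0 \<le> x" "z \<in> upper_closed" shows "jb x (- cnj z) = cnj (jb x z)"
proof -
  have "(\<lambda>n. \<Sum>i<n. jost_iter i x (- cnj z)) \<longlonglongrightarrow> jb x (- cnj z)"
    by (rule jb_lim) (use assms in auto)
  moreover have "(\<lambda>n. cnj (\<Sum>i<n. jost_iter i x z)) \<longlonglongrightarrow> cnj (jb x z)"
    by (intro tendsto_cnj jb_lim assms)
  ultimately show ?thesis
    using LIMSEQ_unique by (auto simp: jost_iter_cnj[OF assms(1)])
qed

text \<open>The rate Q depends on x only, so \<open>jb\<close> approaches 1 uniformly in z,
  including z = 0. The choice of \<open>x_half\<close> rests on this.\<close>

lemma norm_jb_minus_1:
  assumes x: "0 \<le> x" and z: "z \<in> upper_closed"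
  shows "norm (jb x z - 1) \<le> bnd * Q x"
proof -
  have "jb x z - 1 = (\<integral>y. indicator {0..} y *\<^sub>R (volterra_kernel x y z * of_real (V y) * jb y z) \<partial>lborel)"
    using jb_eq[OF assms] by (simp add: volterra_def set_lebesgue_integral_def)
  also have "norm \<dots> \<le> (\<integral>y. norm (indicator {0..} y *\<^sub>R (volterra_kernel x y z * of_real (V y) * jb y z)) \<partial>lborel)"
    by (rule integral_norm_bound)
  also have "\<dots> \<le> (\<integral>y. indicator {x..} y *\<^sub>R (bnd * mom y) \<partial>lborel)"
  proof (rule integral_mono)
    show "integrable lborel (\<lambda>y. norm (indicator {0..} y *\<^sub>R (volterra_kernel x y z * of_real (V y) * jb y z)))"
      using kernel_bound[where f = jb, OF x z _ jb_bound[OF _ z]]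
        set_integrable_halfline_bound[OF volterra_integrand[OF jb_cont z], of x bnd]
      by (intro integrable_norm) (auto simp: mult.commute set_integrable_def)
    show "integrable lborel (\<lambda>y. indicator {x..} y *\<^sub>R (bnd * mom y))"
      using set_integrable_subset[OF int_mom, of "{x..}"] x
      unfolding set_integrable_def[symmetric] by auto
    show "norm (indicator {0..} y *\<^sub>R (volterra_kernel x y z * of_real (V y) * jb y z)) \<le> indicator {x..} y *\<^sub>R (bnd * mom y)" for y
      using kernel_bound[where f = jb, OF x z _ jb_bound[OF _ z], of y] x
      by (cases "x \<le> y") (auto simp: volterra_kernel_eq_0 mult.commute)
  qed
  also have "\<dots> = (LINT y:{x..}|lborel. bnd * mom y)" by (simp only: set_lebesgue_integral_def)
  also have "\<dots> = bnd * Q x" unfolding Q_def by (rule set_integral_mult_right)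
  finally show ?thesis .
qed

text \<open>The x-derivative of the kernel is \<open>- exp (2 * \<i> * z * (y - x))\<close> for y >
  x. The factor depending on x is pulled out of the integral, so that x enters the integral only as
  its lower limit.\<close>

definition jbp :: "real \<Rightarrow> complex \<Rightarrow> complex" where
  "jbp x z = - (exp (- 2 * \<i> * z * of_real x) * (LINT y:{x..}|lborel. exp (2 * \<i> * z * of_real y) * of_real (V y) * jb y z))"

lemma norm_exp_upper: "z \<in> upper_closed \<Longrightarrow> 0 \<le> y \<Longrightarrow> norm (exp (2 * \<i> * z * of_real y)) \<le> 1"
  by (simp add: mult_nonneg_nonneg)

lemma Vjb_cont: "z \<in> upper_closed \<Longrightarrow> continuous_on {0..} (\<lambda>y. of_real (V y) * jb y z)"
  by (intro continuous_intros contV cont_slice[OF jb_cont])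

lemma Vjb_bound: "z \<in> upper_closed \<Longrightarrow> 0 \<le> y \<Longrightarrow> norm (of_real (V y) * jb y z) \<le> bnd * mom y"
  using mult_mono[OF jb_bound[of y z] V_le_mom[of y]] bnd_pos by (simp add: norm_mult mult.commute)

lemma eVjb:
  assumes z: "z \<in> upper_closed"
  shows "continuous_on {0..} (\<lambda>y. exp (2 * \<i> * z * of_real y) * of_real (V y) * jb y z)"
    and "set_integrable lborel {0..} (\<lambda>y. exp (2 * \<i> * z * of_real y) * of_real (V y) * jb y z)"
    and "\<And>y. 0 \<le> y \<Longrightarrow> norm (exp (2 * \<i> * z * of_real y) * of_real (V y) * jb y z) \<le> bnd * mom y"
proof -
  show c: "continuous_on {0..} (\<lambda>y. exp (2 * \<i> * z * of_real y) * of_real (V y) * jb y z)"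
    by (intro continuous_intros contV cont_slice[OF jb_cont] z)
  show b: "norm (exp (2 * \<i> * z * of_real y) * of_real (V y) * jb y z) \<le> bnd * mom y" if "0 \<le> y" for y
    using mult_mono[OF norm_exp_upper[OF z that] Vjb_bound[OF z that]] by (simp add: norm_mult mult.assoc)
  show "set_integrable lborel {0..} (\<lambda>y. exp (2 * \<i> * z * of_real y) * of_real (V y) * jb y z)"
    by (rule set_integrable_halfline_bound[OF c b])
qed

lemma Vjb_int: "z \<in> upper_closed \<Longrightarrow> set_integrable lborel {0..} (\<lambda>y. of_real (V y) * jb y z)"
  by (rule set_integrable_halfline_bound[OF Vjb_cont Vjb_bound])

lemma exp_vector_derivative:
  "((\<lambda>x. exp (c * of_real x)) has_vector_derivative c * exp (c * of_real x)) (at x within S)" for c :: complex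
proof -
  have "((\<lambda>w. exp (c * w)) has_field_derivative c * exp (c * of_real x)) (at (of_real x))"
    by (auto intro!: derivative_eq_intros)
  then show ?thesis
    by (intro has_vector_derivative_real_field) 
qed

lemma jbp_deriv:
  assumes x: "0 \<le> x" and z: "z \<in> upper_closed"
  shows "((\<lambda>x. jbp x z) has_vector_derivative of_real (V x) * jb x z - 2 * \<i> * z * jbp x z) (at x within {0..})"
proof -
  note t = tail_integral_has_vector_derivative[OF eVjb(1,2)[OF z] x]
  have "exp (- 2 * \<i> * z * of_real x) * exp (2 * \<i> * z * of_real x) = 1"
    by (simp add: exp_add[symmetric])
  then have e: "exp (- 2 * \<i> * z * of_real x) * (exp (2 * \<i> * z * of_real x) * of_real (V x) * jb x z) = of_real (V x) * jb x z"
    by (metis mult.assoc mult_1)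
  show ?thesis
    unfolding jbp_def
    by (rule has_vector_derivative_eq_rhs[OF has_vector_derivative_minus[OF has_vector_derivative_mult[OF exp_vector_derivative t]]])
       (use e in \<open>simp add: algebra_simps\<close>)
qed

text \<open>Differentiation under the integral is avoided by separating the variables of the kernel:
  for z \<noteq> 0 it is (exp (- 2 i z x) exp (2 i z y) - 1) / (2 i z), for z = 0 it is y - x. In
  both cases \<open>jb\<close> becomes a combination of explicit functions of x and tail integrals,
  whose derivatives are known.\<close>

lemma jb_deriv:
  assumes x: "0 \<le> x" and z: "z \<in> upper_closed"
  shows "((\<lambda>x. jb x z) has_vector_derivative jbp x z) (at x within {0..})"
proof (cases "z = 0")
  case False
  let ?A = "\<lambda>x. LINT y:{x..}|lborel. exp (2 * \<i> * z * of_real y) * of_real (V y) * jb y z"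
  let ?B = "\<lambda>x. LINT y:{x..}|lborel. of_real (V y) * jb y z"
  have eq: "1 + (exp (- 2 * \<i> * z * of_real x) * ?A x - ?B x) / (2 * \<i> * z) = jb x z" if "0 \<le> x" for x
  proof -
    have i: "set_integrable lborel {x..} (\<lambda>y. exp (2 * \<i> * z * of_real y) * of_real (V y) * jb y z)"
      "set_integrable lborel {x..} (\<lambda>y. of_real (V y) * jb y z)"
      using that by (auto intro: set_integrable_subset[OF eVjb(2)[OF z]] set_integrable_subset[OF Vjb_int[OF z]])
    have "(exp (- 2 * \<i> * z * of_real x) * ?A x - ?B x) / (2 * \<i> * z) =
      (LINT y:{x..}|lborel. (exp (- 2 * \<i> * z * of_real x) * (exp (2 * \<i> * z * of_real y) * of_real (V y) * jb y z) - of_real (V y) * jb y z) / (2 * \<i> * z))"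
      by (subst set_integral_divide_zero, subst set_integral_diff(2)[OF set_integrable_mult_right[OF i(1)] i(2)],
          subst set_integral_mult_right) (rule refl)
    also have "\<dots> = volterra jb x z"
      unfolding volterra_def set_lebesgue_integral_def
    proof (intro Bochner_Integration.integral_cong refl)
      fix y :: real
      have e: "exp (- 2 * \<i> * z * of_real x) * exp (2 * \<i> * z * of_real y) = exp (2 * \<i> * z * of_real (y - x))"
        by (simp add: exp_add[symmetric] algebra_simps)
      have k: "volterra_kernel x y z = (exp (2 * \<i> * z * of_real (y - x)) - 1) / (2 * \<i> * z)" if "x \<le> y"
        using that False by (auto simp: volterra_kernel_def expdiv_def max_def)
      show "indicat_real {x..} y *\<^sub>R ((exp (- 2 * \<i> * z * complex_of_real x) * (exp (2 * \<i> * z * complex_of_real y) * complex_of_real (V y) * jb y z) - complex_of_real (V y) * jb y z) / (2 * \<i> * z))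
        = indicat_real {0..} y *\<^sub>R (volterra_kernel x y z * complex_of_real (V y) * jb y z)"
      proof (cases "x \<le> y")
        case True
        have "exp (- 2 * \<i> * z * complex_of_real x) * (exp (2 * \<i> * z * complex_of_real y) * complex_of_real (V y) * jb y z)
          = exp (2 * \<i> * z * of_real (y - x)) * complex_of_real (V y) * jb y z"
          using e by (simp add: mult.assoc[symmetric])
        then have "(exp (- 2 * \<i> * z * complex_of_real x) * (exp (2 * \<i> * z * complex_of_real y) * complex_of_real (V y) * jb y z) - complex_of_real (V y) * jb y z) / (2 * \<i> * z)
           = (exp (2 * \<i> * z * of_real (y - x)) * complex_of_real (V y) * jb y z - complex_of_real (V y) * jb y z) / (2 * \<i> * z)"
          by (simp only:)
        also have "\<dots> = (exp (2 * \<i> * z * of_real (y - x)) - 1) / (2 * \<i> * z) * complex_of_real (V y) * jb y z"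
          by (simp add: algebra_simps diff_divide_distrib)
        also have "\<dots> = volterra_kernel x y z * complex_of_real (V y) * jb y z"
          by (simp only: k[OF True])
        finally show ?thesis using True \<open>0 \<le> x\<close> by simp
      next
        case False then show ?thesis by (simp add: volterra_kernel_eq_0)
      qed
    qed
    finally show ?thesis using jb_eq[OF that z] by simp
  qed
  have e: "exp (- 2 * \<i> * z * of_real x) * (exp (2 * \<i> * z * of_real x) * of_real (V x) * jb x z) = of_real (V x) * jb x z"
  proof -
    have "exp (- 2 * \<i> * z * of_real x) * exp (2 * \<i> * z * of_real x) = 1"
      by (simp add: exp_add[symmetric])
    then show ?thesis by (metis mult.assoc mult_1)
  qed
  have "((\<lambda>x. 1 + (exp (- 2 * \<i> * z * of_real x) * ?A x - ?B x) / (2 * \<i> * z)) has_vector_derivative jbp x z) (at x within {0..})"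
    by (rule has_vector_derivative_eq_rhs[OF has_vector_derivative_add[OF has_vector_derivative_const
         has_vector_derivative_divide[OF has_vector_derivative_diff[OF has_vector_derivative_mult[OF exp_vector_derivative
         tail_integral_has_vector_derivative[OF eVjb(1,2)[OF z] x]] tail_integral_has_vector_derivative[OF Vjb_cont[OF z] Vjb_int[OF z] x]]]]])
       (use e False in \<open>simp add: jbp_def field_simps\<close>)
  then show ?thesis
    by (rule has_vector_derivative_transform[rotated 2]) (use x eq in auto)
next
  case True
  let ?A = "\<lambda>x. LINT y:{x..}|lborel. of_real (y * V y) * jb y z"
  let ?B = "\<lambda>x. LINT y:{x..}|lborel. of_real (V y) * jb y z"
  have c: "continuous_on {0..} (\<lambda>y. of_real (y * V y) * jb y z)"
    by (intro continuous_intros contV cont_slice[OF jb_cont z])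
  have i0: "set_integrable lborel {0..} (\<lambda>y. of_real (y * V y) * jb y z)"
  proof (rule set_integrable_halfline_bound[OF c, of bnd])
    fix y :: real assume y: "0 \<le> y"
    have "\<bar>y * V y\<bar> \<le> mom y" using y by (simp add: mom_def abs_mult algebra_simps)
    then show "norm (of_real (y * V y) * jb y z) \<le> bnd * mom y"
      using mult_mono[OF _ jb_bound[OF y z], of "\<bar>y * V y\<bar>" "mom y"] mom_nonneg[OF y]
      unfolding norm_mult norm_of_real by (simp add: mult.commute)
  qed
  have eq: "1 + (?A x - of_real x * ?B x) = jb x z" if "0 \<le> x" for x
  proof -
    have i: "set_integrable lborel {x..} (\<lambda>y. of_real (y * V y) * jb y z)"
      "set_integrable lborel {x..} (\<lambda>y. of_real (V y) * jb y z)"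
      by (rule set_integrable_subset[OF i0] set_integrable_subset[OF Vjb_int[OF z]]; use that in simp)+
    have "?A x - of_real x * ?B x = (LINT y:{x..}|lborel. of_real (y * V y) * jb y z - of_real x * (of_real (V y) * jb y z))"
      using i by (subst set_integral_diff(2)) auto
    also have "\<dots> = volterra jb x z"
      unfolding volterra_def set_lebesgue_integral_def
    proof (intro Bochner_Integration.integral_cong refl)
      fix y :: real
      show "indicat_real {x..} y *\<^sub>R (complex_of_real (y * V y) * jb y z - complex_of_real x * (complex_of_real (V y) * jb y z))
        = indicat_real {0..} y *\<^sub>R (volterra_kernel x y z * complex_of_real (V y) * jb y z)"
        using that True by (cases "x \<le> y") (auto simp: volterra_kernel_eq_0 volterra_kernel_def expdiv_def algebra_simps)
    qed
    finally show ?thesis using jb_eq[OF that z] by simp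
  qed
  have xd: "((\<lambda>x. complex_of_real x) has_vector_derivative 1) (at x within {0..})"
    using has_vector_derivative_of_real[OF DERIV_ident] by simp
  have "((\<lambda>x. 1 + (?A x - of_real x * ?B x)) has_vector_derivative jbp x z) (at x within {0..})"
    by (rule has_vector_derivative_eq_rhs[OF has_vector_derivative_add[OF has_vector_derivative_const
         has_vector_derivative_diff[OF tail_integral_has_vector_derivative[OF c i0 x] has_vector_derivative_mult[OF xd
         tail_integral_has_vector_derivative[OF Vjb_cont[OF z] Vjb_int[OF z] x]]]]])
       (use True in \<open>simp add: jbp_def algebra_simps\<close>)
  then show ?thesis
    by (rule has_vector_derivative_transform[rotated 2]) (use x eq in auto)
qed

lemma norm_jbp:
  assumes x: "0 \<le> x" and z: "z \<in> upper_closed"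
  shows "norm (jbp x z) \<le> bnd * Q x"
proof -
  have "norm (jbp x z) = norm (LINT y:{x..}|lborel. exp (- 2 * \<i> * z * of_real x) * (exp (2 * \<i> * z * of_real y) * of_real (V y) * jb y z))"
    unfolding jbp_def by (simp only: norm_minus_cancel set_integral_mult_right)
  also have "\<dots> \<le> (\<integral>y. norm (indicator {x..} y *\<^sub>R (exp (- 2 * \<i> * z * of_real x) * (exp (2 * \<i> * z * of_real y) * of_real (V y) * jb y z))) \<partial>lborel)"
    unfolding set_lebesgue_integral_def by (rule integral_norm_bound)
  also have "\<dots> \<le> (\<integral>y. indicator {x..} y *\<^sub>R (bnd * mom y) \<partial>lborel)"
  proof (rule integral_mono)
    have i: "set_integrable lborel {x..} (\<lambda>y. exp (- 2 * \<i> * z * of_real x) * (exp (2 * \<i> * z * of_real y) * of_real (V y) * jb y z))"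
      by (intro set_integrable_mult_right impI set_integrable_subset[OF eVjb(2)[OF z]]) (use x in auto)
    then show "integrable lborel (\<lambda>y. norm (indicator {x..} y *\<^sub>R (exp (- 2 * \<i> * z * of_real x) * (exp (2 * \<i> * z * of_real y) * of_real (V y) * jb y z))))"
      unfolding set_integrable_def by (rule integrable_norm)
    show "integrable lborel (\<lambda>y. indicator {x..} y *\<^sub>R (bnd * mom y))"
      using set_integrable_subset[OF int_mom, of "{x..}"] x
      unfolding set_integrable_def[symmetric] by auto
    show "norm (indicator {x..} y *\<^sub>R (exp (- 2 * \<i> * z * of_real x) * (exp (2 * \<i> * z * of_real y) * of_real (V y) * jb y z)))
        \<le> indicator {x..} y *\<^sub>R (bnd * mom y)" for y
    proof (cases "x \<le> y")
      case True
      have e: "exp (- 2 * \<i> * z * of_real x) * exp (2 * \<i> * z * of_real y) = exp (2 * \<i> * z * of_real (y - x))"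
        by (simp add: exp_add[symmetric] algebra_simps)
      have "norm (exp (2 * \<i> * z * of_real (y - x)) * (of_real (V y) * jb y z)) \<le> 1 * (bnd * mom y)"
        unfolding norm_mult[of "exp _"] using True x
        by (intro mult_mono Vjb_bound norm_exp_upper z) auto
      then show ?thesis using True e by (simp add: mult.assoc[symmetric])
    qed auto
  qed
  also have "\<dots> = (LINT y:{x..}|lborel. bnd * mom y)" by (simp only: set_lebesgue_integral_def)
  also have "\<dots> = bnd * Q x" unfolding Q_def by (rule set_integral_mult_right)
  finally show ?thesis .
qed

lemma jbp_0: "jbp 0 z = - (LINT y:{0..}|lborel. exp (2 * \<i> * z * of_real y) * of_real (V y) * jb y z)"
  by (simp add: jbp_def)

lemma jbp_0_cont: "continuous_on upper_closed (jbp 0)"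
  and jbp_0_holo: "jbp 0 holomorphic_on upper_open"
proof -
  have gi: "integrable lborel (\<lambda>y. indicator {0..} y *\<^sub>R (bnd * mom y))"
    using int_mom unfolding set_integrable_def[symmetric] by simp
  have m: "(\<lambda>y. indicator {0..} y *\<^sub>R (exp (2 * \<i> * z * of_real y) * of_real (V y) * jb y z)) \<in> borel_measurable lborel"
    if "z \<in> upper_closed" for z
    using borel_measurable_continuous_on_indicator[OF _ eVjb(1)[OF that]] by simp
  have d: "norm (indicator {0..} y *\<^sub>R (exp (2 * \<i> * z * of_real y) * of_real (V y) * jb y z)) \<le> indicator {0..} y *\<^sub>R (bnd * mom y)"
    if "z \<in> upper_closed" for y z
    using eVjb(3)[OF that, of y] by (auto simp: indicator_def)
  have "continuous_on upper_closed (\<lambda>z. \<integral>y. indicator {0..} y *\<^sub>R (exp (2 * \<i> * z * of_real y) * of_real (V y) * jb y z) \<partial>lborel)"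
  proof (rule continuous_on_lebesgue_integral[OF _ _ _ gi])
    show "continuous_on upper_closed (\<lambda>z. indicator {0..} y *\<^sub>R (exp (2 * \<i> * z * of_real y) * of_real (V y) * jb y z))" for y
    proof (cases "0 \<le> y")
      case True
      have "continuous_on upper_closed (\<lambda>z. jb y z)"
        using continuous_on_compose2[OF jb_cont, of upper_closed "\<lambda>z. (y, z)"] True by (force intro!: continuous_intros)
      then show ?thesis by (intro continuous_intros)
    qed auto
  qed (use m d in auto)
  then show "continuous_on upper_closed (jbp 0)"
    unfolding jbp_0[abs_def] set_lebesgue_integral_def by (intro continuous_intros)
  have "(\<lambda>z. \<integral>y. indicator {0..} y *\<^sub>R (exp (2 * \<i> * z * of_real y) * of_real (V y) * jb y z) \<partial>lborel) holomorphic_on upper_open"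
  proof (rule holomorphic_on_lebesgue_integral[OF open_upper_open _ _ _ gi])
    show "(\<lambda>z. indicator {0..} y *\<^sub>R (exp (2 * \<i> * z * of_real y) * of_real (V y) * jb y z)) holomorphic_on upper_open" for y
      by (cases "0 \<le> y") (auto intro!: holomorphic_intros jb_holo)
  qed (use m d in auto)
  then show "jbp 0 holomorphic_on upper_open"
    unfolding jbp_0[abs_def] set_lebesgue_integral_def by (intro holomorphic_intros)
qed

lemma jbp_cnj:
  assumes "0 \<le> x" "z \<in> upper_closed" shows "jbp x (- cnj z) = cnj (jbp x z)"
proof -
  have "(LINT y:{x..}|lborel. exp (2 * \<i> * (- cnj z) * of_real y) * of_real (V y) * jb y (- cnj z))
     = (\<integral>y. cnj (indicator {x..} y *\<^sub>R (exp (2 * \<i> * z * of_real y) * of_real (V y) * jb y z)) \<partial>lborel)"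
    unfolding set_lebesgue_integral_def using assms
    by (intro Bochner_Integration.integral_cong) (auto simp: indicator_def jb_cnj exp_cnj)
  also have "\<dots> = cnj (LINT y:{x..}|lborel. exp (2 * \<i> * z * of_real y) * of_real (V y) * jb y z)"
    unfolding set_lebesgue_integral_def by (rule Bochner_Integration.integral_cnj)
  finally show ?thesis unfolding jbp_def by (simp add: exp_cnj)
qed

definition jtheta :: "complex \<Rightarrow> real \<Rightarrow> complex" where
  "jtheta z x = exp (\<i> * z * of_real x) * jb x z"
definition jthetap :: "complex \<Rightarrow> real \<Rightarrow> complex" where
  "jthetap z x = exp (\<i> * z * of_real x) * (\<i> * z * jb x z + jbp x z)"

lemma jtheta_deriv:
  assumes x: "0 \<le> x" and z: "z \<in> upper_closed"
  shows "(jtheta z has_vector_derivative jthetap z x) (at x within {0..})"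
    and "(jthetap z has_vector_derivative (of_real (V x) - z\<^sup>2) * jtheta z x) (at x within {0..})"
proof -
  show "(jtheta z has_vector_derivative jthetap z x) (at x within {0..})"
    unfolding jtheta_def[abs_def] jthetap_def
    by (rule has_vector_derivative_eq_rhs[OF has_vector_derivative_mult[OF exp_vector_derivative jb_deriv[OF assms]]])
       (simp add: algebra_simps)
  show "(jthetap z has_vector_derivative (of_real (V x) - z\<^sup>2) * jtheta z x) (at x within {0..})"
    unfolding jthetap_def[abs_def] jtheta_def
    by (rule has_vector_derivative_eq_rhs[OF has_vector_derivative_mult[OF exp_vector_derivative has_vector_derivative_add[OF
          has_vector_derivative_mult[OF has_vector_derivative_const jb_deriv[OF assms]] jbp_deriv[OF assms]]]])
       (simp add: algebra_simps power2_eq_square)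
qed

end

section \<open>The Jost function on the closed half-plane\<close>

lemma exp_decay: "0 < \<tau> \<Longrightarrow> ((\<lambda>x::real. c * exp (- (\<tau> * x))) \<longlongrightarrow> 0) at_top"
proof -
  assume "0 < \<tau>"
  then have "filterlim (\<lambda>x::real. \<tau> * x) at_top at_top"
    by (intro filterlim_tendsto_pos_mult_at_top[OF tendsto_const] filterlim_ident)
  then have "((\<lambda>x. exp (- (\<tau> * x))) \<longlongrightarrow> 0) at_top"
    by (intro filterlim_compose[OF exp_at_bot] filterlim_compose[OF filterlim_uminus_at_bot_at_top])
  then show ?thesis by (rule tendsto_mult_right_zero)
qed

lemma has_vector_derivative_Re:
  "(f has_vector_derivative d) F \<Longrightarrow> ((\<lambda>x. Re (f x)) has_vector_derivative Re d) F"
  and has_vector_derivative_Im: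
  "(f has_vector_derivative d) F \<Longrightarrow> ((\<lambda>x. Im (f x)) has_vector_derivative Im d) F"
  by (rule bounded_linear.has_vector_derivative[OF bounded_linear_Re] bounded_linear.has_vector_derivative[OF bounded_linear_Im]; assumption)+

lemma has_vector_derivative_exp_decay:
  "((\<lambda>x. c * exp (- (s * x))) has_vector_derivative - (c * s * exp (- (s * x)))) (at x within A)" for c s x :: real
  unfolding has_real_derivative_iff_has_vector_derivative[symmetric]
  by (auto intro!: derivative_eq_intros)

context jost_potential
begin

text \<open>The Jost function of the constructed solution. Unlike \<open>jost_function\<close> it is
  under control at z = 0 as well; the two agree for real k > 0 by
  \<open>jost_function_eq\<close>.\<close>

definition jw :: "real \<Rightarrow> complex \<Rightarrow> complex" where
  "jw \<gamma> z = of_real \<gamma> * jtheta z 0 - jthetap z 0"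

lemma jtheta_0: "jtheta z 0 = jb 0 z" by (simp add: jtheta_def)
lemma jthetap_0: "jthetap z 0 = \<i> * z * jb 0 z + jbp 0 z" by (simp add: jthetap_def)

lemma jtheta_0_cont: "continuous_on upper_closed (\<lambda>z. jtheta z 0)"
  using continuous_on_compose2[OF jb_cont continuous_on_Pair[OF continuous_on_const[of _ 0] continuous_on_id], of upper_closed]
  by (auto simp: jtheta_0)

lemma jthetap_0_cont: "continuous_on upper_closed (\<lambda>z. jthetap z 0)"
  using jtheta_0_cont unfolding jthetap_0 jtheta_0 by (intro continuous_intros jbp_0_cont)

lemma jw_cont: "continuous_on upper_closed (jw \<gamma>)"
  unfolding jw_def by (intro continuous_intros jtheta_0_cont jthetap_0_cont)

lemma jw_holo: "jw \<gamma> holomorphic_on upper_open"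
  unfolding jw_def jtheta_0 jthetap_0 by (intro holomorphic_intros jb_holo jbp_0_holo) auto

lemma jtheta_cnj: "0 \<le> x \<Longrightarrow> z \<in> upper_closed \<Longrightarrow> jtheta (- cnj z) x = cnj (jtheta z x)"
  by (simp add: jtheta_def jb_cnj exp_cnj)
lemma jthetap_cnj: "0 \<le> x \<Longrightarrow> z \<in> upper_closed \<Longrightarrow> jthetap (- cnj z) x = cnj (jthetap z x)"
  by (simp add: jthetap_def jb_cnj jbp_cnj exp_cnj)
lemma jw_cnj: "z \<in> upper_closed \<Longrightarrow> jw \<gamma> (- cnj z) = cnj (jw \<gamma> z)"
  by (simp add: jw_def jtheta_cnj jthetap_cnj)

text \<open>From this point on \<open>jb\<close> stays within 1/2 of 1 for all z simultaneously, so
  the Jost solution has no zeros there.\<close>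

definition x_half :: real where "x_half = (SOME X. 0 \<le> X \<and> (\<forall>x\<ge>X. bnd * Q x \<le> 1/2))"

lemma x_half: "0 \<le> x_half" "\<And>x. x_half \<le> x \<Longrightarrow> bnd * Q x \<le> 1/2"
proof -
  have "((\<lambda>x. bnd * Q x) \<longlongrightarrow> bnd * 0) at_top" by (intro tendsto_intros Q_lim)
  then have "\<forall>\<^sub>F x in at_top. bnd * Q x < 1/2" by (rule order_tendstoD) simp
  then obtain N where N: "\<And>x. N \<le> x \<Longrightarrow> bnd * Q x < 1/2" by (auto simp: eventually_at_top_linorder)
  have "\<exists>X. 0 \<le> X \<and> (\<forall>x\<ge>X. bnd * Q x \<le> 1/2)"
    using N by (intro exI[of _ "max 0 N"]) (auto simp: less_imp_le)
  from someI_ex[OF this] show "0 \<le> x_half" "\<And>x. x_half \<le> x \<Longrightarrow> bnd * Q x \<le> 1/2"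
    by (auto simp: x_half_def)
qed

lemma jb_near_1:
  assumes "x_half \<le> x" "z \<in> upper_closed"
  shows "norm (jb x z - 1) \<le> 1/2" "1/2 \<le> Re (jb x z)" "1/2 \<le> norm (jb x z)"
proof -
  show *: "norm (jb x z - 1) \<le> 1/2"
    using norm_jb_minus_1[of x z] x_half(1) x_half(2)[OF assms(1)] assms by auto
  show "1/2 \<le> Re (jb x z)"
    using * abs_Re_le_cmod[of "jb x z - 1"] by (simp add: abs_le_iff)
  then show "1/2 \<le> norm (jb x z)" using complex_Re_le_cmod[of "jb x z"] by linarith
qed

lemma jtheta_norm: "norm (jtheta z x) = exp (- (Im z * x)) * norm (jb x z)"
  by (simp add: jtheta_def norm_mult)

lemma jtheta_bound:
  assumes "0 \<le> x" "z \<in> upper_closed"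
  shows "norm (jtheta z x) \<le> bnd * exp (- (Im z * x))"
  using jb_bound[OF assms] by (simp add: jtheta_norm mult.commute)

lemma jthetap_bound:
  assumes "0 \<le> x" "z \<in> upper_closed"
  shows "norm (jthetap z x) \<le> (bnd * norm z + bnd * Q 0) * exp (- (Im z * x))"
proof -
  have "norm (\<i> * z * jb x z + jbp x z) \<le> norm (\<i> * z * jb x z) + norm (jbp x z)" by (rule norm_triangle_ineq)
  also have "\<dots> \<le> bnd * norm z + bnd * Q 0"
  proof (rule add_mono)
    show "norm (\<i> * z * jb x z) \<le> bnd * norm z"
      using mult_left_mono[OF jb_bound[OF assms], of "norm z"] by (simp add: norm_mult mult.commute)
    show "norm (jbp x z) \<le> bnd * Q 0"
      by (rule order_trans[OF norm_jbp[OF assms] mult_left_mono]) (use Q_antimono[of 0 x] bnd_pos assms in auto)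
  qed
  finally show ?thesis by (simp add: jthetap_def norm_mult mult.commute)
qed

lemma jtheta_lim: "z \<in> upper_open \<Longrightarrow> (jtheta z \<longlongrightarrow> 0) at_top"
  and jthetap_lim: "z \<in> upper_open \<Longrightarrow> (jthetap z \<longlongrightarrow> 0) at_top"
proof -
  assume z: "z \<in> upper_open"
  show "(jtheta z \<longlongrightarrow> 0) at_top"
    using z jtheta_bound[of _ z] by (intro Lim_null_comparison[OF _ exp_decay[of "Im z" bnd]])
      (auto simp: eventually_at_top_linorder intro!: exI[of _ 0])
  show "(jthetap z \<longlongrightarrow> 0) at_top"
    using z jthetap_bound[of _ z] by (intro Lim_null_comparison[OF _ exp_decay[of "Im z" "bnd * norm z + bnd * Q 0"]])
      (auto simp: eventually_at_top_linorder intro!: exI[of _ 0])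
qed

text \<open>V is real, so it drops out of the imaginary part and only - Im z^2 times |theta|^2
  survives.\<close>

lemma wronskian_Im_deriv:
  assumes x: "0 \<le> x" and z: "z \<in> upper_closed"
  shows "((\<lambda>x. Im (jthetap z x * cnj (jtheta z x))) has_vector_derivative - (2 * Re z * Im z * (norm (jtheta z x))\<^sup>2)) (at x within {0..})"
proof (rule has_vector_derivative_eq_rhs[OF has_vector_derivative_Im[OF has_vector_derivative_mult[OF jtheta_deriv(2)[OF assms]
      has_vector_derivative_cnj[OF jtheta_deriv(1)[OF assms]]]]])
  have "Im ((of_real (V x) - z\<^sup>2) * jtheta z x * cnj (jtheta z x)) = - (2 * Re z * Im z * (norm (jtheta z x))\<^sup>2)"
    by (simp add: mult.assoc complex_norm_square[symmetric] Im_power2)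
  moreover have "Im (jthetap z x * cnj (jthetap z x)) = 0" by simp
  ultimately show "Im (jthetap z x * cnj (jthetap z x) + (of_real (V x) - z\<^sup>2) * jtheta z x * cnj (jtheta z x)) = - (2 * Re z * Im z * (norm (jtheta z x))\<^sup>2)"
    by (simp only: plus_complex.sel)
qed

text \<open>The Wronskian vanishes at infinity, hence at 0 it is the integral of 2 Re z Im z
  |theta|^2. Beyond \<open>x_half\<close>, |theta|^2 is at least exp (- 2 Im z x) / 4; integrating
  this exponential cancels the factor Im z, so that the bound survives as Im z tends to 0.\<close>

lemma wronskian_Im_lower_aux:
  assumes k: "0 < Re z" and t: "0 < Im z"
  shows "Re z / 4 * exp (- (2 * Im z * x_half)) \<le> Im (jthetap z 0 * cnj (jtheta z 0))"
proof -
  have z: "z \<in> upper_closed" using t by simp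
  define I where "I x = Im (jthetap z x * cnj (jtheta z x))" for x
  define s where "s = 2 * Im z"
  have Id: "(I has_vector_derivative - (2 * Re z * Im z * (norm (jtheta z x))\<^sup>2)) (at x within {a..})" if "0 \<le> a" "a \<le> x" for a x
    unfolding I_def[abs_def] using that by (intro has_vector_derivative_within_subset[OF wronskian_Im_deriv[OF _ z]]) auto
  have "- I x_half + Re z / 4 * exp (- (s * x_half)) \<le> 0"
  proof (rule nonpos_if_increasing_to_0[where f = "\<lambda>x. - I x + Re z / 4 * exp (- (s * x))"])
    fix x assume x: "x_half \<le> x"
    show "((\<lambda>x. - I x + Re z / 4 * exp (- (s * x))) has_vector_derivative
       - (- (2 * Re z * Im z * (norm (jtheta z x))\<^sup>2)) + - (Re z / 4 * s * exp (- (s * x)))) (at x within {x_half..})"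
      by (rule has_vector_derivative_add[OF has_vector_derivative_minus[OF Id[OF x_half(1) x]] has_vector_derivative_exp_decay])
    have "(1/2)\<^sup>2 \<le> (norm (jb x z))\<^sup>2" by (rule power_mono[OF jb_near_1(3)[OF x z]]) simp
    then have "exp (- (s * x)) * (1/4) \<le> exp (- (s * x)) * (norm (jb x z))\<^sup>2"
      by (intro mult_left_mono) (auto simp: power2_eq_square)
    also have "\<dots> = (norm (jtheta z x))\<^sup>2"
      by (simp add: jtheta_norm power_mult_distrib s_def exp_of_nat_mult[symmetric] mult.assoc)
    finally have "(2 * Re z * Im z) * (exp (- (s * x)) * (1/4)) \<le> (2 * Re z * Im z) * (norm (jtheta z x))\<^sup>2"
      using k t by (intro mult_left_mono) auto
    then show "0 \<le> - (- (2 * Re z * Im z * (norm (jtheta z x))\<^sup>2)) + - (Re z / 4 * s * exp (- (s * x)))"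
      by (simp add: s_def algebra_simps)
  next
    have "((\<lambda>x. - Im (jthetap z x * cnj (jtheta z x)) + Re z / 4 * exp (- (s * x))) \<longlongrightarrow> - Im (0 * cnj 0) + 0) at_top"
      by (intro tendsto_intros jtheta_lim jthetap_lim exp_decay) (use t in \<open>auto simp: s_def\<close>)
    then show "((\<lambda>x. - I x + Re z / 4 * exp (- (s * x))) \<longlongrightarrow> 0) at_top" by (simp add: I_def)
  qed
  moreover have "I x_half - I 0 \<le> 0"
  proof -
    have "((\<lambda>x. - (2 * Re z * Im z * (norm (jtheta z x))\<^sup>2)) has_integral (I x_half - I 0)) {0..x_half}"
      using x_half(1) by (intro fundamental_theorem_of_calculus)
        (auto intro!: has_vector_derivative_within_subset[OF Id[of 0]])
    from has_integral_neg[OF this] have "0 \<le> - (I x_half - I 0)"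
      by (rule has_integral_nonneg) (use k t in auto)
    then show ?thesis by simp
  qed
  ultimately show ?thesis by (simp add: I_def s_def)
qed

text \<open>On the real axis theta does not decay; that case is the limit from above along Re z + i
  / (n + 1), by continuity at x = 0.\<close>

lemma wronskian_Im_lower:
  assumes k: "0 < Re z" and t: "0 \<le> Im z"
  shows "Re z / 4 * exp (- (2 * Im z * x_half)) \<le> Im (jthetap z 0 * cnj (jtheta z 0))"
proof (cases "Im z = 0")
  case False then show ?thesis using wronskian_Im_lower_aux assms by simp
next
  case True
  define Z where "Z n = Complex (Re z) (1 / real (Suc n))" for n
  have "(\<lambda>n. Re z + \<i> * of_real (1 / real (Suc n))) \<longlonglongrightarrow> of_real (Re z) + \<i> * of_real 0"
    by (intro tendsto_intros LIMSEQ_Suc[OF lim_1_over_n[where 'a=real], unfolded of_nat_Suc]) (use LIMSEQ_inverse_real_of_nat in \<open>auto simp: divide_inverse\<close>)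
  then have "Z \<longlonglongrightarrow> of_real (Re z)"
    by (simp add: Z_def[abs_def] Complex_eq)
  moreover have "of_real (Re z) = z" using True by (simp add: complex_eq_iff)
  ultimately have Z: "Z \<longlonglongrightarrow> z" by (simp only:)
  have lim: "(\<lambda>n. Im (jthetap (Z n) 0 * cnj (jtheta (Z n) 0))) \<longlonglongrightarrow> Im (jthetap z 0 * cnj (jtheta z 0))"
    by (intro tendsto_intros continuous_on_tendsto_compose[OF jtheta_0_cont Z] continuous_on_tendsto_compose[OF jthetap_0_cont Z])
       (use t in \<open>auto simp: Z_def\<close>)
  have "(\<lambda>n. Re (Z n) / 4 * exp (- (2 * Im (Z n) * x_half))) \<longlonglongrightarrow> Re z / 4 * exp (- (2 * Im z * x_half))"
    by (intro tendsto_intros Z)  auto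
  then show ?thesis
  proof (rule LIMSEQ_le[OF _ lim], intro exI[of _ 0] allI impI)
    show "Re (Z n) / 4 * exp (- (2 * Im (Z n) * x_half)) \<le> Im (jthetap (Z n) 0 * cnj (jtheta (Z n) 0))" for n
      by (rule wronskian_Im_lower_aux) (use k in \<open>auto simp: Z_def\<close>)
  qed
qed

lemma jw_Im: "Im (jw \<gamma> z * cnj (jtheta z 0)) = - Im (jthetap z 0 * cnj (jtheta z 0))"
  by (simp add: jw_def algebra_simps)

text \<open>For real \<gamma> the summand \<gamma> |theta(0)|^2 is invisible to the imaginary part
  (\<open>jw_Im\<close>), so the Wronskian bound becomes one for \<open>jw\<close>; |theta(0)| \<le>
  \<open>bnd\<close>, and reflection covers Re z < 0. Three uses: there are no zeros off the
  imaginary axis, those on it are simple, and ln |w| has at most a logarithmic singularity at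
  0.\<close>

lemma jw_lower:
  assumes z: "z \<in> upper_closed"
  shows "\<bar>Re z\<bar> / 4 * exp (- (2 * Im z * x_half)) \<le> bnd * norm (jw \<gamma> z)"
proof -
  have *: "\<bar>Re z\<bar> / 4 * exp (- (2 * Im z * x_half)) \<le> bnd * norm (jw \<gamma> z)" if "0 < Re z" "z \<in> upper_closed" for z
  proof -
    have "\<bar>Re z\<bar> / 4 * exp (- (2 * Im z * x_half)) \<le> Im (jthetap z 0 * cnj (jtheta z 0))"
      using wronskian_Im_lower[of z] that by (simp del: times_complex.sel)
    also have "\<dots> \<le> \<bar>Im (jw \<gamma> z * cnj (jtheta z 0))\<bar>"
      unfolding jw_Im by (simp del: times_complex.sel)
    also have "\<dots> \<le> norm (jw \<gamma> z * cnj (jtheta z 0))" by (rule abs_Im_le_cmod)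
    also have "\<dots> \<le> bnd * norm (jw \<gamma> z)"
      using mult_left_mono[OF jb_bound[of 0 z], of "norm (jw \<gamma> z)"] that
      by (simp add: norm_mult jtheta_0 mult.commute)
    finally show ?thesis .
  qed
  consider "Re z = 0" | "0 < Re z" | "0 < Re (- cnj z)" by fastforce
  then show ?thesis
  proof cases
    case 1 then show ?thesis using bnd_pos by (auto intro: mult_nonneg_nonneg)
  next
    case 2 then show ?thesis using * z by blast
  next
    case 3
    then show ?thesis using *[of "- cnj z"] z jw_cnj[OF z] by simp
  qed
qed

lemma jw_nonzero: "z \<in> upper_closed \<Longrightarrow> Re z \<noteq> 0 \<Longrightarrow> jw \<gamma> z \<noteq> 0"
proof
  assume z: "z \<in> upper_closed" "Re z \<noteq> 0" and "jw \<gamma> z = 0"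
  then have "\<bar>Re z\<bar> / 4 * exp (- (2 * Im z * x_half)) \<le> 0" using jw_lower[OF z(1), of \<gamma>] by simp
  then show False using z(2) by (auto simp: mult_le_0_iff)
qed

text \<open>If theta(0,0) vanished, the boundary condition would make its derivative vanish too, and
  theta would be identically 0, against its size at \<open>x_half\<close>.\<close>

lemma jtheta_0_0_nonzero:
  assumes "jw \<gamma> 0 = 0" shows "jtheta 0 0 \<noteq> 0"
proof
  assume 0: "jtheta 0 0 = 0"
  then have p0: "jthetap 0 0 = 0" using assms by (simp add: jw_def)
  have "jtheta 0 x_half = 0"
  proof (rule second_order_ode_unique[of "jtheta 0" "jthetap 0" "\<lambda>x. of_real (V x)"])
    show "continuous_on {0..} (\<lambda>x. complex_of_real (V x))" by (intro continuous_intros contV)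
  qed (use jtheta_deriv[of _ 0] 0 p0 x_half(1) in auto)
  then show False using jb_near_1(3)[of x_half 0] by (simp add: jtheta_def)
qed

text \<open>The counterpart for large z: the kernel (exp (2 i z (y - x)) - 1) / (2 i z) is also
  bounded by 1 / |z|, since the exponential has modulus at most 1.\<close>

lemma norm_jb_minus_1':
  assumes x: "0 \<le> x" and z: "z \<in> upper_closed" and "z \<noteq> 0"
  shows "norm (jb x z - 1) \<le> bnd * Q 0 / norm z"
proof -
  have kn: "norm (volterra_kernel x y z) \<le> 1 / norm z" for y
  proof (cases "y \<le> x")
    case True then show ?thesis by (simp add: volterra_kernel_eq_0)
  next
    case False
    then have "volterra_kernel x y z = (exp (2 * \<i> * z * of_real (y - x)) - 1) / (2 * \<i> * z)"
      using \<open>z \<noteq> 0\<close> by (auto simp: volterra_kernel_def expdiv_def max_def)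
    moreover have "norm (exp (2 * \<i> * z * of_real (y - x)) - 1) \<le> 1 + 1"
      by (rule order_trans[OF norm_triangle_ineq4] add_mono norm_exp_upper z)+ (use False in auto)
    ultimately have "norm (volterra_kernel x y z) \<le> 2 / norm (2 * \<i> * z)"
      by (simp only: norm_divide) (intro divide_right_mono, auto)
    then show ?thesis by (simp add: norm_mult)
  qed
  have i: "set_integrable lborel {0..} (\<lambda>y. volterra_kernel x y z * of_real (V y) * jb y z)"
    using kernel_bound[where f = jb, OF x z _ jb_bound[OF _ z]]
    by (intro set_integrable_halfline_bound[OF volterra_integrand[OF jb_cont z], of x bnd]) (auto simp: mult.commute)
  have "jb x z - 1 = (\<integral>y. indicator {0..} y *\<^sub>R (volterra_kernel x y z * of_real (V y) * jb y z) \<partial>lborel)"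
    using jb_eq[OF assms(1,2)] by (simp add: volterra_def set_lebesgue_integral_def)
  also have "norm \<dots> \<le> (\<integral>y. norm (indicator {0..} y *\<^sub>R (volterra_kernel x y z * of_real (V y) * jb y z)) \<partial>lborel)"
    by (rule integral_norm_bound)
  also have "\<dots> \<le> (\<integral>y. indicator {0..} y *\<^sub>R (bnd / norm z * mom y) \<partial>lborel)"
  proof (rule integral_mono)
    show "integrable lborel (\<lambda>y. norm (indicator {0..} y *\<^sub>R (volterra_kernel x y z * of_real (V y) * jb y z)))"
      using i by (intro integrable_norm) (simp add: set_integrable_def)
    show "integrable lborel (\<lambda>y. indicator {0..} y *\<^sub>R (bnd / norm z * mom y))"
      using int_mom unfolding set_integrable_def[symmetric] by auto
    show "norm (indicator {0..} y *\<^sub>R (volterra_kernel x y z * of_real (V y) * jb y z)) \<le> indicator {0..} y *\<^sub>R (bnd / norm z * mom y)" for y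
      using mult_mono[OF kn[of y] Vjb_bound[OF z, of y]]
      by (cases "0 \<le> y") (auto simp: norm_mult mult.assoc)
  qed
  also have "\<dots> = (LINT y:{0..}|lborel. bnd / norm z * mom y)" by (simp only: set_lebesgue_integral_def)
  also have "\<dots> = bnd / norm z * Q 0" unfolding Q_def by (rule set_integral_mult_right)
  finally show ?thesis by simp
qed

lemma jw_large:
  obtains R where "0 < R" "\<bar>\<gamma>\<bar> < R" "\<And>z. z \<in> upper_closed \<Longrightarrow> R \<le> norm z \<Longrightarrow> norm (jw \<gamma> z / (of_real \<gamma> - \<i> * z) - 1) \<le> 1/2"
proof -
  define c where "c = bnd * Q 0"
  have c0: "0 \<le> c" using bnd_pos Q_nonneg[of 0] by (simp add: c_def)
  \<comment> \<open>2 |\<gamma>| \<le> |z| gives |\<gamma> - i z| \<ge> |z| / 2, so the two error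
    terms add up to 3 c / |z|, which is below 1/2 once 8 c \<le> |z|; the summand 1 keeps z away
    from 0.\<close>
  define R where "R = 1 + 2 * \<bar>\<gamma>\<bar> + 8 * c"
  have R: "norm (jw \<gamma> z / (of_real \<gamma> - \<i> * z) - 1) \<le> 1/2" if z: "z \<in> upper_closed" "R \<le> norm z" for z
  proof -
    have nz: "norm z > 0" "norm z \<ge> 8 * c" "norm z \<ge> 2 * \<bar>\<gamma>\<bar>" using z(2) c0 by (auto simp: R_def)
    have "norm (\<i> * z) \<le> norm (of_real \<gamma> - \<i> * z) + norm (complex_of_real \<gamma>)"
      using norm_triangle_ineq4[of "of_real \<gamma>" "of_real \<gamma> - \<i> * z"] by simp
    then have g: "norm z / 2 \<le> norm (of_real \<gamma> - \<i> * z)" using nz by (simp add: norm_mult)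
    then have gn: "of_real \<gamma> - \<i> * z \<noteq> 0" using nz by auto
    have "jw \<gamma> z / (of_real \<gamma> - \<i> * z) - 1 = (jb 0 z - 1) - jbp 0 z / (of_real \<gamma> - \<i> * z)"
      using gn by (simp add: jw_def jtheta_0 jthetap_0 field_simps)
    also have "norm \<dots> \<le> norm (jb 0 z - 1) + norm (jbp 0 z / (of_real \<gamma> - \<i> * z))" by (rule norm_triangle_ineq4)
    also have "\<dots> \<le> c / norm z + c / (norm z / 2)"
    proof (rule add_mono)
      show "norm (jb 0 z - 1) \<le> c / norm z" using norm_jb_minus_1'[of 0 z] z nz by (auto simp: c_def)
      show "norm (jbp 0 z / (of_real \<gamma> - \<i> * z)) \<le> c / (norm z / 2)"
        unfolding norm_divide using norm_jbp[of 0 z] z g nz c0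
        by (intro frac_le) (auto simp: c_def)
    qed
    also have "\<dots> = 3 * c / norm z" by (simp add: field_simps)
    also have "\<dots> \<le> 1/2" using nz c0 by (simp add: field_simps)
    finally show ?thesis .
  qed
  show ?thesis using that[of R] R c0 by (auto simp: R_def)
qed

section \<open>Finiteness of the zeros on the imaginary axis\<close>

definition jzeros :: "real \<Rightarrow> real set" where
  "jzeros \<gamma> = {\<kappa>. 0 < \<kappa> \<and> jw \<gamma> (\<i> * of_real \<kappa>) = 0}"

text \<open>Solutions belonging to two distinct zeros are orthogonal. Beyond \<open>x_half\<close>
  their product is at least exp (- (ka + kb) x) / 4, whose integral is of size 1 / (4 (ka + kb)),
  while the part over \<open>{0..x_half}\<close> is at least - \<open>bnd\<^sup>2 * x_half\<close>.
  For small ka and kb the total cannot be 0, so zeros do not accumulate at 0.\<close>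

lemma small_zeros:
  obtains k1 where "0 < k1"
    "\<And>ka kb. \<lbrakk>ka \<in> jzeros \<gamma>; kb \<in> jzeros \<gamma>; ka < k1; kb < k1\<rbrakk> \<Longrightarrow> ka = kb"
proof -
  \<comment> \<open>With s = ka + kb, orthogonality gives 1 - s x_half \<le> exp (- s x_half) \<le>
    4 s bnd^2 x_half, hence 2 \<le> s (8 bnd^2 x_half + 2 x_half). By this choice s < 2 k1 makes the
    right side less than 1; the summand 1 covers x_half = 0.\<close>
  define k1 where "k1 = 1 / (2 * (8 * bnd\<^sup>2 * x_half + 2 * x_half + 1))"
  have pos: "0 < 8 * bnd\<^sup>2 * x_half + 2 * x_half + 1" using x_half(1) by (simp add: add_nonneg_pos)
  have False if ab: "ka \<in> jzeros \<gamma>" "kb \<in> jzeros \<gamma>" "ka < kb" "kb < k1" for ka kb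
  proof -
    have k: "0 < ka" "0 < kb" "jw \<gamma> (\<i> * of_real ka) = 0" "jw \<gamma> (\<i> * of_real kb) = 0"
      using ab by (auto simp: jzeros_def)
    define t where "t k x = Re (jtheta (\<i> * of_real k) x)" for k x
    define t' where "t' k x = Re (jthetap (\<i> * of_real k) x)" for k x
    have td: "(t k has_vector_derivative t' k x) (at x within {0..})"
      "(t' k has_vector_derivative (V x + k\<^sup>2) * t k x) (at x within {0..})" if "0 < k" "0 \<le> x" for k x
    proof -
      show "(t k has_vector_derivative t' k x) (at x within {0..})"
        unfolding t_def[abs_def] t'_def
        by (rule has_vector_derivative_Re[OF jtheta_deriv(1)]) (use that in auto)
      have e: "complex_of_real (V x) - (\<i> * complex_of_real k)\<^sup>2 = of_real (V x + k\<^sup>2)"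
        by (simp add: power_mult_distrib)
      show "(t' k has_vector_derivative (V x + k\<^sup>2) * t k x) (at x within {0..})"
        unfolding t_def t'_def[abs_def]
        by (rule has_vector_derivative_eq_rhs[OF has_vector_derivative_Re[OF jtheta_deriv(2)]])
           (use that in \<open>auto simp only: e times_complex.sel Re_complex_of_real Im_complex_of_real mult_zero_left diff_zero
             mem_Collect_eq imaginary_unit.sel mult_1 add_0 less_imp_le mult_zero_right\<close>)
    qed
    have t0: "t' k 0 = \<gamma> * t k 0" if "jw \<gamma> (\<i> * of_real k) = 0" for k
      using arg_cong[OF that, of Re] by (simp add: jw_def t_def t'_def)
    define s where "s = ka + kb"
    have s: "0 < s" using k by (simp add: s_def)
    define D where "D = ka\<^sup>2 - kb\<^sup>2"
    have D: "D \<noteq> 0" using \<open>ka < kb\<close> k by (simp add: D_def power2_eq_iff)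
    \<comment> \<open>The Wronskian divided by ka^2 - kb^2 is a primitive of the product. It
      vanishes at 0, both solutions having the same boundary condition, and at infinity.\<close>
    define h where "h x = (t' ka x * t kb x - t ka x * t' kb x) / D" for x
    have hd: "(h has_vector_derivative t ka x * t kb x) (at x within {0..})" if "0 \<le> x" for x
    proof -
      have "((\<lambda>x. t' ka x * t kb x - t ka x * t' kb x) has_vector_derivative D * (t ka x * t kb x)) (at x within {0..})"
        by (rule has_vector_derivative_eq_rhs[OF has_vector_derivative_diff[OF has_vector_derivative_mult[OF td(2)[OF k(1) that] td(1)[OF k(2) that]]
             has_vector_derivative_mult[OF td(1)[OF k(1) that] td(2)[OF k(2) that]]]])
           (simp add: D_def algebra_simps)
      from has_vector_derivative_divide[OF this, of D] show ?thesis using D by (simp add: h_def[abs_def])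
    qed
    have h0: "h 0 = 0" using t0[OF k(3)] t0[OF k(4)] by (simp add: h_def)
    have tb: "\<bar>t k x\<bar> \<le> bnd" if "0 < k" "0 \<le> x" for k x
    proof -
      have "\<bar>t k x\<bar> \<le> norm (jtheta (\<i> * of_real k) x)" unfolding t_def by (rule abs_Re_le_cmod)
      also have "\<dots> \<le> bnd * exp (- (k * x))" using jtheta_bound[of x "\<i> * of_real k"] that by simp
      also have "\<dots> \<le> bnd * 1" using that bnd_pos by (intro mult_left_mono) auto
      finally show ?thesis by simp
    qed
    have tl: "exp (- (k * x)) / 2 \<le> t k x" if "0 < k" "x_half \<le> x" for k x
    proof -
      have "t k x = exp (- (k * x)) * Re (jb x (\<i> * of_real k))"
      proof -
        have "\<i> * (\<i> * of_real k) * of_real x = complex_of_real (- (k * x))" by simp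
        then have "jtheta (\<i> * of_real k) x = of_real (exp (- (k * x))) * jb x (\<i> * of_real k)"
          unfolding jtheta_def by (simp only: exp_of_real)
        then show ?thesis by (simp add: t_def)
      qed
      then show ?thesis using jb_near_1(2)[OF that(2), of "\<i> * of_real k"] that by simp
    qed
    have "h x_half + 1 / (4 * s) * exp (- (s * x_half)) \<le> 0"
    proof (rule nonpos_if_increasing_to_0[where f = "\<lambda>x. h x + 1 / (4 * s) * exp (- (s * x))"])
      fix x assume x: "x_half \<le> x"
      show "((\<lambda>x. h x + 1 / (4 * s) * exp (- (s * x))) has_vector_derivative
          t ka x * t kb x + - (1 / (4 * s) * s * exp (- (s * x)))) (at x within {x_half..})"
        using x_half(1) x by (intro has_vector_derivative_add has_vector_derivative_exp_decay has_vector_derivative_within_subset[OF hd]) auto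
      have "exp (- (ka * x)) / 2 * (exp (- (kb * x)) / 2) \<le> t ka x * t kb x"
        by (intro mult_mono tl k x order_trans[OF _ tl]) auto
      moreover have "exp (- (ka * x)) / 2 * (exp (- (kb * x)) / 2) = exp (- (s * x)) / 4"
        by (simp add: s_def exp_add[symmetric] algebra_simps)
      moreover have "1 / (4 * s) * s * exp (- (s * x)) = exp (- (s * x)) / 4" using s by simp
      ultimately show "0 \<le> t ka x * t kb x + - (1 / (4 * s) * s * exp (- (s * x)))" by linarith
    next
      have "((\<lambda>x. (t' ka x * t kb x - t ka x * t' kb x) / D + 1 / (4 * s) * exp (- (s * x))) \<longlongrightarrow>
          (Re 0 * Re 0 - Re 0 * Re 0) / D + 0) at_top"
        unfolding t_def t'_def
        by (intro tendsto_intros jtheta_lim jthetap_lim exp_decay s D) (use k in auto)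
      then show "((\<lambda>x. h x + 1 / (4 * s) * exp (- (s * x))) \<longlongrightarrow> 0) at_top" by (simp add: h_def)
    qed
    moreover have "- (bnd\<^sup>2 * x_half) \<le> h x_half"
    proof -
      have i1: "((\<lambda>x. t ka x * t kb x) has_integral (h x_half - h 0)) {0..x_half}"
        using x_half(1) by (intro fundamental_theorem_of_calculus) (auto intro!: has_vector_derivative_within_subset[OF hd])
      have i2: "((\<lambda>x. - bnd\<^sup>2) has_integral (- bnd\<^sup>2 * x_half)) {0..x_half}"
        using has_integral_const_real[of "- bnd\<^sup>2" 0 x_half] x_half(1) by (simp add: mult.commute)
      have "- bnd\<^sup>2 * x_half \<le> h x_half - h 0"
      proof (rule has_integral_le[OF i2 i1])
        fix x assume "x \<in> {0..x_half}"
        then have "\<bar>t ka x\<bar> * \<bar>t kb x\<bar> \<le> bnd * bnd" by (intro mult_mono tb k) (use bnd_pos in auto)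
        then show "- bnd\<^sup>2 \<le> t ka x * t kb x" by (simp add: power2_eq_square abs_mult[symmetric] abs_le_iff)
      qed
      then show ?thesis by (simp add: h0)
    qed
    ultimately have "1 / (4 * s) * exp (- (s * x_half)) \<le> bnd\<^sup>2 * x_half" by linarith
    then have 1: "exp (- (s * x_half)) \<le> 4 * s * (bnd\<^sup>2 * x_half)" using s by (simp add: field_simps)
    have "1 - s * x_half \<le> exp (- (s * x_half))" using exp_ge_add_one_self[of "- (s * x_half)"] by simp
    with 1 have "2 \<le> s * (8 * bnd\<^sup>2 * x_half + 2 * x_half)" by (simp add: algebra_simps)
    also have "\<dots> \<le> s * (8 * bnd\<^sup>2 * x_half + 2 * x_half + 1)" using s by (intro mult_left_mono) auto
    also have "\<dots> < 2 * k1 * (8 * bnd\<^sup>2 * x_half + 2 * x_half + 1)"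
      using ab pos by (intro mult_strict_right_mono) (auto simp: s_def)
    also have "\<dots> = 1" using pos by (simp add: k1_def)
    finally show False by simp
  qed
  then have "ka = kb" if "ka \<in> jzeros \<gamma>" "kb \<in> jzeros \<gamma>" "ka < k1" "kb < k1" for ka kb
    using that by (cases ka kb rule: linorder_cases) auto
  moreover have "0 < k1" using pos by (simp add: k1_def)
  ultimately show ?thesis using that by blast
qed

lemma convex_upper_open: "convex upper_open"
  by (rule convex_halfspace_Im_gt)

text \<open>Three ranges: close to 0 there is at most one zero by \<open>small_zeros\<close>, far
  out there is none by \<open>jw_large\<close>, and on the compact segment between them the identity
  theorem leaves finitely many.\<close>

lemma finite_jzeros: "finite (jzeros \<gamma>)"
proof -
  obtain k1 where k1: "0 < k1" "\<And>ka kb. \<lbrakk>ka \<in> jzeros \<gamma>; kb \<in> jzeros \<gamma>; ka < k1; kb < k1\<rbrakk> \<Longrightarrow> ka = kb"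
    by (rule small_zeros[of \<gamma>]) blast
  obtain R where R: "0 < R" "\<bar>\<gamma>\<bar> < R" "\<And>z. z \<in> upper_closed \<Longrightarrow> R \<le> norm z \<Longrightarrow> norm (jw \<gamma> z / (of_real \<gamma> - \<i> * z) - 1) \<le> 1/2"
    by (rule jw_large[of \<gamma>]) blast
  have "finite {z \<in> (\<lambda>t. \<i> * complex_of_real t) ` {k1..R}. jw \<gamma> z = 0}"
  proof (rule holomorphic_compact_finite_zeros[OF jw_holo open_upper_open])
    show "connected upper_open" by (rule convex_connected[OF convex_upper_open])
    show "compact ((\<lambda>t. \<i> * complex_of_real t) ` {k1..R})"
      by (intro compact_continuous_image continuous_intros) auto
    show "(\<lambda>t. \<i> * complex_of_real t) ` {k1..R} \<subseteq> upper_open" using k1 by auto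
    \<comment> \<open>A constant c divided by \<gamma> - i z would be smaller than 1/2 at z = i K
      for large K, whereas \<open>jw_large\<close> keeps this quotient within 1/2 of 1.\<close>
    show "\<not> jw \<gamma> constant_on upper_open"
    proof
      assume "jw \<gamma> constant_on upper_open"
      then obtain c where c: "\<And>z. z \<in> upper_open \<Longrightarrow> jw \<gamma> z = c" by (auto simp: constant_on_def)
      define K where "K = 4 * max (norm c) 1 + R + \<bar>\<gamma>\<bar>"
      have K: "0 < K" "R \<le> K" "4 * norm c + \<bar>\<gamma>\<bar> < K" using R by (auto simp: K_def max_def)
      define d where "d = complex_of_real \<gamma> - \<i> * (\<i> * of_real K)"
      have d: "norm d > 2 * norm c"
      proof -
        have "d = of_real (\<gamma> + K)" by (simp add: d_def)
        then have "norm d = \<bar>\<gamma> + K\<bar>" by (metis norm_of_real)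
        then show ?thesis using K norm_ge_zero[of c] by linarith
      qed
      have "norm (jw \<gamma> (\<i> * of_real K) / d - 1) \<le> 1/2"
        unfolding d_def using K by (intro R(3)) (auto simp: norm_mult)
      then have 1: "norm (c / d - 1) \<le> 1/2" using c[of "\<i> * of_real K"] K by simp
      have "norm (c / d) < 1/2" using d norm_ge_zero[of c] by (simp add: norm_divide divide_less_eq)
      moreover have "norm (1::complex) \<le> norm (c / d) + norm (c / d - 1)"
        using norm_triangle_ineq4[of "c / d" "c / d - 1"] by simp
      ultimately show False using 1 by simp
    qed
  qed
  then have f1: "finite (Im ` {z \<in> (\<lambda>t. \<i> * complex_of_real t) ` {k1..R}. jw \<gamma> z = 0})" by simp
  have f2: "finite (jzeros \<gamma> \<inter> {..<k1})"
  proof (cases "jzeros \<gamma> \<inter> {..<k1} = {}")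
    case False
    then obtain a where a: "a \<in> jzeros \<gamma>" "a < k1" by auto
    then have "jzeros \<gamma> \<inter> {..<k1} \<subseteq> {a}" using k1(2) by auto
    then show ?thesis using finite_subset by blast
  qed simp
  have "jzeros \<gamma> \<subseteq> (jzeros \<gamma> \<inter> {..<k1}) \<union> Im ` {z \<in> (\<lambda>t. \<i> * complex_of_real t) ` {k1..R}. jw \<gamma> z = 0}"
  proof
    fix k assume k: "k \<in> jzeros \<gamma>"
    have "k < R"
    proof (rule ccontr)
      assume "\<not> k < R"
      then have "norm (jw \<gamma> (\<i> * of_real k) / (of_real \<gamma> - \<i> * (\<i> * of_real k)) - 1) \<le> 1/2"
        using R(1) by (intro R(3)) (auto simp: norm_mult)
      then show False using k by (simp add: jzeros_def)
    qed
    then show "k \<in> (jzeros \<gamma> \<inter> {..<k1}) \<union> Im ` {z \<in> (\<lambda>t. \<i> * complex_of_real t) ` {k1..R}. jw \<gamma> z = 0}"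
      using k by (cases "k < k1") (auto simp: jzeros_def image_iff intro!: exI[of _ "\<i> * complex_of_real k"])
  qed
  then show ?thesis using f1 f2 finite_subset by (metis finite_UnI)
qed

end

section \<open>Identification with the Jost solution of the definitions\<close>

lemma at_within_atLeast_neq_bot: "0 \<le> (x::real) \<Longrightarrow> at x within {0..} \<noteq> bot"
proof -
  assume "0 \<le> x"
  then have "at x within {x<..} \<le> at x within {0..}" by (intro at_le) auto
  then show ?thesis using trivial_limit_at_right_real[of x] by (metis bot.extremum_uniqueI)
qed

lemma half_deriv_eqI:
  "0 \<le> x \<Longrightarrow> (f has_vector_derivative d) (at x within {0..}) \<Longrightarrow> half_deriv f x = d"
  unfolding half_deriv_def by (rule vector_derivative_within[OF at_within_atLeast_neq_bot])

lemma half_deriv_works: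
  "f differentiable_on {0..} \<Longrightarrow> 0 \<le> x \<Longrightarrow> (f has_vector_derivative half_deriv f x) (at x within {0..})"
  by (metis atLeast_iff differentiable_on_def half_deriv_def vector_derivative_works)

lemma differentiable_on_halfI:
  "(\<And>x. 0 \<le> x \<Longrightarrow> (f has_vector_derivative f' x) (at x within {0..})) \<Longrightarrow> f differentiable_on {0..}"
  by (metis atLeast_iff differentiable_on_def differentiableI_vector)

lemma constant_from_limit:
  fixes f :: "real \<Rightarrow> complex"
  assumes "\<And>x. 0 < x \<Longrightarrow> (f has_vector_derivative 0) (at x within {0..})" "(f \<longlongrightarrow> L) at_top" "0 < a"
  shows "f a = L"
proof -
  have "norm (f a - L) \<le> (LINT y:{a..}|lborel. (0::real))"
  proof (rule norm_le_tail_integral[where f = "\<lambda>x. f x - L" and f' = "\<lambda>_. 0"])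
    fix x assume "a \<le> x"
    have "(f has_vector_derivative 0) (at x within {a..})"
      by (rule has_vector_derivative_within_subset[OF assms(1)]) (use \<open>a \<le> x\<close> \<open>0 < a\<close> in auto)
    from has_vector_derivative_diff[OF this has_vector_derivative_const[of L]]
    show "((\<lambda>x. f x - L) has_vector_derivative 0) (at x within {a..})" by simp
  next
    show "((\<lambda>x. f x - L) \<longlongrightarrow> 0) at_top" using assms(2) by (rule LIM_zero)
  qed (auto simp: set_integrable_def)
  then show ?thesis by simp
qed

text \<open>Only real \<open>\<zeta> = k > 0\<close> matter: there \<open>|exp (i k x)| = 1\<close>, so the difference \<open>d\<close> of two Jost
  solutions and its derivative vanish at infinity, whence the Wronskians of \<open>d\<close> with \<open>\<theta>\<close> and with its
  conjugate vanish, whereas these two are linearly independent.\<close>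

lemma jost_solution_unique:
  assumes k: "0 < k" and 1: "is_jost_solution V (of_real k) \<phi>" and 2: "is_jost_solution V (of_real k) \<theta>"
    and "0 \<le> x"
  shows "\<phi> x = \<theta> x"
proof -
  define e where "e x = exp (\<i> * of_real k * of_real x)" for x
  have ne: "norm (e x) = 1" for x by (simp add: e_def)
  have e0: "e x \<noteq> 0" for x by (simp add: e_def)
  have D: "(u has_vector_derivative half_deriv u x) (at x within {0..})"
    "(half_deriv u has_vector_derivative half_deriv (half_deriv u) x) (at x within {0..})"
    "0 < x \<Longrightarrow> half_deriv (half_deriv u) x = (of_real (V x) - (of_real k)\<^sup>2) * u x"
    "((\<lambda>x. u x / e x) \<longlongrightarrow> 1) at_top" "((\<lambda>x. half_deriv u x / e x) \<longlongrightarrow> \<i> * of_real k) at_top"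
    if "is_jost_solution V (of_real k) u" "0 \<le> x" for u x
  proof -
    note j = that(1)[unfolded is_jost_solution_def]
    show "(u has_vector_derivative half_deriv u x) (at x within {0..})"
      "(half_deriv u has_vector_derivative half_deriv (half_deriv u) x) (at x within {0..})"
      using j that(2) by (auto intro: half_deriv_works)
    show "half_deriv (half_deriv u) x = (of_real (V x) - (of_real k)\<^sup>2) * u x" if "0 < x"
      using j that by (auto simp: algebra_simps)
    show "((\<lambda>x. u x / e x) \<longlongrightarrow> 1) at_top" using j by (simp add: e_def)
    have "((\<lambda>x. half_deriv u x / (\<i> * of_real k * e x)) \<longlongrightarrow> 1) at_top" using j by (simp add: e_def)
    from tendsto_mult_left[OF this, of "\<i> * of_real k"]
    show "((\<lambda>x. half_deriv u x / e x) \<longlongrightarrow> \<i> * of_real k) at_top"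
      using k by (simp add: field_simps)
  qed
  define d where "d x = \<phi> x - \<theta> x" for x
  define d' where "d' x = half_deriv \<phi> x - half_deriv \<theta> x" for x
  note D1 = D[OF 1] and D2 = D[OF 2]
  have dd: "(d has_vector_derivative d' x) (at x within {0..})" if "0 \<le> x" for x
    unfolding d_def[abs_def] d'_def by (intro has_vector_derivative_diff D1 D2 that)
  have dd': "(d' has_vector_derivative (of_real (V x) - (of_real k)\<^sup>2) * d x) (at x within {0..})" if "0 < x" for x
    unfolding d_def d'_def[abs_def]
    by (rule has_vector_derivative_eq_rhs[OF has_vector_derivative_diff[OF D1(2) D2(2)]])
       (use that D1(3)[of x] D2(3)[of x] in \<open>auto simp: algebra_simps\<close>)
  have td': "(half_deriv \<theta> has_vector_derivative (of_real (V x) - (of_real k)\<^sup>2) * \<theta> x) (at x within {0..})" if "0 < x" for x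
    using D2(2)[of x] D2(3)[of x] that by simp
  have l1: "((\<lambda>x. d x / e x) \<longlongrightarrow> 1 - 1) at_top" "((\<lambda>x. d' x / e x) \<longlongrightarrow> \<i> * of_real k - \<i> * of_real k) at_top"
    unfolding d_def d'_def diff_divide_distrib by (intro tendsto_intros D1(4,5)[of 0] D2(4,5)[of 0]; simp)+
  have W1: "d x * half_deriv \<theta> x - d' x * \<theta> x = 0" if "0 < x" for x
  proof (rule constant_from_limit[OF _ _ that, where f = "\<lambda>x. d x * half_deriv \<theta> x - d' x * \<theta> x"])
    fix x :: real assume x: "0 < x"
    then have x0: "0 \<le> x" by simp
    show "((\<lambda>x. d x * half_deriv \<theta> x - d' x * \<theta> x) has_vector_derivative 0) (at x within {0..})"
      by (rule has_vector_derivative_eq_rhs[OF has_vector_derivative_diff[OF has_vector_derivative_mult[OF dd[OF x0] td'[OF x]]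
          has_vector_derivative_mult[OF dd'[OF x] D2(1)[OF x0]]]]) (simp add: algebra_simps)
  next
    have n1: "((\<lambda>x. norm ((d x / e x) * (half_deriv \<theta> x / e x) - (d' x / e x) * (\<theta> x / e x))) \<longlongrightarrow>
       norm ((1 - 1) * (\<i> * of_real k) - (\<i> * of_real k - \<i> * of_real k) * 1)) at_top"
      by (intro tendsto_intros l1 D2(4,5)[of 0]) auto
    have n2: "norm ((d x / e x) * (half_deriv \<theta> x / e x) - (d' x / e x) * (\<theta> x / e x)) = norm (d x * half_deriv \<theta> x - d' x * \<theta> x)" for x
    proof -
      have "(d x / e x) * (half_deriv \<theta> x / e x) - (d' x / e x) * (\<theta> x / e x) = (d x * half_deriv \<theta> x - d' x * \<theta> x) / (e x * e x)"
        by (simp add: diff_divide_distrib)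
      then show ?thesis by (simp add: norm_divide norm_mult ne)
    qed
    have "((\<lambda>x. norm (d x * half_deriv \<theta> x - d' x * \<theta> x)) \<longlongrightarrow>
       norm ((1 - 1) * (\<i> * of_real k) - (\<i> * of_real k - \<i> * of_real k) * 1)) at_top"
      using n1 unfolding n2 .
    then have "((\<lambda>x. norm (d x * half_deriv \<theta> x - d' x * \<theta> x)) \<longlongrightarrow> 0) at_top" by simp
    then show "((\<lambda>x. d x * half_deriv \<theta> x - d' x * \<theta> x) \<longlongrightarrow> 0) at_top"
      by (rule tendsto_norm_zero_cancel)
  qed
  have ec: "e x * cnj (e x) = 1" for x
    using complex_norm_square[of "e x"] by (simp add: ne)
  have td'c: "((\<lambda>x. cnj (half_deriv \<theta> x)) has_vector_derivative (of_real (V x) - (of_real k)\<^sup>2) * cnj (\<theta> x)) (at x within {0..})" if "0 < x" for x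
    using has_vector_derivative_cnj[OF td'[OF that]] by simp
  have W2: "d x * cnj (half_deriv \<theta> x) - d' x * cnj (\<theta> x) = 0" if "0 < x" for x
  proof (rule constant_from_limit[OF _ _ that, where f = "\<lambda>x. d x * cnj (half_deriv \<theta> x) - d' x * cnj (\<theta> x)"])
    fix x :: real assume x: "0 < x"
    then have x0: "0 \<le> x" by simp
    show "((\<lambda>x. d x * cnj (half_deriv \<theta> x) - d' x * cnj (\<theta> x)) has_vector_derivative 0) (at x within {0..})"
      by (rule has_vector_derivative_eq_rhs[OF has_vector_derivative_diff[OF has_vector_derivative_mult[OF dd[OF x0] td'c[OF x]]
          has_vector_derivative_mult[OF dd'[OF x] has_vector_derivative_cnj[OF D2(1)[OF x0]]]]]) (simp add: algebra_simps)
  next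
    have "((\<lambda>x. (d x / e x) * cnj (half_deriv \<theta> x / e x) - (d' x / e x) * cnj (\<theta> x / e x)) \<longlongrightarrow>
       (1 - 1) * cnj (\<i> * of_real k) - (\<i> * of_real k - \<i> * of_real k) * cnj 1) at_top"
      by (intro tendsto_intros l1 D2(4,5)[of 0]) auto
    moreover have "(d x / e x) * cnj (half_deriv \<theta> x / e x) - (d' x / e x) * cnj (\<theta> x / e x) = d x * cnj (half_deriv \<theta> x) - d' x * cnj (\<theta> x)" for x
      using ec[of x] e0[of x] by simp
    ultimately show "((\<lambda>x. d x * cnj (half_deriv \<theta> x) - d' x * cnj (\<theta> x)) \<longlongrightarrow> 0) at_top"
      by simp
  qed
  have W3: "\<theta> x * cnj (half_deriv \<theta> x) - half_deriv \<theta> x * cnj (\<theta> x) = - 2 * \<i> * of_real k" if "0 < x" for x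
  proof (rule constant_from_limit[OF _ _ that, where f = "\<lambda>x. \<theta> x * cnj (half_deriv \<theta> x) - half_deriv \<theta> x * cnj (\<theta> x)"])
    fix x :: real assume x: "0 < x"
    then have x0: "0 \<le> x" by simp
    show "((\<lambda>x. \<theta> x * cnj (half_deriv \<theta> x) - half_deriv \<theta> x * cnj (\<theta> x)) has_vector_derivative 0) (at x within {0..})"
      by (rule has_vector_derivative_eq_rhs[OF has_vector_derivative_diff[OF has_vector_derivative_mult[OF D2(1)[OF x0] td'c[OF x]]
          has_vector_derivative_mult[OF td'[OF x] has_vector_derivative_cnj[OF D2(1)[OF x0]]]]]) (simp add: algebra_simps)
  next
    have "((\<lambda>x. (\<theta> x / e x) * cnj (half_deriv \<theta> x / e x) - (half_deriv \<theta> x / e x) * cnj (\<theta> x / e x)) \<longlongrightarrow>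
       1 * cnj (\<i> * of_real k) - (\<i> * of_real k) * cnj 1) at_top"
      by (intro tendsto_intros D2(4,5)[of 0]) auto
    moreover have "(\<theta> x / e x) * cnj (half_deriv \<theta> x / e x) - (half_deriv \<theta> x / e x) * cnj (\<theta> x / e x) = \<theta> x * cnj (half_deriv \<theta> x) - half_deriv \<theta> x * cnj (\<theta> x)" for x
      using ec[of x] e0[of x] by simp
    ultimately show "((\<lambda>x. \<theta> x * cnj (half_deriv \<theta> x) - half_deriv \<theta> x * cnj (\<theta> x)) \<longlongrightarrow> - 2 * \<i> * of_real k) at_top"
      by (simp add: mult.assoc)
  qed
  have d0: "d x = 0" if "0 < x" for x
  proof -
    have "d x * (\<theta> x * cnj (half_deriv \<theta> x) - half_deriv \<theta> x * cnj (\<theta> x))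
      = \<theta> x * (d x * cnj (half_deriv \<theta> x) - d' x * cnj (\<theta> x)) - cnj (\<theta> x) * (d x * half_deriv \<theta> x - d' x * \<theta> x)"
      by (simp add: algebra_simps)
    also have "\<dots> = 0" unfolding W1[OF that] W2[OF that] by simp
    finally show ?thesis unfolding W3[OF that] using k by simp
  qed
  have "d x = 0"
  proof (rule continuous_constant_on_closure[of "{0<..}" d])
    show "continuous_on (closure {0<..}) d"
      by (auto simp: continuous_on_eq_continuous_within intro!: has_vector_derivative_continuous[OF dd])
  qed (use d0 \<open>0 \<le> x\<close> in auto)
  then show ?thesis by (simp add: d_def)
qed

context jost_potential
begin

lemma half_deriv_jtheta:
  assumes "z \<in> upper_closed" "0 \<le> x"
  shows "half_deriv (\<lambda>x. if x < 0 then 0 else jtheta z x) x = jthetap z x"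
  by (rule half_deriv_eqI[OF assms(2)], rule has_vector_derivative_transform[rotated 2, OF jtheta_deriv(1)[OF assms(2,1)]])
     (use assms in auto)

text \<open>The value 0 at negative arguments matches the normalisation in
  \<open>jost_solution\<close>, where uniqueness means equality of functions on all reals. The two
  conditions at infinity reduce to the limits 1 of \<open>jb\<close> and 0 of
  \<open>jbp\<close>.\<close>

lemma is_jost_solution_jtheta:
  assumes k: "0 < k"
  shows "is_jost_solution V (of_real k) (\<lambda>x. if x < 0 then 0 else jtheta (of_real k) x)" (is "is_jost_solution V _ ?u")
proof -
  have z: "complex_of_real k \<in> upper_closed" by simp
  have d1: "(?u has_vector_derivative jthetap (of_real k) x) (at x within {0..})" if "0 \<le> x" for x
    by (rule has_vector_derivative_transform[rotated 2, OF jtheta_deriv(1)[OF that z]]) (use that in auto)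
  have d2: "(half_deriv ?u has_vector_derivative (of_real (V x) - (of_real k)\<^sup>2) * jtheta (of_real k) x) (at x within {0..})" if "0 \<le> x" for x
    by (rule has_vector_derivative_transform[rotated 2, OF jtheta_deriv(2)[OF that z]]) (use that half_deriv_jtheta[OF z] in auto)
  have Ql: "((\<lambda>x. bnd * Q x) \<longlongrightarrow> 0) at_top" using tendsto_mult_right_zero[OF Q_lim] by simp
  have blaschke: "((\<lambda>x. jb x (of_real k)) \<longlongrightarrow> 1) at_top"
  proof -
    have "((\<lambda>x. jb x (of_real k) - 1) \<longlongrightarrow> 0) at_top"
      by (rule Lim_null_comparison[OF _ Ql]) (use norm_jb_minus_1[OF _ z] in \<open>auto simp: eventually_at_top_linorder\<close>)
    then show ?thesis by (rule LIM_zero_cancel)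
  qed
  have bpl: "((\<lambda>x. jbp x (of_real k)) \<longlongrightarrow> 0) at_top"
    by (rule Lim_null_comparison[OF _ Ql]) (use norm_jbp[OF _ z] in \<open>auto simp: eventually_at_top_linorder\<close>)
  show ?thesis
    unfolding is_jost_solution_def
  proof (intro conjI)
    show "?u differentiable_on {0..}" by (rule differentiable_on_halfI[OF d1])
    show "half_deriv ?u differentiable_on {0..}" by (rule differentiable_on_halfI[OF d2])
    show "\<forall>x>0. - half_deriv (half_deriv ?u) x + of_real (V x) * ?u x = (of_real k)\<^sup>2 * ?u x"
      using half_deriv_eqI[OF _ d2] by (auto simp: algebra_simps)
    show "((\<lambda>x. ?u x / exp (\<i> * of_real k * of_real x)) \<longlongrightarrow> 1) at_top"
    proof (rule Lim_transform_eventually[OF blaschke])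
      show "\<forall>\<^sub>F x in at_top. jb x (of_real k) = ?u x / exp (\<i> * of_real k * of_real x)"
        using eventually_ge_at_top[of 0] by eventually_elim (simp add: jtheta_def)
    qed
    have "((\<lambda>x. jb x (of_real k) + jbp x (of_real k) / (\<i> * of_real k)) \<longlongrightarrow> 1 + 0 / (\<i> * of_real k)) at_top"
      using k by (intro tendsto_intros blaschke bpl) auto
    then have l: "((\<lambda>x. jb x (of_real k) + jbp x (of_real k) / (\<i> * of_real k)) \<longlongrightarrow> 1) at_top" by simp
    show "((\<lambda>x. half_deriv ?u x / (\<i> * of_real k * exp (\<i> * of_real k * of_real x))) \<longlongrightarrow> 1) at_top"
    proof (rule Lim_transform_eventually[OF l])
      show "\<forall>\<^sub>F x in at_top. jb x (of_real k) + jbp x (of_real k) / (\<i> * of_real k) = half_deriv ?u x / (\<i> * of_real k * exp (\<i> * of_real k * of_real x))"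
        using eventually_ge_at_top[of 0]
        by eventually_elim (use k in \<open>simp add: half_deriv_jtheta[OF z] jthetap_def field_simps\<close>)
    qed
  qed
qed

lemma jost_solution_eq:
  assumes k: "0 < k"
  shows "jost_solution V (of_real k) = (\<lambda>x. if x < 0 then 0 else jtheta (of_real k) x)" (is "_ = ?u")
  unfolding jost_solution_def
proof (rule the_equality)
  show "is_jost_solution V (of_real k) ?u \<and> (\<forall>x<0. ?u x = 0)"
    using is_jost_solution_jtheta[OF k] by simp
  fix \<theta> assume t: "is_jost_solution V (of_real k) \<theta> \<and> (\<forall>x<0. \<theta> x = 0)"
  show "\<theta> = ?u"
  proof
    fix x show "\<theta> x = ?u x"
      using jost_solution_unique[OF k conjunct1[OF t] is_jost_solution_jtheta[OF k], of x] t by (cases "x < 0") auto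
  qed
qed

lemma jost_function_eq: "0 < k \<Longrightarrow> jost_function V \<gamma> (of_real k) = jw \<gamma> (of_real k)"
  by (simp add: jost_function_def jost_solution_eq half_deriv_jtheta jw_def)

end

section \<open>Negative eigenvalues and zeros of the Jost function\<close>

lemma L2_half_mult:
  assumes "L2_half f" "L2_half g"
  shows "set_integrable lborel {0..} (\<lambda>x. f x * g x)"
proof -
  have fm: "set_borel_measurable lborel {0..} f" and gm: "set_borel_measurable lborel {0..} g"
    and f2: "set_integrable lborel {0..} (\<lambda>x. (cmod (f x))\<^sup>2)" and g2: "set_integrable lborel {0..} (\<lambda>x. (cmod (g x))\<^sup>2)"
    using assms by (auto simp: L2_half_def)
  have "(\<lambda>x. (indicator {0..} x *\<^sub>R f x) * (indicator {0..} x *\<^sub>R g x)) \<in> borel_measurable lborel"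
    using fm gm unfolding set_borel_measurable_def by (rule borel_measurable_times)
  moreover have "(\<lambda>x. (indicator {0..} x *\<^sub>R f x) * (indicator {0..} x *\<^sub>R g x)) = (\<lambda>x::real. indicator {0..} x *\<^sub>R (f x * g x))"
    by (auto simp: indicator_def fun_eq_iff)
  ultimately have m: "set_borel_measurable lborel {0..} (\<lambda>x. f x * g x)"
    by (simp only: set_borel_measurable_def)
  show ?thesis
  proof (rule set_integrable_bound[OF set_integral_add(1)[OF f2 g2] m])
    have "cmod (f x) * cmod (g x) \<le> (cmod (f x))\<^sup>2 + (cmod (g x))\<^sup>2" for x
    proof -
      have "2 * cmod (f x) * cmod (g x) \<le> (cmod (f x))\<^sup>2 + (cmod (g x))\<^sup>2" by (rule sum_squares_bound)
      moreover have "0 \<le> cmod (f x) * cmod (g x)" by simp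
      ultimately show ?thesis by linarith
    qed
    then show "AE x in lborel. x \<in> {0..} \<longrightarrow> norm (f x * g x) \<le> norm ((cmod (f x))\<^sup>2 + (cmod (g x))\<^sup>2)"
      by (intro AE_I2) (simp add: norm_mult)
  qed
qed

lemma set_borel_measurable_cnj:
  assumes "set_borel_measurable lborel {0..} (f :: real \<Rightarrow> complex)"
  shows "set_borel_measurable lborel {0..} (\<lambda>x. cnj (f x))"
proof -
  have "(\<lambda>x. cnj (indicator {0..} x *\<^sub>R f x)) \<in> borel_measurable lborel"
    using assms unfolding set_borel_measurable_def
    by (rule borel_measurable_continuous_on[OF continuous_on_cnj[OF continuous_on_id], simplified])
  then show ?thesis by (simp add: set_borel_measurable_def)
qed

lemma L2_half_cnj: "L2_half f \<Longrightarrow> L2_half (\<lambda>x. cnj (f x))"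
  using set_borel_measurable_cnj by (auto simp: L2_half_def)

lemma L2_half_locally_integrable:
  assumes "L2_half f" shows "set_integrable lborel {0..X} f"
proof -
  have f2: "set_integrable lborel {0..X} (\<lambda>x. (cmod (f x))\<^sup>2)"
    using assms unfolding L2_half_def by (auto intro: set_integrable_subset)
  have c: "set_integrable lborel {0..X} (\<lambda>x. 1::real)" by (intro borel_integrable_atLeastAtMost' continuous_intros)
  have m: "set_borel_measurable lborel {0..X} f"
    using assms unfolding L2_half_def by (auto intro: set_borel_measurable_subset)
  show ?thesis
  proof (rule set_integrable_bound[OF set_integral_add(1)[OF c f2] m])
    have "cmod (f x) \<le> 1 + (cmod (f x))\<^sup>2" for x
    proof -
      have "2 * cmod (f x) \<le> 1 + (cmod (f x))\<^sup>2" using sum_squares_bound[of 1 "cmod (f x)"] by simp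
      then show ?thesis using norm_ge_zero[of "f x"] by linarith
    qed
    then show "AE x in lborel. x \<in> {0..X} \<longrightarrow> norm (f x) \<le> norm (1 + (cmod (f x))\<^sup>2)"
      by (intro AE_I2) (smt (verit) real_norm_def)
  qed
qed

lemma L2_half_exp_bound:
  fixes f :: "real \<Rightarrow> complex"
  assumes c: "continuous_on {0..} f" and b: "\<And>x. 0 \<le> x \<Longrightarrow> norm (f x) \<le> B * exp (- (\<kappa> * x))" and k: "0 < \<kappa>"
  shows "L2_half f"
proof -
  have e: "set_integrable lborel {0..} (\<lambda>x. B\<^sup>2 * exp (- (2 * \<kappa> * x)))"
  proof -
    have "set_integrable lborel (einterval 0 \<infinity>) (\<lambda>x. exp (- (2 * \<kappa> * x)))"
    proof (rule interval_integral_FTC_nonneg(1)[where F = "\<lambda>x. - (exp (- (2 * \<kappa> * x)) / (2 * \<kappa>))" and A = "- (1 / (2 * \<kappa>))" and B = 0])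
      show "DERIV (\<lambda>x. - (exp (- (2 * \<kappa> * x)) / (2 * \<kappa>))) x :> exp (- (2 * \<kappa> * x))" for x
        using k by (auto intro!: derivative_eq_intros)
      have "((\<lambda>x. - (exp (- (2 * \<kappa> * x)) / (2 * \<kappa>))) \<longlongrightarrow> - (exp (- (2 * \<kappa> * 0)) / (2 * \<kappa>))) (at_right 0)"
        by (intro tendsto_intros) (use k in auto)
      then show "(((\<lambda>x. - (exp (- (2 * \<kappa> * x)) / (2 * \<kappa>))) \<circ> real_of_ereal) \<longlongrightarrow> - (1 / (2 * \<kappa>))) (at_right 0)"
        by (simp add: ereal_tendsto_simps1 zero_ereal_def)
      have "((\<lambda>x. - (exp (- (2 * \<kappa> * x)) / (2 * \<kappa>))) \<longlongrightarrow> - (0 / (2 * \<kappa>))) at_top"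
        using exp_decay[of "2 * \<kappa>" 1] k by (intro tendsto_intros) auto
      then show "(((\<lambda>x. - (exp (- (2 * \<kappa> * x)) / (2 * \<kappa>))) \<circ> real_of_ereal) \<longlongrightarrow> 0) (at_left \<infinity>)"
        by (simp add: ereal_tendsto_simps1)
    qed auto
    then have "set_integrable lborel {0<..} (\<lambda>x. exp (- (2 * \<kappa> * x)))"
      by (simp add: einterval_def zero_ereal_def greaterThan_def)
    then have "set_integrable lborel ({0<..} \<union> {0}) (\<lambda>x. exp (- (2 * \<kappa> * x)))"
    proof (rule set_integrable_Un)
      have "set_integrable lborel {0..0} (\<lambda>x. exp (- (2 * \<kappa> * x)))"
        by (intro borel_integrable_atLeastAtMost' continuous_intros)
      then show "set_integrable lborel {0} (\<lambda>x. exp (- (2 * \<kappa> * x)))" by simp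
    qed auto
    moreover have "{0<..} \<union> {0} = {0::real..}" by auto
    ultimately show ?thesis by (intro set_integrable_mult_right) simp
  qed
  have m: "set_borel_measurable lborel {0..} f"
    unfolding set_borel_measurable_def
    using borel_measurable_continuous_on_indicator[OF _ c] by simp
  have c2: "continuous_on {0..} (\<lambda>x. (cmod (f x))\<^sup>2)" by (intro continuous_intros c)
  have m2: "set_borel_measurable lborel {0..} (\<lambda>x. (cmod (f x))\<^sup>2)"
    unfolding set_borel_measurable_def
    using borel_measurable_continuous_on_indicator[OF _ c2] by simp
  have "set_integrable lborel {0..} (\<lambda>x. (cmod (f x))\<^sup>2)"
  proof (rule set_integrable_bound[OF e m2], intro AE_I2 impI)
    fix x :: real assume "x \<in> {0..}"
    then have "(norm (f x))\<^sup>2 \<le> (B * exp (- (\<kappa> * x)))\<^sup>2" by (intro power_mono b) auto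
    also have "\<dots> = B\<^sup>2 * exp (- (2 * \<kappa> * x))"
      by (simp add: power_mult_distrib exp_of_nat_mult[symmetric] mult.assoc)
    finally show "norm ((cmod (f x))\<^sup>2) \<le> norm (B\<^sup>2 * exp (- (2 * \<kappa> * x)))" by simp
  qed
  then show ?thesis using m by (simp add: L2_half_def)
qed

lemma set_lebesgue_integral_tendsto_halfline:
  fixes f :: "real \<Rightarrow> 'a::euclidean_space"
  assumes "set_integrable lborel {a..} f"
  shows "((\<lambda>X. LINT x:{a..X}|lborel. f x) \<longlongrightarrow> (LINT x:{a..}|lborel. f x)) at_top"
  by (rule tendsto_set_lebesgue_integral_at_top) (use assms in auto)

context jost_potential
begin

lemma V_bounded_mult_L2:
  assumes VB: "\<And>x. 0 \<le> x \<Longrightarrow> \<bar>V x\<bar> \<le> B" and u: "L2_half u"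
  shows "L2_half (\<lambda>x. of_real (V x) * u x)"
proof -
  have c: "continuous_on {0..} (\<lambda>x. complex_of_real (V x))" by (intro continuous_intros contV)
  have "(\<lambda>x. (indicator {0..} x *\<^sub>R complex_of_real (V x)) * (indicator {0..} x *\<^sub>R u x)) \<in> borel_measurable lborel"
    using u borel_measurable_continuous_on_indicator[OF _ c] unfolding L2_half_def set_borel_measurable_def
    by (intro borel_measurable_times) auto
  moreover have "(\<lambda>x. (indicator {0..} x *\<^sub>R complex_of_real (V x)) * (indicator {0..} x *\<^sub>R u x)) = (\<lambda>x. indicator {0..} x *\<^sub>R (of_real (V x) * u x))"
    by (auto simp: indicator_def fun_eq_iff)
  ultimately have m: "set_borel_measurable lborel {0..} (\<lambda>x. of_real (V x) * u x)"
    by (simp only: set_borel_measurable_def)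
  have "(\<lambda>x. (cmod (indicator {0..} x *\<^sub>R (of_real (V x) * u x)))\<^sup>2) \<in> borel_measurable lborel"
    using m unfolding set_borel_measurable_def by measurable
  moreover have "(\<lambda>x. (cmod (indicator {0..} x *\<^sub>R (of_real (V x) * u x)))\<^sup>2) = (\<lambda>x. indicator {0..} x *\<^sub>R (cmod (of_real (V x) * u x))\<^sup>2)"
    by (auto simp: indicator_def fun_eq_iff)
  ultimately have m2: "set_borel_measurable lborel {0..} (\<lambda>x. (cmod (of_real (V x) * u x))\<^sup>2)"
    by (simp only: set_borel_measurable_def)
  have u2: "set_integrable lborel {0..} (\<lambda>x. B\<^sup>2 * (cmod (u x))\<^sup>2)"
    using u by (auto simp: L2_half_def)
  have "set_integrable lborel {0..} (\<lambda>x. (cmod (of_real (V x) * u x))\<^sup>2)"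
  proof (rule set_integrable_bound[OF u2 m2], intro AE_I2 impI)
    fix x :: real assume "x \<in> {0..}"
    then have "\<bar>V x\<bar>\<^sup>2 \<le> B\<^sup>2" by (intro power_mono VB) auto
    then show "norm ((cmod (of_real (V x) * u x))\<^sup>2) \<le> norm (B\<^sup>2 * (cmod (u x))\<^sup>2)"
      by (simp add: norm_mult power_mult_distrib mult_right_mono)
  qed
  then show ?thesis using m by (simp add: L2_half_def)
qed

lemma jtheta_cont: "z \<in> upper_closed \<Longrightarrow> continuous_on {0..} (jtheta z)"
  and jthetap_cont: "z \<in> upper_closed \<Longrightarrow> continuous_on {0..} (jthetap z)"
  by (auto simp: continuous_on_eq_continuous_within
     intro!: has_vector_derivative_continuous[OF jtheta_deriv(1)] has_vector_derivative_continuous[OF jtheta_deriv(2)])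

lemma jtheta_L2:
  assumes "0 < \<kappa>" shows "L2_half (jtheta (\<i> * of_real \<kappa>))" "L2_half (jthetap (\<i> * of_real \<kappa>))"
proof -
  have z: "\<i> * complex_of_real \<kappa> \<in> upper_closed" using assms by simp
  show "L2_half (jtheta (\<i> * of_real \<kappa>))"
    using jtheta_bound[OF _ z] assms by (intro L2_half_exp_bound[of _ bnd \<kappa>] jtheta_cont z) auto
  show "L2_half (jthetap (\<i> * of_real \<kappa>))"
    using jthetap_bound[OF _ z] assms by (intro L2_half_exp_bound[of _ "bnd * norm (\<i> * complex_of_real \<kappa>) + bnd * Q 0" \<kappa>] jthetap_cont z) auto
qed

text \<open>At a zero theta decays exponentially and satisfies the boundary condition. The weak
  equation follows by integration by parts on \<open>{0..X}\<close>; the boundary term u'(X) cnj (v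
  X) converges because the other integrals do, and it is integrable in X, so its limit is 0. This
  handles every H^1 test function v without a pointwise bound on v.\<close>

lemma zero_imp_eigenvalue:
  assumes VB: "\<And>x. 0 \<le> x \<Longrightarrow> \<bar>V x\<bar> \<le> B" and k: "\<kappa> \<in> jzeros \<gamma>"
  shows "- (\<kappa>\<^sup>2) \<in> neg_eigenvalues V \<gamma>"
proof -
  have k0: "0 < \<kappa>" and w0: "jw \<gamma> (\<i> * of_real \<kappa>) = 0" using k by (auto simp: jzeros_def)
  define z where "z = \<i> * complex_of_real \<kappa>"
  have z: "z \<in> upper_closed" and z2: "z\<^sup>2 = - of_real (\<kappa>\<^sup>2)" using k0 by (auto simp: z_def power_mult_distrib)
  define u where "u = jtheta z"
  define u' where "u' = jthetap z"
  have ud: "(u has_vector_derivative u' x) (at x within {0..})"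
    "(u' has_vector_derivative (of_real (V x) + of_real (\<kappa>\<^sup>2)) * u x) (at x within {0..})" if "0 \<le> x" for x
    using jtheta_deriv[OF that z] by (auto simp: u_def u'_def z2)
  have uc: "continuous_on {0..} u" and uc': "continuous_on {0..} u'"
    unfolding u_def u'_def by (rule jtheta_cont[OF z] jthetap_cont[OF z])+
  have uL: "L2_half u" "L2_half u'" using jtheta_L2[OF k0] by (simp_all add: u_def u'_def z_def)
  have bc: "u' 0 = of_real \<gamma> * u 0" using w0 by (simp add: jw_def u_def u'_def z_def)
  have H1: "H1_half u u'"
    unfolding H1_half_def
  proof (intro conjI uL allI impI)
    fix x :: real assume "0 \<le> x"
    have "(LINT t:{0..x}|lborel. u' t) = u x - u 0"
      unfolding set_lebesgue_integral_def
      by (rule integral_FTC_atLeastAtMost[OF \<open>0 \<le> x\<close>])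
         (auto intro: continuous_on_subset[OF uc'] has_vector_derivative_within_subset[OF ud(1)])
    then show "u x = u 0 + (LINT t:{0..x}|lborel. u' t)" by simp
  qed
  have form: "schr_form V \<gamma> u u' v v' = L2_inner (\<lambda>x. of_real (- (\<kappa>\<^sup>2)) * u x) v" if v: "H1_half v v'" for v v'
  proof -
    have vL: "L2_half v" "L2_half v'" and veq: "\<And>x. 0 \<le> x \<Longrightarrow> v x = v 0 + (LINT t:{0..x}|lborel. v' t)"
      using v unfolding H1_half_def by blast+
    have v'i: "set_integrable lborel {0..X} v'" for X by (rule L2_half_locally_integrable[OF vL(2)])
    have v'ci: "set_integrable lborel {0..X} (\<lambda>x. cnj (v' x))" for X
      by (rule L2_half_locally_integrable[OF L2_half_cnj[OF vL(2)]])
    have vceq: "cnj (v x) = cnj (v 0) + (LINT t:{0..x}|lborel. cnj (v' t))" if "0 \<le> x" for x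
    proof -
      have "(LINT t:{0..x}|lborel. cnj (v' t)) = cnj (LINT t:{0..x}|lborel. v' t)"
        unfolding set_lebesgue_integral_def Bochner_Integration.integral_cnj[symmetric] by simp
      then show ?thesis using veq[OF that] by simp
    qed
    have i1: "set_integrable lborel {0..} (\<lambda>x. u' x * cnj (v' x))" by (rule L2_half_mult[OF uL(2) L2_half_cnj[OF vL(2)]])
    have i2: "set_integrable lborel {0..} (\<lambda>x. of_real (V x) * u x * cnj (v x))"
      by (rule L2_half_mult[OF V_bounded_mult_L2[OF VB uL(1)] L2_half_cnj[OF vL(1)]])
    have i3: "set_integrable lborel {0..} (\<lambda>x. u x * cnj (v x))" by (rule L2_half_mult[OF uL(1) L2_half_cnj[OF vL(1)]])
    have i4: "set_integrable lborel {0..} (\<lambda>x. u' x * cnj (v x))" by (rule L2_half_mult[OF uL(2) L2_half_cnj[OF vL(1)]])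
    let ?g = "\<lambda>x. u' x * cnj (v' x) + of_real (V x) * u x * cnj (v x) + of_real (\<kappa>\<^sup>2) * (u x * cnj (v x))"
    have i5: "set_integrable lborel {0..} ?g"
      by (intro set_integral_add(1) i1 i2 set_integrable_mult_right i3)
    have part: "(LINT x:{0..X}|lborel. ?g x) = u' X * cnj (v X) - u' 0 * cnj (v 0)" if "0 \<le> X" for X
    proof -
      have uX: "continuous_on {0..X} (\<lambda>x. (of_real (V x) + of_real (\<kappa>\<^sup>2)) * u x)"
        by (intro continuous_intros continuous_on_subset[OF uc] continuous_on_subset[OF contV]) auto
      have ibp: "(LINT t:{0..X}|lborel. u' t * cnj (v' t)) = u' X * cnj (v X) - u' 0 * cnj (v 0)
         - (LINT t:{0..X}|lborel. ((of_real (V t) + of_real (\<kappa>\<^sup>2)) * u t) * cnj (v t))"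
        by (rule integral_by_parts_AC[OF that v'ci vceq has_vector_derivative_within_subset[OF ud(2)] uX]) auto
      have j: "set_integrable lborel {0..X} (\<lambda>x. u' x * cnj (v' x))"
        "set_integrable lborel {0..X} (\<lambda>x. of_real (V x) * u x * cnj (v x) + of_real (\<kappa>\<^sup>2) * (u x * cnj (v x)))"
        by (rule set_integrable_subset[OF i1] set_integrable_subset[OF set_integral_add(1)[OF i2 set_integrable_mult_right[OF i3]]]; simp)+
      have "(LINT x:{0..X}|lborel. ?g x) = (LINT x:{0..X}|lborel. u' x * cnj (v' x)) +
          (LINT x:{0..X}|lborel. of_real (V x) * u x * cnj (v x) + of_real (\<kappa>\<^sup>2) * (u x * cnj (v x)))"
        unfolding add.assoc by (rule set_integral_add(2)[OF j])
      also have "(\<lambda>x. of_real (V x) * u x * cnj (v x) + of_real (\<kappa>\<^sup>2) * (u x * cnj (v x))) = (\<lambda>t. ((of_real (V t) + of_real (\<kappa>\<^sup>2)) * u t) * cnj (v t))"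
        by (auto simp: algebra_simps)
      finally show ?thesis unfolding ibp by simp
    qed
    have l1: "((\<lambda>X. LINT x:{0..X}|lborel. ?g x) \<longlongrightarrow> (LINT x:{0..}|lborel. ?g x)) at_top"
      by (rule set_lebesgue_integral_tendsto_halfline[OF i5])
    have l2: "((\<lambda>X. u' X * cnj (v X)) \<longlongrightarrow> (LINT x:{0..}|lborel. ?g x) + u' 0 * cnj (v 0)) at_top"
    proof (rule Lim_transform_eventually[OF tendsto_add[OF l1 tendsto_const[of "u' 0 * cnj (v 0)"]]])
      show "\<forall>\<^sub>F x in at_top. (LINT x:{0..x}|lborel. ?g x) + u' 0 * cnj (v 0) = u' x * cnj (v x)"
        using eventually_ge_at_top[of 0] by eventually_elim (simp only: part diff_add_cancel)
    qed
    have g0: "(LINT x:{0..}|lborel. ?g x) + u' 0 * cnj (v 0) = 0"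
      by (rule integrable_halfline_limit_eq_0[OF i4 l2])
    have gs: "(LINT x:{0..}|lborel. ?g x) = (LINT x:{0..}|lborel. u' x * cnj (v' x) + of_real (V x) * u x * cnj (v x)) + of_real (\<kappa>\<^sup>2) * (LINT x:{0..}|lborel. u x * cnj (v x))"
      using set_integral_add(2)[OF set_integral_add(1)[OF i1 i2] set_integrable_mult_right[OF i3]]
      by simp
    have Li: "L2_inner (\<lambda>x. of_real (- (\<kappa>\<^sup>2)) * u x) v = of_real (- (\<kappa>\<^sup>2)) * (LINT x:{0..}|lborel. u x * cnj (v x))"
      unfolding L2_inner_def mult.assoc by (rule set_integral_mult_right)
    have alg: "A + b = - k * B'" if "G + b = 0" "G = A + k * B'" for A b G B' k :: complex
    proof -
      have "A + b + k * B' = 0" using that by (simp add: add_ac)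
      then show ?thesis by (simp add: eq_neg_iff_add_eq_0)
    qed
    show ?thesis
      unfolding schr_form_def Li using alg[OF g0 gs] by (simp only: bc of_real_minus)
  qed
  have L: "L2_half (\<lambda>x. of_real (- (\<kappa>\<^sup>2)) * u x)"
    using jtheta_bound[OF _ z] k0 bnd_pos
    by (intro L2_half_exp_bound[of _ "\<kappa>\<^sup>2 * bnd" \<kappa>] continuous_intros uc)
       (auto simp: u_def z_def norm_mult norm_power mult.assoc intro!: mult_left_mono)
  have "u x_half \<noteq> 0" using jb_near_1(3)[of x_half z] z by (auto simp: u_def jtheta_def)
  then show ?thesis
    unfolding neg_eigenvalues_def schr_op_def using L H1 form k0 x_half(1) by auto
qed

text \<open>The converse: du Bois-Reymond's argument with the test function whose derivative is \<open>u' - p\<close> on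
  \<open>[0, X]\<close> turns a weak eigenfunction into a classical solution, and its Wronskian with \<open>\<theta>\<close>, being
  constant and integrable, vanishes.\<close>

lemma eigenvalue_imp_zero:
  assumes VB: "\<And>x. 0 \<le> x \<Longrightarrow> \<bar>V x\<bar> \<le> B" and ev: "ev \<in> neg_eigenvalues V \<gamma>"
  shows "sqrt (- ev) \<in> jzeros \<gamma>"
proof -
  obtain u u0' where evn: "ev < 0" and nz: "\<exists>x\<ge>0. u x \<noteq> 0" and H1: "H1_half u u0'"
    and form: "\<And>v v'. H1_half v v' \<Longrightarrow> schr_form V \<gamma> u u0' v v' = L2_inner (\<lambda>x. of_real ev * u x) v"
    using ev unfolding neg_eigenvalues_def schr_op_def by auto
  define \<kappa> where "\<kappa> = sqrt (- ev)"
  have k0: "0 < \<kappa>" and k2: "\<kappa>\<^sup>2 = - ev" using evn by (auto simp: \<kappa>_def)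
  have uL: "L2_half u" "L2_half u0'" and ueq: "\<And>x. 0 \<le> x \<Longrightarrow> u x = u 0 + (LINT t:{0..x}|lborel. u0' t)"
    using H1 unfolding H1_half_def by blast+
  have u0'i: "set_integrable lborel {0..X} u0'" for X by (rule L2_half_locally_integrable[OF uL(2)])
  have uc: "continuous_on {0..} u"
  proof -
    have "continuous_on {0..X} u" for X
    proof -
      have "continuous_on {0..X} (\<lambda>x. u 0 + integral {0..x} u0')"
        by (intro continuous_intros indefinite_integral_continuous_1 set_borel_integral_eq_integral(1) u0'i)
      moreover have "u x = u 0 + integral {0..x} u0'" if "x \<in> {0..X}" for x
        using ueq[of x] that set_borel_integral_eq_integral(2)[OF u0'i[of x]] by auto
      ultimately show ?thesis using continuous_on_cong by (metis (no_types, lifting))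
    qed
    then have c: "continuous (at x within {0..x+1}) u" if "0 \<le> x" for x
      using that by (auto simp: continuous_on_eq_continuous_within)
    show ?thesis
      unfolding continuous_on_eq_continuous_within
    proof
      fix x :: real assume x: "x \<in> {0..}"
      have "at x within {0..x+1} = at x within {0..}"
        by (rule at_within_nhd[of x "{..<x+1}"]) auto
      then show "continuous (at x within {0..}) u" using c[of x] x by simp
    qed
  qed
  define g where "g x = (of_real (V x) - of_real ev) * u x" for x
  have gc: "continuous_on {0..} g" unfolding g_def by (intro continuous_intros contV uc)
  \<comment> \<open>The candidate for the classical derivative of u: a primitive of (V - ev) u with
    initial value \<gamma> u(0), so that the natural boundary condition is built in.\<close>
  define p where "p x = of_real \<gamma> * u 0 + integral {0..x} g" for x
  have pd: "(p has_vector_derivative g x) (at x within {0..})" if "0 \<le> x" for x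
  proof -
    have "((\<lambda>u. integral {0..u} g) has_vector_derivative g x) (at x within {0..x+1})"
      by (rule integral_has_vector_derivative) (use \<open>0 \<le> x\<close> in \<open>auto intro: continuous_on_subset[OF gc]\<close>)
    moreover have "at x within {0..x+1} = at x within {0..}"
      by (rule at_within_nhd[of x "{..<x+1}"]) auto
    ultimately show ?thesis unfolding p_def[abs_def]
      using has_vector_derivative_add[OF has_vector_derivative_const] by fastforce
  qed
  have p0: "p 0 = of_real \<gamma> * u 0" by (simp add: p_def)
  have pc: "continuous_on {0..} p"
    by (auto simp: continuous_on_eq_continuous_within intro!: has_vector_derivative_continuous[OF pd])
  have AE: "AE x in lborel. x \<in> {0..X} \<longrightarrow> u0' x = p x" if X: "0 \<le> X" for X
  proof -
    define v' where "v' x = (if x \<in> {0..X} then u0' x - p x else 0)" for x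
    have v'i: "set_integrable lborel {0..X} v'"
    proof -
      have "set_integrable lborel {0..X} (\<lambda>x. u0' x - p x)"
        by (intro set_integral_diff(1) u0'i borel_integrable_atLeastAtMost' continuous_on_subset[OF pc]) auto
      moreover have "(\<lambda>x. indicator {0..X} x *\<^sub>R (u0' x - p x)) = (\<lambda>x. indicator {0..X} x *\<^sub>R v' x)"
        by (auto simp: fun_eq_iff indicator_def v'_def)
      ultimately show ?thesis by (simp only: set_integrable_def)
    qed
    \<comment> \<open>Integrated backwards from X, so that v vanishes at X and can be continued by 0
      as an H^1 function; its value at 0 stays free.\<close>
    define v where "v x = (if x \<in> {0..X} then - (LINT t:{x..X}|lborel. v' t) else 0)" for x
    have veq: "v x = v 0 + (LINT t:{0..x}|lborel. v' t)" if "0 \<le> x" for x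
    proof (cases "x \<le> X")
      case True
      have "(LINT t:{0..X}|lborel. v' t) = integral {0..X} v'" "(LINT t:{0..x}|lborel. v' t) = integral {0..x} v'"
         "(LINT t:{x..X}|lborel. v' t) = integral {x..X} v'"
        using True that by (auto intro!: set_borel_integral_eq_integral(2) set_integrable_subset[OF v'i])
      moreover have "integral {0..x} v' + integral {x..X} v' = integral {0..X} v'"
        using True that by (intro Henstock_Kurzweil_Integration.integral_combine set_borel_integral_eq_integral(1)[OF v'i]) auto
      ultimately show ?thesis using True that X by (simp add: v_def algebra_simps)
    next
      case False
      have "(LINT t:{0..x}|lborel. v' t) = (LINT t:{0..X}|lborel. v' t)"
        unfolding set_lebesgue_integral_def using False
        by (intro Bochner_Integration.integral_cong) (auto simp: indicator_def v'_def)
      then show ?thesis using False X by (simp add: v_def)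
    qed
    have vc: "continuous_on {0..X} v"
    proof -
      have "continuous_on {0..X} (\<lambda>x. v 0 + integral {0..x} v')"
        by (intro continuous_intros indefinite_integral_continuous_1 set_borel_integral_eq_integral(1) v'i)
      moreover have "v x = v 0 + integral {0..x} v'" if "x \<in> {0..X}" for x
        using veq[of x] that set_borel_integral_eq_integral(2)[OF set_integrable_subset[OF v'i, of "{0..x}"]] by auto
      ultimately show ?thesis using continuous_on_cong by (metis (no_types, lifting))
    qed
    have v0: "v x = 0" if "X \<le> x" for x
    proof (cases "x = X")
      case True
      have "(LINT t:{X..X}|lborel. v' t) = integral {X..X} v'"
        using X by (intro set_borel_integral_eq_integral(2) set_integrable_subset[OF v'i]) auto
      then show ?thesis using True X by (simp add: v_def)
    next
      case False then show ?thesis using that by (simp add: v_def)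
    qed
    have i0: "(\<lambda>x. indicator {0..} x *\<^sub>R v' x) = (\<lambda>x. indicator {0..X} x *\<^sub>R v' x)"
      by (auto simp: fun_eq_iff indicator_def v'_def)
    have i00: "(\<lambda>x. indicator {0..} x *\<^sub>R (cmod (v' x))\<^sup>2) = (\<lambda>x. indicator {0..X} x *\<^sub>R (cmod (v' x))\<^sup>2)"
      by (auto simp: fun_eq_iff indicator_def v'_def)
    have iv: "(\<lambda>x. indicator {0..} x *\<^sub>R v x) = (\<lambda>x. indicator {0..X} x *\<^sub>R v x)"
      and ivv: "(\<lambda>x. indicator {0..} x *\<^sub>R (cmod (v x))\<^sup>2) = (\<lambda>x. indicator {0..X} x *\<^sub>R (cmod (v x))\<^sup>2)"
      by (auto simp: fun_eq_iff indicator_def v0)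
    have vL: "L2_half v"
      unfolding L2_half_def set_borel_measurable_def set_integrable_def iv ivv
      using borel_integrable_atLeastAtMost'[OF vc] borel_integrable_atLeastAtMost'[OF continuous_on_power[OF continuous_on_norm[OF vc], of 2]]
      by (auto simp: set_integrable_def)
    have v'sq: "set_integrable lborel {0..X} (\<lambda>x. (cmod (v' x))\<^sup>2)"
    proof -
      have m: "set_borel_measurable lborel {0..X} (\<lambda>x. (cmod (v' x))\<^sup>2)"
      proof -
        have "(\<lambda>x. (cmod (indicator {0..X} x *\<^sub>R v' x))\<^sup>2) \<in> borel_measurable lborel"
          using v'i unfolding set_integrable_def by measurable
        moreover have "(\<lambda>x. (cmod (indicator {0..X} x *\<^sub>R v' x))\<^sup>2) = (\<lambda>x. indicator {0..X} x *\<^sub>R (cmod (v' x))\<^sup>2)"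
          by (auto simp: indicator_def fun_eq_iff)
        ultimately show ?thesis by (simp only: set_borel_measurable_def)
      qed
      have a: "set_integrable lborel {0..X} (\<lambda>x. 2 * (cmod (u0' x))\<^sup>2)"
        using uL(2) unfolding L2_half_def by (auto intro: set_integrable_subset)
      have b: "set_integrable lborel {0..X} (\<lambda>x. 2 * (cmod (p x))\<^sup>2)"
        by (intro borel_integrable_atLeastAtMost' continuous_intros continuous_on_subset[OF pc]) auto
      show ?thesis
      proof (rule set_integrable_bound[OF set_integral_add(1)[OF a b] m], intro AE_I2 impI)
        fix x assume "x \<in> {0..X}"
        have "(cmod (u0' x - p x))\<^sup>2 \<le> (cmod (u0' x) + cmod (p x))\<^sup>2"
          by (intro power_mono norm_triangle_ineq4) auto
        also have "\<dots> \<le> 2 * (cmod (u0' x))\<^sup>2 + 2 * (cmod (p x))\<^sup>2"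
          using sum_squares_bound[of "cmod (u0' x)" "cmod (p x)"] by (simp add: power2_sum)
        finally show "norm ((cmod (v' x))\<^sup>2) \<le> norm (2 * (cmod (u0' x))\<^sup>2 + 2 * (cmod (p x))\<^sup>2)"
          using \<open>x \<in> {0..X}\<close> by (simp add: v'_def)
      qed
    qed
    have v'L: "L2_half v'"
      unfolding L2_half_def set_borel_measurable_def set_integrable_def i0 i00
      using v'i v'sq by (auto simp: set_integrable_def)
    have H1v: "H1_half v v'" unfolding H1_half_def using vL v'L veq by blast
    have v'ci: "set_integrable lborel {0..X} (\<lambda>x. cnj (v' x))"
      by (rule L2_half_locally_integrable[OF L2_half_cnj[OF v'L]])
    have vceq: "cnj (v x) = cnj (v 0) + (LINT t:{0..x}|lborel. cnj (v' t))" if "0 \<le> x" for x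
    proof -
      have "(LINT t:{0..x}|lborel. cnj (v' t)) = cnj (LINT t:{0..x}|lborel. v' t)"
        unfolding set_lebesgue_integral_def Bochner_Integration.integral_cnj[symmetric] by simp
      then show ?thesis using veq[OF that] by simp
    qed
    have ibp: "(LINT t:{0..X}|lborel. p t * cnj (v' t)) = p X * cnj (v X) - p 0 * cnj (v 0) - (LINT t:{0..X}|lborel. g t * cnj (v t))"
      by (rule integral_by_parts_AC[OF X v'ci]) (auto intro: vceq has_vector_derivative_within_subset[OF pd] continuous_on_subset[OF gc])
    have j1: "set_integrable lborel {0..X} (\<lambda>x. u0' x * cnj (v' x))"
      by (rule set_integrable_subset[OF L2_half_mult[OF uL(2) L2_half_cnj[OF v'L]]]) auto
    have j2: "set_integrable lborel {0..X} (\<lambda>x. g x * cnj (v x))"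
      by (intro borel_integrable_atLeastAtMost' continuous_intros continuous_on_subset[OF gc] vc) auto
    have j3: "set_integrable lborel {0..X} (\<lambda>x. p x * cnj (v' x))"
    proof -
      have "set_integrable lborel {0..X} (\<lambda>x. u0' x * cnj (v' x) - v' x * cnj (v' x))"
        by (intro set_integral_diff(1) j1 set_integrable_subset[OF L2_half_mult[OF v'L L2_half_cnj[OF v'L]]]) auto
      moreover have "(\<lambda>x. indicator {0..X} x *\<^sub>R (u0' x * cnj (v' x) - v' x * cnj (v' x))) = (\<lambda>x. indicator {0..X} x *\<^sub>R (p x * cnj (v' x)))"
        by (auto simp: fun_eq_iff indicator_def v'_def algebra_simps)
      ultimately show ?thesis by (simp only: set_integrable_def)
    qed
    have f1: "(LINT x:{0..}|lborel. u0' x * cnj (v' x) + of_real (V x) * u x * cnj (v x)) - (LINT x:{0..}|lborel. of_real ev * u x * cnj (v x))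
       = (LINT x:{0..X}|lborel. u0' x * cnj (v' x)) + (LINT x:{0..X}|lborel. g x * cnj (v x))"
    proof -
      have k1: "set_integrable lborel {0..} (\<lambda>x. u0' x * cnj (v' x) + of_real (V x) * u x * cnj (v x))"
        by (intro set_integral_add(1) L2_half_mult V_bounded_mult_L2[OF VB] uL L2_half_cnj v'L vL)
      have k2: "set_integrable lborel {0..} (\<lambda>x. of_real ev * u x * cnj (v x))"
        unfolding mult.assoc by (intro set_integrable_mult_right L2_half_mult uL L2_half_cnj vL)
      have "(LINT x:{0..}|lborel. u0' x * cnj (v' x) + of_real (V x) * u x * cnj (v x)) - (LINT x:{0..}|lborel. of_real ev * u x * cnj (v x))
        = (LINT x:{0..}|lborel. (u0' x * cnj (v' x) + of_real (V x) * u x * cnj (v x)) - of_real ev * u x * cnj (v x))"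
        by (rule set_integral_diff(2)[OF k1 k2, symmetric])
      also have "\<dots> = (LINT x:{0..X}|lborel. u0' x * cnj (v' x) + g x * cnj (v x))"
        unfolding set_lebesgue_integral_def
        by (intro Bochner_Integration.integral_cong refl) (auto simp: indicator_def v'_def v0 g_def algebra_simps)
      also have "\<dots> = (LINT x:{0..X}|lborel. u0' x * cnj (v' x)) + (LINT x:{0..X}|lborel. g x * cnj (v x))"
        by (rule set_integral_add(2)[OF j1 j2])
      finally show ?thesis .
    qed
    \<comment> \<open>Against this stands the integration by parts of p times cnj v'. The terms at 0
      cancel by \<open>p0\<close>, those at X because v vanishes there, and what remains is the
      integral of |u0' - p|^2 over \<open>{0..X}\<close>, which is therefore 0.\<close>
    have "(LINT x:{0..X}|lborel. u0' x * cnj (v' x)) + (LINT x:{0..X}|lborel. g x * cnj (v x)) + of_real \<gamma> * u 0 * cnj (v 0) = 0"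
      using form[OF H1v] f1 unfolding schr_form_def L2_inner_def by (simp add: algebra_simps)
    then have "(LINT x:{0..X}|lborel. u0' x * cnj (v' x)) - (LINT x:{0..X}|lborel. p x * cnj (v' x)) = 0"
      unfolding ibp p0 using v0[of X] by (simp add: algebra_simps)
    then have "(LINT x:{0..X}|lborel. u0' x * cnj (v' x) - p x * cnj (v' x)) = 0"
      using set_integral_diff(2)[OF j1 j3] by simp
    also have "(LINT x:{0..X}|lborel. u0' x * cnj (v' x) - p x * cnj (v' x)) = (LINT x:{0..X}|lborel. complex_of_real ((cmod (v' x))\<^sup>2))"
      unfolding set_lebesgue_integral_def complex_norm_square
      by (intro Bochner_Integration.integral_cong refl) (auto simp: indicator_def v'_def algebra_simps)
    also have "\<dots> = of_real (LINT x:{0..X}|lborel. (cmod (v' x))\<^sup>2)"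
      by (rule set_integral_complex_of_real)
    finally have "(LINT x:{0..X}|lborel. (cmod (v' x))\<^sup>2) = 0" by simp
    then have "AE x in lborel. indicator {0..X} x *\<^sub>R (cmod (v' x))\<^sup>2 = (0::real)"
      using v'sq unfolding set_lebesgue_integral_def set_integrable_def
      by (subst (asm) integral_nonneg_eq_0_iff_AE) auto
    then show ?thesis
      by eventually_elim (auto simp: v'_def indicator_def)
  qed
  have ueq2: "u x = u 0 + integral {0..x} p" if "0 \<le> x" for x
  proof -
    have pi: "set_integrable lborel {0..x} p" by (intro borel_integrable_atLeastAtMost' continuous_on_subset[OF pc]) auto
    have "(LINT t:{0..x}|lborel. u0' t) = (LINT t:{0..x}|lborel. p t)"
      unfolding set_lebesgue_integral_def
    proof (rule integral_cong_AE)
      show "(\<lambda>t. indicator {0..x} t *\<^sub>R u0' t) \<in> borel_measurable lborel" "(\<lambda>t. indicator {0..x} t *\<^sub>R p t) \<in> borel_measurable lborel"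
        using u0'i[of x] pi unfolding set_integrable_def by (auto intro: borel_measurable_integrable)
      show "AE t in lborel. indicator {0..x} t *\<^sub>R u0' t = indicator {0..x} t *\<^sub>R p t"
        using AE[OF that] by eventually_elim (auto simp: indicator_def)
    qed
    then show ?thesis using ueq[OF that] set_borel_integral_eq_integral(2)[OF pi] by simp
  qed
  have ud: "(u has_vector_derivative p x) (at x within {0..})" if "0 \<le> x" for x
  proof -
    have "((\<lambda>u. integral {0..u} p) has_vector_derivative p x) (at x within {0..x+1})"
      by (rule integral_has_vector_derivative) (use \<open>0 \<le> x\<close> in \<open>auto intro: continuous_on_subset[OF pc]\<close>)
    moreover have "at x within {0..x+1} = at x within {0..}"
      by (rule at_within_nhd[of x "{..<x+1}"]) auto
    ultimately have "((\<lambda>x. u 0 + integral {0..x} p) has_vector_derivative 0 + p x) (at x within {0..})"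
      by (intro has_vector_derivative_add) auto
    then have "((\<lambda>x. u 0 + integral {0..x} p) has_vector_derivative p x) (at x within {0..})" by simp
    then show ?thesis
    proof (rule has_vector_derivative_transform[rotated 2])
      show "u y = u 0 + integral {0..y} p" if "y \<in> {0..}" for y
        using ueq2[of y] that by (simp only: atLeast_iff)
    qed (use that in simp)
  qed
  have pL: "L2_half p"
  proof -
    have AE': "AE x in lborel. x \<in> {0..} \<longrightarrow> u0' x = p x"
    proof -
      have "AE x in lborel. \<forall>n::nat. x \<in> {0..real n} \<longrightarrow> u0' x = p x"
        by (subst AE_all_countable) (use AE in auto)
      then show ?thesis
        by eventually_elim (metis atLeastAtMost_iff atLeast_iff real_arch_simple)
    qed
    have m: "set_borel_measurable lborel {0..} p" "set_borel_measurable lborel {0..} (\<lambda>x. (cmod (p x))\<^sup>2)"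
      unfolding set_borel_measurable_def
      using borel_measurable_continuous_on_indicator[OF _ pc] borel_measurable_continuous_on_indicator[OF _ continuous_on_power[OF continuous_on_norm[OF pc], of 2]] by auto
    have "set_integrable lborel {0..} (\<lambda>x. (cmod (p x))\<^sup>2)"
    proof (rule set_integrable_bound[of _ _ "\<lambda>x. (cmod (u0' x))\<^sup>2", OF _ m(2)])
      show "AE x in lborel. x \<in> {0..} \<longrightarrow> norm ((cmod (p x))\<^sup>2) \<le> norm ((cmod (u0' x))\<^sup>2)"
        using AE' by eventually_elim auto
    qed (use uL(2) in \<open>simp add: L2_half_def\<close>)
    then show ?thesis using m by (simp add: L2_half_def)
  qed
  define z where "z = \<i> * complex_of_real \<kappa>"
  have z: "z \<in> upper_closed" and z2: "z\<^sup>2 = of_real ev"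
    using k0 k2 by (auto simp: z_def power_mult_distrib simp flip: of_real_power)
  have tL: "L2_half (jtheta z)" "L2_half (jthetap z)" using jtheta_L2[OF k0] by (simp_all add: z_def)
  define W where "W x = p x * jtheta z x - u x * jthetap z x" for x
  have Wi: "set_integrable lborel {0..} W"
    unfolding W_def[abs_def] by (intro set_integral_diff(1) L2_half_mult uL pL tL)
  have Wd: "(W has_vector_derivative 0) (at x within {0..})" if "0 \<le> x" for x
    unfolding W_def[abs_def]
    by (rule has_vector_derivative_eq_rhs[OF has_vector_derivative_diff[OF has_vector_derivative_mult[OF pd[OF that] jtheta_deriv(1)[OF that z]]
          has_vector_derivative_mult[OF ud[OF that] jtheta_deriv(2)[OF that z]]]])
       (simp add: g_def z2 algebra_simps)
  obtain c where c: "\<And>x. x \<in> {0..} \<Longrightarrow> W x = c"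
    using has_vector_derivative_zero_constant[of "{0..}" W] Wd by auto
  have "(W \<longlongrightarrow> c) at_top"
    by (rule tendsto_eventually) (use c in \<open>auto simp: eventually_at_top_linorder\<close>)
  from integrable_halfline_limit_eq_0[OF Wi this] have W0: "W 0 = 0" using c[of 0] by simp
  then have "u 0 * jw \<gamma> z = 0" by (simp add: W_def p0 jw_def algebra_simps)
  moreover have "u 0 \<noteq> 0"
  proof
    assume u0: "u 0 = 0"
    obtain x where x: "0 \<le> x" "u x \<noteq> 0" using nz by blast
    have "u x = 0"
    proof (rule second_order_ode_unique[of u p "\<lambda>x. of_real (V x) - of_real ev"])
      show "continuous_on {0..} (\<lambda>x. complex_of_real (V x) - complex_of_real ev)" by (intro continuous_intros contV)
      show "p 0 = 0" using p0 u0 by simp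
    qed (use ud pd x u0 in \<open>auto simp: g_def\<close>)
    then show False using x by simp
  qed
  ultimately show ?thesis using k0 by (simp add: jzeros_def z_def \<kappa>_def)
qed

lemma neg_eigenvalues_eq:
  assumes VB: "\<And>x. 0 \<le> x \<Longrightarrow> \<bar>V x\<bar> \<le> B"
  shows "neg_eigenvalues V \<gamma> = (\<lambda>\<kappa>. - (\<kappa>\<^sup>2)) ` jzeros \<gamma>"
proof
  show "neg_eigenvalues V \<gamma> \<subseteq> (\<lambda>\<kappa>. - (\<kappa>\<^sup>2)) ` jzeros \<gamma>"
  proof
    fix ev assume ev: "ev \<in> neg_eigenvalues V \<gamma>"
    then have "ev < 0" by (simp add: neg_eigenvalues_def)
    then have "ev = - ((sqrt (- ev))\<^sup>2)" by simp
    then show "ev \<in> (\<lambda>\<kappa>. - (\<kappa>\<^sup>2)) ` jzeros \<gamma>" using eigenvalue_imp_zero[OF VB ev] by blast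
  qed
qed (use zero_imp_eigenvalue[OF VB] in auto)

end

section \<open>Decay classes and the coefficients b_n\<close>

text \<open>A symbol class of finite order with the same rate at every order: it is stable under
  products with \<open>bounded_class\<close> functions and integrable for \<rho> > 1. The derivative
  is existentially quantified, so membership can be shown from any formula for it.\<close>

fun decay_class :: "real \<Rightarrow> nat \<Rightarrow> (real \<Rightarrow> real) \<Rightarrow> bool" where
  "decay_class \<rho> 0 f \<longleftrightarrow> continuous_on {0..} f \<and> (\<exists>C. \<forall>x\<ge>0. \<bar>f x\<bar> \<le> C * (1 + x) powr - \<rho>)"
| "decay_class \<rho> (Suc k) f \<longleftrightarrow> decay_class \<rho> 0 f \<and>
     (\<exists>f'. (\<forall>x\<ge>0. (f has_vector_derivative f' x) (at x within {0..})) \<and> decay_class \<rho> k f')"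

text \<open>For functions like the constant 1 and the tail integrals, which are themselves only
  bounded but have derivatives in the decaying class.\<close>

fun bounded_class :: "real \<Rightarrow> nat \<Rightarrow> (real \<Rightarrow> real) \<Rightarrow> bool" where
  "bounded_class \<rho> 0 f \<longleftrightarrow> continuous_on {0..} f \<and> (\<exists>C. \<forall>x\<ge>0. \<bar>f x\<bar> \<le> C)"
| "bounded_class \<rho> (Suc k) f \<longleftrightarrow> bounded_class \<rho> 0 f \<and>
     (\<exists>f'. (\<forall>x\<ge>0. (f has_vector_derivative f' x) (at x within {0..})) \<and> decay_class \<rho> k f')"

lemma has_vector_derivative_complex_of_real:
  "(f has_vector_derivative d) F \<Longrightarrow> ((\<lambda>x. complex_of_real (f x)) has_vector_derivative of_real d) F"
  by (rule bounded_linear.has_vector_derivative[OF bounded_linear_of_real])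

lemma has_vector_derivative_cong_half:
  assumes "\<And>x. 0 \<le> x \<Longrightarrow> f x = g x" "0 \<le> x" "(f has_vector_derivative d) (at x within {0..})"
  shows "(g has_vector_derivative d) (at x within {0..})"
  by (rule has_vector_derivative_transform[rotated 2, OF assms(3)]) (use assms in auto)

lemma decay_class_cong: "(\<And>x. 0 \<le> x \<Longrightarrow> f x = g x) \<Longrightarrow> decay_class \<rho> k f \<Longrightarrow> decay_class \<rho> k g"
proof (cases k)
  case 0
  assume "\<And>x. 0 \<le> x \<Longrightarrow> f x = g x" "decay_class \<rho> k f"
  then show ?thesis using 0 continuous_on_cong[of "{0..}" "{0..}" f g] by auto
next
  case (Suc m)
  assume *: "\<And>x. 0 \<le> x \<Longrightarrow> f x = g x" "decay_class \<rho> k f"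
  then have "decay_class \<rho> 0 g" using Suc continuous_on_cong[of "{0..}" "{0..}" f g] by auto
  moreover obtain f' where "\<forall>x\<ge>0. (f has_vector_derivative f' x) (at x within {0..})" "decay_class \<rho> m f'"
    using * Suc by auto
  then have "\<forall>x\<ge>0. (g has_vector_derivative f' x) (at x within {0..})"
    using has_vector_derivative_cong_half[of f g] *(1) by blast
  ultimately show ?thesis using Suc \<open>decay_class \<rho> m f'\<close> by (metis decay_class.simps(2))
qed

lemma decay_class_0: "decay_class \<rho> k f \<Longrightarrow> decay_class \<rho> 0 f"
  by (cases k) auto

lemma decay_class_Suc: "decay_class \<rho> (Suc k) f \<Longrightarrow> decay_class \<rho> k f"
proof (induction k arbitrary: f)
  case 0 then show ?case by simp
next
  case (Suc k)
  then obtain f' where "decay_class \<rho> 0 f" "\<forall>x\<ge>0. (f has_vector_derivative f' x) (at x within {0..})" "decay_class \<rho> (Suc k) f'"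
    by (metis decay_class.simps(2))
  then show ?case using Suc.IH[of f'] by (metis decay_class.simps(2))
qed

lemma bounded_class_0: "bounded_class \<rho> k f \<Longrightarrow> bounded_class \<rho> 0 f"
  by (cases k) auto

lemma bounded_class_Suc: "bounded_class \<rho> (Suc k) f \<Longrightarrow> bounded_class \<rho> k f"
  by (cases k) (metis bounded_class_0, metis bounded_class.simps(2) decay_class_Suc)

lemma decay_0_imp_bounded_0:
  assumes "0 \<le> \<rho>" "decay_class \<rho> 0 f" shows "bounded_class \<rho> 0 f"
proof -
  obtain C where C: "\<And>x. 0 \<le> x \<Longrightarrow> \<bar>f x\<bar> \<le> C * (1 + x) powr - \<rho>" using assms by auto
  have C0: "0 \<le> C" using C[of 0] by simp
  have "\<bar>f x\<bar> \<le> C" if "0 \<le> x" for x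
  proof -
    have "(1 + x) powr - \<rho> \<le> (1 + x) powr 0" using assms that by (intro powr_mono) auto
    also have "\<dots> = 1" using that by simp
    finally have "C * (1 + x) powr - \<rho> \<le> C * 1" using C0 by (intro mult_left_mono) auto
    then show ?thesis using C[OF that] by simp
  qed
  then show ?thesis using assms by auto
qed

lemma decay_imp_bounded:
  assumes "0 \<le> \<rho>" "decay_class \<rho> k f" shows "bounded_class \<rho> k f"
proof (cases k)
  case 0 then show ?thesis using assms decay_0_imp_bounded_0 by simp
next
  case (Suc m)
  then show ?thesis
    using assms decay_0_imp_bounded_0[OF assms(1) decay_class_0[OF assms(2)]] decay_class_Suc by (metis bounded_class.simps(2) decay_class.simps(2))
qed

lemma decay_class_SucI:
  assumes "decay_class \<rho> 0 f" "\<And>x. 0 \<le> x \<Longrightarrow> (f has_vector_derivative f' x) (at x within {0..})" "decay_class \<rho> k f'"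
  shows "decay_class \<rho> (Suc k) f"
  by (unfold decay_class.simps(2), intro conjI exI[of _ f'] allI impI; (rule assms | assumption)+)

lemma bounded_class_SucI:
  assumes "bounded_class \<rho> 0 f" "\<And>x. 0 \<le> x \<Longrightarrow> (f has_vector_derivative f' x) (at x within {0..})" "decay_class \<rho> k f'"
  shows "bounded_class \<rho> (Suc k) f"
  by (unfold bounded_class.simps(2), intro conjI exI[of _ f'] allI impI; (rule assms | assumption)+)

lemma decay_class_zero: "decay_class \<rho> k (\<lambda>x. 0)"
  by (induction k) (auto intro!: exI[of _ 0] exI[of _ "\<lambda>x. 0"])

lemma bounded_class_const: "bounded_class \<rho> k (\<lambda>x. c)"
proof (cases k)
  case (Suc m)
  show ?thesis unfolding Suc by (rule bounded_class_SucI[OF _ _ decay_class_zero]) auto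
qed auto

lemma decay_0_add:
  assumes "decay_class \<rho> 0 f" "decay_class \<rho> 0 g" shows "decay_class \<rho> 0 (\<lambda>x. f x + g x)"
proof -
  obtain C where C: "\<And>x. 0 \<le> x \<Longrightarrow> \<bar>f x\<bar> \<le> C * (1 + x) powr - \<rho>" using assms(1) by auto
  obtain D where D: "\<And>x. 0 \<le> x \<Longrightarrow> \<bar>g x\<bar> \<le> D * (1 + x) powr - \<rho>" using assms(2) by auto
  have "\<bar>f x + g x\<bar> \<le> (C + D) * (1 + x) powr - \<rho>" if "0 \<le> x" for x
    using add_mono[OF C[OF that] D[OF that]] abs_triangle_ineq[of "f x" "g x"] by (simp add: distrib_right)
  then show ?thesis using assms by (auto intro!: continuous_intros)
qed

lemma decay_class_add:
  "decay_class \<rho> k f \<Longrightarrow> decay_class \<rho> k g \<Longrightarrow> decay_class \<rho> k (\<lambda>x. f x + g x)"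
proof (induction k arbitrary: f g)
  case 0 then show ?case by (rule decay_0_add)
next
  case (Suc k)
  obtain f' where f': "\<And>x. 0 \<le> x \<Longrightarrow> (f has_vector_derivative f' x) (at x within {0..})" "decay_class \<rho> k f'"
    using Suc.prems(1) by auto
  obtain g' where g': "\<And>x. 0 \<le> x \<Longrightarrow> (g has_vector_derivative g' x) (at x within {0..})" "decay_class \<rho> k g'"
    using Suc.prems(2) by auto
  show ?case
    by (rule decay_class_SucI[OF decay_0_add[OF decay_class_0[OF Suc.prems(1)] decay_class_0[OF Suc.prems(2)]]
          has_vector_derivative_add[OF f'(1) g'(1)] Suc.IH[OF f'(2) g'(2)]])
qed

lemma decay_0_mult:
  assumes "decay_class \<rho> 0 f" "bounded_class \<rho> 0 g" shows "decay_class \<rho> 0 (\<lambda>x. f x * g x)"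
proof -
  obtain C where C: "\<And>x. 0 \<le> x \<Longrightarrow> \<bar>f x\<bar> \<le> C * (1 + x) powr - \<rho>" using assms(1) by auto
  obtain D where D: "\<And>x. 0 \<le> x \<Longrightarrow> \<bar>g x\<bar> \<le> D" using assms(2) by auto
  have "\<bar>f x * g x\<bar> \<le> (C * D) * (1 + x) powr - \<rho>" if "0 \<le> x" for x
    using mult_mono[OF C[OF that] D[OF that]] order_trans[OF abs_ge_zero C[OF that]]
    by (simp add: abs_mult mult_ac)
  then show ?thesis using assms by (auto intro!: continuous_intros)
qed

text \<open>In the product rule the summand f g' has two decaying factors; the second is demoted to
  a bounded one, so that the induction hypothesis covers it.\<close>

lemma decay_class_mult:
  "0 \<le> \<rho> \<Longrightarrow> decay_class \<rho> k f \<Longrightarrow> bounded_class \<rho> k g \<Longrightarrow> decay_class \<rho> k (\<lambda>x. f x * g x)"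
proof (induction k arbitrary: f g)
  case 0 then show ?case using decay_0_mult by blast
next
  case (Suc k)
  obtain f' where f': "\<forall>x\<ge>0. (f has_vector_derivative f' x) (at x within {0..})" "decay_class \<rho> k f'"
    using Suc.prems(2) by auto
  obtain g' where g': "\<forall>x\<ge>0. (g has_vector_derivative g' x) (at x within {0..})" "decay_class \<rho> k g'"
    using Suc.prems(3) by auto
  note r = Suc.prems(1)
  show ?case
  proof (rule decay_class_SucI[OF decay_0_mult[OF decay_class_0[OF Suc.prems(2)] bounded_class_0[OF Suc.prems(3)]]])
    show "((\<lambda>x. f x * g x) has_vector_derivative f x * g' x + f' x * g x) (at x within {0..})" if "0 \<le> x" for x
      using f'(1) g'(1) that by (auto intro: has_vector_derivative_mult)
    show "decay_class \<rho> k (\<lambda>x. f x * g' x + f' x * g x)"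
      by (rule decay_class_add[OF Suc.IH[OF r decay_class_Suc[OF Suc.prems(2)] decay_imp_bounded[OF r g'(2)]]
           Suc.IH[OF r f'(2) bounded_class_Suc[OF Suc.prems(3)]]])
  qed
qed

lemma powr_halfline_integrable:
  assumes "1 < \<rho>" shows "set_integrable lborel {0..} (\<lambda>x::real. (1 + x) powr - \<rho>)"
proof -
  have "set_integrable lborel (einterval 0 \<infinity>) (\<lambda>x::real. (1 + x) powr - \<rho>)"
  proof (rule interval_integral_FTC_nonneg(1)[where F = "\<lambda>x. (1 + x) powr (1 - \<rho>) / (1 - \<rho>)" and A = "1 / (1 - \<rho>)" and B = 0])
    show "DERIV (\<lambda>x::real. (1 + x) powr (1 - \<rho>) / (1 - \<rho>)) x :> (1 + x) powr - \<rho>" if "0 < ereal x" for x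
      using that assms by (auto intro!: derivative_eq_intros)
    show "isCont (\<lambda>x::real. (1 + x) powr - \<rho>) x" if "0 < ereal x" for x
      using that by (auto intro!: continuous_intros)
    have "((\<lambda>x::real. (1 + x) powr (1 - \<rho>) / (1 - \<rho>)) \<longlongrightarrow> (1 + 0) powr (1 - \<rho>) / (1 - \<rho>)) (at_right 0)"
      using assms by (intro tendsto_intros) auto
    then show "(((\<lambda>x::real. (1 + x) powr (1 - \<rho>) / (1 - \<rho>)) \<circ> real_of_ereal) \<longlongrightarrow> 1 / (1 - \<rho>)) (at_right 0)"
      by (simp add: ereal_tendsto_simps1 zero_ereal_def)
    have "filterlim (\<lambda>x::real. 1 + x) at_top at_top"
      by (rule filterlim_tendsto_add_at_top[OF tendsto_const filterlim_ident])
    then have "((\<lambda>x::real. (1 + x) powr (1 - \<rho>)) \<longlongrightarrow> 0) at_top"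
      using assms by (intro tendsto_neg_powr) auto
    from tendsto_divide[OF this tendsto_const[of "1 - \<rho>"]]
    show "(((\<lambda>x::real. (1 + x) powr (1 - \<rho>) / (1 - \<rho>)) \<circ> real_of_ereal) \<longlongrightarrow> 0) (at_left \<infinity>)"
      using assms by (simp add: ereal_tendsto_simps1)
  qed auto
  then have "set_integrable lborel {0<..} (\<lambda>x::real. (1 + x) powr - \<rho>)"
    by (simp add: einterval_def zero_ereal_def greaterThan_def)
  then have "set_integrable lborel ({0<..} \<union> {0}) (\<lambda>x::real. (1 + x) powr - \<rho>)"
  proof (rule set_integrable_Un)
    have "set_integrable lborel {0..0} (\<lambda>x::real. (1 + x) powr - \<rho>)"
      by (intro borel_integrable_atLeastAtMost' continuous_intros) auto
    then show "set_integrable lborel {0} (\<lambda>x::real. (1 + x) powr - \<rho>)" by simp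
  qed auto
  moreover have "{0<..} \<union> {0} = {0::real..}" by auto
  ultimately show ?thesis by simp
qed

lemma decay_0_integrable:
  assumes "1 < \<rho>" "decay_class \<rho> 0 f" shows "set_integrable lborel {0..} f"
proof -
  obtain C where C: "\<And>x. 0 \<le> x \<Longrightarrow> \<bar>f x\<bar> \<le> C * (1 + x) powr - \<rho>" using assms by auto
  show ?thesis
  proof (rule set_integrable_bound[OF set_integrable_mult_right[OF powr_halfline_integrable[OF assms(1)], of C]])
    show "set_borel_measurable lborel {0..} f"
      unfolding set_borel_measurable_def using assms(2) borel_measurable_continuous_on_indicator[of "{0..}" f] by simp
    show "AE x in lborel. x \<in> {0..} \<longrightarrow> norm (f x) \<le> norm (C * (1 + x) powr - \<rho>)"
      by (intro AE_I2) (auto intro: order_trans[OF C abs_ge_self])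
  qed
qed

lemma decay_0_tendsto_0:
  assumes "1 < \<rho>" "decay_class \<rho> 0 f" shows "(f \<longlongrightarrow> 0) at_top"
proof -
  obtain C where C: "\<And>x. 0 \<le> x \<Longrightarrow> \<bar>f x\<bar> \<le> C * (1 + x) powr - \<rho>" using assms by auto
  have "filterlim (\<lambda>x::real. 1 + x) at_top at_top"
    by (rule filterlim_tendsto_add_at_top[OF tendsto_const filterlim_ident])
  then have "((\<lambda>x. C * (1 + x) powr - \<rho>) \<longlongrightarrow> C * 0) at_top"
    using assms by (intro tendsto_mult tendsto_const tendsto_neg_powr) auto
  then show ?thesis
    by (intro Lim_null_comparison[of f "\<lambda>x. C * (1 + x) powr - \<rho>"]) (use C in \<open>auto simp: eventually_at_top_linorder\<close>)
qed

lemma tail_integral_bounded_class: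
  assumes r: "1 < \<rho>" and f: "decay_class \<rho> k f"
  shows "bounded_class \<rho> (Suc k) (\<lambda>x. LINT y:{x..}|lborel. f y)"
proof -
  have f0: "decay_class \<rho> 0 f" using decay_class_0[OF f] .
  have fi: "set_integrable lborel {0..} f" by (rule decay_0_integrable[OF r f0])
  have d: "((\<lambda>x. LINT y:{x..}|lborel. f y) has_vector_derivative - f x) (at x within {0..})" if "0 \<le> x" for x
    using f0 by (intro tail_integral_has_vector_derivative fi that) auto
  have c: "continuous_on {0..} (\<lambda>x. LINT y:{x..}|lborel. f y)"
    by (auto simp: continuous_on_eq_continuous_within intro!: has_vector_derivative_continuous[OF d])
  have b: "\<bar>LINT y:{x..}|lborel. f y\<bar> \<le> (LINT y:{0..}|lborel. \<bar>f y\<bar>)" if "0 \<le> x" for x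
  proof -
    have i: "set_integrable lborel {x..} (\<lambda>y. \<bar>f y\<bar>)" using that
      by (intro set_integrable_subset[OF set_integrable_abs[OF fi]]) auto
    have "\<bar>LINT y:{x..}|lborel. f y\<bar> \<le> (\<integral>y. norm (indicator {x..} y *\<^sub>R f y) \<partial>lborel)"
      unfolding set_lebesgue_integral_def using integral_norm_bound[of lborel "\<lambda>y. indicator {x..} y *\<^sub>R f y"] by simp
    also have "\<dots> \<le> (\<integral>y. indicator {0..} y *\<^sub>R \<bar>f y\<bar> \<partial>lborel)"
      by (rule integral_mono) (use i set_integrable_abs[OF fi] that in \<open>auto simp: set_integrable_def indicator_def abs_mult\<close>)
    finally show ?thesis by (simp only: set_lebesgue_integral_def)
  qed
  have "decay_class \<rho> k (\<lambda>x. f x * (- 1))"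
    using r by (intro decay_class_mult[OF _ f bounded_class_const]) simp
  then have nf: "decay_class \<rho> k (\<lambda>x. - f x)" by simp
  have "bounded_class \<rho> 0 (\<lambda>x. LINT y:{x..}|lborel. f y)" using c b by auto
  then show ?thesis by (rule bounded_class_SucI[OF _ d nf])
qed

lemma smooth_imp_decay_class:
  assumes sm: "smooth_half V" and dec: "\<And>j x. 0 \<le> x \<Longrightarrow> \<bar>(half_deriv ^^ j) V x\<bar> \<le> C j * (1 + x) powr (- \<rho> - real j)"
  shows "decay_class \<rho> k ((half_deriv ^^ j) V)"
proof (induction k arbitrary: j)
  case 0
  have "\<bar>(half_deriv ^^ j) V x\<bar> \<le> C j * (1 + x) powr - \<rho>" if "0 \<le> x" for x
  proof -
    have Cj: "0 \<le> C j" using dec[of 0 j] by simp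
    have "(1 + x) powr (- \<rho> - real j) \<le> (1 + x) powr - \<rho>" using that by (intro powr_mono) auto
    then show ?thesis using dec[OF that, of j] mult_left_mono[OF _ Cj] by fastforce
  qed
  moreover have "continuous_on {0..} ((half_deriv ^^ j) V)"
    using sm by (simp add: smooth_half_def differentiable_imp_continuous_on)
  ultimately show ?case by auto
next
  case (Suc k)
  have "((half_deriv ^^ j) V has_vector_derivative (half_deriv ^^ Suc j) V x) (at x within {0..})" if "0 \<le> x" for x
    using half_deriv_works[of "(half_deriv ^^ j) V" x] sm that by (simp add: smooth_half_def)
  moreover have "decay_class \<rho> 0 ((half_deriv ^^ j) V)" using Suc.IH[of j] decay_class_0 by blast
  ultimately show ?case using Suc.IH[of "Suc j"] unfolding decay_class.simps(2) by blast
qed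

lemma bounded_class_half_deriv:
  assumes "bounded_class \<rho> (Suc k) f"
  shows "\<And>x. 0 \<le> x \<Longrightarrow> (f has_vector_derivative half_deriv f x) (at x within {0..})"
    and "decay_class \<rho> k (half_deriv f)"
proof -
  obtain f' where f': "\<forall>x\<ge>0. (f has_vector_derivative f' x) (at x within {0..})" "decay_class \<rho> k f'"
    using assms by auto
  then have e: "half_deriv f x = f' x" if "0 \<le> x" for x using half_deriv_eqI that by blast
  show "(f has_vector_derivative half_deriv f x) (at x within {0..})" if "0 \<le> x" for x using f' e that by simp
  show "decay_class \<rho> k (half_deriv f)" by (rule decay_class_cong[OF _ f'(2)]) (simp add: e)
qed

lemma decay_class_half_deriv:
  assumes "decay_class \<rho> (Suc k) f"
  shows "\<And>x. 0 \<le> x \<Longrightarrow> (f has_vector_derivative half_deriv f x) (at x within {0..})"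
    and "decay_class \<rho> k (half_deriv f)"
proof -
  obtain f' where f': "\<forall>x\<ge>0. (f has_vector_derivative f' x) (at x within {0..})" "decay_class \<rho> k f'"
    using assms by auto
  then have e: "half_deriv f x = f' x" if "0 \<le> x" for x using half_deriv_eqI that by blast
  show "(f has_vector_derivative half_deriv f x) (at x within {0..})" if "0 \<le> x" for x using f' e that by simp
  show "decay_class \<rho> k (half_deriv f)" by (rule decay_class_cong[OF _ f'(2)]) (simp add: e)
qed

section \<open>High-energy expansion of the Jost solution\<close>

locale smooth_potential = jost_potential +
  fixes \<rho> :: real
  assumes rho: "1 < \<rho>" and V_decay: "\<And>k. decay_class \<rho> k V"
begin

text \<open>The recursion differentiates the previous coefficient, which costs orders of smoothness.
  The induction over n is therefore carried out for all k at once and draws on higher orders of the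
  previous coefficient.\<close>

lemma b_coeff_class: "bounded_class \<rho> k (b_coeff V n)"
proof (induction n arbitrary: k)
  case 0
  show ?case using bounded_class_const by simp
next
  case (Suc n)
  have r: "0 \<le> \<rho>" using rho by simp
  have Vb: "decay_class \<rho> k (\<lambda>x. V x * b_coeff V n x)" for k by (rule decay_class_mult[OF r V_decay Suc.IH])
  have t: "bounded_class \<rho> (Suc k) (\<lambda>x. LINT y:{x..}|lborel. V y * b_coeff V n y)" by (rule tail_integral_bounded_class[OF rho Vb])
  have h: "decay_class \<rho> (Suc k) (half_deriv (b_coeff V n))" by (rule bounded_class_half_deriv(2)[OF Suc.IH[of "Suc (Suc k)"]])
  have "bounded_class \<rho> (Suc k) (b_coeff V (Suc n))"
  proof -
    let ?h = "half_deriv (b_coeff V n)" and ?t = "\<lambda>x. LINT y:{x..}|lborel. V y * b_coeff V n y"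
    have "bounded_class \<rho> 0 ?h" "bounded_class \<rho> 0 ?t"
      using decay_imp_bounded[OF r h] t bounded_class_0 by blast+
    then obtain C D where "continuous_on {0..} ?h" "continuous_on {0..} ?t" "\<And>x. 0 \<le> x \<Longrightarrow> \<bar>?h x\<bar> \<le> C" "\<And>x. 0 \<le> x \<Longrightarrow> \<bar>?t x\<bar> \<le> D"
      by auto
    then have 1: "bounded_class \<rho> 0 (b_coeff V (Suc n))"
      by (auto intro!: continuous_intros exI[of _ "C + D"] order_trans[OF abs_triangle_ineq4] add_mono)
    have "decay_class \<rho> (Suc k) (half_deriv ?h)"
      by (rule decay_class_half_deriv(2), rule bounded_class_half_deriv(2), rule Suc.IH)
    then have "decay_class \<rho> (Suc k) (\<lambda>x. half_deriv ?h x * (-1))" by (intro decay_class_mult r bounded_class_const)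
    from decay_class_add[OF Vb[of "Suc k"] this]
    have 2: "decay_class \<rho> (Suc k) (\<lambda>x. V x * b_coeff V n x + (-1) * half_deriv ?h x)" by (simp add: mult.commute)
    have 3: "(b_coeff V (Suc n) has_vector_derivative V x * b_coeff V n x + (-1) * half_deriv ?h x) (at x within {0..})" if "0 \<le> x" for x
      unfolding b_coeff.simps
      by (rule has_vector_derivative_eq_rhs[OF has_vector_derivative_diff[OF has_vector_derivative_minus[OF decay_class_half_deriv(1)[OF h that]]
           tail_integral_has_vector_derivative[OF _ decay_0_integrable[OF rho Vb] that]]])
         (use Vb[of 0] in auto)
    show ?thesis
      by (rule bounded_class_SucI[OF 1 3 decay_class_Suc[OF 2]])
  qed
  then show ?case by (rule bounded_class_Suc)
qed

lemma b_coeff_deriv: "0 \<le> x \<Longrightarrow> (b_coeff V n has_vector_derivative half_deriv (b_coeff V n) x) (at x within {0..})"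
  using bounded_class_half_deriv(1)[OF b_coeff_class[of "Suc 0"]] .

lemma b_coeff'_decay: "decay_class \<rho> k (half_deriv (b_coeff V n))"
  using bounded_class_half_deriv(2)[OF b_coeff_class] .

lemma b_coeff'_deriv: "0 \<le> x \<Longrightarrow> (half_deriv (b_coeff V n) has_vector_derivative half_deriv (half_deriv (b_coeff V n)) x) (at x within {0..})"
  using decay_class_half_deriv(1)[OF b_coeff'_decay[of "Suc 0"]] .

text \<open>The transport equation: it is what comparing powers of (2 i z)^(-1) in b'' + 2 i z b' =
  V b yields. The integrated form in the definition adds the normalisation that the higher
  coefficients vanish at infinity.\<close>

lemma b_coeff_rec_deriv:
  assumes "0 \<le> x"
  shows "half_deriv (b_coeff V (Suc n)) x = V x * b_coeff V n x - half_deriv (half_deriv (b_coeff V n)) x"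
proof (rule half_deriv_eqI[OF assms])
  have Vb: "decay_class \<rho> 0 (\<lambda>x. V x * b_coeff V n x)" using rho by (intro decay_class_mult V_decay b_coeff_class) auto
  show "(b_coeff V (Suc n) has_vector_derivative V x * b_coeff V n x - half_deriv (half_deriv (b_coeff V n)) x) (at x within {0..})"
      unfolding b_coeff.simps
      by (rule has_vector_derivative_eq_rhs[OF has_vector_derivative_diff[OF has_vector_derivative_minus[OF b_coeff'_deriv[OF assms]]
           tail_integral_has_vector_derivative[OF _ decay_0_integrable[OF rho Vb] assms]]])
         (use Vb in auto)
qed

lemma b_coeff_Suc_tendsto_0: "(b_coeff V (Suc n) \<longlongrightarrow> 0) at_top"
proof -
  have Vb: "decay_class \<rho> 0 (\<lambda>x. V x * b_coeff V n x)" using rho by (intro decay_class_mult V_decay b_coeff_class) auto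
  have "((\<lambda>x. - half_deriv (b_coeff V n) x - (LINT y:{x..}|lborel. V y * b_coeff V n y)) \<longlongrightarrow> - 0 - 0) at_top"
    by (intro tendsto_intros tail_integral_tendsto_0[OF decay_0_integrable[OF rho Vb]] decay_0_tendsto_0[OF rho b_coeff'_decay])
  then show ?thesis by simp
qed

definition ipow :: "complex \<Rightarrow> complex" where "ipow z = inverse (2 * \<i> * z)"

definition jpart :: "nat \<Rightarrow> real \<Rightarrow> complex \<Rightarrow> complex" where
  "jpart N x z = (\<Sum>n\<le>N. of_real (b_coeff V n x) * ipow z ^ n)"
definition jpart' :: "nat \<Rightarrow> real \<Rightarrow> complex \<Rightarrow> complex" where
  "jpart' N x z = (\<Sum>n\<le>N. of_real (half_deriv (b_coeff V n) x) * ipow z ^ n)"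
definition jpart'' :: "nat \<Rightarrow> real \<Rightarrow> complex \<Rightarrow> complex" where
  "jpart'' N x z = (\<Sum>n\<le>N. of_real (half_deriv (half_deriv (b_coeff V n)) x) * ipow z ^ n)"

lemma half_deriv_b0: "half_deriv (b_coeff V 0) x = 0" if "0 \<le> x"
  by (rule half_deriv_eqI[OF that]) simp

lemma jpart_deriv:
  assumes "0 \<le> x"
  shows "((\<lambda>x. jpart N x z) has_vector_derivative jpart' N x z) (at x within {0..})"
    "((\<lambda>x. jpart' N x z) has_vector_derivative jpart'' N x z) (at x within {0..})"
  unfolding jpart_def jpart'_def jpart''_def
  by (intro has_vector_derivative_sum has_vector_derivative_mult_left has_vector_derivative_complex_of_real b_coeff_deriv b_coeff'_deriv assms)+

text \<open>Each power of \<open>ipow z\<close> cancels by \<open>b_coeff_rec_deriv\<close> against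
  the next one multiplied by 2 i z; only the top power finds no partner and is left over.\<close>

lemma jpart_eq:
  assumes "0 \<le> x" "z \<noteq> 0"
  shows "jpart'' N x z + 2 * \<i> * z * jpart' N x z = of_real (V x) * jpart N x z - of_real (half_deriv (b_coeff V (Suc N)) x) * ipow z ^ N"
proof (induction N)
  case 0
  have "2 * \<i> * z * jpart' 0 x z = 0" using half_deriv_b0[OF assms(1)] by (simp add: jpart'_def del: b_coeff.simps)
  then show ?case using b_coeff_rec_deriv[OF assms(1), of 0]
    by (simp add: jpart''_def jpart_def del: b_coeff.simps)
next
  case (Suc N)
  have e: "2 * \<i> * z * (of_real (half_deriv (b_coeff V (Suc N)) x) * ipow z ^ Suc N) = of_real (half_deriv (b_coeff V (Suc N)) x) * ipow z ^ N"
  proof -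
    have h1: "2 * \<i> * z * ipow z = 1" unfolding ipow_def by (rule right_inverse) (use assms(2) in simp)
    have h2: "2 * \<i> * z * (B * ipow z ^ Suc N) = (2 * \<i> * z * ipow z) * (B * ipow z ^ N)" for B
      by (simp add: mult_ac)
    show ?thesis by (simp only: h2 h1 mult_1)
  qed
  have "jpart'' (Suc N) x z + 2 * \<i> * z * jpart' (Suc N) x z = (jpart'' N x z + 2 * \<i> * z * jpart' N x z)
     + of_real (half_deriv (half_deriv (b_coeff V (Suc N))) x) * ipow z ^ Suc N
     + 2 * \<i> * z * (of_real (half_deriv (b_coeff V (Suc N)) x) * ipow z ^ Suc N)"
    by (simp add: jpart''_def jpart'_def algebra_simps del: b_coeff.simps)
  also have "\<dots> = of_real (V x) * jpart N x z + of_real (half_deriv (half_deriv (b_coeff V (Suc N))) x) * ipow z ^ Suc N"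
    unfolding Suc.IH e by simp
  also have "half_deriv (half_deriv (b_coeff V (Suc N))) x = V x * b_coeff V (Suc N) x - half_deriv (b_coeff V (Suc (Suc N))) x"
    using b_coeff_rec_deriv[OF assms(1), of "Suc N"] by simp
  finally show ?case by (simp add: jpart_def algebra_simps del: b_coeff.simps)
qed

text \<open>Writing \<open>r = b - \<Sum>\<^bsub>n \<le> N\<^esub> b\<^sub>n t\<^sup>n\<close>, the equation \<open>r'' + 2 i z r' = h\<close> integrates to bounds on
  \<open>r'\<close> and on \<open>r' + 2 i z r\<close> by the \<open>L\<^sup>1\<close> norm of \<open>h = V r + t\<^sup>N b\<^sub>N\<^sub>+\<^sub>1'\<close>, which is in turn bounded by
  \<open>sup |r|\<close>; for large \<open>z\<close> this closes.\<close>

lemma jost_remainder: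
  "\<exists>C R. 0 < R \<and> (\<forall>z. 0 \<le> Im z \<and> R \<le> norm z \<longrightarrow>
     norm (jb 0 z - jpart N 0 z) \<le> C / norm z ^ Suc N \<and> norm (jbp 0 z - jpart' N 0 z) \<le> C / norm z ^ N)"
proof -
  define v where "v = (LINT y:{0..}|lborel. \<bar>V y\<bar>)"
  define c where "c = (LINT y:{0..}|lborel. \<bar>half_deriv (b_coeff V (Suc N)) y\<bar>)"
  have Vi: "set_integrable lborel {0..} (\<lambda>y. \<bar>V y\<bar>)"
    by (rule set_integrable_abs[OF decay_0_integrable[OF rho V_decay]])
  have bi: "set_integrable lborel {0..} (\<lambda>y. \<bar>half_deriv (b_coeff V (Suc N)) y\<bar>)"
    by (rule set_integrable_abs[OF decay_0_integrable[OF rho b_coeff'_decay]])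
  have v0: "0 \<le> v" and c0: "0 \<le> c"
    unfolding v_def c_def set_lebesgue_integral_def by (auto intro!: integral_nonneg_AE)
  \<comment> \<open>With 2 v \<le> |z|, the term m v caused by V r is at most half of m |z| and can
    be absorbed on the left; |z| \<ge> 1 orders the powers of |z|.\<close>
  define R where "R = 1 + 2 * v"
  have main: "norm (jb 0 z - jpart N 0 z) \<le> (2 * c + 2 * c * v) / norm z ^ Suc N \<and> norm (jbp 0 z - jpart' N 0 z) \<le> (2 * c + 2 * c * v) / norm z ^ N"
    if z: "z \<in> upper_closed" and zR: "R \<le> norm z" for z
  proof -
    have z1: "1 \<le> norm z" "2 * v \<le> norm z" using zR v0 by (auto simp: R_def)
    then have z0: "z \<noteq> 0" by auto
    define r where "r x = jb x z - jpart N x z" for x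
    define r' where "r' x = jbp x z - jpart' N x z" for x
    define h where "h x = of_real (V x) * r x + of_real (half_deriv (b_coeff V (Suc N)) x) * ipow z ^ N" for x
    have rd: "(r has_vector_derivative r' x) (at x within {0..})" if "0 \<le> x" for x
      unfolding r_def[abs_def] r'_def by (intro has_vector_derivative_diff jb_deriv jpart_deriv that z)
    have rd': "(r' has_vector_derivative h x - 2 * \<i> * z * r' x) (at x within {0..})" if "0 \<le> x" for x
      unfolding r'_def[abs_def]
      by (rule has_vector_derivative_eq_rhs[OF has_vector_derivative_diff[OF jbp_deriv[OF that z] jpart_deriv(2)[OF that]]])
         (use jpart_eq[OF that z0, of N] in \<open>simp add: h_def r_def r'_def algebra_simps del: b_coeff.simps\<close>)
    have n2: "norm (2 * \<i> * z) = 2 * norm z" by (simp add: norm_mult)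
    have ni: "norm (ipow z) = 1 / (2 * norm z)" unfolding ipow_def norm_inverse n2 by (rule inverse_eq_divide)
    have rb: "bdd_above ((\<lambda>x. norm (r x)) ` {0..})"
    proof -
      have "\<exists>B. \<forall>x\<ge>0. \<bar>b_coeff V n x\<bar> \<le> B" for n using b_coeff_class[of 0 n] by auto
      then obtain B where B: "\<And>n x. 0 \<le> x \<Longrightarrow> \<bar>b_coeff V n x\<bar> \<le> B n" by metis
      have "norm (r x) \<le> bnd + (\<Sum>n\<le>N. B n * norm (ipow z) ^ n)" if "0 \<le> x" for x
      proof -
        have "norm (r x) \<le> norm (jb x z) + norm (jpart N x z)" unfolding r_def by (rule norm_triangle_ineq4)
        also have "norm (jpart N x z) \<le> (\<Sum>n\<le>N. B n * norm (ipow z) ^ n)"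
          unfolding jpart_def by (intro sum_norm_le) (use B[OF that] in \<open>auto simp: norm_mult norm_power intro!: mult_right_mono\<close>)
        finally show ?thesis using jb_bound[OF that z] by simp
      qed
      then show ?thesis by (auto simp: bdd_above_def)
    qed
    define m where "m = (SUP x\<in>{0..}. norm (r x))"
    have rm: "norm (r x) \<le> m" if "0 \<le> x" for x unfolding m_def by (rule cSUP_upper[OF _ rb]) (use that in simp)
    have m0: "0 \<le> m" using order_trans[OF norm_ge_zero rm[of 0]] by simp
    have pl: "((\<lambda>x. jpart N x z) \<longlongrightarrow> 1) at_top"
    proof -
      have "(b_coeff V n \<longlongrightarrow> (if n = 0 then 1 else 0)) at_top" for n
        by (cases n) (use b_coeff_Suc_tendsto_0 in \<open>auto simp del: b_coeff.simps(2)\<close>)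
      then have "((\<lambda>x. jpart N x z) \<longlongrightarrow> (\<Sum>n\<le>N. of_real (if n = 0 then 1 else 0) * ipow z ^ n)) at_top"
        unfolding jpart_def by (intro tendsto_intros)
      moreover have "(\<Sum>n\<le>N. of_real (if n = 0 then 1 else 0) * ipow z ^ n) = 1"
        by (subst sum.remove[of _ 0]) auto
      ultimately show ?thesis by simp
    qed
    have Ql: "((\<lambda>x. bnd * Q x) \<longlongrightarrow> 0) at_top" using tendsto_mult_right_zero[OF Q_lim] by simp
    have blaschke: "((\<lambda>x. jb x z) \<longlongrightarrow> 1) at_top"
    proof -
      have "((\<lambda>x. jb x z - 1) \<longlongrightarrow> 0) at_top"
        by (rule Lim_null_comparison[OF _ Ql]) (use norm_jb_minus_1[OF _ z] in \<open>auto simp: eventually_at_top_linorder\<close>)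
      then show ?thesis by (rule LIM_zero_cancel)
    qed
    have rl: "(r \<longlongrightarrow> 0) at_top" unfolding r_def using tendsto_diff[OF blaschke pl] by simp
    have rl': "(r' \<longlongrightarrow> 0) at_top"
    proof -
      have "((\<lambda>x. jbp x z) \<longlongrightarrow> 0) at_top"
        by (rule Lim_null_comparison[OF _ Ql]) (use norm_jbp[OF _ z] in \<open>auto simp: eventually_at_top_linorder\<close>)
      moreover have "((\<lambda>x. jpart' N x z) \<longlongrightarrow> (\<Sum>n\<le>N. of_real 0 * ipow z ^ n)) at_top"
        unfolding jpart'_def by (intro tendsto_intros decay_0_tendsto_0[OF rho b_coeff'_decay])
      ultimately show ?thesis unfolding r'_def using tendsto_diff by fastforce
    qed
    define g where "g y = m * \<bar>V y\<bar> + norm (ipow z) ^ N * \<bar>half_deriv (b_coeff V (Suc N)) y\<bar>" for y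
    have gi: "set_integrable lborel {0..} g"
      unfolding g_def by (intro set_integral_add(1) set_integrable_mult_right Vi bi)
    have G: "(LINT y:{0..}|lborel. g y) = m * v + norm (ipow z) ^ N * c"
      unfolding g_def v_def c_def
      by (subst set_integral_add(2)[OF set_integrable_mult_right[OF Vi] set_integrable_mult_right[OF bi]]) (simp only: set_integral_mult_right)
    have hg: "norm (h y) \<le> g y" if "0 \<le> y" for y
    proof -
      have "norm (h y) \<le> norm (of_real (V y) * r y) + norm (of_real (half_deriv (b_coeff V (Suc N)) y) * ipow z ^ N)"
        unfolding h_def by (rule norm_triangle_ineq)
      also have "\<dots> \<le> g y"
        unfolding g_def norm_mult norm_of_real norm_power
        using mult_right_mono[OF rm[OF that], of "\<bar>V y\<bar>"] by (simp add: mult.commute)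
      finally show ?thesis .
    qed
    have tail: "(LINT y:{x..}|lborel. g y) \<le> m * v + norm (ipow z) ^ N * c" if "0 \<le> x" for x
    proof -
      have "0 \<le> integral {0..x} g"
      proof (rule integral_nonneg)
        show "g integrable_on {0..x}" by (intro set_borel_integral_eq_integral(1) set_integrable_subset[OF gi]) auto
      qed (auto simp: g_def m0)
      then show ?thesis using set_integral_split_halfline[OF gi that] G by simp
    qed
    have r'b: "norm (r' x) \<le> m * v + norm (ipow z) ^ N * c" if x: "0 \<le> x" for x
    proof -
      \<comment> \<open>An integrating factor for r'' + 2 i z r' = h. It equals 1 at y = x and has
        modulus at most 1 for y \<ge> x, so r' is bounded by the integral of |h| alone.\<close>
      define f where "f y = exp (2 * \<i> * z * of_real (y - x)) * r' y" for y
      have fd: "(f has_vector_derivative exp (2 * \<i> * z * of_real (y - x)) * h y) (at y within {x..})" if "x \<le> y" for y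
      proof -
        have e: "((\<lambda>y. exp (2 * \<i> * z * of_real (y - x))) has_vector_derivative 2 * \<i> * z * exp (2 * \<i> * z * of_real (y - x))) (at y within {x..})"
        proof -
          have "((\<lambda>y. exp (- (2 * \<i> * z * of_real x)) * exp (2 * \<i> * z * of_real y)) has_vector_derivative exp (- (2 * \<i> * z * of_real x)) * (2 * \<i> * z * exp (2 * \<i> * z * of_real y))) (at y within {x..})"
            by (intro has_vector_derivative_mult_right exp_vector_derivative)
          moreover have "exp (- (2 * \<i> * z * of_real x)) * exp (2 * \<i> * z * of_real y) = exp (2 * \<i> * z * of_real (y - x))" for y
            by (simp add: exp_add[symmetric] algebra_simps)
          ultimately show ?thesis by (simp add: mult.left_commute[of "exp (- (2 * \<i> * z * of_real x))"])
        qed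
        have r: "(r' has_vector_derivative h y - 2 * \<i> * z * r' y) (at y within {x..})"
          by (rule has_vector_derivative_within_subset[OF rd']) (use x that in auto)
        show ?thesis unfolding f_def[abs_def]
          by (rule has_vector_derivative_eq_rhs[OF has_vector_derivative_mult[OF e r]]) (simp add: algebra_simps)
      qed
      have ne: "norm (exp (2 * \<i> * z * of_real (y - x))) \<le> 1" if "x \<le> y" for y
        by (rule norm_exp_upper[OF z]) (use that in simp)
      have "norm (f x) \<le> (LINT y:{x..}|lborel. g y)"
      proof (rule norm_le_tail_integral[OF fd])
        fix y assume y: "x \<le> y"
        have "norm (exp (2 * \<i> * z * of_real (y - x))) * norm (h y) \<le> 1 * g y"
          using x y by (intro mult_mono ne hg) auto
        then show "norm (exp (2 * \<i> * z * of_real (y - x)) * h y) \<le> g y" unfolding norm_mult by simp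
      next
        show "set_integrable lborel {x..} g" by (rule set_integrable_subset[OF gi]) (use x in auto)
        show "(f \<longlongrightarrow> 0) at_top"
        proof (rule Lim_null_comparison[OF _ tendsto_norm_zero[OF rl']])
          show "\<forall>\<^sub>F y in at_top. norm (f y) \<le> norm (r' y)"
            using eventually_ge_at_top[of x]
            by eventually_elim (use ne in \<open>auto simp: f_def norm_mult simp del: norm_exp_eq_Re intro!: mult_left_le_one_le\<close>)
        qed
      qed
      then show ?thesis using tail[OF x] by (simp add: f_def)
    qed
    \<comment> \<open>The combination r' + 2 i z r has derivative exactly h. Subtracting r' isolates
      2 i z r, and the division by z supplies one more power of 1 / |z|.\<close>
    have sb: "norm (r' x + 2 * \<i> * z * r x) \<le> m * v + norm (ipow z) ^ N * c" if x: "0 \<le> x" for x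
    proof -
      have "norm (r' x + 2 * \<i> * z * r x) \<le> (LINT y:{x..}|lborel. g y)"
      proof (rule norm_le_tail_integral[where f = "\<lambda>x. r' x + 2 * \<i> * z * r x" and f' = h])
        fix y assume y: "x \<le> y"
        have a: "(r' has_vector_derivative h y - 2 * \<i> * z * r' y) (at y within {x..})"
          by (rule has_vector_derivative_within_subset[OF rd']) (use x y in auto)
        have b: "(r has_vector_derivative r' y) (at y within {x..})"
          by (rule has_vector_derivative_within_subset[OF rd]) (use x y in auto)
        show "((\<lambda>x. r' x + 2 * \<i> * z * r x) has_vector_derivative h y) (at y within {x..})"
          by (rule has_vector_derivative_eq_rhs[OF has_vector_derivative_add[OF a has_vector_derivative_mult_right[OF b]]]) simp
        show "norm (h y) \<le> g y" using hg x y by simp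
      next
        show "set_integrable lborel {x..} g" by (rule set_integrable_subset[OF gi]) (use x in auto)
        have "((\<lambda>x. r' x + 2 * \<i> * z * r x) \<longlongrightarrow> 0 + 2 * \<i> * z * 0) at_top" by (intro tendsto_intros rl rl')
        then show "((\<lambda>x. r' x + 2 * \<i> * z * r x) \<longlongrightarrow> 0) at_top" by simp
      qed
      then show ?thesis using tail[OF x] by simp
    qed
    have rbd: "norm (r x) \<le> (m * v + norm (ipow z) ^ N * c) / norm z" if x: "0 \<le> x" for x
    proof -
      have "norm (2 * \<i> * z * r x) \<le> norm (r' x + 2 * \<i> * z * r x) + norm (r' x)"
        using norm_triangle_ineq4[of "r' x + 2 * \<i> * z * r x" "r' x"] by simp
      also have "\<dots> \<le> 2 * (m * v + norm (ipow z) ^ N * c)" using sb[OF x] r'b[OF x] by simp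
      finally have "norm (2 * \<i> * z * r x) \<le> 2 * (m * v + norm (ipow z) ^ N * c)" .
      moreover have "norm (2 * \<i> * z * r x) = 2 * (norm (r x) * norm z)" by (simp add: norm_mult)
      ultimately have "2 * (norm (r x) * norm z) \<le> 2 * (m * v + norm (ipow z) ^ N * c)" by (simp only:)
      then have "norm (r x) * norm z \<le> m * v + norm (ipow z) ^ N * c" by (rule mult_left_le_imp_le) simp
      then show ?thesis using z0 by (simp add: pos_le_divide_eq)
    qed
    have "m \<le> (m * v + norm (ipow z) ^ N * c) / norm z"
      unfolding m_def by (rule cSUP_least) (use rbd in \<open>auto simp: m_def\<close>)
    then have "m * norm z \<le> m * v + norm (ipow z) ^ N * c" using z0 by (simp add: pos_le_divide_eq)
    moreover have "m * v \<le> m * (norm z / 2)" using z1 m0 by (intro mult_left_mono) auto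
    ultimately have mz: "m * norm z \<le> 2 * (norm (ipow z) ^ N * c)" by simp
    have ip: "norm (ipow z) ^ N \<le> 1 / norm z ^ N"
    proof -
      have "norm (ipow z) \<le> 1 / norm z" using z1 z0 unfolding ni by (intro divide_left_mono mult_pos_pos) auto
      then have "norm (ipow z) ^ N \<le> (1 / norm z) ^ N" by (intro power_mono) auto
      then show ?thesis by (simp add: power_divide)
    qed
    have mz2: "m * norm z \<le> 2 * c / norm z ^ N"
      using mz mult_right_mono[OF ip c0] by simp
    then have "m \<le> (2 * c / norm z ^ N) / norm z" using z0 by (subst pos_le_divide_eq) auto
    then have m1: "m \<le> 2 * c / norm z ^ Suc N" by (simp add: mult.commute)
    have mm: "m \<le> 2 * c / norm z ^ N"
    proof -
      have "m * 1 \<le> m * norm z" using z1 m0 by (intro mult_left_mono) auto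
      then show ?thesis using mz2 by simp
    qed
    have 1: "norm (r 0) \<le> (2 * c + 2 * c * v) / norm z ^ Suc N"
    proof -
      have "2 * c / norm z ^ Suc N \<le> (2 * c + 2 * c * v) / norm z ^ Suc N" using c0 v0 by (intro divide_right_mono) auto
      then show ?thesis using rm[of 0] m1 by simp
    qed
    have 2: "norm (r' 0) \<le> (2 * c + 2 * c * v) / norm z ^ N"
    proof -
      have "norm (r' 0) \<le> m * v + norm (ipow z) ^ N * c" using r'b by simp
      also have "\<dots> \<le> 2 * c / norm z ^ N * v + 1 / norm z ^ N * c"
        by (intro add_mono mult_right_mono mm ip v0 c0)
      also have "\<dots> \<le> (2 * c + 2 * c * v) / norm z ^ N" using c0 z1 by (simp add: add_divide_distrib divide_right_mono)
      finally show ?thesis .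
    qed
    from 1 2 show ?thesis by (simp only: r_def r'_def)
  qed
  show ?thesis by (rule exI[of _ "2 * c + 2 * c * v"], rule exI[of _ R]) (use main v0 in \<open>auto simp: R_def\<close>)
qed

end

section \<open>Asymptotic expansions of logarithms\<close>

lemma poly_eq_sum_upto:
  "degree p \<le> N \<Longrightarrow> poly p t = (\<Sum>n\<le>N. coeff p n * t ^ n)" for p :: "complex poly"
  unfolding poly_altdef by (rule sum.mono_neutral_left) (auto simp: coeff_eq_0)

text \<open>Writing \<open>P\<close> and \<open>L\<close> for the two truncated series, the recursion says that the coefficients of
  \<open>P' - L' P\<close> vanish below order \<open>N\<close>, so the derivative of \<open>exp (-L) P\<close> is \<open>O(t\<^sup>N)\<close>.\<close>

lemma exp_log_series:
  fixes d l :: "nat \<Rightarrow> complex"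
  assumes d0: "d 0 = 1"
    and rec: "\<And>n. 1 \<le> n \<Longrightarrow> of_nat n * d n = (\<Sum>j=1..n. of_nat j * l j * d (n - j))"
  shows "\<exists>C\<ge>0. \<forall>t. norm t \<le> 1 \<longrightarrow>
    norm (exp (- (\<Sum>j=1..N. l j * t ^ j)) * (\<Sum>n\<le>N. d n * t ^ n) - 1) \<le> C * norm t ^ Suc N"
proof -
  define P where "P = Poly (map d [0..<Suc N])"
  define L where "L = Poly (map (\<lambda>j. if j = 0 then 0 else l j) [0..<Suc N])"
  have cP: "coeff P n = (if n \<le> N then d n else 0)" for n
    by (auto simp: P_def coeff_Poly_eq nth_default_def simp del: upt_Suc)
  have cL: "coeff L n = (if 1 \<le> n \<and> n \<le> N then l n else 0)" for n
    by (auto simp: L_def coeff_Poly_eq nth_default_def simp del: upt_Suc)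
  have dP: "degree P \<le> N" by (rule degree_le) (simp add: cP)
  have dL: "degree L \<le> N" by (rule degree_le) (simp add: cL)
  have pP: "poly P t = (\<Sum>n\<le>N. d n * t ^ n)" for t
    using poly_eq_sum_upto[OF dP, of t] by (simp add: cP)
  have pL: "poly L t = (\<Sum>j=1..N. l j * t ^ j)" for t
  proof -
    have "poly L t = (\<Sum>n\<le>N. coeff L n * t ^ n)" using poly_eq_sum_upto[OF dL, of t] by simp
    also have "\<dots> = (\<Sum>j=1..N. l j * t ^ j)"
      by (rule sum.mono_neutral_cong_right) (auto simp: cL)
    finally show ?thesis .
  qed
  define D where "D = pderiv P - pderiv L * P"
  have cD: "coeff D n = 0" if "n < N" for n
  proof -
    have "coeff (pderiv L * P) n = (\<Sum>i\<le>n. coeff (pderiv L) i * coeff P (n - i))" by (rule coeff_mult)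
    also have "\<dots> = (\<Sum>i\<le>n. of_nat (Suc i) * l (Suc i) * d (Suc n - Suc i))"
      using that by (intro sum.cong) (auto simp: coeff_pderiv cL cP)
    also have "\<dots> = (\<Sum>j=1..Suc n. of_nat j * l j * d (Suc n - j))"
      by (rule sum.reindex_bij_witness[of _ "\<lambda>j. j - 1" Suc]) auto
    also have "\<dots> = of_nat (Suc n) * d (Suc n)" using rec[of "Suc n"] by simp
    finally show ?thesis using that by (simp add: D_def coeff_pderiv cP)
  qed
  then have "monom 1 N dvd D" by (simp add: monom_1_dvd_iff')
  then obtain E where E: "D = monom 1 N * E" by (elim dvdE)
  have pD: "poly D t = t ^ N * poly E t" for t by (simp add: E poly_monom)
  have "continuous_on (cball 0 1) (\<lambda>t. exp (- poly L t) * poly E t)" by (intro continuous_intros)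
  then have "bounded ((\<lambda>t. exp (- poly L t) * poly E t) ` cball 0 1)"
    by (intro compact_imp_bounded compact_continuous_image) auto
  then obtain B where "\<forall>y\<in>(\<lambda>t. exp (- poly L t) * poly E t) ` cball 0 1. norm y \<le> B" by (auto simp only: bounded_iff)
  then have B: "norm (exp (- poly L t) * poly E t) \<le> B" if "norm t \<le> 1" for t using that by auto
  have B0: "0 \<le> B" using order_trans[OF norm_ge_zero B[of 0]] by simp
  have "norm (exp (- poly L t) * poly P t - 1) \<le> B * norm t ^ Suc N" if t: "norm t \<le> 1" for t
  proof -
    have "norm (exp (- poly L t) * poly P t - exp (- poly L 0) * poly P 0) \<le> (B * norm t ^ N) * norm (t - 0)"
    proof (rule field_differentiable_bound[of "cball 0 (norm t)" _ "\<lambda>s. exp (- poly L s) * poly D s"])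
      show "((\<lambda>t. exp (- poly L t) * poly P t) has_field_derivative exp (- poly L s) * poly D s) (at s within cball 0 (norm t))" for s
        unfolding D_def by (auto intro!: derivative_eq_intros simp: algebra_simps)
      show "norm (exp (- poly L s) * poly D s) \<le> B * norm t ^ N" if s: "s \<in> cball 0 (norm t)" for s
      proof -
        have "norm (exp (- poly L s) * poly D s) = norm (exp (- poly L s) * poly E s) * norm s ^ N"
          by (simp add: pD norm_mult norm_power mult_ac)
        also have "\<dots> \<le> B * norm t ^ N"
          using s t by (intro mult_mono B power_mono B0) auto
        finally show ?thesis .
      qed
    qed auto
    moreover have "exp (- poly L 0) * poly P 0 = 1" by (simp add: poly_0_coeff_0 cL cP d0)
    ultimately show ?thesis by (simp add: mult_ac)
  qed
  then show ?thesis using B0 unfolding pP pL by blast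
qed

text \<open>The expansion \<open>ln F = \<Sum> l\<^sub>n (2 i z)\<^sup>-\<^sup>n\<close>, phrased without choosing a branch of the logarithm.\<close>

definition log_expansion :: "(complex \<Rightarrow> complex) \<Rightarrow> (nat \<Rightarrow> complex) \<Rightarrow> bool" where
  "log_expansion F l \<longleftrightarrow> (\<forall>N. \<exists>C\<ge>0. \<exists>R>0. \<forall>z. 0 \<le> Im z \<longrightarrow> R \<le> norm z \<longrightarrow>
     norm (F z * exp (- (\<Sum>j=1..N. l j * inverse (2 * \<i> * z) ^ j)) - 1) \<le> C / norm z ^ Suc N)"

lemma log_expansion_mult:
  assumes "log_expansion F l" "log_expansion G m"
  shows "log_expansion (\<lambda>z. F z * G z) (\<lambda>n. l n + m n)"
  unfolding log_expansion_def
proof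
  fix N
  obtain C R where F: "0 \<le> C" "0 < R" "\<And>z. 0 \<le> Im z \<Longrightarrow> R \<le> norm z \<Longrightarrow>
     norm (F z * exp (- (\<Sum>j=1..N. l j * inverse (2 * \<i> * z) ^ j)) - 1) \<le> C / norm z ^ Suc N"
    using assms(1) unfolding log_expansion_def by metis
  obtain D S where G: "0 \<le> D" "0 < S" "\<And>z. 0 \<le> Im z \<Longrightarrow> S \<le> norm z \<Longrightarrow>
     norm (G z * exp (- (\<Sum>j=1..N. m j * inverse (2 * \<i> * z) ^ j)) - 1) \<le> D / norm z ^ Suc N"
    using assms(2) unfolding log_expansion_def by metis
  have "norm (F z * G z * exp (- (\<Sum>j=1..N. (l j + m j) * inverse (2 * \<i> * z) ^ j)) - 1) \<le> (C + D + C * D) / norm z ^ Suc N"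
    if z: "0 \<le> Im z" "max 1 (max R S) \<le> norm z" for z
  proof -
    define f where "f = F z * exp (- (\<Sum>j=1..N. l j * inverse (2 * \<i> * z) ^ j)) - 1"
    define g where "g = G z * exp (- (\<Sum>j=1..N. m j * inverse (2 * \<i> * z) ^ j)) - 1"
    define q where "q = norm z ^ Suc N"
    have q: "1 \<le> q" unfolding q_def using z by (intro one_le_power) auto
    have f: "norm f \<le> C / q" and g: "norm g \<le> D / q"
      unfolding f_def g_def q_def using F(3)[of z] G(3)[of z] z by auto
    have e: "exp (- (\<Sum>j=1..N. (l j + m j) * inverse (2 * \<i> * z) ^ j)) =
        exp (- (\<Sum>j=1..N. l j * inverse (2 * \<i> * z) ^ j)) * exp (- (\<Sum>j=1..N. m j * inverse (2 * \<i> * z) ^ j))"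
      by (simp add: exp_add[symmetric] sum.distrib distrib_right)
    have "F z * G z * exp (- (\<Sum>j=1..N. (l j + m j) * inverse (2 * \<i> * z) ^ j)) - 1 = f + g + f * g"
      unfolding e f_def g_def by (simp add: algebra_simps)
    also have "norm \<dots> \<le> norm f + norm g + norm (f * g)"
      by (intro norm_triangle_le add_mono norm_triangle_ineq order_refl)
    also have "\<dots> \<le> C / q + D / q + (C / q) * (D / q)"
      unfolding norm_mult using f g F(1) q by (intro add_mono mult_mono) auto
    also have "\<dots> \<le> C / q + D / q + C * D / q"
    proof -
      have "C * D / q / q \<le> C * D / q / 1" using q F(1) G(1) by (intro divide_left_mono) auto
      then show ?thesis by simp
    qed
    finally show ?thesis by (simp add: q_def add_divide_distrib)
  qed
  moreover have "0 \<le> C + D + C * D" "0 < max 1 (max R S)" using F G by auto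
  ultimately show "\<exists>C\<ge>0. \<exists>R>0. \<forall>z. 0 \<le> Im z \<longrightarrow> R \<le> norm z \<longrightarrow>
     norm (F z * G z * exp (- (\<Sum>j=1..N. (l j + m j) * inverse (2 * \<i> * z) ^ j)) - 1) \<le> C / norm z ^ Suc N"
    by blast
qed

lemma log_expansion_inverse:
  assumes "log_expansion F l"
  shows "log_expansion (\<lambda>z. inverse (F z)) (\<lambda>n. - l n)"
  unfolding log_expansion_def
proof
  fix N
  obtain C R where F: "0 \<le> C" "0 < R" "\<And>z. 0 \<le> Im z \<Longrightarrow> R \<le> norm z \<Longrightarrow>
     norm (F z * exp (- (\<Sum>j=1..N. l j * inverse (2 * \<i> * z) ^ j)) - 1) \<le> C / norm z ^ Suc N"
    using assms(1) unfolding log_expansion_def by metis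
  have "norm (inverse (F z) * exp (- (\<Sum>j=1..N. - l j * inverse (2 * \<i> * z) ^ j)) - 1) \<le> (2 * C) / norm z ^ Suc N"
    if z: "0 \<le> Im z" "max (1 + 2 * C) R \<le> norm z" for z
  proof -
    define f where "f = F z * exp (- (\<Sum>j=1..N. l j * inverse (2 * \<i> * z) ^ j))"
    define q where "q = norm z ^ Suc N"
    have "norm z ^ 1 \<le> q" unfolding q_def using z F(1) by (intro power_increasing) auto
    then have q: "1 + 2 * C \<le> q" using z by simp
    have f: "norm (f - 1) \<le> C / q"
      unfolding f_def q_def using F(3)[of z] z by auto
    have "C / q \<le> 1/2" using q F(1) by (simp add: field_simps)
    with f have "norm (f - 1) \<le> 1/2" by (rule order_trans)
    then have "norm (1 - f) \<le> 1/2" by (simp only: norm_minus_commute)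
    then have f2: "1/2 \<le> norm f" using norm_triangle_ineq2[of 1 "1 - f"] by simp
    have e: "inverse (F z) * exp (- (\<Sum>j=1..N. - l j * inverse (2 * \<i> * z) ^ j)) = inverse f"
      unfolding f_def by (simp add: sum_negf exp_minus)
    have "norm (inverse f - 1) = norm (f - 1) / norm f"
    proof -
      have "f \<noteq> 0" using f2 by auto
      then have "inverse f - 1 = - (f - 1) / f" by (simp add: field_simps)
      then show ?thesis by (simp only: norm_divide norm_minus_cancel)
    qed
    also have "\<dots> \<le> (C / q) / (1/2)" using f f2 order_trans[OF norm_ge_zero f] by (intro frac_le) auto
    finally show ?thesis unfolding e q_def by (simp add: mult.commute)
  qed
  moreover have "0 \<le> 2 * C" "0 < max (1 + 2 * C) R" using F by auto
  ultimately show "\<exists>C\<ge>0. \<exists>R>0. \<forall>z. 0 \<le> Im z \<longrightarrow> R \<le> norm z \<longrightarrow>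
     norm (inverse (F z) * exp (- (\<Sum>j=1..N. - l j * inverse (2 * \<i> * z) ^ j)) - 1) \<le> C / norm z ^ Suc N"
    by blast
qed

text \<open>The recursion is the identity D' = L' D for the formal series D with coefficients d and
  L with coefficients l, that is, D = exp L. An ordinary expansion of F thus becomes a logarithmic
  one without a logarithm of F being taken.\<close>

lemma log_expansionI:
  fixes d l :: "nat \<Rightarrow> complex"
  assumes d0: "d 0 = 1"
    and rec: "\<And>n. 1 \<le> n \<Longrightarrow> of_nat n * d n = (\<Sum>j=1..n. of_nat j * l j * d (n - j))"
    and F: "\<And>N. \<exists>C R. 0 < R \<and> (\<forall>z. 0 \<le> Im z \<and> R \<le> norm z \<longrightarrow>
       norm (F z - (\<Sum>n\<le>N. d n * inverse (2 * \<i> * z) ^ n)) \<le> C / norm z ^ Suc N)"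
  shows "log_expansion F l"
  unfolding log_expansion_def
proof
  fix N
  obtain A where A: "0 \<le> A" "\<And>t. norm t \<le> 1 \<Longrightarrow>
    norm (exp (- (\<Sum>j=1..N. l j * t ^ j)) * (\<Sum>n\<le>N. d n * t ^ n) - 1) \<le> A * norm t ^ Suc N"
    using exp_log_series[where d = d and l = l and N = N, OF d0 rec] by blast
  obtain C R where C: "0 < R" "\<And>z. 0 \<le> Im z \<Longrightarrow> R \<le> norm z \<Longrightarrow>
       norm (F z - (\<Sum>n\<le>N. d n * inverse (2 * \<i> * z) ^ n)) \<le> C / norm z ^ Suc N"
    using F[of N] by blast
  have "continuous_on (cball 0 1) (\<lambda>t. exp (- (\<Sum>j=1..N. l j * t ^ j)))" by (intro continuous_intros)
  then have "bounded ((\<lambda>t. exp (- (\<Sum>j=1..N. l j * t ^ j))) ` cball 0 1)"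
    by (intro compact_imp_bounded compact_continuous_image) auto
  then obtain B where "\<forall>y\<in>(\<lambda>t. exp (- (\<Sum>j=1..N. l j * t ^ j))) ` cball 0 1. norm y \<le> B" by (auto simp only: bounded_iff)
  then have B: "norm (exp (- (\<Sum>j=1..N. l j * t ^ j))) \<le> B" if "norm t \<le> 1" for t using that by (auto simp del: norm_exp_eq_Re)
  have "norm (F z * exp (- (\<Sum>j=1..N. l j * inverse (2 * \<i> * z) ^ j)) - 1) \<le> (B * \<bar>C\<bar> + A) / norm z ^ Suc N"
    if z: "0 \<le> Im z" "max 1 R \<le> norm z" for z
  proof -
    define t where "t = inverse (2 * \<i> * z)"
    have n2: "norm (2 * \<i> * z) = 2 * norm z" by (simp add: norm_mult)
    have nt: "norm t = 1 / (2 * norm z)" unfolding t_def norm_inverse n2 by (rule inverse_eq_divide)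
    have t1: "norm t \<le> 1" using z unfolding nt by (intro order_trans[OF divide_left_mono[of 1 "2 * norm z" 1]]) auto
    have tz: "norm t ^ Suc N \<le> 1 / norm z ^ Suc N"
    proof -
      have "0 < norm z" using z by linarith
      then have "norm t \<le> 1 / norm z" unfolding nt by (intro divide_left_mono mult_pos_pos) auto
      then have "norm t ^ Suc N \<le> (1 / norm z) ^ Suc N" by (intro power_mono) auto
      then show ?thesis by (simp add: power_divide)
    qed
    have tri: "norm (a * E - 1) \<le> norm E * norm (a - p) + norm (E * p - 1)" for a E p :: complex
    proof -
      have "a * E - 1 = E * (a - p) + (E * p - 1)" by (simp add: algebra_simps)
      then show ?thesis by (metis norm_triangle_ineq norm_mult)
    qed
    have "norm (F z * exp (- (\<Sum>j=1..N. l j * t ^ j)) - 1) \<le> norm (exp (- (\<Sum>j=1..N. l j * t ^ j))) * norm (F z - (\<Sum>n\<le>N. d n * t ^ n))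
       + norm (exp (- (\<Sum>j=1..N. l j * t ^ j)) * (\<Sum>n\<le>N. d n * t ^ n) - 1)"
      by (rule tri)
    also have "\<dots> \<le> B * (\<bar>C\<bar> / norm z ^ Suc N) + A * (1 / norm z ^ Suc N)"
    proof (rule add_mono)
      have "norm (F z - (\<Sum>n\<le>N. d n * t ^ n)) \<le> C / norm z ^ Suc N" unfolding t_def using C(2) z by simp
      also have "\<dots> \<le> \<bar>C\<bar> / norm z ^ Suc N" by (intro divide_right_mono) auto
      finally show "norm (exp (- (\<Sum>j=1..N. l j * t ^ j))) * norm (F z - (\<Sum>n\<le>N. d n * t ^ n)) \<le> B * (\<bar>C\<bar> / norm z ^ Suc N)"
        using order_trans[OF norm_ge_zero B[OF t1]] by (intro mult_mono B[OF t1]) auto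
      show "norm (exp (- (\<Sum>j=1..N. l j * t ^ j)) * (\<Sum>n\<le>N. d n * t ^ n) - 1) \<le> A * (1 / norm z ^ Suc N)"
        using A(2)[OF t1] mult_left_mono[OF tz A(1)] by linarith
    qed
    finally show ?thesis by (simp add: t_def add_divide_distrib)
  qed
  moreover have "0 \<le> B * \<bar>C\<bar> + A" "0 < max 1 R"
    using A(1) order_trans[OF norm_ge_zero B[of 0]] by auto
  ultimately show "\<exists>C\<ge>0. \<exists>R>0. \<forall>z. 0 \<le> Im z \<longrightarrow> R \<le> norm z \<longrightarrow>
     norm (F z * exp (- (\<Sum>j=1..N. l j * inverse (2 * \<i> * z) ^ j)) - 1) \<le> C / norm z ^ Suc N"
    by blast
qed

text \<open>These are the Taylor coefficients of ln (1 + c t). In the recursion only j = n and j = n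
  - 1 survive, and for n \<ge> 2 the two terms cancel.\<close>

lemma log_expansion_linear:
  "log_expansion (\<lambda>z. 1 + c * inverse (2 * \<i> * z)) (\<lambda>n. - ((- c) ^ n) / of_nat n)"
proof (rule log_expansionI[where d = "\<lambda>n. if n = 0 then 1 else if n = 1 then c else 0"])
  fix n :: nat assume n: "1 \<le> n"
  let ?d = "\<lambda>n::nat. if n = 0 then 1 else if n = 1 then c else 0"
  show "of_nat n * ?d n = (\<Sum>j=1..n. of_nat j * (- ((- c) ^ j) / of_nat j) * ?d (n - j))"
  proof (cases "n = 1")
    case False
    then obtain m where m: "n = Suc (Suc m)" using n by (metis One_nat_def Suc_le_D le_SucE not0_implies_Suc)
    have "(\<Sum>j=1..n. of_nat j * (- ((- c) ^ j) / of_nat j) * ?d (n - j)) = (\<Sum>j\<in>{n, n - 1}. - ((- c) ^ j) * ?d (n - j))"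
      using m by (intro sum.mono_neutral_cong_right) auto
    also have "\<dots> = 0" using m by simp
    finally show ?thesis using False n by simp
  qed simp
next
  fix N :: nat
  let ?d = "\<lambda>n::nat. if n = 0 then 1 else if n = 1 then c else 0"
  show "\<exists>C R. 0 < R \<and> (\<forall>z. 0 \<le> Im z \<and> R \<le> norm z \<longrightarrow>
       norm (1 + c * inverse (2 * \<i> * z) - (\<Sum>n\<le>N. ?d n * inverse (2 * \<i> * z) ^ n)) \<le> C / norm z ^ Suc N)"
  proof (cases N)
    case 0
    show ?thesis
    proof (rule exI[of _ "norm c"], rule exI[of _ "1::real"], intro conjI allI impI)
      fix z :: complex assume z: "0 \<le> Im z \<and> 1 \<le> norm z"
      have n2: "norm (2 * \<i> * z) = 2 * norm z" by (simp add: norm_mult)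
      have "1 + c * inverse (2 * \<i> * z) - (\<Sum>n\<le>N. ?d n * inverse (2 * \<i> * z) ^ n) = c * inverse (2 * \<i> * z)"
        using 0 by simp
      then have "norm (1 + c * inverse (2 * \<i> * z) - (\<Sum>n\<le>N. ?d n * inverse (2 * \<i> * z) ^ n)) = norm c * inverse (2 * norm z)"
        by (simp only: norm_mult[of c] norm_inverse n2)
      also have "\<dots> \<le> norm c * inverse (norm z)" using z by (intro mult_left_mono le_imp_inverse_le) auto
      finally show "norm (1 + c * inverse (2 * \<i> * z) - (\<Sum>n\<le>N. ?d n * inverse (2 * \<i> * z) ^ n)) \<le> norm c / norm z ^ Suc N"
        using 0 by (simp add: inverse_eq_divide)
    qed simp
  next
    case (Suc M)
    have "(\<Sum>n\<le>N. ?d n * t ^ n) = 1 + c * t" for t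
    proof -
      have "(\<Sum>n\<le>N. ?d n * t ^ n) = (\<Sum>n\<in>{0, 1}. ?d n * t ^ n)"
        using Suc by (intro sum.mono_neutral_cong_right) auto
      then show ?thesis by simp
    qed
    then show ?thesis by (intro exI[of _ 0] exI[of _ 1]) simp
  qed
qed simp

section \<open>Cauchy's theorem on half-discs\<close>

lemma inv_sqrt_integrable: "0 < R \<Longrightarrow> set_integrable lborel {0<..<R} (\<lambda>x. 1 / sqrt x)"
proof -
  assume R: "0 < (R::real)"
  have "set_integrable lborel (einterval 0 (ereal R)) (\<lambda>x. 1 / sqrt x)"
  proof (rule interval_integral_FTC_nonneg(1)[where F = "\<lambda>x. 2 * sqrt x" and A = 0 and B = "2 * sqrt R"])
    show "DERIV (\<lambda>x. 2 * sqrt x) x :> 1 / sqrt x" if "0 < ereal x" for x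
      by (rule DERIV_cong[OF DERIV_cmult[OF DERIV_real_sqrt]]) (use that in \<open>simp_all add: inverse_eq_divide\<close>)
    show "isCont (\<lambda>x. 1 / sqrt x) x" if "0 < ereal x" for x
      using that by (intro continuous_intros) auto
    have "((\<lambda>x. 2 * sqrt x) \<longlongrightarrow> 2 * sqrt 0) (at_right 0)" by (intro tendsto_intros)
    then show "(((\<lambda>x. 2 * sqrt x) \<circ> real_of_ereal) \<longlongrightarrow> 0) (at_right 0)"
      by (simp add: ereal_tendsto_simps1 zero_ereal_def)
    have "((\<lambda>x. 2 * sqrt x) \<longlongrightarrow> 2 * sqrt R) (at_left R)" by (intro tendsto_intros)
    then show "(((\<lambda>x. 2 * sqrt x) \<circ> real_of_ereal) \<longlongrightarrow> 2 * sqrt R) (at_left (ereal R))"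
      by (simp add: ereal_tendsto_simps1)
  qed (use R in \<open>auto simp: zero_ereal_def\<close>)
  moreover have "einterval 0 (ereal R) = {0<..<R}" by (auto simp: einterval_def zero_ereal_def)
  ultimately show ?thesis by simp
qed

lemma inv_square_integrable: "0 < R \<Longrightarrow> set_integrable lborel {R<..} (\<lambda>x::real. 1 / x\<^sup>2)"
proof -
  assume R: "0 < R"
  have "set_integrable lborel (einterval (ereal R) \<infinity>) (\<lambda>x. 1 / x\<^sup>2)"
  proof (rule interval_integral_FTC_nonneg(1)[where F = "\<lambda>x. - 1 / x" and A = "- 1 / R" and B = 0])
    show "DERIV (\<lambda>x. - 1 / x) x :> 1 / x\<^sup>2" if "ereal R < ereal x" for x
      using that R by (auto intro!: derivative_eq_intros simp: power2_eq_square)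
    show "isCont (\<lambda>x. 1 / x\<^sup>2) x" if "ereal R < ereal x" for x
      using that R by (intro continuous_intros) auto
    have "((\<lambda>x. - 1 / x) \<longlongrightarrow> - 1 / R) (at_right R)" using R by (intro tendsto_intros) auto
    then show "(((\<lambda>x. - 1 / x) \<circ> real_of_ereal) \<longlongrightarrow> - 1 / R) (at_right (ereal R))"
      by (simp add: ereal_tendsto_simps1)
    have "((\<lambda>x::real. - 1 / x) \<longlongrightarrow> 0) at_top"
      by (intro tendsto_divide_0[OF tendsto_const] filterlim_at_top_imp_at_infinity filterlim_ident)
    then show "(((\<lambda>x. - 1 / x) \<circ> real_of_ereal) \<longlongrightarrow> 0) (at_left \<infinity>)"
      by (simp add: ereal_tendsto_simps1)
  qed auto
  moreover have "einterval (ereal R) \<infinity> = {R<..}" by (auto simp: einterval_def)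
  ultimately show ?thesis by simp
qed

text \<open>The contour is raised by \<epsilon> because f is holomorphic only in the open
  half-plane. The diameter is folded onto \<open>{0..R}\<close> because it is the sum of the values
  at x and - x that the symmetry of f makes real or imaginary.\<close>

lemma half_disc_cauchy:
  assumes hol: "f holomorphic_on upper_open" and "0 < R" "0 < \<epsilon>"
  shows "integral {0..R} (\<lambda>x. f (of_real x + \<i> * of_real \<epsilon>) + f (- of_real x + \<i> * of_real \<epsilon>))
     + integral {0..pi} (\<lambda>t. f (of_real R * cis t + \<i> * of_real \<epsilon>) * of_real R * \<i> * cis t) = 0"
proof -
  define g where "g z = f (z + \<i> * of_real \<epsilon>)" for z
  define S where "S = {z. - \<epsilon> < Im z}"
  have S: "convex S" unfolding S_def by (rule convex_halfspace_Im_gt)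
  have gh: "g holomorphic_on S"
    unfolding g_def
    by (rule holomorphic_on_compose_gen[OF _ hol, unfolded o_def]) (auto intro!: holomorphic_intros simp: S_def)
  let ?l = "linepath (- of_real R) (of_real R) :: real \<Rightarrow> complex"
  let ?c = "part_circlepath 0 R 0 pi"
  have sub: "path_image ?l \<subseteq> S" "path_image ?c \<subseteq> S"
  proof -
    have "closed_segment (- complex_of_real R) (of_real R) \<subseteq> S"
      using S \<open>0 < \<epsilon>\<close> by (intro closed_segment_subset) (auto simp: S_def)
    then show "path_image ?l \<subseteq> S" by simp
    show "path_image ?c \<subseteq> S"
    proof
      fix z assume "z \<in> path_image ?c"
      then obtain t where t: "0 \<le> t" "t \<le> pi" "z = of_real R * exp (\<i> * of_real t)"
        by (auto simp: path_image_part_circlepath)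
      then have "Im z = R * sin t" by (simp add: cis_conv_exp[symmetric])
      also have "\<dots> \<ge> 0" using t \<open>0 < R\<close> by (simp add: sin_ge_zero)
      finally show "z \<in> S" using \<open>0 < \<epsilon>\<close> by (simp add: S_def)
    qed
  qed
  have fin: "pathfinish ?l = pathstart ?c" "pathfinish ?c = pathstart ?l"
    by (auto simp: exp_Euler)
  have "(g has_contour_integral 0) (?l +++ ?c)"
  proof (rule Cauchy_theorem_convex_simple[OF gh S])
    show "valid_path (?l +++ ?c)" using fin by (intro valid_path_join) auto
    show "path_image (?l +++ ?c) \<subseteq> S" using sub fin by (subst path_image_join) auto
    show "pathfinish (?l +++ ?c) = pathstart (?l +++ ?c)" using fin by simp
  qed
  then have 0: "g contour_integrable_on (?l +++ ?c)" "contour_integral (?l +++ ?c) g = 0"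
    by (auto simp: contour_integral_unique has_contour_integral_integrable)
  have i: "g contour_integrable_on ?l" "g contour_integrable_on ?c"
    using contour_integrable_joinD1[OF 0(1)] contour_integrable_joinD2[OF 0(1)] by auto
  have sum: "contour_integral ?l g + contour_integral ?c g = 0"
    using contour_integral_join[OF i] 0(2) by simp
  have "((\<lambda>x. g (of_real x)) has_integral contour_integral ?l g) {Re (- of_real R)..Re (of_real R)}"
    using has_contour_integral_linepath_Reals_iff[of "- of_real R" "of_real R" g "contour_integral ?l g"]
      has_contour_integral_integral[OF i(1)] \<open>0 < R\<close> by simp
  then have l: "contour_integral ?l g = integral {-R..R} (\<lambda>x. g (of_real x))" by (simp add: integral_unique)
  have "((\<lambda>t. g (0 + of_real R * cis t) * of_real R * \<i> * cis t) has_integral contour_integral ?c g) {0..pi}"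
    using has_contour_integral_part_circlepath_iff[of 0 pi g "contour_integral ?c g" 0 R]
      has_contour_integral_integral[OF i(2)] by simp
  then have c: "contour_integral ?c g = integral {0..pi} (\<lambda>t. g (of_real R * cis t) * of_real R * \<i> * cis t)"
    by (simp add: integral_unique)
  have gc: "continuous_on A (\<lambda>x::real. g (s * of_real x))" if "s \<in> {1, -1}" for A s
    using that \<open>0 < \<epsilon>\<close> by (intro continuous_on_compose2[OF holomorphic_on_imp_continuous_on[OF gh]] continuous_intros) (auto simp: S_def)
  have gc1: "continuous_on A (\<lambda>x::real. g (of_real x))" and gc2: "continuous_on A (\<lambda>x::real. g (- of_real x))" for A
    using gc[of 1 A] gc[of "-1" A] by auto
  have "integral {-R..R} (\<lambda>x. g (of_real x)) = integral {-R..0} (\<lambda>x. g (of_real x)) + integral {0..R} (\<lambda>x. g (of_real x))"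
    using \<open>0 < R\<close> by (intro Henstock_Kurzweil_Integration.integral_combine[symmetric] integrable_continuous_real gc1) auto
  also have "integral {-R..0} (\<lambda>x. g (of_real x)) = integral {0..R} (\<lambda>x. g (- of_real x))"
    using Henstock_Kurzweil_Integration.integral_reflect_real[of R 0 "\<lambda>x. g (- of_real x)"] by simp
  also have "integral {0..R} (\<lambda>x. g (- of_real x)) + integral {0..R} (\<lambda>x. g (of_real x)) = integral {0..R} (\<lambda>x. g (of_real x) + g (- of_real x))"
    by (subst Henstock_Kurzweil_Integration.integral_add) (auto intro!: integrable_continuous_real gc1 gc2 simp: add.commute)
  finally show ?thesis using sum unfolding l c by (simp add: g_def)
qed

text \<open>The contour is lowered to the real line along heights 1 / (n + 1). On the diameter the
  bound A / sqrt |k|, uniform in the height, is the integrable majorant across a possible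
  singularity at 0; on the arc f is bounded by compactness.\<close>

lemma half_disc_cauchy_limit:
  assumes hol: "f holomorphic_on upper_open" and cont: "continuous_on (upper_closed - {0}) f" and R: "0 < R"
    and bnd: "\<And>k \<tau>. 0 < \<bar>k\<bar> \<Longrightarrow> \<bar>k\<bar> \<le> R \<Longrightarrow> 0 \<le> \<tau> \<Longrightarrow> \<tau> \<le> 1 \<Longrightarrow> norm (f (of_real k + \<i> * of_real \<tau>)) \<le> A / sqrt \<bar>k\<bar>"
  shows "integral {0<..<R} (\<lambda>x. f (of_real x) + f (- of_real x))
     + integral {0..pi} (\<lambda>t. f (of_real R * cis t) * of_real R * \<i> * cis t) = 0"
proof -
  define e where "e n = 1 / real (Suc n)" for n
  have e: "0 < e n" "e n \<le> 1" for n by (auto simp: e_def)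
  have elim: "e \<longlonglongrightarrow> 0" unfolding e_def using LIMSEQ_Suc[OF lim_1_over_n[where 'a=real]] by simp
  have fc: "(\<lambda>n. f (w + \<i> * of_real (e n))) \<longlonglongrightarrow> f w" if "0 \<le> Im w" "w \<noteq> 0" for w
  proof (rule continuous_on_tendsto_compose[OF cont])
    have "(\<lambda>n. w + \<i> * of_real (e n)) \<longlonglongrightarrow> w + \<i> * of_real 0" by (intro tendsto_intros elim)
    then show "(\<lambda>n. w + \<i> * of_real (e n)) \<longlonglongrightarrow> w" by simp
    have "w + \<i> * of_real (e n) \<in> upper_closed - {0}" for n
      using that e[of n] by (auto simp: complex_eq_iff)
    then show "\<forall>\<^sub>F n in sequentially. w + \<i> * of_real (e n) \<in> upper_closed - {0}" by simp
  qed (use that in auto)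
  define p where "p n x = f (of_real x + \<i> * of_real (e n)) + f (- of_real x + \<i> * of_real (e n))" for n x
  have pcont: "continuous_on B (p n)" for B n
    unfolding p_def using e[of n]
    by (intro continuous_intros continuous_on_compose2[OF cont]) (auto simp: complex_eq_iff)
  have n1: "negligible {x \<in> {0..R} - {0<..<R}. p n x \<noteq> 0}" for n
    by (rule negligible_subset[of "{0, R}"]) auto
  have n2: "negligible {x \<in> {0<..<R} - {0..R}. p n x \<noteq> 0}" for n
    by (rule negligible_subset[of "{}"]) auto
  have pint: "p n integrable_on {0<..<R}" for n
    by (rule integrable_spike_set[OF integrable_continuous_real[OF pcont] n1 n2])
  have peq: "integral {0..R} (p n) = integral {0<..<R} (p n)" for n
    by (rule integral_spike_set[OF n1 n2])
  have hint: "(\<lambda>x. 2 * A * (1 / sqrt x)) integrable_on {0<..<R}"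
    by (intro set_borel_integral_eq_integral(1) set_integrable_mult_right inv_sqrt_integrable R)
  have pdom: "norm (p n x) \<le> 2 * A * (1 / sqrt x)" if "x \<in> {0<..<R}" for n x
  proof -
    have "norm (p n x) \<le> norm (f (of_real x + \<i> * of_real (e n))) + norm (f (- of_real x + \<i> * of_real (e n)))"
      unfolding p_def by (rule norm_triangle_ineq)
    also have "\<dots> \<le> A / sqrt \<bar>x\<bar> + A / sqrt \<bar>- x\<bar>"
      using bnd[of x "e n"] bnd[of "-x" "e n"] that e[of n] by (intro add_mono) auto
    finally show ?thesis using that by simp
  qed
  have l1: "(\<lambda>n. integral {0<..<R} (p n)) \<longlonglongrightarrow> integral {0<..<R} (\<lambda>x. f (of_real x) + f (- of_real x))"
  proof (rule dominated_convergence(2)[OF pint hint pdom])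
    show "(\<lambda>n. p n x) \<longlonglongrightarrow> f (of_real x) + f (- of_real x)" if "x \<in> {0<..<R}" for x
      unfolding p_def using that by (intro tendsto_add fc) auto
  qed
  define q where "q n t = f (of_real R * cis t + \<i> * of_real (e n)) * of_real R * \<i> * cis t" for n t
  have sin: "0 \<le> R * sin t" if "t \<in> {0..pi}" for t using that R by (simp add: sin_ge_zero)
  \<comment> \<open>A compact half-annulus away from 0 that contains all the raised arcs, the
    heights being at most 1.\<close>
  define K where "K = {z. 0 \<le> Im z \<and> R \<le> norm z \<and> norm z \<le> R + 1}"
  have K: "compact K"
  proof -
    have "K = upper_closed \<inter> (cball 0 (R + 1) \<inter> - ball 0 R)" by (auto simp: K_def dist_norm)
    moreover have "closed upper_closed" by (rule closed_halfspace_Im_ge)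
    ultimately show ?thesis by (simp add: compact_Int_closed closed_Int_compact closed_Compl)
  qed
  have "continuous_on K f" by (rule continuous_on_subset[OF cont]) (use R in \<open>auto simp: K_def\<close>)
  then have "bounded (f ` K)" by (intro compact_imp_bounded compact_continuous_image K)
  then obtain B where "\<forall>y\<in>f ` K. norm y \<le> B" by (auto simp only: bounded_iff)
  then have B: "norm (f z) \<le> B" if "z \<in> K" for z using that by auto
  have inK: "of_real R * cis t + \<i> * of_real (e n) \<in> K" if "t \<in> {0..pi}" for t n
  proof -
    have "R\<^sup>2 \<le> (norm (of_real R * cis t + \<i> * of_real (e n)))\<^sup>2"
    proof -
      have "(norm (of_real R * cis t + \<i> * of_real (e n)))\<^sup>2 = (R * cos t)\<^sup>2 + (R * sin t + e n)\<^sup>2"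
        by (simp add: cmod_power2)
      also have "\<dots> = R\<^sup>2 * ((cos t)\<^sup>2 + (sin t)\<^sup>2) + 2 * (R * sin t) * e n + (e n)\<^sup>2"
      proof -
        have gen: "(R * c)\<^sup>2 + (R * s + d)\<^sup>2 = R\<^sup>2 * (c\<^sup>2 + s\<^sup>2) + 2 * (R * s) * d + d\<^sup>2" for c s d :: real
          by (simp add: power2_eq_square algebra_simps)
        show ?thesis by (rule gen)
      qed
      also have "\<dots> \<ge> R\<^sup>2" using sin[OF that] e[of n] by simp
      finally show ?thesis .
    qed
    then have "R \<le> norm (of_real R * cis t + \<i> * of_real (e n))" by (rule power2_le_imp_le) simp
    moreover have "norm (of_real R * cis t + \<i> * of_real (e n)) \<le> R + 1"
      using norm_triangle_ineq[of "of_real R * cis t" "\<i> * of_real (e n)"] e[of n] R by (simp add: norm_mult)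
    moreover have "0 \<le> Im (of_real R * cis t + \<i> * of_real (e n))" using sin[OF that] e(1)[of n] by simp
    ultimately show ?thesis by (simp add: K_def)
  qed
  have qcont: "continuous_on {0..pi} (q n)" for n
    unfolding q_def using inK[of _ n] R
    by (intro continuous_intros continuous_on_compose2[OF \<open>continuous_on K f\<close>]) auto
  have l2: "(\<lambda>n. integral {0..pi} (q n)) \<longlonglongrightarrow> integral {0..pi} (\<lambda>t. f (of_real R * cis t) * of_real R * \<i> * cis t)"
  proof (rule dominated_convergence(2)[where h = "\<lambda>_. B * R"])
    show "q n integrable_on {0..pi}" for n by (intro integrable_continuous_real qcont)
    show "(\<lambda>_. B * R) integrable_on {0..pi}" by (intro integrable_continuous_real continuous_intros)
    show "norm (q n t) \<le> B * R" if "t \<in> {0..pi}" for n t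
      using B[OF inK[OF that, of n]] R by (simp add: q_def norm_mult)
    show "(\<lambda>n. q n t) \<longlonglongrightarrow> f (of_real R * cis t) * of_real R * \<i> * cis t" if "t \<in> {0..pi}" for t
    proof -
      have "complex_of_real R * cis t \<noteq> 0" using R by simp
      then show ?thesis unfolding q_def using sin[OF that] by (intro tendsto_intros fc) auto
    qed
  qed
  have "integral {0<..<R} (p n) + integral {0..pi} (q n) = 0" for n
    using half_disc_cauchy[OF hol R e(1)[of n]] peq[of n] by (simp add: p_def[abs_def] q_def[abs_def])
  then have "(\<lambda>n. 0) \<longlonglongrightarrow> integral {0<..<R} (\<lambda>x. f (of_real x) + f (- of_real x)) + integral {0..pi} (\<lambda>t. f (of_real R * cis t) * of_real R * \<i> * cis t)"
    using tendsto_add[OF l1 l2] by simp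
  then show ?thesis by (rule LIMSEQ_unique[OF _ tendsto_const])
qed

text \<open>Since f is asymptotic to c / z, the arcs contribute i pi c in the limit. In f(x) + f(-
  x) the leading terms c / x and - c / x cancel, so q is of order 1 / x^2 and absolutely integrable
  at infinity. The constant s, later 2 or 2 i, lets the same lemma serve real and imaginary
  parts.\<close>

lemma half_plane_integral:
  fixes f :: "complex \<Rightarrow> complex" and q :: "real \<Rightarrow> real"
  assumes hol: "f holomorphic_on upper_open" and cont: "continuous_on (upper_closed - {0}) f"
    and bnd: "\<And>R. 0 < R \<Longrightarrow> \<exists>A. \<forall>k \<tau>. 0 < \<bar>k\<bar> \<longrightarrow> \<bar>k\<bar> \<le> R \<longrightarrow> 0 \<le> \<tau> \<longrightarrow> \<tau> \<le> 1 \<longrightarrow>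
          norm (f (of_real k + \<i> * of_real \<tau>)) \<le> A / sqrt \<bar>k\<bar>"
    and inf: "\<exists>C R. \<forall>z. 0 \<le> Im z \<longrightarrow> R \<le> norm z \<longrightarrow> norm (z * f z - c) \<le> C / norm z"
    and sym: "\<And>x. 0 < x \<Longrightarrow> f (of_real x) + f (- of_real x) = s * of_real (q x)" and s: "s \<noteq> 0"
  shows "set_integrable lborel {0<..} q" "s * of_real (LINT x:{0<..}|lborel. q x) = - (\<i> * of_real pi * c)"
proof -
  obtain C0 R0 where C0: "\<And>z. 0 \<le> Im z \<Longrightarrow> R0 \<le> norm z \<Longrightarrow> norm (z * f z - c) \<le> C0 / norm z"
    using inf by metis
  define R1 where "R1 = max 1 R0"
  have R1: "1 \<le> R1" "0 < R1" "R0 \<le> R1" by (auto simp: R1_def)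
  define C where "C = \<bar>C0\<bar>"
  have C: "norm (z * f z - c) \<le> C / norm z" if "0 \<le> Im z" "R1 \<le> norm z" for z
  proof -
    have "norm (z * f z - c) \<le> C0 / norm z" using C0 that R1 by auto
    also have "\<dots> \<le> C / norm z" by (intro divide_right_mono) (auto simp: C_def)
    finally show ?thesis .
  qed
  have qeq: "q x = Re ((f (of_real x) + f (- of_real x)) / s)" if "0 < x" for x
    using sym[OF that] s by simp
  have qc: "continuous_on {0<..} q"
  proof -
    have "continuous_on {0<..} (\<lambda>x. Re ((f (of_real x) + f (- of_real x)) / s))"
      using s by (intro continuous_intros continuous_on_compose2[OF cont]) auto
    then show ?thesis using qeq continuous_on_cong by (metis (no_types, lifting) greaterThan_iff)
  qed
  have qm: "set_borel_measurable lborel S q" if "S \<subseteq> {0<..}" "S \<in> sets borel" for S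
    unfolding set_borel_measurable_def
    using borel_measurable_continuous_on_indicator[OF that(2) continuous_on_subset[OF qc that(1)]] by simp
  have qn: "\<bar>q x\<bar> \<le> norm (f (of_real x) + f (- of_real x)) / norm s" if "0 < x" for x
    using sym[OF that] s by (simp add: norm_mult)
  obtain A where A: "\<And>k \<tau>. 0 < \<bar>k\<bar> \<Longrightarrow> \<bar>k\<bar> \<le> R1 + 1 \<Longrightarrow> 0 \<le> \<tau> \<Longrightarrow> \<tau> \<le> 1 \<Longrightarrow> norm (f (of_real k + \<i> * of_real \<tau>)) \<le> A / sqrt \<bar>k\<bar>"
    using bnd[of "R1 + 1"] R1 by auto
  have i1: "set_integrable lborel {0<..<R1 + 1} q"
  proof (rule set_integrable_bound[of _ _ "\<lambda>x. (2 * A / norm s) * (1 / sqrt x)"])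
    show "set_integrable lborel {0<..<R1 + 1} (\<lambda>x. (2 * A / norm s) * (1 / sqrt x))"
      using R1 by (intro set_integrable_mult_right inv_sqrt_integrable) auto
    show "set_borel_measurable lborel {0<..<R1 + 1} q" by (rule qm) auto
    show "AE x in lborel. x \<in> {0<..<R1 + 1} \<longrightarrow> norm (q x) \<le> norm ((2 * A / norm s) * (1 / sqrt x))"
    proof (intro AE_I2 impI)
      fix x assume x: "x \<in> {0<..<R1 + 1}"
      have "norm (f (of_real x) + f (- of_real x)) \<le> norm (f (of_real x)) + norm (f (- of_real x))" by (rule norm_triangle_ineq)
      also have "\<dots> \<le> A / sqrt \<bar>x\<bar> + A / sqrt \<bar>- x\<bar>"
        using A[of x 0] A[of "-x" 0] x by (intro add_mono) auto
      finally have "norm (f (of_real x) + f (- of_real x)) \<le> 2 * A * (1 / sqrt x)" using x by simp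
      then have "norm (f (of_real x) + f (- of_real x)) / norm s \<le> 2 * A * (1 / sqrt x) / norm s"
        by (intro divide_right_mono) auto
      then have "\<bar>q x\<bar> \<le> 2 * A * (1 / sqrt x) / norm s" using qn[of x] x by auto
      also have "\<dots> = (2 * A / norm s) * (1 / sqrt x)" by simp
      finally show "norm (q x) \<le> norm ((2 * A / norm s) * (1 / sqrt x))"
        unfolding real_norm_def by (rule order_trans[OF _ abs_ge_self])
    qed
  qed
  have i2: "set_integrable lborel {R1<..} q"
  proof (rule set_integrable_bound[of _ _ "\<lambda>x. (2 * C / norm s) * (1 / x\<^sup>2)"])
    show "set_integrable lborel {R1<..} (\<lambda>x. (2 * C / norm s) * (1 / x\<^sup>2))"
      using R1 by (intro set_integrable_mult_right inv_square_integrable) auto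
    show "set_borel_measurable lborel {R1<..} q" by (rule qm) (use R1 in auto)
    show "AE x in lborel. x \<in> {R1<..} \<longrightarrow> norm (q x) \<le> norm ((2 * C / norm s) * (1 / x\<^sup>2))"
    proof (intro AE_I2 impI)
      fix x assume x: "x \<in> {R1<..}"
      then have x0: "0 < x" using R1 by auto
      have "of_real x * (f (of_real x) + f (- of_real x)) = (of_real x * f (of_real x) - c) - ((- of_real x) * f (- of_real x) - c)"
        by (simp add: algebra_simps)
      also have "norm \<dots> \<le> C / x + C / x"
        by (rule order_trans[OF norm_triangle_ineq4 add_mono]) (use C[of "of_real x"] C[of "- of_real x"] x x0 in auto)
      finally have "x * norm (f (of_real x) + f (- of_real x)) \<le> 2 * C / x" using x0 by (simp add: norm_mult)
      then have "norm (f (of_real x) + f (- of_real x)) \<le> 2 * C * (1 / x\<^sup>2)"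
        using x0 by (simp add: field_simps power2_eq_square)
      then have "norm (f (of_real x) + f (- of_real x)) / norm s \<le> 2 * C * (1 / x\<^sup>2) / norm s"
        by (intro divide_right_mono) auto
      then have "\<bar>q x\<bar> \<le> 2 * C * (1 / x\<^sup>2) / norm s" using qn[OF x0] by auto
      also have "\<dots> = (2 * C / norm s) * (1 / x\<^sup>2)" by simp
      finally show "norm (q x) \<le> norm ((2 * C / norm s) * (1 / x\<^sup>2))"
        unfolding real_norm_def by (rule order_trans[OF _ abs_ge_self])
    qed
  qed
  have un: "{0<..} = {0<..<R1 + 1} \<union> {R1<..}" using R1 by auto
  show qi: "set_integrable lborel {0<..} q"
    unfolding un by (rule set_integrable_Un[OF i1 i2]) auto
  have lq: "((\<lambda>R. LINT x:{0<..<R}|lborel. q x) \<longlongrightarrow> (LINT x:{0<..}|lborel. q x)) at_top"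
    unfolding set_lebesgue_integral_def
  proof (rule integral_dominated_convergence_at_top[where w = "\<lambda>x. norm (indicator {0<..} x *\<^sub>R q x)"])
    show "integrable lborel (\<lambda>x. norm (indicator {0<..} x *\<^sub>R q x))"
      using qi unfolding set_integrable_def by (rule integrable_norm)
    show "(\<lambda>x. indicator {0<..} x *\<^sub>R q x) \<in> borel_measurable lborel"
      using qm[of "{0<..}"] by (simp add: set_borel_measurable_def)
    show "(\<lambda>x. indicator {0<..<R} x *\<^sub>R q x) \<in> borel_measurable lborel" for R
    proof -
      have "set_borel_measurable lborel {0<..<R} q" by (rule qm) auto
      then show ?thesis by (simp add: set_borel_measurable_def)
    qed
    show "\<forall>\<^sub>F R in at_top. AE x in lborel. norm (indicator {0<..<R} x *\<^sub>R q x) \<le> norm (indicator {0<..} x *\<^sub>R q x)"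
      by (intro always_eventually allI AE_I2) (auto simp: indicator_def)
    show "AE x in lborel. ((\<lambda>R. indicator {0<..<R} x *\<^sub>R q x) \<longlongrightarrow> indicator {0<..} x *\<^sub>R q x) at_top"
    proof (intro AE_I2 tendsto_eventually)
      fix x :: real
      show "\<forall>\<^sub>F R in at_top. indicator {0<..<R} x *\<^sub>R q x = indicator {0<..} x *\<^sub>R q x"
        using eventually_gt_at_top[of x] by eventually_elim (auto simp: indicator_def)
    qed
  qed
  define arc where "arc R = integral {0..pi} (\<lambda>t. f (of_real R * cis t) * of_real R * \<i> * cis t)" for R
  have arcb: "norm (arc R - \<i> * of_real pi * c) \<le> pi * C / R" if "R1 \<le> R" for R
  proof -
    have R: "0 < R" using that R1 by simp
    have ci: "continuous_on {0..pi} (\<lambda>t. f (of_real R * cis t) * of_real R * \<i> * cis t)"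
      using R by (intro continuous_intros continuous_on_compose2[OF cont]) (auto simp: sin_ge_zero)
    have hi: "((\<lambda>t. f (of_real R * cis t) * of_real R * \<i> * cis t - \<i> * c) has_integral (arc R - (pi - 0) *\<^sub>R (\<i> * c))) {0..pi}"
      unfolding arc_def using has_integral_const_real[of "\<i> * c" 0 pi]
      by (intro has_integral_diff integrable_integral integrable_continuous_real ci) simp
    have "norm (arc R - (pi - 0) *\<^sub>R (\<i> * c)) \<le> (C / R) * measure lborel {0..pi}"
    proof (rule has_integral_bound_real[where S = "{}", OF _ _ hi])
      show "0 \<le> C / R" using R by (simp add: C_def)
      fix t assume "t \<in> {0..pi} - {}"
      then have t: "t \<in> {0..pi}" by simp
      have "f (of_real R * cis t) * of_real R * \<i> * cis t - \<i> * c = \<i> * ((of_real R * cis t) * f (of_real R * cis t) - c)"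
        by (simp add: algebra_simps)
      then have "norm (f (of_real R * cis t) * of_real R * \<i> * cis t - \<i> * c) = norm ((of_real R * cis t) * f (of_real R * cis t) - c)"
        by (simp add: norm_mult)
      also have "\<dots> \<le> C / norm (of_real R * cis t)"
        using t that R by (intro C) (auto simp: norm_mult sin_ge_zero)
      finally show "norm (f (of_real R * cis t) * of_real R * \<i> * cis t - \<i> * c) \<le> C / R" using R by (simp add: norm_mult)
    qed simp
    then show ?thesis by (simp add: scaleR_conv_of_real mult_ac)
  qed
  have la: "(arc \<longlongrightarrow> \<i> * of_real pi * c) at_top"
  proof -
    have "((\<lambda>R. arc R - \<i> * of_real pi * c) \<longlongrightarrow> 0) at_top"
    proof (rule Lim_null_comparison)
      show "\<forall>\<^sub>F R in at_top. norm (arc R - \<i> * of_real pi * c) \<le> pi * C / R"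
        using eventually_ge_at_top[of R1] by eventually_elim (rule arcb)
      show "((\<lambda>R. pi * C / R) \<longlongrightarrow> 0) at_top"
        by (intro tendsto_divide_0[OF tendsto_const] filterlim_at_top_imp_at_infinity filterlim_ident)
    qed
    then show ?thesis by (rule LIM_zero_cancel)
  qed
  have eqR: "s * of_real (LINT x:{0<..<R}|lborel. q x) + arc R = 0" if R: "0 < R" for R
  proof -
    obtain A where A: "\<And>k \<tau>. 0 < \<bar>k\<bar> \<Longrightarrow> \<bar>k\<bar> \<le> R \<Longrightarrow> 0 \<le> \<tau> \<Longrightarrow> \<tau> \<le> 1 \<Longrightarrow> norm (f (of_real k + \<i> * of_real \<tau>)) \<le> A / sqrt \<bar>k\<bar>"
      using bnd[OF R] by auto
    have qR: "set_integrable lborel {0<..<R} q" by (rule set_integrable_subset[OF qi]) auto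
    have "(q has_integral (LINT x:{0<..<R}|lborel. q x)) {0<..<R}"
      using set_borel_integral_eq_integral[OF qR] by (simp add: integrable_integral)
    then have "((\<lambda>x. s * of_real (q x)) has_integral s * of_real (LINT x:{0<..<R}|lborel. q x)) {0<..<R}"
      by (intro has_integral_mult_right has_integral_of_real)
    then have "((\<lambda>x. f (of_real x) + f (- of_real x)) has_integral s * of_real (LINT x:{0<..<R}|lborel. q x)) {0<..<R}"
      by (rule has_integral_eq[rotated]) (simp add: sym)
    then have "integral {0<..<R} (\<lambda>x. f (of_real x) + f (- of_real x)) = s * of_real (LINT x:{0<..<R}|lborel. q x)"
      by (rule integral_unique)
    then show ?thesis using half_disc_cauchy_limit[OF hol cont R A] by (simp add: arc_def)
  qed
  have "((\<lambda>R. s * of_real (LINT x:{0<..<R}|lborel. q x) + arc R) \<longlongrightarrow> s * of_real (LINT x:{0<..}|lborel. q x) + \<i> * of_real pi * c) at_top"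
    by (intro tendsto_intros lq la)
  moreover have "((\<lambda>R. s * of_real (LINT x:{0<..<R}|lborel. q x) + arc R) \<longlongrightarrow> 0) at_top"
    by (rule tendsto_eventually) (use eventually_gt_at_top[of 0] in eventually_elim, rule eqR)
  ultimately have "s * of_real (LINT x:{0<..}|lborel. q x) + \<i> * of_real pi * c = 0"
    by (rule tendsto_unique[OF trivial_limit_at_top_linorder])
  then show "s * of_real (LINT x:{0<..}|lborel. q x) = - (\<i> * of_real pi * c)"
    by (simp add: eq_neg_iff_add_eq_0)
qed

section \<open>Moments of the subtracted arctangent\<close>

text \<open>The subtracted sum is the start of the expansion of the arctangent at infinity, and
  matches what a Blaschke factor contributes to the terms subtracted from the logarithm on the real
  line.\<close>

definition arctan_rem :: "real \<Rightarrow> nat \<Rightarrow> real \<Rightarrow> real" where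
  "arctan_rem \<kappa> n x = arctan (\<kappa> / x) - (\<Sum>j<n. (-1) ^ j * (\<kappa> / x) ^ (2 * j + 1) / real (2 * j + 1))"

text \<open>The derivative of arctan (\<kappa> / x) is a geometric series in - (\<kappa> / x)^2; its
  remainder after n terms has this closed form.\<close>

lemma arctan_rem_deriv:
  assumes x: "0 < x"
  shows "(arctan_rem \<kappa> n has_real_derivative - ((-1) ^ n * (\<kappa> / x) ^ (2 * n) * \<kappa> / (x\<^sup>2 + \<kappa>\<^sup>2))) (at x)"
proof (induction n)
  case 0
  have d: "((\<lambda>x. \<kappa> / x) has_real_derivative - (\<kappa> / x\<^sup>2)) (at x)"
    using x by (auto intro!: derivative_eq_intros simp: power2_eq_square)
  have "((\<lambda>x. arctan (\<kappa> / x)) has_real_derivative - (\<kappa> / x\<^sup>2) * inverse (1 + (\<kappa> / x)\<^sup>2)) (at x)"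
    by (rule DERIV_cong[OF DERIV_chain2[OF DERIV_arctan d]]) simp
  moreover have "- (\<kappa> / x\<^sup>2) * inverse (1 + (\<kappa> / x)\<^sup>2) = - (\<kappa> / (x\<^sup>2 + \<kappa>\<^sup>2))"
  proof -
    have "1 + (\<kappa> / x)\<^sup>2 = (x\<^sup>2 + \<kappa>\<^sup>2) / x\<^sup>2" using x by (simp add: field_simps)
    then show ?thesis using x by simp
  qed
  ultimately show ?case by (simp add: arctan_rem_def[abs_def])
next
  case (Suc n)
  have d: "((\<lambda>x. \<kappa> / x) has_real_derivative - (\<kappa> / x\<^sup>2)) (at x)"
    using x by (auto intro!: derivative_eq_intros simp: power2_eq_square)
  have p: "((\<lambda>x. (-1) ^ n * (\<kappa> / x) ^ (2 * n + 1) / real (2 * n + 1)) has_real_derivative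
      (-1) ^ n * ((\<kappa> / x) ^ (2 * n) * - (\<kappa> / x\<^sup>2))) (at x)"
  proof -
    have "((\<lambda>x. (\<kappa> / x) ^ (2 * n + 1)) has_real_derivative real (2 * n + 1) * (- (\<kappa> / x\<^sup>2) * (\<kappa> / x) ^ (2 * n))) (at x)"
      by (rule DERIV_cong[OF DERIV_power[OF d, of "2 * n + 1"]]) simp
    from DERIV_cdivide[OF DERIV_cmult[OF this, of "(-1) ^ n"], of "real (2 * n + 1)"]
    show ?thesis by (rule DERIV_cong) (simp add: mult_ac)
  qed
  have pos: "0 < x\<^sup>2 + \<kappa>\<^sup>2" using x by (simp add: add_pos_nonneg)
  have alg: "\<kappa> / (x\<^sup>2 + \<kappa>\<^sup>2) - \<kappa> / x\<^sup>2 = - ((\<kappa> / x)\<^sup>2 * \<kappa> / (x\<^sup>2 + \<kappa>\<^sup>2))"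
    using x pos by (simp add: field_simps power2_eq_square)
  have "- ((-1) ^ n * (\<kappa> / x) ^ (2 * n) * \<kappa> / (x\<^sup>2 + \<kappa>\<^sup>2)) - (-1) ^ n * ((\<kappa> / x) ^ (2 * n) * - (\<kappa> / x\<^sup>2))
     = - ((-1) ^ n * (\<kappa> / x) ^ (2 * n)) * (\<kappa> / (x\<^sup>2 + \<kappa>\<^sup>2) - \<kappa> / x\<^sup>2)"
    by (simp only: right_diff_distrib) (simp add: mult_ac)
  also have "\<dots> = - ((-1) ^ Suc n * (\<kappa> / x) ^ (2 * Suc n) * \<kappa> / (x\<^sup>2 + \<kappa>\<^sup>2))"
    unfolding alg by (simp add: power_add power2_eq_square mult_ac)
  finally have e: "- ((-1) ^ n * (\<kappa> / x) ^ (2 * n) * \<kappa> / (x\<^sup>2 + \<kappa>\<^sup>2)) - (-1) ^ n * ((\<kappa> / x) ^ (2 * n) * - (\<kappa> / x\<^sup>2))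
     = - ((-1) ^ Suc n * (\<kappa> / x) ^ (2 * Suc n) * \<kappa> / (x\<^sup>2 + \<kappa>\<^sup>2))" .
  have "arctan_rem \<kappa> (Suc n) = (\<lambda>x. arctan_rem \<kappa> n x - (-1) ^ n * (\<kappa> / x) ^ (2 * n + 1) / real (2 * n + 1))"
    by (auto simp: arctan_rem_def fun_eq_iff)
  then show ?case using DERIV_cong[OF DERIV_diff[OF Suc.IH p] e] by simp
qed

lemma arctan_rem_tendsto_0: "(arctan_rem \<kappa> n \<longlongrightarrow> 0) at_top"
proof -
  have k: "((\<lambda>x. \<kappa> / x) \<longlongrightarrow> 0) at_top"
    by (intro tendsto_divide_0[OF tendsto_const] filterlim_at_top_imp_at_infinity filterlim_ident)
  have "((\<lambda>x. arctan (\<kappa> / x) - (\<Sum>j<n. (-1) ^ j * (\<kappa> / x) ^ (2 * j + 1) / real (2 * j + 1))) \<longlongrightarrow>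
     arctan 0 - (\<Sum>j<n. (-1) ^ j * 0 ^ (2 * j + 1) / real (2 * j + 1))) at_top"
    by (intro tendsto_intros k) auto
  then show ?thesis by (simp add: arctan_rem_def[abs_def])
qed

text \<open>The derivative has one sign and the remainder vanishes at infinity, which gives the
  sign; replacing x^2 + \<kappa>^2 by x^2 in the derivative gives the upper bound. The sign also
  makes the moment accessible to the fundamental theorem for nonnegative integrands.\<close>

lemma arctan_rem_bounds:
  assumes k: "0 < \<kappa>" and x: "0 < x"
  shows "0 \<le> (-1) ^ n * arctan_rem \<kappa> n x" "(-1) ^ n * arctan_rem \<kappa> n x \<le> (\<kappa> / x) ^ (2 * n + 1)"
proof -
  have s: "(-1) ^ n * ((-1) ^ n * a) = (a::real)" for a
    by (simp add: mult.assoc[symmetric] power_add[symmetric] mult_2[symmetric])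
  have d: "((\<lambda>y. (-1) ^ n * arctan_rem \<kappa> n y) has_real_derivative - ((\<kappa> / y) ^ (2 * n) * \<kappa> / (y\<^sup>2 + \<kappa>\<^sup>2))) (at y within A)" if "0 < y" for y A
  proof (rule has_field_derivative_at_within)
    show "((\<lambda>y. (-1) ^ n * arctan_rem \<kappa> n y) has_real_derivative - ((\<kappa> / y) ^ (2 * n) * \<kappa> / (y\<^sup>2 + \<kappa>\<^sup>2))) (at y)"
      by (rule DERIV_cong[OF DERIV_cmult[OF arctan_rem_deriv[OF that, of \<kappa> n], of "(-1) ^ n"]])
         (simp add: s times_divide_eq_right[symmetric] mult.assoc del: times_divide_eq_right)
  qed
  have "- ((-1) ^ n * arctan_rem \<kappa> n x) \<le> 0"
  proof (rule nonpos_if_increasing_to_0[where f = "\<lambda>x. - ((-1) ^ n * arctan_rem \<kappa> n x)"])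
    fix y assume y: "x \<le> y"
    show "((\<lambda>x. - ((-1) ^ n * arctan_rem \<kappa> n x)) has_vector_derivative - (- ((\<kappa> / y) ^ (2 * n) * \<kappa> / (y\<^sup>2 + \<kappa>\<^sup>2)))) (at y within {x..})"
      unfolding has_real_derivative_iff_has_vector_derivative[symmetric]
      by (rule DERIV_minus[OF d]) (use x y in auto)
    show "0 \<le> - (- ((\<kappa> / y) ^ (2 * n) * \<kappa> / (y\<^sup>2 + \<kappa>\<^sup>2)))" using x y k by simp
  next
    have "((\<lambda>x. - ((-1) ^ n * arctan_rem \<kappa> n x)) \<longlongrightarrow> - ((-1) ^ n * 0)) at_top"
      by (intro tendsto_intros arctan_rem_tendsto_0)
    then show "((\<lambda>x. - ((-1) ^ n * arctan_rem \<kappa> n x)) \<longlongrightarrow> 0) at_top" by simp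
  qed
  then show "0 \<le> (-1) ^ n * arctan_rem \<kappa> n x" by simp
  have "(-1) ^ n * arctan_rem \<kappa> n x - (\<kappa> / x) ^ (2 * n + 1) / real (2 * n + 1) \<le> 0"
  proof (rule nonpos_if_increasing_to_0[where f = "\<lambda>x. (-1) ^ n * arctan_rem \<kappa> n x - (\<kappa> / x) ^ (2 * n + 1) / real (2 * n + 1)"])
    fix y assume y: "x \<le> y"
    then have y0: "0 < y" using x by simp
    have d2: "((\<lambda>x. (\<kappa> / x) ^ (2 * n + 1) / real (2 * n + 1)) has_real_derivative (\<kappa> / y) ^ (2 * n) * - (\<kappa> / y\<^sup>2)) (at y within {x..})"
    proof (rule has_field_derivative_at_within)
      have d: "((\<lambda>x. \<kappa> / x) has_real_derivative - (\<kappa> / y\<^sup>2)) (at y)"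
        using y0 by (auto intro!: derivative_eq_intros simp: power2_eq_square)
      have "((\<lambda>x. (\<kappa> / x) ^ (2 * n + 1)) has_real_derivative real (2 * n + 1) * (- (\<kappa> / y\<^sup>2) * (\<kappa> / y) ^ (2 * n))) (at y)"
        by (rule DERIV_cong[OF DERIV_power[OF d, of "2 * n + 1"]]) simp
      from DERIV_cdivide[OF this, of "real (2 * n + 1)"]
      show "((\<lambda>x. (\<kappa> / x) ^ (2 * n + 1) / real (2 * n + 1)) has_real_derivative (\<kappa> / y) ^ (2 * n) * - (\<kappa> / y\<^sup>2)) (at y)"
        by (rule DERIV_cong) (simp add: mult_ac)
    qed
    show "((\<lambda>x. (-1) ^ n * arctan_rem \<kappa> n x - (\<kappa> / x) ^ (2 * n + 1) / real (2 * n + 1)) has_vector_derivative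
       - ((\<kappa> / y) ^ (2 * n) * \<kappa> / (y\<^sup>2 + \<kappa>\<^sup>2)) - (\<kappa> / y) ^ (2 * n) * - (\<kappa> / y\<^sup>2)) (at y within {x..})"
      unfolding has_real_derivative_iff_has_vector_derivative[symmetric]
      by (rule DERIV_diff[OF d[OF y0] d2])
    have "\<kappa> / (y\<^sup>2 + \<kappa>\<^sup>2) \<le> \<kappa> / y\<^sup>2" using y0 k by (intro divide_left_mono) (auto intro!: mult_pos_pos add_pos_nonneg)
    then have "(\<kappa> / y) ^ (2 * n) * (\<kappa> / (y\<^sup>2 + \<kappa>\<^sup>2)) \<le> (\<kappa> / y) ^ (2 * n) * (\<kappa> / y\<^sup>2)"
      using y0 k by (intro mult_left_mono) auto
    then show "0 \<le> - ((\<kappa> / y) ^ (2 * n) * \<kappa> / (y\<^sup>2 + \<kappa>\<^sup>2)) - (\<kappa> / y) ^ (2 * n) * - (\<kappa> / y\<^sup>2)" by simp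
  next
    have k: "((\<lambda>x. \<kappa> / x) \<longlongrightarrow> 0) at_top"
      by (intro tendsto_divide_0[OF tendsto_const] filterlim_at_top_imp_at_infinity filterlim_ident)
    have "((\<lambda>x. (-1) ^ n * arctan_rem \<kappa> n x - (\<kappa> / x) ^ (2 * n + 1) / real (2 * n + 1)) \<longlongrightarrow> (-1) ^ n * 0 - 0 ^ (2 * n + 1) / real (2 * n + 1)) at_top"
      by (intro tendsto_intros arctan_rem_tendsto_0 k) auto
    then show "((\<lambda>x. (-1) ^ n * arctan_rem \<kappa> n x - (\<kappa> / x) ^ (2 * n + 1) / real (2 * n + 1)) \<longlongrightarrow> 0) at_top" by simp
  qed
  then have "(-1) ^ n * arctan_rem \<kappa> n x \<le> (\<kappa> / x) ^ (2 * n + 1) / real (2 * n + 1)" by simp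
  also have "\<dots> \<le> (\<kappa> / x) ^ (2 * n + 1) / 1" using x \<open>0 < \<kappa>\<close> by (intro divide_left_mono) auto
  finally show "(-1) ^ n * arctan_rem \<kappa> n x \<le> (\<kappa> / x) ^ (2 * n + 1)" by simp
qed

text \<open>The primitive used is \<open>x\<^bsup>2n\<^esup> r(x) / (2n) + (-1)\<^bsup>n\<^esup> \<kappa>\<^bsup>2n\<^esup> arctan (x / \<kappa>) / (2n)\<close>, where \<open>r\<close> is the
  remainder.\<close>

lemma arctan_rem_moment:
  assumes k: "0 < \<kappa>" and n: "1 \<le> n"
  shows "set_integrable lborel {0<..} (\<lambda>x. arctan_rem \<kappa> n x * x ^ (2 * n - 1))"
    and "(LINT x:{0<..}|lborel. arctan_rem \<kappa> n x * x ^ (2 * n - 1)) = (-1) ^ n * pi * \<kappa> ^ (2 * n) / (4 * real n)"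
proof -
  let ?f = "\<lambda>x. (-1) ^ n * arctan_rem \<kappa> n x * x ^ (2 * n - 1)"
  define F where "F x = x ^ (2 * n) / real (2 * n) * ((-1) ^ n * arctan_rem \<kappa> n x) + \<kappa> ^ (2 * n) / real (2 * n) * arctan (x / \<kappa>)" for x
  have s: "(-1) ^ n * ((-1) ^ n * a) = (a::real)" for a
    by (simp add: mult.assoc[symmetric] power_add[symmetric] mult_2[symmetric])
  have Fd: "DERIV F x :> ?f x" if x: "0 < x" for x
  proof -
    have d: "((\<lambda>y. (-1) ^ n * arctan_rem \<kappa> n y) has_real_derivative - ((\<kappa> / x) ^ (2 * n) * \<kappa> / (x\<^sup>2 + \<kappa>\<^sup>2))) (at x)"
      by (rule DERIV_cong[OF DERIV_cmult[OF arctan_rem_deriv[OF x, of \<kappa> n], of "(-1) ^ n"]])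
         (simp add: s times_divide_eq_right[symmetric] mult.assoc del: times_divide_eq_right)
    have p: "((\<lambda>x. x ^ (2 * n) / real (2 * n)) has_real_derivative x ^ (2 * n - 1)) (at x)"
      using n by (auto intro!: derivative_eq_intros)
    have "((\<lambda>x. arctan (x / \<kappa>)) has_real_derivative (1 / \<kappa>) * inverse (1 + (x / \<kappa>)\<^sup>2)) (at x)"
      using k by (auto intro!: derivative_eq_intros)
    moreover have "(1 / \<kappa>) * inverse (1 + (x / \<kappa>)\<^sup>2) = \<kappa> / (x\<^sup>2 + \<kappa>\<^sup>2)"
    proof -
      have "1 + (x / \<kappa>)\<^sup>2 = (x\<^sup>2 + \<kappa>\<^sup>2) / \<kappa>\<^sup>2" using k by (simp add: field_simps)
      then show ?thesis using k by (simp add: power2_eq_square)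
    qed
    ultimately have a: "((\<lambda>x. \<kappa> ^ (2 * n) / real (2 * n) * arctan (x / \<kappa>)) has_real_derivative \<kappa> ^ (2 * n) / real (2 * n) * (\<kappa> / (x\<^sup>2 + \<kappa>\<^sup>2))) (at x)"
      by (intro DERIV_cmult) simp
    have e: "x ^ (2 * n) * (\<kappa> / x) ^ (2 * n) = \<kappa> ^ (2 * n)" using x by (simp add: power_divide)
    have e2: "x ^ (2 * n) / real (2 * n) * - ((\<kappa> / x) ^ (2 * n) * \<kappa> / (x\<^sup>2 + \<kappa>\<^sup>2)) = - (\<kappa> ^ (2 * n) / real (2 * n) * (\<kappa> / (x\<^sup>2 + \<kappa>\<^sup>2)))"
      unfolding e[symmetric] by simp
    show ?thesis
      unfolding F_def[abs_def]
      by (rule DERIV_cong[OF DERIV_add[OF DERIV_mult[OF p d] a]]) (subst mult.commute[of "- ((\<kappa> / x) ^ (2 * n) * \<kappa> / (x\<^sup>2 + \<kappa>\<^sup>2))"], simp only: e2, simp add: mult_ac)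
  qed
  have lim0: "(F \<longlongrightarrow> 0) (at_right 0)"
  proof -
    \<comment> \<open>Multiplied by x^(2n), the subtracted terms become powers of x with exponent 2
      n - (2 j + 1) > 0, so each vanishes at 0 although \<open>arctan_rem\<close> itself is singular
      there.\<close>
    have eq: "F x = x ^ (2 * n) / real (2 * n) * (-1) ^ n * arctan (\<kappa> / x) -
       (\<Sum>j<n. (-1) ^ n * (-1) ^ j * \<kappa> ^ (2 * j + 1) / (real (2 * n) * real (2 * j + 1)) * x ^ (2 * n - (2 * j + 1))) + \<kappa> ^ (2 * n) / real (2 * n) * arctan (x / \<kappa>)" if "0 < x" for x
    proof -
      have h0: "x ^ (2 * n) / real (2 * n) * ((-1) ^ n * ((-1) ^ j * (\<kappa> / x) ^ (2 * j + 1) / real (2 * j + 1)))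
         = (-1) ^ n * (-1) ^ j * \<kappa> ^ (2 * j + 1) / (real (2 * n) * real (2 * j + 1)) * x ^ (2 * n - (2 * j + 1))" if "j < n" for j
      proof -
        have "x ^ (2 * n) = x ^ (2 * n - (2 * j + 1)) * x ^ (2 * j + 1)"
          using that by (simp only: power_add[symmetric]) simp
        then have "x ^ (2 * n) * (\<kappa> / x) ^ (2 * j + 1) = \<kappa> ^ (2 * j + 1) * x ^ (2 * n - (2 * j + 1))"
          using \<open>0 < x\<close> by (simp add: power_divide)
        then have h: "x ^ (2 * n) * (\<kappa> / x) ^ (2 * j + 1) = \<kappa> ^ (2 * j + 1) * x ^ (2 * n - (2 * j + 1))" .
        have gen: "a / b * (s1 * (s2 * c / r)) = s1 * s2 * (a * c) / (b * r)" for a b c s1 s2 r :: real by simp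
        show ?thesis unfolding gen h by (simp only: times_divide_eq_left mult.assoc)
      qed
      have gen2: "c * (s * (a - sum S {..<n})) = c * s * a - (\<Sum>j<n. c * (s * S j))" for c s a :: real and S
        by (simp add: right_diff_distrib sum_distrib_left mult.assoc)
      have "(\<Sum>j<n. x ^ (2 * n) / real (2 * n) * ((-1) ^ n * ((-1) ^ j * (\<kappa> / x) ^ (2 * j + 1) / real (2 * j + 1))))
         = (\<Sum>j<n. (-1) ^ n * (-1) ^ j * \<kappa> ^ (2 * j + 1) / (real (2 * n) * real (2 * j + 1)) * x ^ (2 * n - (2 * j + 1)))"
        by (rule sum.cong[OF refl]) (simp only: h0 lessThan_iff)
      then show ?thesis unfolding F_def arctan_rem_def gen2 by (simp only:)
    qed
    have t1: "((\<lambda>x. x ^ (2 * n) / real (2 * n) * (-1) ^ n * arctan (\<kappa> / x)) \<longlongrightarrow> 0) (at_right 0)"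
    proof (rule Lim_null_comparison)
      show "\<forall>\<^sub>F x in at_right 0. norm (x ^ (2 * n) / real (2 * n) * (-1) ^ n * arctan (\<kappa> / x)) \<le> \<bar>x\<bar> ^ (2 * n) / real (2 * n) * (pi / 2)"
      proof (intro always_eventually allI)
        fix x
        have "\<bar>arctan (\<kappa> / x)\<bar> \<le> pi / 2" using arctan_lbound[of "\<kappa> / x"] arctan_ubound[of "\<kappa> / x"] by linarith
        then show "norm (x ^ (2 * n) / real (2 * n) * (-1) ^ n * arctan (\<kappa> / x)) \<le> \<bar>x\<bar> ^ (2 * n) / real (2 * n) * (pi / 2)"
          unfolding real_norm_def abs_mult abs_divide power_abs by (intro mult_mono) (auto simp: power_abs)
      qed
      have "((\<lambda>x::real. \<bar>x\<bar> ^ (2 * n) / real (2 * n) * (pi / 2)) \<longlongrightarrow> \<bar>0\<bar> ^ (2 * n) / real (2 * n) * (pi / 2)) (at_right 0)"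
        by (intro tendsto_intros) (use n in auto)
      then show "((\<lambda>x::real. \<bar>x\<bar> ^ (2 * n) / real (2 * n) * (pi / 2)) \<longlongrightarrow> 0) (at_right 0)" using n by (simp add: power_0_left)
    qed
    have t2: "((\<lambda>x. \<Sum>j<n. (-1) ^ n * (-1) ^ j * \<kappa> ^ (2 * j + 1) / (real (2 * n) * real (2 * j + 1)) * x ^ (2 * n - (2 * j + 1))) \<longlongrightarrow> 0) (at_right (0::real))"
    proof (rule tendsto_null_sum)
      fix j assume j: "j \<in> {..<n}"
      have "((\<lambda>x. (-1) ^ n * (-1) ^ j * \<kappa> ^ (2 * j + 1) / (real (2 * n) * real (2 * j + 1)) * x ^ (2 * n - (2 * j + 1))) \<longlongrightarrow> (-1) ^ n * (-1) ^ j * \<kappa> ^ (2 * j + 1) / (real (2 * n) * real (2 * j + 1)) * 0 ^ (2 * n - (2 * j + 1))) (at_right (0::real))"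
        by (intro tendsto_intros)
      then show "((\<lambda>x. (-1) ^ n * (-1) ^ j * \<kappa> ^ (2 * j + 1) / (real (2 * n) * real (2 * j + 1)) * x ^ (2 * n - (2 * j + 1))) \<longlongrightarrow> 0) (at_right (0::real))"
        using j by (simp add: power_0_left)
    qed
    have t3: "((\<lambda>x. \<kappa> ^ (2 * n) / real (2 * n) * arctan (x / \<kappa>)) \<longlongrightarrow> \<kappa> ^ (2 * n) / real (2 * n) * arctan (0 / \<kappa>)) (at_right 0)"
      by (intro tendsto_intros) (use k in auto)
    have "((\<lambda>x. x ^ (2 * n) / real (2 * n) * (-1) ^ n * arctan (\<kappa> / x) -
       (\<Sum>j<n. (-1) ^ n * (-1) ^ j * \<kappa> ^ (2 * j + 1) / (real (2 * n) * real (2 * j + 1)) * x ^ (2 * n - (2 * j + 1))) + \<kappa> ^ (2 * n) / real (2 * n) * arctan (x / \<kappa>)) \<longlongrightarrow> 0) (at_right 0)"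
      using tendsto_add[OF tendsto_diff[OF t1 t2] t3] by simp
    then show ?thesis
      by (rule Lim_transform_eventually) (use eq in \<open>auto simp: eventually_at_right_less eventually_at intro!: exI[of _ 1]\<close>)
  qed
  \<comment> \<open>By \<open>arctan_rem_bounds\<close> the first summand of F is of order 1 / x, so
    only the arctangent of x / \<kappa> remains and contributes pi / 2.\<close>
  have liminf: "(F \<longlongrightarrow> \<kappa> ^ (2 * n) / real (2 * n) * (pi / 2)) at_top"
  proof -
    have "((\<lambda>x. x ^ (2 * n) / real (2 * n) * ((-1) ^ n * arctan_rem \<kappa> n x)) \<longlongrightarrow> 0) at_top"
    proof (rule Lim_null_comparison)
      show "\<forall>\<^sub>F x in at_top. norm (x ^ (2 * n) / real (2 * n) * ((-1) ^ n * arctan_rem \<kappa> n x)) \<le> (\<kappa> ^ (2 * n + 1) / real (2 * n)) / x"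
        using eventually_gt_at_top[of 0]
      proof eventually_elim
        case (elim x)
        have "norm (x ^ (2 * n) / real (2 * n) * ((-1) ^ n * arctan_rem \<kappa> n x)) = x ^ (2 * n) / real (2 * n) * ((-1) ^ n * arctan_rem \<kappa> n x)"
          using arctan_rem_bounds(1)[OF k elim, of n] elim by simp
        also have "\<dots> \<le> x ^ (2 * n) / real (2 * n) * (\<kappa> / x) ^ (2 * n + 1)"
          using elim by (intro mult_left_mono arctan_rem_bounds k) auto
        also have "\<dots> = (\<kappa> ^ (2 * n + 1) / real (2 * n)) / x" using elim by (simp add: power_divide)
        finally show ?case .
      qed
      show "((\<lambda>x. (\<kappa> ^ (2 * n + 1) / real (2 * n)) / x) \<longlongrightarrow> 0) at_top"
        by (intro tendsto_divide_0[OF tendsto_const] filterlim_at_top_imp_at_infinity filterlim_ident)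
    qed
    moreover have "((\<lambda>x. arctan (x / \<kappa>)) \<longlongrightarrow> pi / 2) at_top"
    proof (rule filterlim_compose[OF tendsto_arctan_at_top])
      show "filterlim (\<lambda>x. x / \<kappa>) at_top at_top"
        using filterlim_tendsto_pos_mult_at_top[OF tendsto_const[of "1 / \<kappa>"] _ filterlim_ident] k by simp
    qed
    ultimately have "(F \<longlongrightarrow> 0 + \<kappa> ^ (2 * n) / real (2 * n) * (pi / 2)) at_top"
      unfolding F_def[abs_def] by (intro tendsto_add tendsto_mult tendsto_const)
    then show ?thesis by simp
  qed
  have f0: "0 \<le> ?f x" if "0 < x" for x
    using arctan_rem_bounds(1)[OF k that, of n] that by simp
  have fc: "isCont ?f x" if "0 < x" for x
    using DERIV_isCont[OF arctan_rem_deriv[OF that, of \<kappa> n]] by (intro continuous_intros)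
  have eint: "einterval 0 \<infinity> = {0<..}" by (simp add: einterval_def zero_ereal_def greaterThan_def)
  have a1: "((F \<circ> real_of_ereal) \<longlongrightarrow> 0) (at_right 0)"
    using lim0 by (simp add: ereal_tendsto_simps1 zero_ereal_def)
  have a2: "((F \<circ> real_of_ereal) \<longlongrightarrow> \<kappa> ^ (2 * n) / real (2 * n) * (pi / 2)) (at_left \<infinity>)"
    using liminf by (simp add: ereal_tendsto_simps1)
  note FTC = interval_integral_FTC_nonneg[of 0 \<infinity> F ?f, OF _ _ _ _ a1 a2]
  have i: "set_integrable lborel {0<..} ?f"
    using FTC(1) Fd fc f0 unfolding eint by auto
  have v: "(LINT x:{0<..}|lborel. ?f x) = \<kappa> ^ (2 * n) / real (2 * n) * (pi / 2)"
    using FTC(2) Fd fc f0 by (simp add: interval_lebesgue_integral_def eint)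
  have e: "(\<lambda>x. arctan_rem \<kappa> n x * x ^ (2 * n - 1)) = (\<lambda>x. (-1) ^ n * ?f x)"
    by (simp add: fun_eq_iff s mult.assoc)
  show "set_integrable lborel {0<..} (\<lambda>x. arctan_rem \<kappa> n x * x ^ (2 * n - 1))"
    unfolding e using i by (rule set_integrable_mult_right)
  have "(LINT x:{0<..}|lborel. arctan_rem \<kappa> n x * x ^ (2 * n - 1)) = (-1) ^ n * (LINT x:{0<..}|lborel. ?f x)"
    unfolding e by (rule set_integral_mult_right)
  then show "(LINT x:{0<..}|lborel. arctan_rem \<kappa> n x * x ^ (2 * n - 1)) = (-1) ^ n * pi * \<kappa> ^ (2 * n) / (4 * real n)"
    unfolding v by simp
qed

section \<open>Blaschke factors and branches of the logarithm\<close>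

lemma log_expansion_cong:
  assumes "log_expansion F l" "0 < R1" "\<And>z. 0 \<le> Im z \<Longrightarrow> R1 \<le> norm z \<Longrightarrow> F z = G z"
  shows "log_expansion G l"
  unfolding log_expansion_def
proof
  fix N
  obtain C R where F: "0 \<le> C" "0 < R" "\<And>z. 0 \<le> Im z \<Longrightarrow> R \<le> norm z \<Longrightarrow>
     norm (F z * exp (- (\<Sum>j=1..N. l j * inverse (2 * \<i> * z) ^ j)) - 1) \<le> C / norm z ^ Suc N"
    using assms(1) unfolding log_expansion_def by metis
  show "\<exists>C\<ge>0. \<exists>R>0. \<forall>z. 0 \<le> Im z \<longrightarrow> R \<le> norm z \<longrightarrow>
     norm (G z * exp (- (\<Sum>j=1..N. l j * inverse (2 * \<i> * z) ^ j)) - 1) \<le> C / norm z ^ Suc N"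
  proof (rule exI[of _ C], rule conjI[OF F(1)], rule exI[of _ "max R R1"], rule conjI)
    show "0 < max R R1" using F(2) by simp
    show "\<forall>z. 0 \<le> Im z \<longrightarrow> max R R1 \<le> norm z \<longrightarrow> norm (G z * exp (- (\<Sum>j=1..N. l j * inverse (2 * \<i> * z) ^ j)) - 1) \<le> C / norm z ^ Suc N"
    proof (intro allI impI)
      fix z :: complex assume z: "0 \<le> Im z" "max R R1 \<le> norm z"
      have "F z = G z" using assms(3)[of z] z by simp
      then show "norm (G z * exp (- (\<Sum>j=1..N. l j * inverse (2 * \<i> * z) ^ j)) - 1) \<le> C / norm z ^ Suc N"
        using F(3)[of z] z by simp
    qed
  qed
qed

lemma log_expansion_one: "log_expansion (\<lambda>z. 1) (\<lambda>n. 0)"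
  unfolding log_expansion_def
proof (intro allI, rule exI[of _ 0], rule conjI[OF order_refl], rule exI[of _ 1])
qed simp

lemma log_expansion_prod:
  "finite A \<Longrightarrow> (\<And>a. a \<in> A \<Longrightarrow> log_expansion (F a) (l a)) \<Longrightarrow>
   log_expansion (\<lambda>z. \<Prod>a\<in>A. F a z) (\<lambda>n. \<Sum>a\<in>A. l a n)"
proof (induction A rule: finite_induct)
  case empty then show ?case using log_expansion_one by simp
next
  case (insert a A)
  then show ?case using log_expansion_mult[of "F a" "l a" "\<lambda>z. \<Prod>a\<in>A. F a z" "\<lambda>n. \<Sum>a\<in>A. l a n"] by simp
qed

text \<open>With t = (2 i z)^(-1) the factor (z + i a) / (z - i a) equals (1 - 2 a t) / (1 + 2 a t),
  and these are the coefficients of its logarithm. They vanish for even n.\<close>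

definition blaschke_coeff :: "real \<Rightarrow> nat \<Rightarrow> real" where
  "blaschke_coeff a n = ((- 2 * a) ^ n - (2 * a) ^ n) / real n"

lemma log_expansion_blaschke:
  assumes "0 \<le> a"
  shows "log_expansion (\<lambda>z. (z + \<i> * of_real a) / (z - \<i> * of_real a)) (\<lambda>n. of_real (blaschke_coeff a n))"
proof -
  let ?F = "\<lambda>z. (1 + (- 2 * of_real a) * inverse (2 * \<i> * z)) * inverse (1 + (2 * of_real a) * inverse (2 * \<i> * z))"
  have "log_expansion ?F (\<lambda>n. - ((- (- 2 * of_real a)) ^ n) / of_nat n + - (- ((- (2 * of_real a)) ^ n) / of_nat n))"
    by (rule log_expansion_mult[OF log_expansion_linear log_expansion_inverse[OF log_expansion_linear]])
  moreover have "(\<lambda>n. - ((- (- 2 * of_real a)) ^ n) / of_nat n + - (- ((- (2 * of_real a)) ^ n) / of_nat n)) = (\<lambda>n. complex_of_real (blaschke_coeff a n))"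
    by (auto simp: blaschke_coeff_def fun_eq_iff diff_divide_distrib)
  ultimately have "log_expansion ?F (\<lambda>n. of_real (blaschke_coeff a n))" by simp
  then show ?thesis
  proof (rule log_expansion_cong)
    show "0 < a + 1" using assms by simp
    fix z :: complex assume z: "0 \<le> Im z" "a + 1 \<le> norm z"
    then have z0: "z \<noteq> 0" using assms by auto
    have za: "z - \<i> * of_real a \<noteq> 0"
    proof
      assume "z - \<i> * of_real a = 0"
      then have "norm z = a" using assms by (simp add: norm_mult)
      then show False using z by simp
    qed
    have 1: "1 + (- 2 * of_real a) * inverse (2 * \<i> * z) = (z + \<i> * of_real a) / z"
      using z0 by (simp add: field_simps)
    have 2: "1 + (2 * of_real a) * inverse (2 * \<i> * z) = (z - \<i> * of_real a) / z"
      using z0 by (simp add: field_simps)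
    show "?F z = (z + \<i> * of_real a) / (z - \<i> * of_real a)"
      unfolding 1 2 using z0 za by simp
  qed
qed

text \<open>Keeps F in a small disc around 1, where the principal logarithm is continuous and
  small.\<close>

lemma log_expansion_tendsto:
  assumes "log_expansion F l"
  obtains R where "0 < R" "\<And>z. 0 \<le> Im z \<Longrightarrow> R \<le> norm z \<Longrightarrow> norm (F z - 1) < 1/4"
proof -
  obtain C R where F: "0 \<le> C" "0 < R" "\<And>z. 0 \<le> Im z \<Longrightarrow> R \<le> norm z \<Longrightarrow>
     norm (F z * exp (- (\<Sum>j=1..0. l j * inverse (2 * \<i> * z) ^ j)) - 1) \<le> C / norm z ^ Suc 0"
    using assms unfolding log_expansion_def by metis
  have "norm (F z - 1) < 1/4" if "0 \<le> Im z" "max R (4 * C + 1) \<le> norm z" for z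
  proof -
    have "norm (F z - 1) \<le> C / norm z" using F(3)[of z] that by simp
    also have "\<dots> < 1/4"
    proof -
      have "0 < norm z" using that F(1) by linarith
      then show ?thesis using that F(1) by (simp add: divide_less_eq)
    qed
    finally show ?thesis .
  qed
  then show ?thesis using that[of "max R (4 * C + 1)"] F by auto
qed

text \<open>The principal branch is the right one: the difference D of \<open>Ln (F z)\<close> and
  the polynomial q has norm at most 1 < pi, hence \<open>Ln (exp D) = D\<close>. Since exp D = F exp
  (- q) is close to 1, the bound on exp D - 1 carries over to D.\<close>

lemma log_expansion_Ln:
  assumes "log_expansion F l"
  shows "\<exists>C R. 0 < R \<and> (\<forall>z. 0 \<le> Im z \<longrightarrow> R \<le> norm z \<longrightarrow>
     norm (Ln (F z) - (\<Sum>j=1..N. l j * inverse (2 * \<i> * z) ^ j)) \<le> C / norm z ^ Suc N)"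
proof -
  obtain C R where F: "0 \<le> C" "0 < R" "\<And>z. 0 \<le> Im z \<Longrightarrow> R \<le> norm z \<Longrightarrow>
     norm (F z * exp (- (\<Sum>j=1..N. l j * inverse (2 * \<i> * z) ^ j)) - 1) \<le> C / norm z ^ Suc N"
    using assms unfolding log_expansion_def by metis
  obtain R1 where R1: "0 < R1" "\<And>z. 0 \<le> Im z \<Longrightarrow> R1 \<le> norm z \<Longrightarrow> norm (F z - 1) < 1/4"
    by (rule log_expansion_tendsto[OF assms]) blast
  define K where "K = (\<Sum>j=1..N. norm (l j))"
  have K: "0 \<le> K" unfolding K_def by (rule sum_nonneg) simp
  \<comment> \<open>2 K \<le> |z| makes q at most 1/2, and 2 C < |z| keeps exp D - 1 below 1/2, as
    \<open>norm_Ln_le\<close> requires.\<close>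
  define S where "S = max (max R R1) (4 * C + 2 * K + 1)"
  have "norm (Ln (F z) - (\<Sum>j=1..N. l j * inverse (2 * \<i> * z) ^ j)) \<le> (2 * C) / norm z ^ Suc N"
    if z: "0 \<le> Im z" "S \<le> norm z" for z
  proof -
    have zb: "R \<le> norm z" "R1 \<le> norm z" "4 * C + 2 * K + 1 \<le> norm z" using z by (auto simp: S_def)
    have z1: "1 \<le> norm z" using zb F(1) K by linarith
    define t where "t = inverse (2 * \<i> * z)"
    define q where "q = (\<Sum>j=1..N. l j * t ^ j)"
    have n2: "norm (2 * \<i> * z) = 2 * norm z" by (simp add: norm_mult)
    have nt: "norm t = inverse (2 * norm z)" unfolding t_def norm_inverse n2 by simp
    have nt1: "norm t \<le> inverse (norm z)" unfolding nt using z1 by (intro le_imp_inverse_le) auto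
    have nt2: "inverse (norm z) \<le> 1" using z1 le_imp_inverse_le[of 1 "norm z"] by simp
    have qb: "norm q \<le> K * inverse (norm z)"
    proof -
      have "norm q \<le> (\<Sum>j=1..N. norm (l j) * inverse (norm z))"
        unfolding q_def
      proof (rule sum_norm_le)
        fix j assume "j \<in> {1..N}"
        then have "norm t ^ j \<le> norm t ^ 1" using nt1 nt2 by (intro power_decreasing) auto
        then show "norm (l j * t ^ j) \<le> norm (l j) * inverse (norm z)"
          unfolding norm_mult norm_power using nt1 by (intro mult_left_mono) auto
      qed
      then show ?thesis by (simp add: K_def sum_distrib_right)
    qed
    also have "\<dots> \<le> 1/2"
    proof -
      have "2 * K \<le> norm z" using zb F(1) by linarith
      then show ?thesis using z1 by (simp add: inverse_eq_divide divide_le_eq)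
    qed
    finally have q1: "norm q \<le> 1/2" .
    have F1: "norm (F z - 1) < 1/4" using R1(2) z(1) zb by blast
    have F0: "F z \<noteq> 0" using F1 by auto
    have L: "norm (Ln (F z)) \<le> 1/2" using norm_Ln_le[of "F z - 1"] F1 by simp
    define D where "D = Ln (F z) - q"
    have D1: "norm D \<le> 1" unfolding D_def using norm_triangle_ineq4[of "Ln (F z)" q] L q1 by linarith
    have eD: "exp D = F z * exp (- q)" unfolding D_def by (simp add: exp_diff exp_minus F0 divide_inverse)
    have "\<bar>Im D\<bar> \<le> 1" using abs_Im_le_cmod[of D] D1 by linarith
    then have LD: "Ln (exp D) = D" using pi_gt3 by (intro Ln_exp) auto
    have E: "norm (exp D - 1) \<le> C / norm z ^ Suc N" unfolding eD q_def t_def using F(3) z(1) zb by blast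
    have "C / norm z ^ Suc N \<le> C / norm z ^ 1"
    proof -
      have "0 < norm z" using z1 by linarith
      then show ?thesis using z1 F(1)
        by (intro divide_left_mono power_increasing mult_pos_pos zero_less_power) auto
    qed
    also have "\<dots> < 1/2"
    proof -
      have "2 * C < norm z" "0 < norm z" using zb F(1) K z1 by linarith+
      then show ?thesis by (simp add: divide_less_eq)
    qed
    finally have "norm (exp D - 1) < 1/2" using E by linarith
    from norm_Ln_le[OF this] have "norm D \<le> 2 * norm (exp D - 1)" using LD by simp
    also have "\<dots> \<le> 2 * (C / norm z ^ Suc N)" using E by simp
    finally show ?thesis by (simp add: D_def q_def t_def)
  qed
  then show ?thesis using F(2) by - (rule exI[of _ "2 * C"], rule exI[of _ S], auto simp: S_def)
qed

text \<open>The solutions of exp = 1 keep distance at least 1 from each other, so a continuous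
  function with values among them is constant on a connected set. Applied throughout to the
  difference of two continuous logarithms of the same function.\<close>

lemma exp_eq_1_const:
  fixes D :: "'a::topological_space \<Rightarrow> complex"
  assumes "connected A" "continuous_on A D" "\<And>x. x \<in> A \<Longrightarrow> exp (D x) = 1"
  obtains c where "exp c = 1" "\<And>x. x \<in> A \<Longrightarrow> D x = c"
proof (cases "A = {}")
  case True then show ?thesis using that[of 0] by simp
next
  case False
  have "D constant_on A"
  proof (rule continuous_discrete_range_constant[OF assms(1,2)])
    fix x assume x: "x \<in> A"
    have "1 \<le> norm (D y - D x)" if "y \<in> A" "D y \<noteq> D x" for y
    proof (rule ccontr)
      assume "\<not> 1 \<le> norm (D y - D x)"
      then have n: "norm (D y - D x) < 1" by simp
      have "exp (D y - D x) = 1" using assms(3) x that by (simp add: exp_diff)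
      moreover have "\<bar>Im (D y - D x)\<bar> < 1" using abs_Im_le_cmod[of "D y - D x"] n by linarith
      ultimately have "D y - D x = 0" using Ln_exp[of "D y - D x"] pi_gt3 by (simp add: abs_less_iff)
      then show False using that by simp
    qed
    then show "\<exists>e>0. \<forall>y. y \<in> A \<and> D y \<noteq> D x \<longrightarrow> e \<le> norm (D y - D x)" by (intro exI[of _ 1]) auto
  qed
  then obtain c where "\<And>x. x \<in> A \<Longrightarrow> D x = c" by (auto simp: constant_on_def)
  then show ?thesis using that[of c] False assms(3) by auto
qed

text \<open>Points are divided out one at a time: the product over the remaining ones does not
  vanish at a, so the quotient found so far still vanishes there, and its difference quotient at a
  is holomorphic.\<close>

lemma factor_finite_zeros:
  fixes f :: "complex \<Rightarrow> complex"
  assumes "finite A" "f holomorphic_on U" "open U" "\<And>a. a \<in> A \<Longrightarrow> a \<in> U \<and> f a = 0"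
  shows "\<exists>h. h holomorphic_on U \<and> (\<forall>z\<in>U. f z = h z * (\<Prod>a\<in>A. z - a))"
  using assms(1,4)
proof (induction A rule: finite_induct)
  case empty then show ?case using assms(2) by auto
next
  case (insert a A)
  then obtain h where h: "h holomorphic_on U" "\<And>z. z \<in> U \<Longrightarrow> f z = h z * (\<Prod>a\<in>A. z - a)" by auto
  have a: "a \<in> U" "f a = 0" using insert.prems by auto
  have "(\<Prod>b\<in>A. a - b) \<noteq> 0" using insert.hyps by auto
  then have ha: "h a = 0" using h(2)[OF a(1)] a(2) by simp
  have "(\<lambda>z. if z = a then deriv h a else (h z - h a) / (z - a)) holomorphic_on U"
    by (rule pole_lemma_open[OF h(1) assms(3)])
  moreover have "f z = (if z = a then deriv h a else (h z - h a) / (z - a)) * (\<Prod>b\<in>insert a A. z - b)" if "z \<in> U" for z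
    using h(2)[OF that] insert.hyps ha a(2) by auto
  ultimately show ?case by blast
qed

section \<open>Expansion of the Jost function\<close>

context smooth_potential
begin

text \<open>The explicit sum defining d_n solves a first-order recursion for d_n - b_n(0). The sum
  may start at m = 1 because b_0 is constant.\<close>

lemma d_coeff_rec:
  fixes \<gamma> :: real and n :: nat
  defines "e \<equiv> \<lambda>n. d_coeff V \<gamma> n - b_coeff V n 0"
  shows "e 0 = 0" "e (Suc n) = 2 * \<gamma> * e n + 2 * half_deriv (b_coeff V n) 0"
proof -
  show "e 0 = 0" by (simp add: e_def d_coeff_def)
  show "e (Suc n) = 2 * \<gamma> * e n + 2 * half_deriv (b_coeff V n) 0"
  proof (cases n)
    case 0
    then show ?thesis using half_deriv_b0[of 0] by (simp add: e_def d_coeff_def del: b_coeff.simps(2))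
  next
    case (Suc k)
    have "(\<Sum>m=1..n. half_deriv (b_coeff V m) 0 * (2 * \<gamma>) ^ (Suc n - m - 1))
       = (\<Sum>m=1..k. half_deriv (b_coeff V m) 0 * (2 * \<gamma>) ^ (Suc n - m - 1)) + half_deriv (b_coeff V n) 0"
      unfolding Suc by (simp del: b_coeff.simps)
    also have "(\<Sum>m=1..k. half_deriv (b_coeff V m) 0 * (2 * \<gamma>) ^ (Suc n - m - 1)) = 2 * \<gamma> * (\<Sum>m=1..k. half_deriv (b_coeff V m) 0 * (2 * \<gamma>) ^ (n - m - 1))"
      unfolding sum_distrib_left
    proof (rule sum.cong[OF refl])
      fix m assume m: "m \<in> {1..k}"
      have "Suc n - m - 1 = Suc (n - m - 1)" using m Suc by auto
      then show "half_deriv (b_coeff V m) 0 * (2 * \<gamma>) ^ (Suc n - m - 1) = 2 * \<gamma> * (half_deriv (b_coeff V m) 0 * (2 * \<gamma>) ^ (n - m - 1))"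
        by (simp del: b_coeff.simps)
    qed
    finally show ?thesis using Suc by (simp add: e_def d_coeff_def del: b_coeff.simps)
  qed
qed

text \<open>In t = (2 i z)^(-1), the quotient w / (\<gamma> - i z) is b + 2 t b' / (1 - 2 \<gamma>
  t) at x = 0. Here the second summand is expanded: the truncated series with coefficients d_n -
  b_n(0), multiplied by the denominator, reproduces 2 t b' up to one term of order N + 1.\<close>

lemma jost_expansion_sum:
  fixes \<gamma> :: real and t :: complex
  defines "e \<equiv> \<lambda>n. d_coeff V \<gamma> n - b_coeff V n 0"
  shows "(1 - 2 * of_real \<gamma> * t) * (\<Sum>n\<le>N. of_real (e n) * t ^ n) =
     2 * t * (\<Sum>n\<le>N. of_real (half_deriv (b_coeff V n) 0) * t ^ n) - of_real (e (Suc N)) * t ^ Suc N"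
proof -
  have e0: "e 0 = 0" and es: "e (Suc n) = 2 * \<gamma> * e n + 2 * half_deriv (b_coeff V n) 0" for n
    unfolding e_def by (rule d_coeff_rec)+
  show ?thesis
  proof (induction N)
    case 0
    then show ?case using es[of 0] e0 by (simp del: b_coeff.simps)
  next
    case (Suc N)
    have "(1 - 2 * of_real \<gamma> * t) * (\<Sum>n\<le>Suc N. of_real (e n) * t ^ n)
      = (1 - 2 * of_real \<gamma> * t) * (\<Sum>n\<le>N. of_real (e n) * t ^ n) + (1 - 2 * of_real \<gamma> * t) * (of_real (e (Suc N)) * t ^ Suc N)"
      by (simp add: distrib_left)
    also have "\<dots> = 2 * t * (\<Sum>n\<le>N. of_real (half_deriv (b_coeff V n) 0) * t ^ n) - 2 * of_real \<gamma> * of_real (e (Suc N)) * t ^ Suc (Suc N)"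
      unfolding Suc.IH by (simp add: algebra_simps)
    also have "2 * complex_of_real \<gamma> * of_real (e (Suc N)) = of_real (e (Suc (Suc N))) - 2 * of_real (half_deriv (b_coeff V (Suc N)) 0)"
      unfolding es[of "Suc N"] by simp
    finally show ?case by (simp add: algebra_simps del: b_coeff.simps)
  qed
qed

lemma jw_log_expansion:
  "log_expansion (\<lambda>z. jw \<gamma> z / (of_real \<gamma> - \<i> * z)) (\<lambda>n. of_real (l_coeff V \<gamma> n))"
proof (rule log_expansionI[where d = "\<lambda>n. of_real (d_coeff V \<gamma> n)"])
  show "complex_of_real (d_coeff V \<gamma> 0) = 1" by (simp add: d_coeff_def)
  fix n :: nat assume n: "1 \<le> n"
  \<comment> \<open>The definition of l_n solved for n d_n; the term j = n of the sum comes from d_0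
    = 1.\<close>
  have "real n * d_coeff V \<gamma> n = (\<Sum>j=1..n. real j * l_coeff V \<gamma> j * d_coeff V \<gamma> (n - j))"
  proof -
    have i: "{1..n} = insert n {1..<n}" using n by auto
    have "real n * l_coeff V \<gamma> n = real n * d_coeff V \<gamma> n - (\<Sum>j\<in>{1..<n}. real j * d_coeff V \<gamma> (n - j) * l_coeff V \<gamma> j)"
      using n by (subst l_coeff.simps) (simp add: right_diff_distrib)
    then show ?thesis unfolding i by (simp add: d_coeff_def[of _ _ 0] mult_ac)
  qed
  from arg_cong[OF this, of complex_of_real]
  show "of_nat n * complex_of_real (d_coeff V \<gamma> n) = (\<Sum>j=1..n. of_nat j * complex_of_real (l_coeff V \<gamma> j) * complex_of_real (d_coeff V \<gamma> (n - j)))"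
    by simp
next
  fix N
  obtain C R where R: "0 < R" and C: "\<And>z. 0 \<le> Im z \<Longrightarrow> R \<le> norm z \<Longrightarrow>
     norm (jb 0 z - jpart N 0 z) \<le> C / norm z ^ Suc N \<and> norm (jbp 0 z - jpart' N 0 z) \<le> C / norm z ^ N"
    using jost_remainder[of N] by blast
  define e where "e = (\<lambda>n. d_coeff V \<gamma> n - b_coeff V n 0)"
  \<comment> \<open>The outer factor 2 bounds 1 / |u| for u = 1 - 2 \<gamma> t; the threshold S
    below makes |2 \<gamma> t| \<le> 1/2.\<close>
  define A where "A = C + 2 * (2 * C + \<bar>e (Suc N)\<bar>)"
  define S where "S = max R (2 * \<bar>\<gamma>\<bar> + 1)"
  have "norm (jw \<gamma> z / (of_real \<gamma> - \<i> * z) - (\<Sum>n\<le>N. of_real (d_coeff V \<gamma> n) * inverse (2 * \<i> * z) ^ n)) \<le> A / norm z ^ Suc N"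
    if z: "0 \<le> Im z" "S \<le> norm z" for z
  proof -
    have zb: "R \<le> norm z" "2 * \<bar>\<gamma>\<bar> + 1 \<le> norm z" using z by (auto simp: S_def)
    then have z1: "1 \<le> norm z" by linarith
    then have z0: "z \<noteq> 0" by auto
    define t where "t = inverse (2 * \<i> * z)"
    have n2: "norm (2 * \<i> * z) = 2 * norm z" by (simp add: norm_mult)
    have nt: "norm t = inverse (2 * norm z)" unfolding t_def norm_inverse n2 by simp
    have nt1: "norm t \<le> inverse (norm z)" unfolding nt using z1 by (intro le_imp_inverse_le) auto
    have t0: "t \<noteq> 0" unfolding t_def using z0 by simp
    have tz: "2 * \<i> * z * t = 1" unfolding t_def by (rule right_inverse) (use z0 in simp)
    define u where "u = 1 - 2 * of_real \<gamma> * t"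
    have nu: "1/2 \<le> norm u"
    proof -
      have "norm (2 * of_real \<gamma> * t) = 2 * \<bar>\<gamma>\<bar> * inverse (2 * norm z)" unfolding norm_mult nt by simp
      also have "\<dots> = \<bar>\<gamma>\<bar> / norm z"
      proof -
        have "2 * g * inverse (2 * n) = g / n" for g n :: real by (cases "n = 0") (auto simp: field_simps)
        then show ?thesis .
      qed
      also have "\<dots> \<le> 1/2"
      proof -
        have "0 < norm z" "2 * \<bar>\<gamma>\<bar> \<le> norm z" using zb z1 by linarith+
        then show ?thesis by (simp add: divide_le_eq)
      qed
      finally show ?thesis using norm_triangle_ineq2[of 1 "2 * of_real \<gamma> * t"] unfolding u_def by simp
    qed
    then have u0: "u \<noteq> 0" by auto
    have gu: "(of_real \<gamma> - \<i> * z) * (2 * t) = - u"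
    proof -
      have "(of_real \<gamma> - \<i> * z) * (2 * t) = 2 * of_real \<gamma> * t - 2 * \<i> * z * t" by (simp add: algebra_simps)
      then show ?thesis unfolding tz u_def by simp
    qed
    then have gz: "of_real \<gamma> - \<i> * z \<noteq> 0" using u0 by auto
    have gi: "inverse (of_real \<gamma> - \<i> * z) = - (2 * t) / u"
      using gu gz u0 by (simp add: field_simps)
    define r where "r = jb 0 z - jpart N 0 z"
    define r' where "r' = jbp 0 z - jpart' N 0 z"
    have rb: "norm r \<le> C / norm z ^ Suc N" "norm r' \<le> C / norm z ^ N" using C[of z] z(1) zb by (auto simp: r_def r'_def)
    define E where "E = (\<Sum>n\<le>N. of_real (e n) * t ^ n)"
    have uE: "u * E = 2 * t * jpart' N 0 z - of_real (e (Suc N)) * t ^ Suc N"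
      using jost_expansion_sum[of \<gamma> t N] unfolding u_def E_def e_def jpart'_def ipow_def t_def by simp
    have ds: "(\<Sum>n\<le>N. of_real (d_coeff V \<gamma> n) * t ^ n) = jpart N 0 z + E"
      unfolding E_def jpart_def ipow_def t_def[symmetric] e_def by (simp add: sum.distrib[symmetric] algebra_simps)
    have "jw \<gamma> z / (of_real \<gamma> - \<i> * z) = jb 0 z - jbp 0 z * inverse (of_real \<gamma> - \<i> * z)"
      using gz by (simp add: jw_def jtheta_0 jthetap_0 field_simps)
    also have "\<dots> = jb 0 z + 2 * t * jbp 0 z / u" unfolding gi by (simp add: mult_ac)
    finally have "jw \<gamma> z / (of_real \<gamma> - \<i> * z) - (\<Sum>n\<le>N. of_real (d_coeff V \<gamma> n) * t ^ n) = r + (2 * t * jbp 0 z / u - E)"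
      unfolding ds r_def by simp
    also have "2 * t * jbp 0 z / u - E = (2 * t * r' + of_real (e (Suc N)) * t ^ Suc N) / u"
    proof -
      have "2 * t * jbp 0 z - u * E = 2 * t * r' + of_real (e (Suc N)) * t ^ Suc N"
        unfolding uE r'_def by (simp add: algebra_simps)
      moreover have "2 * t * jbp 0 z / u - E = (2 * t * jbp 0 z - u * E) / u" using u0 by (simp add: field_simps)
      ultimately show ?thesis by simp
    qed
    finally have eq: "jw \<gamma> z / (of_real \<gamma> - \<i> * z) - (\<Sum>n\<le>N. of_real (d_coeff V \<gamma> n) * t ^ n) = r + (2 * t * r' + of_real (e (Suc N)) * t ^ Suc N) / u" .
    have i1: "inverse (norm z) * (C / norm z ^ N) = C / norm z ^ Suc N" by (simp add: divide_inverse mult_ac)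
    have b1: "norm (2 * t * r' + of_real (e (Suc N)) * t ^ Suc N) \<le> (2 * C + \<bar>e (Suc N)\<bar>) / norm z ^ Suc N"
    proof -
      have "norm (2 * t * r') \<le> 2 * (inverse (norm z) * (C / norm z ^ N))"
      proof -
        have "norm (2 * t * r') = 2 * (norm t * norm r')" by (simp add: norm_mult)
        also have "\<dots> \<le> 2 * (inverse (norm z) * (C / norm z ^ N))"
          using nt1 rb(2) by (intro mult_left_mono mult_mono) auto
        finally show ?thesis .
      qed
      moreover have "norm (of_real (e (Suc N)) * t ^ Suc N) \<le> \<bar>e (Suc N)\<bar> * (1 / norm z ^ Suc N)"
      proof -
        have "norm (of_real (e (Suc N)) * t ^ Suc N) \<le> \<bar>e (Suc N)\<bar> * inverse (norm z) ^ Suc N"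
          unfolding norm_mult norm_power norm_of_real using nt1 by (intro mult_left_mono power_mono) auto
        also have "inverse (norm z) ^ Suc N = 1 / norm z ^ Suc N" unfolding power_inverse by (rule inverse_eq_divide)
        finally show ?thesis .
      qed
      ultimately have "norm (2 * t * r') + norm (of_real (e (Suc N)) * t ^ Suc N) \<le> 2 * (C / norm z ^ Suc N) + \<bar>e (Suc N)\<bar> * (1 / norm z ^ Suc N)"
        unfolding i1 by (rule add_mono)
      then show ?thesis using norm_triangle_ineq[of "2 * t * r'" "of_real (e (Suc N)) * t ^ Suc N"]
        by (simp only: add_divide_distrib mult_1_right times_divide_eq_right)
    qed
    have "norm ((2 * t * r' + of_real (e (Suc N)) * t ^ Suc N) / u) \<le> ((2 * C + \<bar>e (Suc N)\<bar>) / norm z ^ Suc N) / (1/2)"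
      unfolding norm_divide using b1 nu order_trans[OF norm_ge_zero b1] by (intro frac_le) auto
    then have "norm (r + (2 * t * r' + of_real (e (Suc N)) * t ^ Suc N) / u) \<le> C / norm z ^ Suc N + ((2 * C + \<bar>e (Suc N)\<bar>) / norm z ^ Suc N) / (1/2)"
      by (rule order_trans[OF norm_triangle_ineq add_mono[OF rb(1)]])
    also have "\<dots> = A / norm z ^ Suc N" 
    proof -
      have "a / d + (b / d) / (1/2) = (a + 2 * b) / d" for a b d :: real by (simp add: add_divide_distrib)
      then show ?thesis unfolding A_def .
    qed
    finally show ?thesis unfolding t_def[symmetric] eq .
  qed
  then show "\<exists>C R. 0 < R \<and> (\<forall>z. 0 \<le> Im z \<and> R \<le> norm z \<longrightarrow>
       norm (jw \<gamma> z / (of_real \<gamma> - \<i> * z) - (\<Sum>n\<le>N. of_real (d_coeff V \<gamma> n) * inverse (2 * \<i> * z) ^ n)) \<le> C / norm z ^ Suc N)"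
    using R by - (rule exI[of _ A], rule exI[of _ S], auto simp: S_def)
qed

end

section \<open>The outer factor and its logarithm\<close>

text \<open>In the right half-plane the principal logarithm is continuous with imaginary part at
  most pi in modulus. G differs from the corresponding combination of principal logarithms by a
  constant, so its imaginary part is bounded however small or large the moduli of the factors
  become.\<close>

lemma Im_log_bounded:
  fixes G f1 f2 f3 f4 :: "complex \<Rightarrow> complex"
  assumes Q: "connected Q" and G: "continuous_on Q G"
    and c: "continuous_on Q f1" "continuous_on Q f2" "continuous_on Q f3" "continuous_on Q f4"
    and pos: "\<And>z. z \<in> Q \<Longrightarrow> 0 < Re (f1 z) \<and> 0 < Re (f2 z) \<and> 0 < Re (f3 z) \<and> 0 < Re (f4 z)"
    and "k \<noteq> 0" and eq: "\<And>z. z \<in> Q \<Longrightarrow> exp (G z) = k * f1 z * f2 z / (f3 z * f4 z)"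
  obtains M where "\<And>z. z \<in> Q \<Longrightarrow> \<bar>Im (G z)\<bar> \<le> M"
proof -
  define D where "D z = G z - (Ln k + Ln (f1 z) + Ln (f2 z) - Ln (f3 z) - Ln (f4 z))" for z
  have Lc: "continuous_on Q (\<lambda>z. Ln (f z))" if "continuous_on Q f" "\<And>z. z \<in> Q \<Longrightarrow> 0 < Re (f z)" for f
  proof (rule continuous_on_Ln'[OF that(1)])
    fix z assume "z \<in> Q"
    then show "f z \<notin> \<real>\<^sub>\<le>\<^sub>0" using that(2)[of z] by (auto simp: complex_nonpos_Reals_iff)
  qed
  have "continuous_on Q D" unfolding D_def using pos by (intro continuous_intros G Lc c) auto
  moreover have "exp (D z) = 1" if "z \<in> Q" for z
  proof -
    have nz: "f1 z \<noteq> 0" "f2 z \<noteq> 0" "f3 z \<noteq> 0" "f4 z \<noteq> 0" using pos[OF that] by auto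
    then show ?thesis using \<open>k \<noteq> 0\<close> unfolding D_def exp_diff exp_add eq[OF that] by simp
  qed
  ultimately obtain d where d: "\<And>z. z \<in> Q \<Longrightarrow> D z = d" using exp_eq_1_const[OF Q] by metis
  have "\<bar>Im (G z)\<bar> \<le> \<bar>Im d\<bar> + \<bar>Im (Ln k)\<bar> + 4 * pi" if "z \<in> Q" for z
  proof -
    have nz: "f1 z \<noteq> 0" "f2 z \<noteq> 0" "f3 z \<noteq> 0" "f4 z \<noteq> 0" using pos[OF that] by auto
    have L: "\<bar>Im (Ln w)\<bar> \<le> pi" if "w \<noteq> 0" for w
      using mpi_less_Im_Ln[OF that] Im_Ln_le_pi[OF that] by (simp add: abs_le_iff)
    have "Im (G z) = Im d + Im (Ln k) + Im (Ln (f1 z)) + Im (Ln (f2 z)) - Im (Ln (f3 z)) - Im (Ln (f4 z))"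
      using arg_cong[OF d[OF that], of Im] unfolding D_def by simp
    then show ?thesis using L[OF nz(1)] L[OF nz(2)] L[OF nz(3)] L[OF nz(4)] by linarith
  qed
  then show ?thesis by (rule that)
qed

text \<open>The reciprocal of the usual Blaschke factor: multiplication by it removes a zero at i a,
  for a > 0, without changing moduli on the real line.\<close>

definition blaschke :: "real \<Rightarrow> complex \<Rightarrow> complex" where
  "blaschke a z = (z + \<i> * of_real a) / (z - \<i> * of_real a)"

context smooth_potential
begin

lemma jw_zero_imag:
  assumes "z \<in> upper_open" "jw \<gamma> z = 0"
  shows "z = \<i> * of_real (Im z)" "Im z \<in> jzeros \<gamma>"
proof -
  have "Re z = 0" using jw_nonzero[of z \<gamma>] assms by auto
  then show e: "z = \<i> * of_real (Im z)" by (simp add: complex_eq_iff)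
  have "jw \<gamma> (\<i> * of_real (Im z)) = 0" using assms(2) e by simp
  then show "Im z \<in> jzeros \<gamma>" using assms(1) by (simp add: jzeros_def)
qed

lemma jzeros_pos: "\<kappa> \<in> jzeros \<gamma> \<Longrightarrow> 0 < \<kappa>" by (simp add: jzeros_def)

text \<open>Dividing out the zeros beforehand gives the outer factor a formula that is holomorphic
  at the zeros themselves, where the Blaschke factors have poles.\<close>

definition jost_quot :: "real \<Rightarrow> complex \<Rightarrow> complex" where
  "jost_quot \<gamma> = (SOME h. h holomorphic_on upper_open \<and> (\<forall>z\<in>upper_open. jw \<gamma> z = h z * (\<Prod>\<kappa>\<in>jzeros \<gamma>. z - \<i> * of_real \<kappa>)))"

lemma jost_quot: "jost_quot \<gamma> holomorphic_on upper_open"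
  "\<And>z. z \<in> upper_open \<Longrightarrow> jw \<gamma> z = jost_quot \<gamma> z * (\<Prod>\<kappa>\<in>jzeros \<gamma>. z - \<i> * of_real \<kappa>)"
proof -
  let ?A = "(\<lambda>\<kappa>. \<i> * complex_of_real \<kappa>) ` jzeros \<gamma>"
  have "\<exists>h. h holomorphic_on upper_open \<and> (\<forall>z\<in>upper_open. jw \<gamma> z = h z * (\<Prod>a\<in>?A. z - a))"
    by (rule factor_finite_zeros) (use finite_jzeros jw_holo open_upper_open in \<open>auto simp: jzeros_def\<close>)
  moreover have "(\<Prod>a\<in>?A. z - a) = (\<Prod>\<kappa>\<in>jzeros \<gamma>. z - \<i> * of_real \<kappa>)" for z
    by (subst prod.reindex) (auto simp: inj_on_def)
  ultimately have "\<exists>h. h holomorphic_on upper_open \<and> (\<forall>z\<in>upper_open. jw \<gamma> z = h z * (\<Prod>\<kappa>\<in>jzeros \<gamma>. z - \<i> * of_real \<kappa>))"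
    by simp
  from someI_ex[OF this] show "jost_quot \<gamma> holomorphic_on upper_open"
    "\<And>z. z \<in> upper_open \<Longrightarrow> jw \<gamma> z = jost_quot \<gamma> z * (\<Prod>\<kappa>\<in>jzeros \<gamma>. z - \<i> * of_real \<kappa>)"
    by (auto simp: jost_quot_def)
qed

text \<open>The zeros of \<open>jw\<close> are simple because \<open>jw_lower\<close> bounds \<open>|jw|\<close> at \<open>i \<kappa> + \<delta>\<close> below by a multiple
  of \<open>\<delta>\<close>.\<close>

lemma jost_quot_nonzero:
  assumes z: "z \<in> upper_open" shows "jost_quot \<gamma> z \<noteq> 0"
proof
  assume h0: "jost_quot \<gamma> z = 0"
  then have "jw \<gamma> z = 0" using jost_quot(2)[OF z] by simp
  note zi = jw_zero_imag[OF z this]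
  define c where "c = exp (- (2 * Im z * x_half)) / 4"
  define P where "P w = (\<Prod>\<kappa>\<in>jzeros \<gamma> - {Im z}. w - \<i> * of_real \<kappa>)" for w
  have low: "c \<le> bnd * (norm (jost_quot \<gamma> (z + of_real \<delta>)) * norm (P (z + of_real \<delta>)))" if d: "0 < \<delta>" for \<delta>
  proof -
    define w where "w = z + of_real \<delta>"
    have w: "w \<in> upper_open" "Re w = \<delta>" "Im w = Im z" using z zi(1) by (auto simp: w_def complex_eq_iff)
    have "(\<Prod>\<kappa>\<in>jzeros \<gamma>. w - \<i> * of_real \<kappa>) = (w - \<i> * of_real (Im z)) * P w"
      unfolding P_def by (rule prod.remove[OF finite_jzeros zi(2)])
    also have "w - \<i> * of_real (Im z) = of_real \<delta>" unfolding w_def using zi(1) by simp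
    finally have "jw \<gamma> w = jost_quot \<gamma> w * (of_real \<delta> * P w)" using jost_quot(2)[OF w(1)] by simp
    then have "norm (jw \<gamma> w) = \<delta> * (norm (jost_quot \<gamma> w) * norm (P w))" using d by (simp add: norm_mult)
    moreover have "\<bar>Re w\<bar> / 4 * exp (- (2 * Im w * x_half)) \<le> bnd * norm (jw \<gamma> w)"
      by (rule jw_lower) (use w in auto)
    ultimately have "\<delta> * c \<le> \<delta> * (bnd * (norm (jost_quot \<gamma> w) * norm (P w)))"
      using d w by (simp add: c_def mult_ac)
    then show ?thesis using d by (simp add: w_def)
  qed
  have hc: "isCont (jost_quot \<gamma>) z"
    using holomorphic_on_imp_continuous_on[OF jost_quot(1)] continuous_on_eq_continuous_at[OF open_upper_open] z by blast
  have l0: "((\<lambda>\<delta>. z + of_real \<delta>) \<longlongrightarrow> z + of_real 0) (at_right 0)" by (intro tendsto_intros)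
  have lh: "((\<lambda>\<delta>. jost_quot \<gamma> (z + of_real \<delta>)) \<longlongrightarrow> jost_quot \<gamma> z) (at_right 0)"
    using isCont_tendsto_compose[OF hc] l0 by simp
  have lP: "((\<lambda>\<delta>. P (z + of_real \<delta>)) \<longlongrightarrow> P (z + of_real 0)) (at_right 0)"
    unfolding P_def by (intro tendsto_intros)
  have "((\<lambda>\<delta>. bnd * (norm (jost_quot \<gamma> (z + of_real \<delta>)) * norm (P (z + of_real \<delta>)))) \<longlongrightarrow> bnd * (norm (jost_quot \<gamma> z) * norm (P (z + of_real 0)))) (at_right 0)"
    by (intro tendsto_intros lh lP)
  then have "c \<le> bnd * (norm (jost_quot \<gamma> z) * norm (P (z + of_real 0)))"
    by (rule tendsto_lowerbound) (use low in \<open>auto simp: eventually_at_right_less eventually_at intro!: exI[of _ 1]\<close>)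
  then show False using h0 by (simp add: c_def)
qed

text \<open>Up to the zeros of \<open>jw\<close>, where the second formula has removable singularities, this is
  \<open>jw \<gamma> z / (\<gamma> - i z)\<close> times Blaschke factors that cancel the zeros of the numerator and, if \<open>\<gamma> < 0\<close>,
  that of the denominator at \<open>i |\<gamma>|\<close>.\<close>

definition jost_outer :: "real \<Rightarrow> complex \<Rightarrow> complex" where
  "jost_outer \<gamma> z = (if 0 < Im z
     then \<i> * jost_quot \<gamma> z * (\<Prod>\<kappa>\<in>jzeros \<gamma>. z + \<i> * of_real \<kappa>) / (z + \<i> * of_real \<bar>\<gamma>\<bar>)
     else \<i> * jw \<gamma> z * (\<Prod>\<kappa>\<in>jzeros \<gamma>. blaschke \<kappa> z) / (z + \<i> * of_real \<bar>\<gamma>\<bar>))"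

definition imag_zeros :: "real \<Rightarrow> complex set" where "imag_zeros \<gamma> = (\<lambda>\<kappa>. \<i> * of_real \<kappa>) ` jzeros \<gamma>"

lemma imag_zeros_closed: "closed (imag_zeros \<gamma>)"
  unfolding imag_zeros_def by (intro finite_imp_closed finite_imageI finite_jzeros)

lemma jost_outer_eq:
  assumes "z \<in> upper_closed" "z \<notin> imag_zeros \<gamma>"
  shows "jost_outer \<gamma> z = \<i> * jw \<gamma> z * (\<Prod>\<kappa>\<in>jzeros \<gamma>. blaschke \<kappa> z) / (z + \<i> * of_real \<bar>\<gamma>\<bar>)"
proof (cases "0 < Im z")
  case True
  have "(\<Prod>\<kappa>\<in>jzeros \<gamma>. z - \<i> * of_real \<kappa>) * (\<Prod>\<kappa>\<in>jzeros \<gamma>. blaschke \<kappa> z) = (\<Prod>\<kappa>\<in>jzeros \<gamma>. z + \<i> * of_real \<kappa>)"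
    unfolding prod.distrib[symmetric]
  proof (rule prod.cong[OF refl])
    fix \<kappa> assume "\<kappa> \<in> jzeros \<gamma>"
    then have "z - \<i> * of_real \<kappa> \<noteq> 0" using assms(2) by (auto simp: imag_zeros_def)
    then show "(z - \<i> * of_real \<kappa>) * blaschke \<kappa> z = z + \<i> * of_real \<kappa>" by (simp add: blaschke_def)
  qed
  then have "\<i> * jw \<gamma> z * (\<Prod>\<kappa>\<in>jzeros \<gamma>. blaschke \<kappa> z) = \<i> * jost_quot \<gamma> z * (\<Prod>\<kappa>\<in>jzeros \<gamma>. z + \<i> * of_real \<kappa>)"
    using jost_quot(2)[of z \<gamma>] True by (simp add: mult.assoc)
  then show ?thesis using True by (simp add: jost_outer_def)
qed (simp add: jost_outer_def)

lemma plus_abs_nonzero: "z \<in> upper_closed \<Longrightarrow> z \<noteq> 0 \<Longrightarrow> z + \<i> * of_real \<bar>\<gamma>\<bar> \<noteq> 0"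
proof
  assume z: "z \<in> upper_closed" "z \<noteq> 0" and e: "z + \<i> * of_real \<bar>\<gamma>\<bar> = 0"
  have "Re z = 0" "Im z + \<bar>\<gamma>\<bar> = 0" using arg_cong[OF e, of Re] arg_cong[OF e, of Im] by simp_all
  then show False using z by (auto simp: complex_eq_iff)
qed

lemma jost_outer_holo: "jost_outer \<gamma> holomorphic_on upper_open"
proof (rule holomorphic_transform)
  show "(\<lambda>z. \<i> * jost_quot \<gamma> z * (\<Prod>\<kappa>\<in>jzeros \<gamma>. z + \<i> * of_real \<kappa>) / (z + \<i> * of_real \<bar>\<gamma>\<bar>)) holomorphic_on upper_open"
  proof (intro holomorphic_intros jost_quot)
    fix z assume "z \<in> upper_open"
    then show "z + \<i> * of_real \<bar>\<gamma>\<bar> \<noteq> 0" by (intro plus_abs_nonzero) auto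
  qed
qed (auto simp: jost_outer_def)

text \<open>At interior points this is holomorphy. A nonzero real point has a neighbourhood free of
  the finitely many zeros, where the formula with \<open>jw\<close> holds on both sides of the case
  distinction.\<close>

lemma jost_outer_cont: "continuous_on (upper_closed - {0}) (jost_outer \<gamma>)"
  unfolding continuous_on_eq_continuous_within
proof
  fix z assume z: "z \<in> upper_closed - {0}"
  show "continuous (at z within upper_closed - {0}) (jost_outer \<gamma>)"
  proof (cases "0 < Im z")
    case True
    then have "isCont (jost_outer \<gamma>) z"
      using holomorphic_on_imp_continuous_on[OF jost_outer_holo] continuous_on_eq_continuous_at[OF open_upper_open] by blast
    then show ?thesis by (rule continuous_at_imp_continuous_within)
  next
    case False
    let ?S = "upper_closed - {0} - imag_zeros \<gamma>"
    have zI: "z \<notin> imag_zeros \<gamma>" using False z by (auto simp: imag_zeros_def jzeros_def)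
    have "continuous_on ?S (\<lambda>z. \<i> * jw \<gamma> z * (\<Prod>\<kappa>\<in>jzeros \<gamma>. blaschke \<kappa> z) / (z + \<i> * of_real \<bar>\<gamma>\<bar>))"
    proof (intro continuous_intros continuous_on_subset[OF jw_cont] ballI)
      show "z + \<i> * of_real \<bar>\<gamma>\<bar> \<noteq> 0" if "z \<in> ?S" for z using plus_abs_nonzero that by blast
      show "continuous_on ?S (\<lambda>z. blaschke \<kappa> z)" if "\<kappa> \<in> jzeros \<gamma>" for \<kappa>
        unfolding blaschke_def using that by (intro continuous_intros) (auto simp: imag_zeros_def)
    qed auto
    then have "continuous_on ?S (jost_outer \<gamma>)"
      by (rule continuous_on_eq) (use jost_outer_eq in auto)
    then have "continuous (at z within ?S) (jost_outer \<gamma>)"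
      using z zI by (auto simp: continuous_on_eq_continuous_within)
    moreover have "at z within ?S = at z within (upper_closed - {0})"
      by (rule at_within_nhd[of z "- imag_zeros \<gamma>"]) (use zI imag_zeros_closed in auto)
    ultimately show ?thesis by simp
  qed
qed

lemma jost_outer_nonzero:
  assumes z: "z \<in> upper_closed - {0}" shows "jost_outer \<gamma> z \<noteq> 0"
proof (cases "0 < Im z")
  case True
  have "z + \<i> * of_real \<kappa> \<noteq> 0" if "\<kappa> \<in> jzeros \<gamma>" for \<kappa>
  proof
    assume "z + \<i> * of_real \<kappa> = 0"
    then have "Im (z + \<i> * of_real \<kappa>) = Im 0" by (rule arg_cong)
    then have "Im z + \<kappa> = 0" by simp
    then show False using True jzeros_pos[OF that] by simp
  qed
  then have "(\<Prod>\<kappa>\<in>jzeros \<gamma>. z + \<i> * of_real \<kappa>) \<noteq> 0" using finite_jzeros by simp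
  then show ?thesis using True jost_quot_nonzero[of z \<gamma>] plus_abs_nonzero[of z \<gamma>] z by (simp add: jost_outer_def)
next
  case False
  then have i: "Im z = 0" "Re z \<noteq> 0" using z by (auto simp: complex_eq_iff)
  have "blaschke \<kappa> z \<noteq> 0" for \<kappa>
  proof -
    have "z + \<i> * of_real \<kappa> \<noteq> 0" "z - \<i> * of_real \<kappa> \<noteq> 0" using i by (auto simp: complex_eq_iff)
    then show ?thesis by (simp add: blaschke_def)
  qed
  then show ?thesis using False jw_nonzero[of z \<gamma>] plus_abs_nonzero[of z \<gamma>] z i finite_jzeros by (simp add: jost_outer_def)
qed

definition log_coeff :: "real \<Rightarrow> nat \<Rightarrow> real" where
  "log_coeff \<gamma> n = l_coeff V \<gamma> n + (\<Sum>\<kappa>\<in>jzeros \<gamma>. blaschke_coeff \<kappa> n) - (if \<gamma> < 0 then blaschke_coeff \<bar>\<gamma>\<bar> n else 0)"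

lemma jost_outer_log_expansion: "log_expansion (jost_outer \<gamma>) (\<lambda>n. of_real (log_coeff \<gamma> n))"
proof -
  let ?B = "\<lambda>z. if \<gamma> < 0 then inverse (blaschke \<bar>\<gamma>\<bar> z) else 1"
  have blz: "log_expansion (blaschke a) (\<lambda>n. of_real (blaschke_coeff a n))" if "0 \<le> a" for a
    unfolding blaschke_def by (rule log_expansion_blaschke[OF that])
  have B: "log_expansion ?B (\<lambda>n. if \<gamma> < 0 then - of_real (blaschke_coeff \<bar>\<gamma>\<bar> n) else 0)"
    using log_expansion_inverse[OF blz[of "\<bar>\<gamma>\<bar>"]] log_expansion_one by (cases "\<gamma> < 0") auto
  have P: "log_expansion (\<lambda>z. \<Prod>\<kappa>\<in>jzeros \<gamma>. blaschke \<kappa> z) (\<lambda>n. \<Sum>\<kappa>\<in>jzeros \<gamma>. of_real (blaschke_coeff \<kappa> n))"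
    by (rule log_expansion_prod[OF finite_jzeros blz]) (simp add: jzeros_def)
  have "log_expansion (\<lambda>z. (jw \<gamma> z / (of_real \<gamma> - \<i> * z)) * (\<Prod>\<kappa>\<in>jzeros \<gamma>. blaschke \<kappa> z) * ?B z)
    (\<lambda>n. of_real (l_coeff V \<gamma> n) + (\<Sum>\<kappa>\<in>jzeros \<gamma>. of_real (blaschke_coeff \<kappa> n)) + (if \<gamma> < 0 then - of_real (blaschke_coeff \<bar>\<gamma>\<bar> n) else 0))"
    by (intro log_expansion_mult jw_log_expansion P B)
  moreover have "(\<lambda>n. of_real (l_coeff V \<gamma> n) + (\<Sum>\<kappa>\<in>jzeros \<gamma>. of_real (blaschke_coeff \<kappa> n)) + (if \<gamma> < 0 then - of_real (blaschke_coeff \<bar>\<gamma>\<bar> n) else 0))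
     = (\<lambda>n. complex_of_real (log_coeff \<gamma> n))"
    by (auto simp: log_coeff_def fun_eq_iff)
  ultimately have L: "log_expansion (\<lambda>z. (jw \<gamma> z / (of_real \<gamma> - \<i> * z)) * (\<Prod>\<kappa>\<in>jzeros \<gamma>. blaschke \<kappa> z) * ?B z) (\<lambda>n. of_real (log_coeff \<gamma> n))"
    by simp
  \<comment> \<open>The zeros are positive, so their sum bounds each of them; beyond R neither the
    zeros nor the point i |\<gamma>| can interfere.\<close>
  define R where "R = 1 + \<bar>\<gamma>\<bar> + (\<Sum>\<kappa>\<in>jzeros \<gamma>. \<kappa>)"
  have s0: "0 \<le> (\<Sum>\<kappa>\<in>jzeros \<gamma>. \<kappa>)" by (rule sum_nonneg) (simp add: jzeros_def)
  show ?thesis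
  proof (rule log_expansion_cong[OF L])
    show "0 < R" using s0 by (simp add: R_def)
    fix z :: complex assume z: "0 \<le> Im z" "R \<le> norm z"
    have zg: "norm z > \<bar>\<gamma>\<bar>" and z0: "z \<noteq> 0" using z s0 by (auto simp: R_def)
    have zI: "z \<notin> imag_zeros \<gamma>"
    proof
      assume "z \<in> imag_zeros \<gamma>"
      then obtain \<kappa> where k: "\<kappa> \<in> jzeros \<gamma>" "z = \<i> * of_real \<kappa>" by (auto simp: imag_zeros_def)
      have "norm z = \<kappa>" using k jzeros_pos[OF k(1)] by (simp add: norm_mult)
      moreover have "\<kappa> \<le> (\<Sum>\<kappa>\<in>jzeros \<gamma>. \<kappa>)"
        by (rule member_le_sum[OF k(1) _ finite_jzeros]) (simp add: jzeros_def)
      ultimately show False using z by (simp add: R_def)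
    qed
    have p: "z + \<i> * of_real \<bar>\<gamma>\<bar> \<noteq> 0" by (rule plus_abs_nonzero) (use z z0 in auto)
    have q: "z - \<i> * of_real \<bar>\<gamma>\<bar> \<noteq> 0"
    proof
      assume "z - \<i> * of_real \<bar>\<gamma>\<bar> = 0"
      then have "norm z = \<bar>\<gamma>\<bar>" by (simp add: norm_mult)
      then show False using zg by simp
    qed
    \<comment> \<open>For \<gamma> < 0 the denominator \<gamma> - i z has its zero at i |\<gamma>|,
      and the reciprocal Blaschke factor moves it to - i |\<gamma>|; for \<gamma> \<ge> 0 it lies at
      - i |\<gamma>| already.\<close>
    have h: "?B z / (of_real \<gamma> - \<i> * z) = \<i> / (z + \<i> * of_real \<bar>\<gamma>\<bar>)"
    proof (cases "\<gamma> < 0")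
      case True
      have e: "of_real \<gamma> - \<i> * z = - (\<i> * (z - \<i> * of_real \<bar>\<gamma>\<bar>))" using True by (simp add: algebra_simps)
      have "?B z / (of_real \<gamma> - \<i> * z) = (z - \<i> * of_real \<bar>\<gamma>\<bar>) / (z + \<i> * of_real \<bar>\<gamma>\<bar>) / - (\<i> * (z - \<i> * of_real \<bar>\<gamma>\<bar>))"
        unfolding e using True by (simp add: blaschke_def)
      also have "\<dots> = - inverse \<i> / (z + \<i> * of_real \<bar>\<gamma>\<bar>)" using p q by (simp add: divide_inverse)
      finally show ?thesis by simp
    next
      case False
      have e: "of_real \<gamma> - \<i> * z = - (\<i> * (z + \<i> * of_real \<bar>\<gamma>\<bar>))" using False by (simp add: algebra_simps)
      have "?B z / (of_real \<gamma> - \<i> * z) = - inverse \<i> / (z + \<i> * of_real \<bar>\<gamma>\<bar>)"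
        unfolding e using False p by (simp add: divide_inverse)
      then show ?thesis by simp
    qed
    have alg: "a / g * P * B = a * P * (B / g)" for a g P B :: complex by simp
    have "(jw \<gamma> z / (of_real \<gamma> - \<i> * z)) * (\<Prod>\<kappa>\<in>jzeros \<gamma>. blaschke \<kappa> z) * ?B z = jw \<gamma> z * (\<Prod>\<kappa>\<in>jzeros \<gamma>. blaschke \<kappa> z) * (\<i> / (z + \<i> * of_real \<bar>\<gamma>\<bar>))"
      unfolding alg h ..
    also have "\<dots> = jost_outer \<gamma> z" using jost_outer_eq[of z \<gamma>] z zI by (simp add: mult_ac)
    finally show "(jw \<gamma> z / (of_real \<gamma> - \<i> * z)) * (\<Prod>\<kappa>\<in>jzeros \<gamma>. blaschke \<kappa> z) * ?B z = jost_outer \<gamma> z" .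
  qed
qed

text \<open>The closed half-plane without 0 is star-shaped about i, so a continuous logarithm exists
  up to the boundary. Its branch is fixed by comparison with the principal logarithm near infinity;
  one constant has to serve both ends of the real line, which is why that comparison takes place on
  a connected set.\<close>

lemma jost_log_exists:
  "\<exists>G R. continuous_on (upper_closed - {0}) G \<and> G holomorphic_on upper_open \<and>
     (\<forall>z\<in>upper_closed - {0}. jost_outer \<gamma> z = exp (G z)) \<and> 0 < R \<and> (\<forall>z\<in>upper_closed. R \<le> norm z \<longrightarrow> G z = Ln (jost_outer \<gamma> z))"
proof -
  let ?S = "upper_closed - {0}"
  have "starlike ?S"
    unfolding starlike_def
  proof (rule bexI[of _ \<i>], intro ballI)
    fix z assume z: "z \<in> ?S"
    show "closed_segment \<i> z \<subseteq> ?S"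
    proof
      fix w assume "w \<in> closed_segment \<i> z"
      then obtain u where u: "0 \<le> u" "u \<le> 1" "w = (1 - u) *\<^sub>R \<i> + u *\<^sub>R z" by (auto simp: in_segment)
      have iw: "Im w = (1 - u) + u * Im z" using u by simp
      show "w \<in> ?S"
      proof (cases "u = 1")
        case True then show ?thesis using u z by simp
      next
        case False
        have "0 \<le> u * Im z" using u z by simp
        then have "0 < Im w" using iw u False by simp
        then show ?thesis by auto
      qed
    qed
  qed simp
  then have "contractible ?S" by (rule starlike_imp_contractible)
  from continuous_logarithm_on_contractible[OF jost_outer_cont this jost_outer_nonzero]
  obtain g where g: "continuous_on ?S g" "\<And>z. z \<in> ?S \<Longrightarrow> jost_outer \<gamma> z = exp (g z)" by metis
  obtain R where R: "0 < R" "\<And>z. 0 \<le> Im z \<Longrightarrow> R \<le> norm z \<Longrightarrow> norm (jost_outer \<gamma> z - 1) < 1/4"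
    using log_expansion_tendsto[OF jost_outer_log_expansion] by metis
  \<comment> \<open>A union of three overlapping convex sets, which makes connectedness easy.
    Outside U both coordinates are less than R in modulus, so U contains all points of the
    half-plane with |z| \<ge> 2 R.\<close>
  define U where "U = ({z. Re z \<ge> R} \<inter> upper_closed) \<union> {z. Im z \<ge> R} \<union> ({z. Re z \<le> - R} \<inter> upper_closed)"
  have Uc: "connected U"
    unfolding U_def
  proof (intro connected_Un)
    show "connected ({z. Re z \<ge> R} \<inter> upper_closed)" "connected {z. Im z \<ge> R}" "connected ({z. Re z \<le> - R} \<inter> upper_closed)"
      by (intro convex_connected convex_Int convex_halfspace_Re_ge convex_halfspace_Im_ge convex_halfspace_Re_le)+
    have "Complex R R \<in> ({z. Re z \<ge> R} \<inter> upper_closed) \<inter> {z. Im z \<ge> R}" using R by simp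
    then show "({z. Re z \<ge> R} \<inter> upper_closed) \<inter> {z. Im z \<ge> R} \<noteq> {}" by blast
    have "Complex (- R) R \<in> (({z. Re z \<ge> R} \<inter> upper_closed) \<union> {z. Im z \<ge> R}) \<inter> ({z. Re z \<le> - R} \<inter> upper_closed)" using R by simp
    then show "(({z. Re z \<ge> R} \<inter> upper_closed) \<union> {z. Im z \<ge> R}) \<inter> ({z. Re z \<le> - R} \<inter> upper_closed) \<noteq> {}" by blast
  qed
  have Ub: "0 \<le> Im z \<and> R \<le> norm z" if "z \<in> U" for z
    using that R(1) abs_Re_le_cmod[of z] abs_Im_le_cmod[of z] by (auto simp: U_def)
  have US: "U \<subseteq> ?S" using Ub R(1) by fastforce
  have re: "0 < Re (jost_outer \<gamma> z)" if "z \<in> U" for z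
  proof -
    have "norm (jost_outer \<gamma> z - 1) < 1/4" using R(2)[of z] Ub[OF that] by blast
    then show ?thesis using abs_Re_le_cmod[of "jost_outer \<gamma> z - 1"] by (simp add: abs_le_iff)
  qed
  define D where "D z = g z - Ln (jost_outer \<gamma> z)" for z
  have "continuous_on U D"
    unfolding D_def
  proof (intro continuous_intros continuous_on_subset[OF g(1) US] continuous_on_Ln' continuous_on_subset[OF jost_outer_cont US])
    show "jost_outer \<gamma> z \<notin> \<real>\<^sub>\<le>\<^sub>0" if "z \<in> U" for z using re[OF that] by (auto simp: complex_nonpos_Reals_iff)
  qed
  moreover have "exp (D z) = 1" if "z \<in> U" for z
  proof -
    have "z \<in> ?S" using US that by blast
    then show ?thesis using g(2)[of z] jost_outer_nonzero[of z \<gamma>] by (simp add: D_def exp_diff)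
  qed
  ultimately obtain c where c: "exp c = 1" "\<And>z. z \<in> U \<Longrightarrow> D z = c"
    using exp_eq_1_const[OF Uc] by metis
  define G where "G z = g z - c" for z
  have Gc: "continuous_on ?S G" unfolding G_def by (intro continuous_intros g)
  have Ge: "jost_outer \<gamma> z = exp (G z)" if "z \<in> ?S" for z using g(2)[OF that] c(1) by (simp add: G_def exp_diff)
  have Gi: "G z = Ln (jost_outer \<gamma> z)" if "z \<in> upper_closed" "2 * R \<le> norm z" for z
  proof -
    have "z \<in> U"
    proof (rule ccontr)
      assume "z \<notin> U"
      then have "\<bar>Re z\<bar> < R" "\<bar>Im z\<bar> < R" using that by (auto simp: U_def)
      then show False using cmod_le[of z] that(2) by linarith
    qed
    then show ?thesis using c(2)[of z] by (simp add: G_def D_def algebra_simps)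
  qed
  \<comment> \<open>G is so far only continuous. On the simply connected open half-plane a
    holomorphic logarithm exists as well, and the two differ by a constant.\<close>
  have "G holomorphic_on upper_open"
  proof -
    obtain G1 where G1: "G1 holomorphic_on upper_open" "\<And>z. z \<in> upper_open \<Longrightarrow> jost_outer \<gamma> z = exp (G1 z)"
      using contractible_imp_holomorphic_log[OF jost_outer_holo convex_imp_contractible[OF convex_upper_open]] jost_outer_nonzero
      by (metis (no_types, lifting) Diff_iff complex.sel(2) less_imp_le mem_Collect_eq order_less_irrefl singletonD zero_complex.sel(2))
    define D1 where "D1 z = G z - G1 z" for z
    have "continuous_on upper_open D1"
      unfolding D1_def by (intro continuous_intros continuous_on_subset[OF Gc] holomorphic_on_imp_continuous_on[OF G1(1)]) auto
    moreover have "exp (D1 z) = 1" if "z \<in> upper_open" for z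
    proof -
      have "z \<in> ?S" using that by auto
      then have "exp (G z) = exp (G1 z)" using Ge G1(2)[OF that] by metis
      then show ?thesis by (simp add: D1_def exp_diff)
    qed
    ultimately obtain d where d: "\<And>z. z \<in> upper_open \<Longrightarrow> D1 z = d"
      using exp_eq_1_const[OF convex_connected[OF convex_upper_open]] by metis
    have "(\<lambda>z. G1 z + d) holomorphic_on upper_open" by (intro holomorphic_intros G1)
    then show ?thesis by (rule holomorphic_transform) (use d in \<open>auto simp: D1_def algebra_simps\<close>)
  qed
  then show ?thesis using Gc Ge Gi R(1) by - (rule exI[of _ G], rule exI[of _ "2 * R"], auto)
qed

definition jost_log :: "real \<Rightarrow> complex \<Rightarrow> complex" where
  "jost_log \<gamma> = (SOME G. \<exists>R. continuous_on (upper_closed - {0}) G \<and> G holomorphic_on upper_open \<and>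
     (\<forall>z\<in>upper_closed - {0}. jost_outer \<gamma> z = exp (G z)) \<and> 0 < R \<and> (\<forall>z\<in>upper_closed. R \<le> norm z \<longrightarrow> G z = Ln (jost_outer \<gamma> z)))"

lemma jost_log:
  shows "continuous_on (upper_closed - {0}) (jost_log \<gamma>)" "jost_log \<gamma> holomorphic_on upper_open"
    "\<And>z. z \<in> upper_closed \<Longrightarrow> z \<noteq> 0 \<Longrightarrow> jost_outer \<gamma> z = exp (jost_log \<gamma> z)"
    "\<exists>R>0. \<forall>z\<in>upper_closed. R \<le> norm z \<longrightarrow> jost_log \<gamma> z = Ln (jost_outer \<gamma> z)"
  using someI_ex[OF jost_log_exists[of \<gamma>]] unfolding jost_log_def[symmetric] by auto

lemma jost_log_expansion:
  "\<exists>C R. 0 < R \<and> (\<forall>z. 0 \<le> Im z \<longrightarrow> R \<le> norm z \<longrightarrow>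
     norm (jost_log \<gamma> z - (\<Sum>j=1..N. of_real (log_coeff \<gamma> j) * inverse (2 * \<i> * z) ^ j)) \<le> C / norm z ^ Suc N)"
proof -
  obtain C R where C: "0 < R" "\<And>z. 0 \<le> Im z \<Longrightarrow> R \<le> norm z \<Longrightarrow>
     norm (Ln (jost_outer \<gamma> z) - (\<Sum>j=1..N. of_real (log_coeff \<gamma> j) * inverse (2 * \<i> * z) ^ j)) \<le> C / norm z ^ Suc N"
    using log_expansion_Ln[OF jost_outer_log_expansion[of \<gamma>], of N] by blast
  obtain R2 where R2: "R2 > 0" "\<And>z. z \<in> upper_closed \<Longrightarrow> R2 \<le> norm z \<Longrightarrow> jost_log \<gamma> z = Ln (jost_outer \<gamma> z)"
    using jost_log(4)[of \<gamma>] by blast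
  show ?thesis
  proof (rule exI[of _ C], rule exI[of _ "max R R2"], intro conjI allI impI)
    show "0 < max R R2" using C(1) by simp
    fix z :: complex assume z: "0 \<le> Im z" "max R R2 \<le> norm z"
    have "jost_log \<gamma> z = Ln (jost_outer \<gamma> z)" by (rule R2(2)) (use z in auto)
    then show "norm (jost_log \<gamma> z - (\<Sum>j=1..N. of_real (log_coeff \<gamma> j) * inverse (2 * \<i> * z) ^ j)) \<le> C / norm z ^ Suc N"
      using C(2)[of z] z by simp
  qed
qed

lemma jost_outer_cnj_real:
  assumes "0 < k" shows "jost_outer \<gamma> (- of_real k) = cnj (jost_outer \<gamma> (of_real k))"
proof -
  have w1: "jw \<gamma> (- of_real k) = cnj (jw \<gamma> (of_real k))" using jw_cnj[of "of_real k" \<gamma>] by simp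
  have w2: "blaschke \<kappa> (- of_real k) = cnj (blaschke \<kappa> (of_real k))" for \<kappa>
  proof -
    have e: "- complex_of_real k + \<i> * of_real \<kappa> = - (of_real k - \<i> * of_real \<kappa>)" "- complex_of_real k - \<i> * of_real \<kappa> = - (of_real k + \<i> * of_real \<kappa>)"
      by simp_all
    have "blaschke \<kappa> (- of_real k) = (of_real k - \<i> * of_real \<kappa>) / (of_real k + \<i> * of_real \<kappa>)"
      unfolding blaschke_def e by (rule minus_divide_divide)
    then show ?thesis by (simp add: blaschke_def)
  qed
  have w3: "\<i> / (- complex_of_real k + \<i> * of_real \<bar>\<gamma>\<bar>) = cnj (\<i> / (of_real k + \<i> * of_real \<bar>\<gamma>\<bar>))"
  proof -
    have e: "- complex_of_real k + \<i> * of_real \<bar>\<gamma>\<bar> = - (of_real k - \<i> * of_real \<bar>\<gamma>\<bar>)" by simp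
    show ?thesis unfolding e minus_divide_right[symmetric] by simp
  qed
  have w4: "jost_outer \<gamma> w = jw \<gamma> w * (\<Prod>\<kappa>\<in>jzeros \<gamma>. blaschke \<kappa> w) * (\<i> / (w + \<i> * of_real \<bar>\<gamma>\<bar>))" if "Im w = 0" for w
    using that by (simp add: jost_outer_def mult_ac)
  have "jost_outer \<gamma> (- of_real k) = jw \<gamma> (- of_real k) * (\<Prod>\<kappa>\<in>jzeros \<gamma>. blaschke \<kappa> (- of_real k)) * (\<i> / (- complex_of_real k + \<i> * of_real \<bar>\<gamma>\<bar>))"
    by (rule w4) simp
  also have "\<dots> = cnj (jw \<gamma> (of_real k) * (\<Prod>\<kappa>\<in>jzeros \<gamma>. blaschke \<kappa> (of_real k)) * (\<i> / (of_real k + \<i> * of_real \<bar>\<gamma>\<bar>)))"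
    unfolding w1 w2 w3 by (simp only: complex_cnj_mult cnj_prod)
  also have "jw \<gamma> (of_real k) * (\<Prod>\<kappa>\<in>jzeros \<gamma>. blaschke \<kappa> (of_real k)) * (\<i> / (of_real k + \<i> * of_real \<bar>\<gamma>\<bar>)) = jost_outer \<gamma> (of_real k)"
    by (rule w4[symmetric]) simp
  finally show ?thesis .
qed

text \<open>Both sides are continuous logarithms of the same function of k, so they differ by a
  constant, and this is 0 because both decay at infinity.\<close>

lemma jost_log_cnj_real:
  assumes k: "0 < k" shows "jost_log \<gamma> (- of_real k) = cnj (jost_log \<gamma> (of_real k))"
proof -
  define D where "D k = jost_log \<gamma> (- of_real k) - cnj (jost_log \<gamma> (of_real k))" for k :: real
  have "continuous_on {0<..} D"
    unfolding D_def by (intro continuous_intros continuous_on_compose2[OF jost_log(1)]) auto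
  moreover have "exp (D k) = 1" if "k \<in> {0<..}" for k
  proof -
    have k: "0 < k" using that by simp
    have "exp (jost_log \<gamma> (- of_real k)) = exp (cnj (jost_log \<gamma> (of_real k)))"
      using jost_log(3)[of "- of_real k" \<gamma>] jost_log(3)[of "of_real k" \<gamma>] jost_outer_cnj_real[OF k, of \<gamma>] k by (simp add: exp_cnj)
    then show ?thesis by (simp add: D_def exp_diff)
  qed
  ultimately obtain c where c: "\<And>k. k \<in> {0<..} \<Longrightarrow> D k = c"
    using exp_eq_1_const[of "{0<..}" D] by (metis connected_Ioi)
  obtain C R where C: "0 < R" "\<And>z. 0 \<le> Im z \<Longrightarrow> R \<le> norm z \<Longrightarrow> norm (jost_log \<gamma> z) \<le> C / norm z"
    using jost_log_expansion[of \<gamma> 0] by auto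
  have "norm c \<le> 2 * C / x" if "R \<le> x" for x
  proof -
    have x: "0 < x" using that C(1) by simp
    have "norm c = norm (D x)" using c x by simp
    also have "\<dots> \<le> norm (jost_log \<gamma> (- of_real x)) + norm (jost_log \<gamma> (of_real x))"
      unfolding D_def using norm_triangle_ineq4[of "jost_log \<gamma> (- of_real x)" "cnj (jost_log \<gamma> (of_real x))"] by simp
    also have "\<dots> \<le> C / x + C / x" using C(2)[of "- of_real x"] C(2)[of "of_real x"] x that by (intro add_mono) auto
    finally show ?thesis by simp
  qed
  moreover have "((\<lambda>x. 2 * C / x) \<longlongrightarrow> 0) at_top"
    by (intro tendsto_divide_0[OF tendsto_const] filterlim_at_top_imp_at_infinity filterlim_ident)
  ultimately have "norm c \<le> 0"
    by (intro tendsto_lowerbound[of "\<lambda>x. 2 * C / x" 0 at_top]) (auto simp: eventually_at_top_linorder)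
  then show ?thesis using c[of k] k by (simp add: D_def)
qed

section \<open>The logarithm near the threshold z = 0\<close>

text \<open>Confines the argument of w to a bounded range on the right (\<sigma> = 1) and left
  (\<sigma> = -1) quarter-disc. If w(0) \<noteq> 0, continuity suffices. Otherwise theta(0,0)
  \<noteq> 0, and \<open>wronskian_Im_lower\<close> gives the imaginary part of w cnj (theta(0)) a
  definite sign; f1 and f3 involve conjugates and are only continuous.\<close>

lemma jw_near_zero:
  assumes s: "\<sigma> = 1 \<or> \<sigma> = (-1::real)"
  obtains r c f1 f3 where "0 < r" "c \<noteq> 0"
    "continuous_on {z. 0 < \<sigma> * Re z \<and> 0 \<le> Im z \<and> norm z < r} f1" "continuous_on {z. 0 < \<sigma> * Re z \<and> 0 \<le> Im z \<and> norm z < r} f3"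
    "\<And>z. \<lbrakk>0 < \<sigma> * Re z; 0 \<le> Im z; norm z < r\<rbrakk> \<Longrightarrow> 0 < Re (f1 z) \<and> 0 < Re (f3 z) \<and> jw \<gamma> z = c * f1 z / f3 z"
proof (cases "jw \<gamma> 0 = 0")
  case False
  define w0 where "w0 = jw \<gamma> 0"
  have "norm w0 > 0" using False by (simp add: w0_def)
  then obtain r where r: "0 < r" "\<And>z. z \<in> upper_closed \<Longrightarrow> dist z 0 < r \<Longrightarrow> dist (jw \<gamma> z) (jw \<gamma> 0) < norm w0"
    using jw_cont[of \<gamma>] unfolding continuous_on_iff by (metis (no_types, lifting) mem_Collect_eq order_refl zero_complex.sel(2))
  show ?thesis
  proof (rule that[of r w0 "\<lambda>z. jw \<gamma> z / w0" "\<lambda>z. 1"])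
    show "continuous_on {z. 0 < \<sigma> * Re z \<and> 0 \<le> Im z \<and> norm z < r} (\<lambda>z. jw \<gamma> z / w0)"
      using \<open>norm w0 > 0\<close> by (intro continuous_intros continuous_on_subset[OF jw_cont]) auto
    fix z assume z: "0 < \<sigma> * Re z" "0 \<le> Im z" "norm z < r"
    have "norm (jw \<gamma> z - w0) < norm w0" using r(2)[of z] z by (simp add: dist_norm w0_def)
    moreover have "jw \<gamma> z / w0 - 1 = (jw \<gamma> z - w0) / w0" using \<open>norm w0 > 0\<close> by (simp add: field_simps)
    ultimately have "norm (jw \<gamma> z / w0 - 1) < 1" using \<open>norm w0 > 0\<close> by (simp add: norm_divide divide_less_eq)
    then have "0 < Re (jw \<gamma> z / w0)" using abs_Re_le_cmod[of "jw \<gamma> z / w0 - 1"] by (simp add: abs_le_iff)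
    then show "0 < Re (jw \<gamma> z / w0) \<and> 0 < Re 1 \<and> jw \<gamma> z = w0 * (jw \<gamma> z / w0) / 1"
      using \<open>norm w0 > 0\<close> by simp
  qed (use r \<open>norm w0 > 0\<close> in auto)
next
  case True
  define t0 where "t0 = jtheta 0 0"
  have "norm t0 > 0" using jtheta_0_0_nonzero[OF True] by (simp add: t0_def)
  then have t0: "t0 \<noteq> 0" by auto
  obtain r where r: "0 < r" "\<And>z. z \<in> upper_closed \<Longrightarrow> dist z 0 < r \<Longrightarrow> dist (jtheta z 0) (jtheta 0 0) < norm t0"
    using jtheta_0_cont \<open>norm t0 > 0\<close> unfolding continuous_on_iff by (metis (no_types, lifting) mem_Collect_eq order_refl zero_complex.sel(2))
  have s2: "complex_of_real \<sigma> * of_real \<sigma> = 1" using s by auto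
  show ?thesis
  proof (rule that[of r "1 / (of_real \<sigma> * \<i> * cnj t0)" "\<lambda>z. of_real \<sigma> * \<i> * (jw \<gamma> z * cnj (jtheta z 0))" "\<lambda>z. cnj (jtheta z 0) / cnj t0"])
    show "continuous_on {z. 0 < \<sigma> * Re z \<and> 0 \<le> Im z \<and> norm z < r} (\<lambda>z. of_real \<sigma> * \<i> * (jw \<gamma> z * cnj (jtheta z 0)))"
      by (intro continuous_intros continuous_on_subset[OF jw_cont] continuous_on_subset[OF jtheta_0_cont]) auto
    show "continuous_on {z. 0 < \<sigma> * Re z \<and> 0 \<le> Im z \<and> norm z < r} (\<lambda>z. cnj (jtheta z 0) / cnj t0)"
      using t0 by (intro continuous_intros continuous_on_subset[OF jtheta_0_cont]) auto
    show "1 / (of_real \<sigma> * \<i> * cnj t0) \<noteq> 0" using t0 s by auto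
    fix z assume z: "0 < \<sigma> * Re z" "0 \<le> Im z" "norm z < r"
    have zc: "z \<in> upper_closed" using z by simp
    have "norm (cnj (jtheta z 0) - cnj t0) < norm t0"
      using r(2)[OF zc] z unfolding complex_cnj_diff[symmetric] complex_mod_cnj by (simp add: dist_norm t0_def)
    moreover have "cnj (jtheta z 0) / cnj t0 - 1 = (cnj (jtheta z 0) - cnj t0) / cnj t0" using t0 by (simp add: field_simps)
    ultimately have "norm (cnj (jtheta z 0) / cnj t0 - 1) < 1" using \<open>norm t0 > 0\<close> by (simp add: norm_divide divide_less_eq)
    then have f3: "0 < Re (cnj (jtheta z 0) / cnj t0)" using abs_Re_le_cmod[of "cnj (jtheta z 0) / cnj t0 - 1"] by (simp add: abs_le_iff)
    have I: "0 < \<sigma> * Im (jthetap z 0 * cnj (jtheta z 0))"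
    proof (cases "\<sigma> = 1")
      case True
      then have "0 < Re z / 4 * exp (- (2 * Im z * x_half))" using z by simp
      also have "\<dots> \<le> Im (jthetap z 0 * cnj (jtheta z 0))"
        using z True by (intro wronskian_Im_lower) auto
      finally show ?thesis using True by (simp del: times_complex.sel)
    next
      case False
      then have s1: "\<sigma> = -1" using s by simp
      have "0 < Re (- cnj z) / 4 * exp (- (2 * Im (- cnj z) * x_half))" using z s1 by (simp add: mult_neg_pos)
      also have "\<dots> \<le> Im (jthetap (- cnj z) 0 * cnj (jtheta (- cnj z) 0))"
        using z s1 by (intro wronskian_Im_lower) auto
      also have "\<dots> = Im (cnj (jthetap z 0 * cnj (jtheta z 0)))"
        using jtheta_cnj[OF order_refl zc] jthetap_cnj[OF order_refl zc] by simp
      also have "\<dots> = - Im (jthetap z 0 * cnj (jtheta z 0))" by (rule cnj.sel(2))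
      finally show ?thesis using s1 by (simp del: times_complex.sel)
    qed
    have "Re (of_real \<sigma> * \<i> * (jw \<gamma> z * cnj (jtheta z 0))) = - \<sigma> * Im (jw \<gamma> z * cnj (jtheta z 0))"
      by (simp add: algebra_simps)
    also have "\<dots> = \<sigma> * Im (jthetap z 0 * cnj (jtheta z 0))" unfolding jw_Im by (simp del: times_complex.sel)
    finally have f1: "0 < Re (of_real \<sigma> * \<i> * (jw \<gamma> z * cnj (jtheta z 0)))" using I by (simp only:)
    have "cnj (jtheta z 0) \<noteq> 0" using f3 by auto
    then have "jw \<gamma> z = 1 / (of_real \<sigma> * \<i> * cnj t0) * (of_real \<sigma> * \<i> * (jw \<gamma> z * cnj (jtheta z 0))) / (cnj (jtheta z 0) / cnj t0)"
      using t0 s by auto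
    then show "0 < Re (of_real \<sigma> * \<i> * (jw \<gamma> z * cnj (jtheta z 0))) \<and> 0 < Re (cnj (jtheta z 0) / cnj t0) \<and>
       jw \<gamma> z = 1 / (of_real \<sigma> * \<i> * cnj t0) * (of_real \<sigma> * \<i> * (jw \<gamma> z * cnj (jtheta z 0))) / (cnj (jtheta z 0) / cnj t0)"
      using f1 f3 by blast
  qed (use r in auto)
qed

definition blaschke_prod :: "real \<Rightarrow> complex \<Rightarrow> complex" where "blaschke_prod \<gamma> z = (\<Prod>\<kappa>\<in>jzeros \<gamma>. blaschke \<kappa> z)"

lemma blaschke_prod_0: "blaschke_prod \<gamma> 0 \<noteq> 0"
  unfolding blaschke_prod_def using finite_jzeros by (auto simp: blaschke_def jzeros_def)

lemma blaschke_prod_near_zero: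
  obtains r where "0 < r" "\<And>z. norm z < r \<Longrightarrow> norm (blaschke_prod \<gamma> z / blaschke_prod \<gamma> 0 - 1) < 1/2"
proof -
  have "isCont (\<lambda>z. blaschke_prod \<gamma> z / blaschke_prod \<gamma> 0) 0"
    unfolding blaschke_prod_def blaschke_def
  proof (intro continuous_intros)
    show "(\<Prod>\<kappa>\<in>jzeros \<gamma>. (0 + \<i> * of_real \<kappa>) / (0 - \<i> * of_real \<kappa>)) \<noteq> 0"
      using blaschke_prod_0[of \<gamma>] by (simp add: blaschke_prod_def blaschke_def)
    show "0 - \<i> * complex_of_real \<kappa> \<noteq> 0" if "\<kappa> \<in> jzeros \<gamma>" for \<kappa> using jzeros_pos[OF that] by simp
  qed
  then obtain r where "0 < r" "\<And>z. dist z 0 < r \<Longrightarrow> dist (blaschke_prod \<gamma> z / blaschke_prod \<gamma> 0) (blaschke_prod \<gamma> 0 / blaschke_prod \<gamma> 0) < 1/2"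
    unfolding continuous_at_eps_delta by (metis half_gt_zero zero_less_one)
  then show ?thesis using that[of r] blaschke_prod_0[of \<gamma>] by (simp add: dist_norm)
qed

lemma jost_log_Im_bounded_sector:
  assumes s: "\<sigma> = 1 \<or> \<sigma> = (-1::real)"
  obtains r M where "0 < r" "\<And>z. \<lbrakk>0 < \<sigma> * Re z; 0 \<le> Im z; norm z < r\<rbrakk> \<Longrightarrow> \<bar>Im (jost_log \<gamma> z)\<bar> \<le> M"
proof -
  obtain r1 c f1 f3 where r1: "0 < r1" "c \<noteq> 0"
    "continuous_on {z. 0 < \<sigma> * Re z \<and> 0 \<le> Im z \<and> norm z < r1} f1" "continuous_on {z. 0 < \<sigma> * Re z \<and> 0 \<le> Im z \<and> norm z < r1} f3"
    "\<And>z. \<lbrakk>0 < \<sigma> * Re z; 0 \<le> Im z; norm z < r1\<rbrakk> \<Longrightarrow> 0 < Re (f1 z) \<and> 0 < Re (f3 z) \<and> jw \<gamma> z = c * f1 z / f3 z"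
    by (rule jw_near_zero[OF s]) blast
  obtain r2 where r2: "0 < r2" "\<And>z. norm z < r2 \<Longrightarrow> norm (blaschke_prod \<gamma> z / blaschke_prod \<gamma> 0 - 1) < 1/2"
    by (rule blaschke_prod_near_zero) blast
  define r where "r = min r1 r2"
  define Q where "Q = {z. 0 < \<sigma> * Re z \<and> 0 \<le> Im z \<and> norm z < r}"
  have "convex Q"
  proof -
    have "Q = {z. 0 < \<sigma> * Re z} \<inter> upper_closed \<inter> ball 0 r" by (auto simp: Q_def)
    moreover have "{z. 0 < \<sigma> * Re z} = (if \<sigma> = 1 then {z. Re z > 0} else {z. Re z < 0})" using s by auto
    ultimately show ?thesis
      by (auto intro!: convex_Int convex_halfspace_Im_ge convex_halfspace_Re_gt convex_halfspace_Re_lt split: if_splits)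
  qed
  then have Qc: "connected Q" by (rule convex_connected)
  have Qr: "Q \<subseteq> {z. 0 < \<sigma> * Re z \<and> 0 \<le> Im z \<and> norm z < r1}" by (auto simp: Q_def r_def)
  have ss: "complex_of_real \<sigma> * (of_real \<sigma> * w) = w" for w using s by auto
  have QS: "Q \<subseteq> upper_closed - {0}" by (auto simp: Q_def)
  \<comment> \<open>The real part of the denominator z + i |\<gamma>| has the sign \<sigma>, hence
    the factor \<sigma>; this factor and the value of the Blaschke product at 0 are compensated in
    the constant.\<close>
  obtain M where M: "\<And>z. z \<in> Q \<Longrightarrow> \<bar>Im (jost_log \<gamma> z)\<bar> \<le> M"
  proof (rule Im_log_bounded[OF Qc, of "jost_log \<gamma>" f1 "\<lambda>z. blaschke_prod \<gamma> z / blaschke_prod \<gamma> 0" f3 "\<lambda>z. of_real \<sigma> * (z + \<i> * of_real \<bar>\<gamma>\<bar>)" "\<i> * c * blaschke_prod \<gamma> 0 * of_real \<sigma>"])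
    show "continuous_on Q (jost_log \<gamma>)" by (rule continuous_on_subset[OF jost_log(1) QS])
    show "continuous_on Q f1" "continuous_on Q f3" using r1(3,4) Qr continuous_on_subset by blast+
    show "continuous_on Q (\<lambda>z. blaschke_prod \<gamma> z / blaschke_prod \<gamma> 0)"
    proof (rule continuous_on_divide[OF _ continuous_on_const])
      show "continuous_on Q (blaschke_prod \<gamma>)"
        unfolding blaschke_prod_def blaschke_def
      proof (intro continuous_intros ballI)
        show "z - \<i> * complex_of_real \<kappa> \<noteq> 0" if "z \<in> Q" for z \<kappa>
        proof
          assume "z - \<i> * of_real \<kappa> = 0"
          then have "Re z = 0" by (simp add: complex_eq_iff)
          then show False using that by (simp add: Q_def)
        qed
      qed
    qed (use blaschke_prod_0 in auto)
    show "continuous_on Q (\<lambda>z. of_real \<sigma> * (z + \<i> * of_real \<bar>\<gamma>\<bar>))" by (intro continuous_intros)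
    show "\<i> * c * blaschke_prod \<gamma> 0 * of_real \<sigma> \<noteq> 0" using r1(2) blaschke_prod_0[of \<gamma>] s by auto
    fix z assume z: "z \<in> Q"
    then have zr: "0 < \<sigma> * Re z" "0 \<le> Im z" "norm z < r1" "norm z < r2" by (auto simp: Q_def r_def)
    have "0 < Re (blaschke_prod \<gamma> z / blaschke_prod \<gamma> 0)"
      using r2(2)[OF zr(4)] abs_Re_le_cmod[of "blaschke_prod \<gamma> z / blaschke_prod \<gamma> 0 - 1"] by (simp add: abs_le_iff)
    then show "0 < Re (f1 z) \<and> 0 < Re (blaschke_prod \<gamma> z / blaschke_prod \<gamma> 0) \<and> 0 < Re (f3 z) \<and> 0 < Re (of_real \<sigma> * (z + \<i> * of_real \<bar>\<gamma>\<bar>))"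
      using r1(5)[OF zr(1-3)] zr(1) by simp
    have zI: "z \<notin> imag_zeros \<gamma>" using zr(1) by (auto simp: imag_zeros_def)
    have "exp (jost_log \<gamma> z) = jost_outer \<gamma> z" using jost_log(3)[of z \<gamma>] zr(1,2) by fastforce
    also have "\<dots> = \<i> * jw \<gamma> z * blaschke_prod \<gamma> z / (z + \<i> * of_real \<bar>\<gamma>\<bar>)" using jost_outer_eq[of z \<gamma>] zI zr by (simp add: blaschke_prod_def)
    also have "\<dots> = (\<i> * c * blaschke_prod \<gamma> 0 * of_real \<sigma>) * f1 z * (blaschke_prod \<gamma> z / blaschke_prod \<gamma> 0) / (f3 z * (of_real \<sigma> * (z + \<i> * of_real \<bar>\<gamma>\<bar>)))"
    proof -
      have w: "jw \<gamma> z = c * f1 z / f3 z" using r1(5)[OF zr(1-3)] by blast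
      have alg: "i * (c' * f / g) * p / u = (i * c' * q * s') * f * (p / q) / (g * (s' * u))" if "q \<noteq> 0" "s' \<noteq> 0" for i c' f g p u q s' :: complex
        using that by simp
      show ?thesis unfolding w by (rule alg) (use blaschke_prod_0 s in auto)
    qed
    finally show "exp (jost_log \<gamma> z) = (\<i> * c * blaschke_prod \<gamma> 0 * of_real \<sigma>) * f1 z * (blaschke_prod \<gamma> z / blaschke_prod \<gamma> 0) / (f3 z * (of_real \<sigma> * (z + \<i> * of_real \<bar>\<gamma>\<bar>)))" .
  qed blast
  show ?thesis
    by (rule that[of r M]) (use M r1(1) r2(1) in \<open>auto simp: Q_def r_def\<close>)
qed

text \<open>Trades the logarithmic singularity for the integrable majorant that
  \<open>half_disc_cauchy_limit\<close> asks for.\<close>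

lemma ln_abs_le_inv_sqrt:
  assumes "0 < x" "x \<le> (1::real)" shows "\<bar>ln x\<bar> \<le> 2 / sqrt x"
proof -
  have "ln (inverse (sqrt x)) \<le> inverse (sqrt x)" using assms by (intro ln_le_minus_one[THEN order_trans]) auto
  moreover have "ln (inverse (sqrt x)) = - (ln x / 2)" using assms by (simp add: ln_inverse ln_sqrt)
  moreover have "ln x \<le> 0" using assms by simp
  ultimately show ?thesis by (simp add: inverse_eq_divide)
qed

text \<open>The real part is ln |\<open>jost_outer\<close>|, and this modulus lies between A1 |Re z|
  and A2 / |Re z|: the lower bound comes from \<open>jw_lower\<close>, the upper one from |z + i
  |\<gamma>|| \<ge> |Re z|, which also covers \<gamma> = 0. The imaginary part is bounded on each
  quarter-disc. The resulting bound involves Re z only, hence is uniform in the height.\<close>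

lemma jost_log_near_zero:
  obtains r A where "0 < r" "\<And>z. \<lbrakk>Re z \<noteq> 0; 0 \<le> Im z; norm z < r\<rbrakk> \<Longrightarrow> norm (jost_log \<gamma> z) \<le> A / sqrt \<bar>Re z\<bar>"
proof -
  obtain r1 M1 where r1: "0 < r1" "\<And>z. \<lbrakk>0 < 1 * Re z; 0 \<le> Im z; norm z < r1\<rbrakk> \<Longrightarrow> \<bar>Im (jost_log \<gamma> z)\<bar> \<le> M1"
    by (rule jost_log_Im_bounded_sector[of 1 \<gamma>]) auto
  obtain r2 M2 where r2: "0 < r2" "\<And>z. \<lbrakk>0 < -1 * Re z; 0 \<le> Im z; norm z < r2\<rbrakk> \<Longrightarrow> \<bar>Im (jost_log \<gamma> z)\<bar> \<le> M2"
    by (rule jost_log_Im_bounded_sector[of "-1" \<gamma>]) auto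
  obtain r3 where r3: "0 < r3" "\<And>z. norm z < r3 \<Longrightarrow> norm (blaschke_prod \<gamma> z / blaschke_prod \<gamma> 0 - 1) < 1/2"
    by (rule blaschke_prod_near_zero) blast
  obtain r4 where r4: "0 < r4" "\<And>z. z \<in> upper_closed \<Longrightarrow> dist z 0 < r4 \<Longrightarrow> dist (jw \<gamma> z) (jw \<gamma> 0) < 1"
    using jw_cont[of \<gamma>] unfolding continuous_on_iff by (metis (no_types, lifting) mem_Collect_eq order_refl zero_complex.sel(2) zero_less_one)
  define r where "r = min (min r1 r2) (min (min r3 r4) 1)"
  define p0 where "p0 = norm (blaschke_prod \<gamma> 0)"
  have p0: "0 < p0" using blaschke_prod_0 by (simp add: p0_def)
  define A2 where "A2 = (norm (jw \<gamma> 0) + 1) * (3/2 * p0)"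
  define A1 where "A1 = exp (- (2 * x_half)) / (4 * bnd) * (p0 / 2) / (1 + \<bar>\<gamma>\<bar>)"
  have A2: "0 < A2" unfolding A2_def using p0 by (intro mult_pos_pos add_nonneg_pos) auto
  have A1: "0 < A1" unfolding A1_def using p0 bnd_pos by (intro divide_pos_pos mult_pos_pos) auto
  define K where "K = \<bar>ln A1\<bar> + \<bar>ln A2\<bar> + \<bar>M1\<bar> + \<bar>M2\<bar>"
  have main: "norm (jost_log \<gamma> z) \<le> (K + 2) / sqrt \<bar>Re z\<bar>" if z: "Re z \<noteq> 0" "0 \<le> Im z" "norm z < r" for z
  proof -
    define k where "k = \<bar>Re z\<bar>"
    have zr: "norm z < r1" "norm z < r2" "norm z < r3" "norm z < r4" "norm z < 1" using z(3) by (auto simp: r_def)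
    have k: "0 < k" "k \<le> 1" using z(1) abs_Re_le_cmod[of z] zr by (auto simp: k_def)
    have Imz: "Im z \<le> 1" using abs_Im_le_cmod[of z] zr by linarith
    have zc: "z \<in> upper_closed" "z \<noteq> 0" using z by auto
    have zI: "z \<notin> imag_zeros \<gamma>" using z(1) by (auto simp: imag_zeros_def)
    have im: "\<bar>Im (jost_log \<gamma> z)\<bar> \<le> \<bar>M1\<bar> + \<bar>M2\<bar>"
      using r1(2)[of z] r2(2)[of z] z zr by (cases "0 < Re z") fastforce+
    have F: "norm (jost_outer \<gamma> z) = norm (jw \<gamma> z) * norm (blaschke_prod \<gamma> z) / norm (z + \<i> * of_real \<bar>\<gamma>\<bar>)"
      using jost_outer_eq[OF zc(1) zI] by (simp add: blaschke_prod_def norm_mult norm_divide)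
    have w1: "norm (jw \<gamma> z) \<le> norm (jw \<gamma> 0) + 1"
      using r4(2)[of z] zr zc norm_triangle_ineq2[of "jw \<gamma> z" "jw \<gamma> 0"] by (simp add: dist_norm)
    have w2: "exp (- (2 * x_half)) / (4 * bnd) * k \<le> norm (jw \<gamma> z)"
    proof -
      have "k / 4 * exp (- (2 * x_half)) \<le> k / 4 * exp (- (2 * Im z * x_half))"
        using k Imz x_half(1) by (intro mult_left_mono) (auto simp: mult_right_le_one_le mult_left_le_one_le z)
      also have "\<dots> \<le> bnd * norm (jw \<gamma> z)" using jw_lower[OF zc(1), of \<gamma>] by (simp add: k_def)
      finally show ?thesis using bnd_pos by (simp add: field_simps)
    qed
    have "norm (blaschke_prod \<gamma> z / blaschke_prod \<gamma> 0 - 1) < 1/2" using r3(2) zr by blast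
    moreover have "blaschke_prod \<gamma> z / blaschke_prod \<gamma> 0 - 1 = (blaschke_prod \<gamma> z - blaschke_prod \<gamma> 0) / blaschke_prod \<gamma> 0" using blaschke_prod_0[of \<gamma>] by (simp add: field_simps)
    ultimately have pd: "norm (blaschke_prod \<gamma> z - blaschke_prod \<gamma> 0) < p0 / 2"
      using p0 by (simp add: norm_divide p0_def divide_less_eq)
    have p1: "norm (blaschke_prod \<gamma> z) \<le> 3/2 * p0" and p2: "p0 / 2 \<le> norm (blaschke_prod \<gamma> z)"
      using pd norm_triangle_ineq2[of "blaschke_prod \<gamma> z" "blaschke_prod \<gamma> 0"] norm_triangle_ineq2[of "blaschke_prod \<gamma> 0" "blaschke_prod \<gamma> z"] norm_minus_commute[of "blaschke_prod \<gamma> 0" "blaschke_prod \<gamma> z"]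
      unfolding p0_def by linarith+
    have u1: "k \<le> norm (z + \<i> * of_real \<bar>\<gamma>\<bar>)" using abs_Re_le_cmod[of "z + \<i> * of_real \<bar>\<gamma>\<bar>"] by (simp add: k_def)
    have u2: "norm (z + \<i> * of_real \<bar>\<gamma>\<bar>) \<le> 1 + \<bar>\<gamma>\<bar>"
      using norm_triangle_ineq[of z "\<i> * of_real \<bar>\<gamma>\<bar>"] zr by (simp add: norm_mult)
    have up: "norm (jost_outer \<gamma> z) \<le> A2 / k"
      unfolding F A2_def using w1 p1 u1 k p0 by (intro frac_le mult_mono) (auto intro!: mult_nonneg_nonneg)
    have "(exp (- (2 * x_half)) / (4 * bnd) * k) * (p0 / 2) / (1 + \<bar>\<gamma>\<bar>) \<le> norm (jost_outer \<gamma> z)"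
      unfolding F using w2 p2 u1 u2 k p0 bnd_pos by (intro frac_le mult_mono) auto
    then have lo: "A1 * k \<le> norm (jost_outer \<gamma> z)" by (simp add: A1_def mult_ac)
    have Fpos: "0 < norm (jost_outer \<gamma> z)" using jost_outer_nonzero[of z \<gamma>] zc by simp
    have "ln (norm (jost_outer \<gamma> z)) \<le> ln (A2 / k)" using up Fpos A2 k by simp
    also have "\<dots> = ln A2 - ln k" using A2 k by (simp add: ln_div)
    finally have l1: "ln (norm (jost_outer \<gamma> z)) \<le> ln A2 - ln k" .
    have "ln (A1 * k) \<le> ln (norm (jost_outer \<gamma> z))" using lo Fpos A1 k by simp
    then have l2: "ln A1 + ln k \<le> ln (norm (jost_outer \<gamma> z))" using A1 k by (simp add: ln_mult)
    have "Re (jost_log \<gamma> z) = ln (norm (jost_outer \<gamma> z))" using jost_log(3)[OF zc, of \<gamma>] by simp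
    then have re: "\<bar>Re (jost_log \<gamma> z)\<bar> \<le> \<bar>ln A1\<bar> + \<bar>ln A2\<bar> + \<bar>ln k\<bar>" using l1 l2 by linarith
    have sq: "1 \<le> 1 / sqrt k" using k by simp
    have "norm (jost_log \<gamma> z) \<le> \<bar>Re (jost_log \<gamma> z)\<bar> + \<bar>Im (jost_log \<gamma> z)\<bar>" by (rule cmod_le)
    also have "\<dots> \<le> K + 2 / sqrt k" using re im ln_abs_le_inv_sqrt[OF k] unfolding K_def by linarith
    also have "\<dots> \<le> K * (1 / sqrt k) + 2 / sqrt k"
      using mult_left_mono[OF sq, of K] by (simp add: K_def)
    also have "\<dots> = (K + 2) / sqrt k" by (simp add: add_divide_distrib)
    finally show ?thesis by (simp add: k_def)
  qed
  have "0 < r" using r1(1) r2(1) r3(1) r4(1) by (simp add: r_def)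
  then show ?thesis using main by (rule that)
qed

lemma jost_log_strip_bound:
  assumes R: "0 < R"
  shows "\<exists>A. \<forall>k \<tau>. 0 < \<bar>k\<bar> \<longrightarrow> \<bar>k\<bar> \<le> R \<longrightarrow> 0 \<le> \<tau> \<longrightarrow> \<tau> \<le> 1 \<longrightarrow> norm (jost_log \<gamma> (of_real k + \<i> * of_real \<tau>)) \<le> A / sqrt \<bar>k\<bar>"
proof -
  obtain r A where r: "0 < r" "\<And>z. \<lbrakk>Re z \<noteq> 0; 0 \<le> Im z; norm z < r\<rbrakk> \<Longrightarrow> norm (jost_log \<gamma> z) \<le> A / sqrt \<bar>Re z\<bar>"
    by (rule jost_log_near_zero) blast
  define K where "K = upper_closed \<inter> (cball 0 (R + 1) \<inter> - ball (0::complex) r)"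
  have K: "compact K"
    unfolding K_def by (intro closed_Int_compact closed_halfspace_Im_ge compact_Int_closed compact_cball closed_Compl open_ball)
  have "continuous_on K (jost_log \<gamma>)" by (rule continuous_on_subset[OF jost_log(1)]) (use r(1) in \<open>auto simp: K_def\<close>)
  then have "bounded (jost_log \<gamma> ` K)" by (intro compact_imp_bounded compact_continuous_image K)
  then obtain M where "\<forall>y\<in>jost_log \<gamma> ` K. norm y \<le> M" by (auto simp only: bounded_iff)
  then have M: "norm (jost_log \<gamma> z) \<le> M" if "z \<in> K" for z using that by auto
  have "norm (jost_log \<gamma> (of_real k + \<i> * of_real \<tau>)) \<le> (\<bar>A\<bar> + \<bar>M\<bar> * sqrt R) / sqrt \<bar>k\<bar>"
    if k: "0 < \<bar>k\<bar>" "\<bar>k\<bar> \<le> R" "0 \<le> \<tau>" "\<tau> \<le> 1" for k \<tau>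
  proof -
    define z where "z = complex_of_real k + \<i> * of_real \<tau>"
    have zz: "Re z = k" "Im z = \<tau>" by (auto simp: z_def)
    show ?thesis
    proof (cases "norm z < r")
      case True
      have "norm (jost_log \<gamma> z) \<le> A / sqrt \<bar>k\<bar>" using r(2)[of z] True k zz by auto
      also have "\<dots> \<le> (\<bar>A\<bar> + \<bar>M\<bar> * sqrt R) / sqrt \<bar>k\<bar>" using R by (intro divide_right_mono) (auto intro: add_increasing2)
      finally show ?thesis by (simp add: z_def)
    next
      case False
      have "norm z \<le> R + 1" using cmod_le[of z] zz k by simp
      then have "z \<in> K" using False zz k by (auto simp: K_def)
      then have "norm (jost_log \<gamma> z) \<le> \<bar>M\<bar>" using M[of z] by simp
      moreover have "1 \<le> sqrt R / sqrt \<bar>k\<bar>" using k by simp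
      then have "\<bar>M\<bar> * 1 \<le> \<bar>M\<bar> * (sqrt R / sqrt \<bar>k\<bar>)" by (intro mult_left_mono) auto
      ultimately have "norm (jost_log \<gamma> z) \<le> (\<bar>M\<bar> * sqrt R) / sqrt \<bar>k\<bar>" by simp
      also have "\<dots> \<le> (\<bar>A\<bar> + \<bar>M\<bar> * sqrt R) / sqrt \<bar>k\<bar>" by (intro divide_right_mono) auto
      finally show ?thesis by (simp add: z_def)
    qed
  qed
  then show ?thesis by blast
qed

end

section \<open>Limit amplitude and limit phase\<close>

text \<open>On the positive half-line a Blaschke factor is unimodular, and 2 arctan (a / k) is the
  branch of its argument that vanishes at infinity.\<close>

lemma cis_2_arctan: "cis (2 * arctan (a / k)) = blaschke a (of_real k)" if "0 < k"
proof -
  define t where "t = a / k"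
  have s: "0 < 1 + t\<^sup>2" by (simp add: add_pos_nonneg)
  have c: "cis (arctan t) = (1 + \<i> * of_real t) / of_real (sqrt (1 + t\<^sup>2))"
    by (simp add: complex_eq_iff cos_arctan sin_arctan)
  have "cis (2 * arctan t) = (cis (arctan t))\<^sup>2" by (simp add: cis_mult power2_eq_square)
  also have "\<dots> = (1 + \<i> * of_real t)\<^sup>2 / of_real (1 + t\<^sup>2)"
    unfolding c power_divide of_real_power[symmetric] using s by simp
  also have "complex_of_real (1 + t\<^sup>2) = (1 + \<i> * of_real t) * (1 - \<i> * of_real t)"
    by (simp add: algebra_simps power2_eq_square)
  finally have c2: "cis (2 * arctan t) = (1 + \<i> * of_real t)\<^sup>2 / ((1 + \<i> * of_real t) * (1 - \<i> * of_real t))" .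
  have nz1: "1 + \<i> * complex_of_real t \<noteq> 0" "1 - \<i> * complex_of_real t \<noteq> 0" by (auto simp: complex_eq_iff)
  have alg: "u\<^sup>2 / (u * v) * v = u" if "u \<noteq> 0" "v \<noteq> 0" for u v :: complex
    using that by (simp add: power2_eq_square)
  have "cis (2 * arctan t) * (1 - \<i> * of_real t) = 1 + \<i> * of_real t"
    unfolding c2 by (rule alg[OF nz1])
  then have e: "cis (2 * arctan t) * (of_real k * (1 - \<i> * of_real t)) = of_real k * (1 + \<i> * of_real t)"
    by (simp add: mult_ac)
  have kt: "complex_of_real k * of_real t = of_real a" using that by (simp add: t_def)
  have nz: "of_real k - \<i> * of_real a \<noteq> 0" using that by (auto simp: complex_eq_iff)
  have "cis (2 * arctan t) * (of_real k - \<i> * of_real a) = of_real k + \<i> * of_real a"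
    using e kt by (simp add: algebra_simps)
  then show ?thesis using nz unfolding blaschke_def t_def[symmetric] by (simp add: eq_divide_eq)
qed

lemma sum_odd_zero: "(\<And>j. T (2 * j + 1) = 0) \<Longrightarrow> (\<Sum>j=1..2*n. T j) = (\<Sum>j=1..n. T (2 * j))" for T :: "nat \<Rightarrow> 'a::comm_monoid_add"
  by (induction n) (auto simp: ac_simps)

lemma sum_even_zero: "(\<And>j. T (2 * j) = 0) \<Longrightarrow> (\<Sum>j=1..2*n+1. T j) = (\<Sum>j=0..n. T (2 * j + 1))" for T :: "nat \<Rightarrow> 'a::comm_monoid_add"
proof (induction n)
  case (Suc n)
  have "(\<Sum>j=1..2*Suc n+1. T j) = (\<Sum>j=1..2*n+1. T j) + T (2 * Suc n) + T (2 * Suc n + 1)" by simp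
  also have "\<dots> = (\<Sum>j=0..n. T (2 * j + 1)) + T (2 * Suc n + 1)"
    unfolding Suc.IH[OF Suc.prems] Suc.prems by simp
  finally show ?case by simp
qed simp

text \<open>On the real line even powers are real and odd powers imaginary, so the even coefficients
  govern ln a and the odd ones the phase.\<close>

lemma inverse_2i_power:
  "inverse (2 * \<i> * of_real x) ^ (2 * j) = of_real ((-1) ^ j / (2 * x) ^ (2 * j))"
  "inverse (2 * \<i> * of_real x) ^ (2 * j + 1) = \<i> * of_real ((-1) ^ (j + 1) / (2 * x) ^ (2 * j + 1))"
proof -
  define c where "c = 1 / (2 * x)"
  have i: "inverse (2 * \<i> * of_real x) = - (\<i> * of_real c)"
  proof (cases "x = 0")
    case False
    have "2 * \<i> * of_real x * - (\<i> * of_real c) = - (\<i> * \<i>) * of_real (2 * x * c)"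
      by (simp only: of_real_mult of_real_numeral mult_minus_right mult_minus_left mult_ac)
    also have "\<dots> = 1" using False by (simp add: c_def)
    finally show ?thesis by (rule inverse_unique)
  qed (simp add: c_def)
  have e: "inverse (2 * \<i> * of_real x) ^ 2 = of_real (- 1 * c\<^sup>2)"
    unfolding i by (simp add: power_mult_distrib)
  have c: "c ^ j = 1 / (2 * x) ^ j" for j unfolding c_def by (rule power_one_over)
  have 1: "inverse (2 * \<i> * of_real x) ^ (2 * j) = of_real ((-1) ^ j / (2 * x) ^ (2 * j))"
  proof -
    have "(- 1 * c\<^sup>2) ^ j = (-1) ^ j * (c\<^sup>2) ^ j" by (rule power_mult_distrib)
    also have "(c\<^sup>2) ^ j = c ^ (2 * j)" by (rule power_mult[symmetric])
    also have "\<dots> = 1 / (2 * x) ^ (2 * j)" by (rule c)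
    finally have "(- 1 * c\<^sup>2) ^ j = (-1) ^ j / (2 * x) ^ (2 * j)" by simp
    then show ?thesis unfolding power_mult[of "inverse (2 * \<i> * of_real x)"] e of_real_power[symmetric] by (rule arg_cong)
  qed
  then show "inverse (2 * \<i> * of_real x) ^ (2 * j) = of_real ((-1) ^ j / (2 * x) ^ (2 * j))" .
  have "inverse (2 * \<i> * of_real x) ^ (2 * j + 1) = of_real ((-1) ^ j / (2 * x) ^ (2 * j)) * (- (\<i> * of_real c))"
    unfolding power_add 1 unfolding i by simp
  also have "\<dots> = \<i> * of_real ((-1) ^ j / (2 * x) ^ (2 * j) * - c)"
    by (simp only: of_real_mult of_real_minus mult_minus_right mult_minus_left mult_ac)
  also have "(-1) ^ j / (2 * x) ^ (2 * j) * - c = (-1) ^ (j + 1) / (2 * x) ^ (2 * j + 1)" by (simp add: c_def)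
  finally show "inverse (2 * \<i> * of_real x) ^ (2 * j + 1) = \<i> * of_real ((-1) ^ (j + 1) / (2 * x) ^ (2 * j + 1))" .
qed

context smooth_potential
begin

lemma blaschke_real:
  assumes "0 < k" shows "norm (blaschke a (of_real k)) = 1" "blaschke a (of_real k) \<noteq> 0"
proof -
  show "norm (blaschke a (of_real k)) = 1" unfolding cis_2_arctan[OF assms, symmetric] by simp
  then show "blaschke a (of_real k) \<noteq> 0" by auto
qed

lemma jost_outer_real:
  "0 < k \<Longrightarrow> jost_outer \<gamma> (of_real k) = \<i> * jw \<gamma> (of_real k) * (\<Prod>\<kappa>\<in>jzeros \<gamma>. blaschke \<kappa> (of_real k)) / (of_real k + \<i> * of_real \<bar>\<gamma>\<bar>)"
  by (simp add: jost_outer_def)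

lemma limit_amplitude_eq:
  assumes k: "0 < k" shows "limit_amplitude V \<gamma> k = exp (Re (jost_log \<gamma> (of_real k)))"
proof -
  have "exp (Re (jost_log \<gamma> (of_real k))) = norm (exp (jost_log \<gamma> (of_real k)))" by simp
  also have "exp (jost_log \<gamma> (of_real k)) = jost_outer \<gamma> (of_real k)" using jost_log(3)[of "of_real k" \<gamma>] k by simp
  also have "norm \<dots> = norm (jw \<gamma> (of_real k)) / norm (of_real k + \<i> * of_real \<bar>\<gamma>\<bar>)"
    unfolding jost_outer_real[OF k] by (simp add: norm_mult norm_divide prod_norm[symmetric] blaschke_real[OF k])
  also have "norm (of_real k + \<i> * of_real \<bar>\<gamma>\<bar>) = sqrt (\<gamma>\<^sup>2 + k\<^sup>2)" by (simp add: cmod_def add.commute)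
  finally show ?thesis by (simp add: limit_amplitude_def jost_function_eq[OF k])
qed

text \<open>The explicit candidate for \<open>limit_phase\<close>: the argument of the outer factor
  with the arguments of the Blaschke factors taken back. Every summand is continuous for k > 0 and
  vanishes at infinity, so no multiple of 2 pi is left undetermined.\<close>

definition phase :: "real \<Rightarrow> real \<Rightarrow> real" where
  "phase \<gamma> k = (if k \<le> 0 then 0 else
     Im (jost_log \<gamma> (of_real k)) - (\<Sum>\<kappa>\<in>jzeros \<gamma>. 2 * arctan (\<kappa> / k)) + (if \<gamma> < 0 then 2 * arctan (\<bar>\<gamma>\<bar> / k) else 0))"

lemma phase_works:
  assumes k: "0 < k"
  shows "jost_function V \<gamma> (of_real k) = of_real (limit_amplitude V \<gamma> k) * exp (\<i> * of_real (phase \<gamma> k)) * (of_real \<gamma> - \<i> * of_real k)"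
proof -
  let ?B = "if \<gamma> < 0 then blaschke \<bar>\<gamma>\<bar> (of_real k) else 1"
  let ?P = "\<Prod>\<kappa>\<in>jzeros \<gamma>. blaschke \<kappa> (of_real k)"
  have P: "?P \<noteq> 0" using blaschke_real[OF k] finite_jzeros by simp
  have n: "of_real k + \<i> * of_real \<bar>\<gamma>\<bar> \<noteq> 0" "of_real k - \<i> * of_real \<bar>\<gamma>\<bar> \<noteq> 0"
    using k by (auto simp: complex_eq_iff)
  have "exp (\<i> * of_real (\<Sum>\<kappa>\<in>jzeros \<gamma>. 2 * arctan (\<kappa> / k))) = (\<Prod>\<kappa>\<in>jzeros \<gamma>. exp (\<i> * of_real (2 * arctan (\<kappa> / k))))"
    unfolding of_real_sum sum_distrib_left by (rule exp_sum[OF finite_jzeros])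
  also have "\<dots> = ?P" by (rule prod.cong[OF refl]) (use cis_2_arctan[OF k] in \<open>simp only: cis_conv_exp\<close>)
  finally have S: "exp (\<i> * of_real (\<Sum>\<kappa>\<in>jzeros \<gamma>. 2 * arctan (\<kappa> / k))) = ?P" .
  have M: "exp (\<i> * of_real (if \<gamma> < 0 then 2 * arctan (\<bar>\<gamma>\<bar> / k) else 0)) = ?B"
  proof (cases "\<gamma> < 0")
    case True
    then show ?thesis using cis_2_arctan[OF k, of "\<bar>\<gamma>\<bar>"] by (simp only: if_True cis_conv_exp)
  qed simp
  have "of_real (limit_amplitude V \<gamma> k) * exp (\<i> * of_real (phase \<gamma> k))
     = exp (of_real (Re (jost_log \<gamma> (of_real k))) + \<i> * of_real (Im (jost_log \<gamma> (of_real k)))) / ?P * ?B"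
    unfolding limit_amplitude_eq[OF k] S[symmetric] M[symmetric] exp_of_real[symmetric] exp_diff[symmetric] exp_add[symmetric]
    using k by (simp add: phase_def algebra_simps)
  also have "of_real (Re (jost_log \<gamma> (of_real k))) + \<i> * of_real (Im (jost_log \<gamma> (of_real k))) = jost_log \<gamma> (of_real k)"
    by (rule complex_eq[symmetric])
  also have "exp (jost_log \<gamma> (of_real k)) = jost_outer \<gamma> (of_real k)" using jost_log(3)[of "of_real k" \<gamma>] k by simp
  also have "jost_outer \<gamma> (of_real k) / ?P = \<i> * jw \<gamma> (of_real k) / (of_real k + \<i> * of_real \<bar>\<gamma>\<bar>)"
    unfolding jost_outer_real[OF k] using P by simp
  finally have a: "of_real (limit_amplitude V \<gamma> k) * exp (\<i> * of_real (phase \<gamma> k)) = \<i> * jw \<gamma> (of_real k) / (of_real k + \<i> * of_real \<bar>\<gamma>\<bar>) * ?B" .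
  have b: "?B * (of_real \<gamma> - \<i> * of_real k) = - \<i> * (of_real k + \<i> * of_real \<bar>\<gamma>\<bar>)"
  proof (cases "\<gamma> < 0")
    case True
    then have "of_real \<gamma> - \<i> * of_real k = - \<i> * (of_real k - \<i> * of_real \<bar>\<gamma>\<bar>)" by (simp add: algebra_simps)
    then show ?thesis using True n by (simp add: blaschke_def)
  qed (simp add: algebra_simps)
  have "of_real (limit_amplitude V \<gamma> k) * exp (\<i> * of_real (phase \<gamma> k)) * (of_real \<gamma> - \<i> * of_real k)
    = \<i> * jw \<gamma> (of_real k) / (of_real k + \<i> * of_real \<bar>\<gamma>\<bar>) * (?B * (of_real \<gamma> - \<i> * of_real k))"
    unfolding a by (simp only: mult.assoc)
  also have "\<dots> = jw \<gamma> (of_real k)"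
  proof -
    have "\<i> * w / d * (- \<i> * d) = w" if "d \<noteq> 0" for w d :: complex
    proof -
      have "\<i> * w / d * (- \<i> * d) = - (\<i> * \<i>) * w * (d / d)"
        by (simp only: divide_inverse mult_ac mult_minus_left mult_minus_right)
      then show ?thesis using that by simp
    qed
    then show ?thesis unfolding b using n(1) by blast
  qed
  finally show ?thesis by (simp add: jost_function_eq[OF k])
qed

lemma phase_cont: "continuous_on {0<..} (phase \<gamma>)"
proof -
  have "continuous_on {0<..} (\<lambda>k. Im (jost_log \<gamma> (of_real k)) - (\<Sum>\<kappa>\<in>jzeros \<gamma>. 2 * arctan (\<kappa> / k)) + (if \<gamma> < 0 then 2 * arctan (\<bar>\<gamma>\<bar> / k) else 0))"
  proof (cases "\<gamma> < 0")
    case True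
    then show ?thesis by (simp only: if_True) (intro continuous_intros continuous_on_compose2[OF jost_log(1)], auto)
  next
    case False
    then show ?thesis by (simp only: if_False) (intro continuous_intros continuous_on_compose2[OF jost_log(1)], auto)
  qed
  then show ?thesis by (rule continuous_on_eq) (simp add: phase_def)
qed

lemma phase_tendsto: "(phase \<gamma> \<longlongrightarrow> 0) at_top"
proof -
  obtain C R where C: "0 < R" "\<And>z. 0 \<le> Im z \<Longrightarrow> R \<le> norm z \<Longrightarrow> norm (jost_log \<gamma> z) \<le> C / norm z"
    using jost_log_expansion[of \<gamma> 0] by auto
  have id: "((\<lambda>x. c / x) \<longlongrightarrow> 0) at_top" for c :: real
    by (intro tendsto_divide_0[OF tendsto_const] filterlim_at_top_imp_at_infinity filterlim_ident)
  have G: "((\<lambda>k. Im (jost_log \<gamma> (of_real k))) \<longlongrightarrow> 0) at_top"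
  proof (rule Lim_null_comparison[OF _ id[of C]])
    show "\<forall>\<^sub>F k in at_top. norm (Im (jost_log \<gamma> (of_real k))) \<le> C / k"
      using eventually_ge_at_top[of R]
    proof eventually_elim
      case (elim k)
      then have "norm (jost_log \<gamma> (of_real k)) \<le> C / k" using C(2)[of "of_real k"] C(1) by simp
      then show ?case using abs_Im_le_cmod[of "jost_log \<gamma> (of_real k)"] by simp
    qed
  qed
  have a: "((\<lambda>k. 2 * arctan (c / k)) \<longlongrightarrow> 0) at_top" for c
    using tendsto_mult[OF tendsto_const[of 2] tendsto_arctan[OF id[of c]]] by simp
  have "((\<lambda>k. Im (jost_log \<gamma> (of_real k)) - (\<Sum>\<kappa>\<in>jzeros \<gamma>. 2 * arctan (\<kappa> / k)) + (if \<gamma> < 0 then 2 * arctan (\<bar>\<gamma>\<bar> / k) else 0)) \<longlongrightarrow> 0 - (\<Sum>\<kappa>\<in>jzeros \<gamma>. 0) + 0) at_top"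
  proof (cases "\<gamma> < 0")
    case True
    then show ?thesis by (simp only: if_True) (intro tendsto_add tendsto_diff tendsto_sum G a)
  next
    case False
    then show ?thesis by (simp only: if_False) (intro tendsto_add tendsto_diff tendsto_sum G a tendsto_const)
  qed
  then have "((\<lambda>k. Im (jost_log \<gamma> (of_real k)) - (\<Sum>\<kappa>\<in>jzeros \<gamma>. 2 * arctan (\<kappa> / k)) + (if \<gamma> < 0 then 2 * arctan (\<bar>\<gamma>\<bar> / k) else 0)) \<longlongrightarrow> 0) at_top" by simp
  then show ?thesis
    by (rule Lim_transform_eventually) (use eventually_gt_at_top[of 0] in eventually_elim, simp add: phase_def)
qed

lemma limit_phase_eq: "limit_phase V \<gamma> = phase \<gamma>"
  unfolding limit_phase_def
proof (rule the_equality)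
  show "continuous_on {0<..} (phase \<gamma>) \<and> (phase \<gamma> \<longlongrightarrow> 0) at_top \<and>
     (\<forall>k>0. jost_function V \<gamma> (of_real k) = of_real (limit_amplitude V \<gamma> k) * exp (\<i> * of_real (phase \<gamma> k)) * (of_real \<gamma> - \<i> * of_real k)) \<and>
     (\<forall>k\<le>0. phase \<gamma> k = 0)"
    using phase_cont phase_tendsto phase_works by (simp add: phase_def)
next
  fix \<eta> assume h: "continuous_on {0<..} \<eta> \<and> (\<eta> \<longlongrightarrow> 0) at_top \<and>
     (\<forall>k>0. jost_function V \<gamma> (of_real k) = of_real (limit_amplitude V \<gamma> k) * exp (\<i> * of_real (\<eta> k)) * (of_real \<gamma> - \<i> * of_real k)) \<and>
     (\<forall>k\<le>0. \<eta> k = 0)"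
  define D where "D k = \<i> * of_real (\<eta> k - phase \<gamma> k)" for k
  have "continuous_on {0<..} D" unfolding D_def using h phase_cont by (intro continuous_intros) auto
  moreover have "exp (D k) = 1" if "k \<in> {0<..}" for k
  proof -
    have k: "0 < k" using that by simp
    have n: "of_real \<gamma> - \<i> * of_real k \<noteq> 0" using k by (auto simp: complex_eq_iff)
    have a: "complex_of_real (limit_amplitude V \<gamma> k) \<noteq> 0" by (simp add: limit_amplitude_eq[OF k])
    have "of_real (limit_amplitude V \<gamma> k) * exp (\<i> * of_real (\<eta> k)) * (of_real \<gamma> - \<i> * of_real k)
      = of_real (limit_amplitude V \<gamma> k) * exp (\<i> * of_real (phase \<gamma> k)) * (of_real \<gamma> - \<i> * of_real k)"
      using h k phase_works[OF k] by metis
    then have "exp (\<i> * of_real (\<eta> k)) = exp (\<i> * of_real (phase \<gamma> k))" using k a by auto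
    then show ?thesis by (simp add: D_def right_diff_distrib exp_diff)
  qed
  ultimately obtain c where c: "\<And>k. k \<in> {0<..} \<Longrightarrow> D k = c"
    using exp_eq_1_const[of "{0<..}" D] by (metis connected_Ioi)
  have "((\<lambda>k. \<eta> k - phase \<gamma> k) \<longlongrightarrow> 0 - 0) at_top" using h phase_tendsto by (intro tendsto_diff) auto
  moreover have "\<forall>\<^sub>F k in at_top. \<eta> k - phase \<gamma> k = Im c"
    using eventually_gt_at_top[of 0]
  proof eventually_elim
    case (elim k) then show ?case using c[of k] by (auto simp: D_def)
  qed
  ultimately have "((\<lambda>k::real. Im c) \<longlongrightarrow> 0) at_top" using Lim_transform_eventually by fastforce
  then have "Im c = 0" by (simp add: tendsto_const_iff)
  then have "\<eta> k = phase \<gamma> k" if "0 < k" for k using c[of k] that by (auto simp: D_def)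
  moreover have "\<eta> k = phase \<gamma> k" if "\<not> 0 < k" for k using h that by (simp add: phase_def)
  ultimately show "\<eta> = phase \<gamma>" by blast
qed

section \<open>Moments of the logarithm and the trace identities\<close>

text \<open>Subtracting the terms of order less than \<open>m\<close> leaves \<open>z * log_moment \<gamma> m z\<close> convergent at infinity.\<close>

definition log_moment :: "real \<Rightarrow> nat \<Rightarrow> complex \<Rightarrow> complex" where
  "log_moment \<gamma> m z = z ^ (m - 1) * (jost_log \<gamma> z - (\<Sum>j=1..m-1. of_real (log_coeff \<gamma> j) * inverse (2 * \<i> * z) ^ j))"

text \<open>Multiplication by z^(m - 1) turns the subtracted negative powers into nonnegative ones,
  which are bounded on the strip; the singularity at 0 is that of \<open>jost_log\<close>.\<close>

lemma log_moment_strip_bound: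
  assumes R: "0 < R"
  shows "\<exists>A. \<forall>k \<tau>. 0 < \<bar>k\<bar> \<longrightarrow> \<bar>k\<bar> \<le> R \<longrightarrow> 0 \<le> \<tau> \<longrightarrow> \<tau> \<le> 1 \<longrightarrow> norm (log_moment \<gamma> m (of_real k + \<i> * of_real \<tau>)) \<le> A / sqrt \<bar>k\<bar>"
proof -
  obtain A where A: "\<And>k \<tau>. \<lbrakk>0 < \<bar>k\<bar>; \<bar>k\<bar> \<le> R; 0 \<le> \<tau>; \<tau> \<le> 1\<rbrakk> \<Longrightarrow> norm (jost_log \<gamma> (of_real k + \<i> * of_real \<tau>)) \<le> A / sqrt \<bar>k\<bar>"
    using jost_log_strip_bound[OF R, of \<gamma>] by metis
  define S where "S = R + 1"
  have S: "1 \<le> S" using R by (simp add: S_def)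
  define B where "B = (\<Sum>j=1..m-1. \<bar>log_coeff \<gamma> j\<bar> * S ^ (m - 1 - j))"
  have B: "0 \<le> B" unfolding B_def using S by (intro sum_nonneg) auto
  have "norm (log_moment \<gamma> m (of_real k + \<i> * of_real \<tau>)) \<le> (S ^ (m - 1) * A + B * sqrt R) / sqrt \<bar>k\<bar>"
    if k: "0 < \<bar>k\<bar>" "\<bar>k\<bar> \<le> R" "0 \<le> \<tau>" "\<tau> \<le> 1" for k \<tau>
  proof -
    define z where "z = complex_of_real k + \<i> * of_real \<tau>"
    have zz: "Re z = k" "Im z = \<tau>" by (auto simp: z_def)
    then have z0: "z \<noteq> 0" using k by auto
    have zS: "norm z \<le> S" using cmod_le[of z] zz k by (simp add: S_def)
    have "norm (\<Sum>j=1..m-1. of_real (log_coeff \<gamma> j) * (z ^ (m - 1) * inverse (2 * \<i> * z) ^ j)) \<le> B"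
      unfolding B_def
    proof (rule sum_norm_le)
      fix j assume j: "j \<in> {1..m-1}"
      then have "j \<le> m - 1" by simp
      then have "m - 1 = (m - 1 - j) + j" by (rule le_add_diff_inverse2[symmetric])
      then have "z ^ (m - 1) = z ^ (m - 1 - j) * z ^ j" by (metis power_add)
      then have "z ^ (m - 1) * inverse (2 * \<i> * z) ^ j = z ^ (m - 1 - j) * (z * inverse (2 * \<i> * z)) ^ j"
        by (simp only: power_mult_distrib mult.assoc)
      also have "z * inverse (2 * \<i> * z) = inverse (2 * \<i>)" using z0 by simp
      finally have "norm (z ^ (m - 1) * inverse (2 * \<i> * z) ^ j) = norm z ^ (m - 1 - j) * (1/2) ^ j"
        by (simp only: norm_mult norm_power) (simp add: norm_divide)
      also have "\<dots> \<le> S ^ (m - 1 - j) * 1" using zS S by (intro mult_mono power_mono power_le_one) auto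
      finally show "norm (of_real (log_coeff \<gamma> j) * (z ^ (m - 1) * inverse (2 * \<i> * z) ^ j)) \<le> \<bar>log_coeff \<gamma> j\<bar> * S ^ (m - 1 - j)"
        by (subst norm_mult) (simp add: mult_left_mono)
    qed
    also have "B = B * 1" by simp
    also have "\<dots> \<le> B * (sqrt R / sqrt \<bar>k\<bar>)" using k B by (intro mult_left_mono) auto
    finally have b: "norm (\<Sum>j=1..m-1. of_real (log_coeff \<gamma> j) * (z ^ (m - 1) * inverse (2 * \<i> * z) ^ j)) \<le> B * sqrt R / sqrt \<bar>k\<bar>" by simp
    have "norm (z ^ (m - 1) * jost_log \<gamma> z) \<le> S ^ (m - 1) * (A / sqrt \<bar>k\<bar>)"
      unfolding norm_mult norm_power using zS A[OF k] S by (intro mult_mono power_mono) (auto simp: z_def)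
    moreover have e: "log_moment \<gamma> m z = z ^ (m - 1) * jost_log \<gamma> z - (\<Sum>j=1..m-1. of_real (log_coeff \<gamma> j) * (z ^ (m - 1) * inverse (2 * \<i> * z) ^ j))"
      by (simp add: log_moment_def right_diff_distrib sum_distrib_left mult_ac del: inverse_mult_distrib)
    ultimately have "norm (log_moment \<gamma> m z) \<le> S ^ (m - 1) * (A / sqrt \<bar>k\<bar>) + B * sqrt R / sqrt \<bar>k\<bar>"
      unfolding e using b norm_triangle_ineq4[of "z ^ (m - 1) * jost_log \<gamma> z" "\<Sum>j=1..m-1. of_real (log_coeff \<gamma> j) * (z ^ (m - 1) * inverse (2 * \<i> * z) ^ j)"] by linarith
    then show ?thesis by (simp add: z_def add_divide_distrib)
  qed
  then show ?thesis by blast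
qed

text \<open>The expansion is used one order beyond the subtraction: its m-th term supplies the
  limit, and the remainder of order |z|^(- m - 1), multiplied by z^m, is of order 1 / |z|.\<close>

lemma log_moment_infinity:
  assumes m: "1 \<le> m"
  shows "\<exists>C R. \<forall>z. 0 \<le> Im z \<longrightarrow> R \<le> norm z \<longrightarrow> norm (z * log_moment \<gamma> m z - of_real (log_coeff \<gamma> m) * inverse (2 * \<i>) ^ m) \<le> C / norm z"
proof -
  obtain C R where C: "0 < R" "\<And>z. 0 \<le> Im z \<Longrightarrow> R \<le> norm z \<Longrightarrow>
     norm (jost_log \<gamma> z - (\<Sum>j=1..m. of_real (log_coeff \<gamma> j) * inverse (2 * \<i> * z) ^ j)) \<le> C / norm z ^ Suc m"
    using jost_log_expansion[of \<gamma> m] by blast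
  have "norm (z * log_moment \<gamma> m z - of_real (log_coeff \<gamma> m) * inverse (2 * \<i>) ^ m) \<le> C / norm z" if z: "0 \<le> Im z" "R \<le> norm z" for z
  proof -
    have z0: "z \<noteq> 0" using z C(1) by auto
    obtain p where p: "m = Suc p" using m by (cases m) auto
    have "z ^ m * inverse (2 * \<i> * z) ^ m = (z * inverse (2 * \<i> * z)) ^ m" by (simp only: power_mult_distrib)
    also have "z * inverse (2 * \<i> * z) = inverse (2 * \<i>)" using z0 by simp
    finally have c: "of_real (log_coeff \<gamma> m) * inverse (2 * \<i>) ^ m = z ^ m * (of_real (log_coeff \<gamma> m) * inverse (2 * \<i> * z) ^ m)" by simp
    have e1: "z * log_moment \<gamma> m z = z ^ m * (jost_log \<gamma> z - (\<Sum>j=1..p. of_real (log_coeff \<gamma> j) * inverse (2 * \<i> * z) ^ j))"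
      unfolding log_moment_def p by (simp only: power_Suc mult.assoc diff_Suc_1)
    have e2: "(\<Sum>j=1..m. of_real (log_coeff \<gamma> j) * inverse (2 * \<i> * z) ^ j) = (\<Sum>j=1..p. of_real (log_coeff \<gamma> j) * inverse (2 * \<i> * z) ^ j) + of_real (log_coeff \<gamma> m) * inverse (2 * \<i> * z) ^ m"
      unfolding p by simp
    have e3: "z * log_moment \<gamma> m z - of_real (log_coeff \<gamma> m) * inverse (2 * \<i>) ^ m = z ^ m * (jost_log \<gamma> z - (\<Sum>j=1..m. of_real (log_coeff \<gamma> j) * inverse (2 * \<i> * z) ^ j))"
      unfolding c e1 e2 by (simp only: right_diff_distrib distrib_left diff_diff_eq)
    have "norm (z * log_moment \<gamma> m z - of_real (log_coeff \<gamma> m) * inverse (2 * \<i>) ^ m) \<le> norm z ^ m * (C / norm z ^ Suc m)"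
      unfolding e3 norm_mult norm_power by (intro mult_left_mono C(2)[OF z]) simp
    also have "\<dots> = C / norm z" using z0 by simp
    finally show ?thesis .
  qed
  then show ?thesis by blast
qed

text \<open>The sign decides what the sum of the values at x and - x extracts: twice the real part
  for odd m, 2 i times the imaginary part for even m.\<close>

lemma log_moment_minus:
  assumes "0 < x" shows "log_moment \<gamma> m (- of_real x) = (-1) ^ (m - 1) * cnj (log_moment \<gamma> m (of_real x))"
proof -
  have "inverse (2 * \<i> * - complex_of_real x) = cnj (inverse (2 * \<i> * of_real x))" by simp
  then have "(\<Sum>j=1..m-1. of_real (log_coeff \<gamma> j) * inverse (2 * \<i> * - of_real x) ^ j) = cnj (\<Sum>j=1..m-1. of_real (log_coeff \<gamma> j) * inverse (2 * \<i> * of_real x) ^ j)"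
    by (simp only: cnj_sum complex_cnj_mult complex_cnj_power complex_cnj_complex_of_real)
  moreover have "(- complex_of_real x) ^ (m - 1) = (-1) ^ (m - 1) * of_real x ^ (m - 1)" by (rule power_minus)
  ultimately show ?thesis unfolding log_moment_def jost_log_cnj_real[OF assms]
    by (simp only: complex_cnj_diff complex_cnj_mult complex_cnj_power complex_cnj_complex_of_real mult.assoc)
qed

lemma log_moment_integral:
  fixes q :: "real \<Rightarrow> real"
  assumes m: "1 \<le> m" and s: "s \<noteq> 0"
    and sym: "\<And>x. 0 < x \<Longrightarrow> log_moment \<gamma> m (of_real x) + log_moment \<gamma> m (- of_real x) = s * of_real (q x)"
  shows "set_integrable lborel {0<..} q"
    "s * of_real (LINT x:{0<..}|lborel. q x) = - (\<i> * of_real pi * (of_real (log_coeff \<gamma> m) * inverse (2 * \<i>) ^ m))"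
proof -
  have hol: "log_moment \<gamma> m holomorphic_on upper_open"
    unfolding log_moment_def by (intro holomorphic_intros jost_log) auto
  have cont: "continuous_on (upper_closed - {0}) (log_moment \<gamma> m)"
    unfolding log_moment_def by (intro continuous_intros jost_log) auto
  note H = half_plane_integral[OF hol cont log_moment_strip_bound log_moment_infinity[OF m] sym s]
  show "set_integrable lborel {0<..} q" by (rule H(1))
  show "s * of_real (LINT x:{0<..}|lborel. q x) = - (\<i> * of_real pi * (of_real (log_coeff \<gamma> m) * inverse (2 * \<i>) ^ m))" by (rule H(2))
qed

lemma blaschke_coeff_even: "blaschke_coeff a (2 * j) = 0"
  by (simp add: blaschke_coeff_def)

lemma blaschke_coeff_odd: "blaschke_coeff a (2 * j + 1) = - (2 * (2 * a) ^ (2 * j + 1)) / real (2 * j + 1)"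
  by (simp add: blaschke_coeff_def)

text \<open>Even coefficients do not see the Blaschke factors, so in the integer-power identities
  the eigenvalues have to come from the arctangents in the phase.\<close>

lemma log_coeff_even: "log_coeff \<gamma> (2 * j) = l_coeff V \<gamma> (2 * j)"
  unfolding log_coeff_def blaschke_coeff_even by simp

text \<open>With \<open>h \<kappa> = \<kappa>\<^bsup>2s\<^esup>\<close> this is the sum over the eigenvalues minus \<open>M\<^sub>s(\<gamma>)\<close>.\<close>

definition psum :: "real \<Rightarrow> (real \<Rightarrow> real) \<Rightarrow> real" where
  "psum \<gamma> h = (\<Sum>\<kappa>\<in>jzeros \<gamma>. h \<kappa>) - (if \<gamma> < 0 then h \<bar>\<gamma>\<bar> else 0)"

lemma psum_cmult: "psum \<gamma> (\<lambda>\<kappa>. c * h \<kappa>) = c * psum \<gamma> h"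
  by (simp add: psum_def sum_distrib_left right_diff_distrib)

lemma psum_add: "psum \<gamma> (\<lambda>\<kappa>. h \<kappa> + g \<kappa>) = psum \<gamma> h + psum \<gamma> g"
  by (simp add: psum_def sum.distrib)

lemma psum_sum: "finite A \<Longrightarrow> psum \<gamma> (\<lambda>\<kappa>. \<Sum>i\<in>A. h i \<kappa>) = (\<Sum>i\<in>A. psum \<gamma> (h i))"
proof (induction A rule: finite_induct)
  case empty then show ?case by (simp add: psum_def)
qed (simp add: psum_add)

lemma log_coeff_odd: "log_coeff \<gamma> (2 * j + 1) = l_coeff V \<gamma> (2 * j + 1) + psum \<gamma> (\<lambda>\<kappa>. - (2 * (2 * \<kappa>) ^ (2 * j + 1)) / real (2 * j + 1))"
  unfolding log_coeff_def blaschke_coeff_odd psum_def by simp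

lemma psum_cong:
  assumes "\<And>\<kappa>. 0 < \<kappa> \<Longrightarrow> h \<kappa> = g \<kappa>" shows "psum \<gamma> h = psum \<gamma> g"
proof -
  have "(\<Sum>\<kappa>\<in>jzeros \<gamma>. h \<kappa>) = (\<Sum>\<kappa>\<in>jzeros \<gamma>. g \<kappa>)" by (rule sum.cong[OF refl]) (simp add: assms jzeros_def)
  moreover have "(if \<gamma> < 0 then h \<bar>\<gamma>\<bar> else 0) = (if \<gamma> < 0 then g \<bar>\<gamma>\<bar> else 0)"
  proof (cases "\<gamma> < 0")
    case True
    then have "h \<bar>\<gamma>\<bar> = g \<bar>\<gamma>\<bar>" by (intro assms) simp
    then show ?thesis using True by (simp only: if_True)
  qed simp
  ultimately show ?thesis unfolding psum_def by (simp only:)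
qed

lemma psum_arctan_rem_moment:
  assumes n: "1 \<le> n"
  shows "set_integrable lborel {0<..} (\<lambda>x. psum \<gamma> (\<lambda>\<kappa>. arctan_rem \<kappa> n x) * x ^ (2 * n - 1))"
    "(LINT x:{0<..}|lborel. psum \<gamma> (\<lambda>\<kappa>. arctan_rem \<kappa> n x) * x ^ (2 * n - 1)) = psum \<gamma> (\<lambda>\<kappa>. (-1) ^ n * pi * \<kappa> ^ (2 * n) / (4 * real n))"
proof -
  \<comment> \<open>The guard makes r integrable for every real \<kappa>, so that sum and integral
    can be exchanged before positivity of the zeros is invoked.\<close>
  define r where "r \<kappa> x = (if 0 < \<kappa> then arctan_rem \<kappa> n x else 0) * x ^ (2 * n - 1)" for \<kappa> x
  have r1: "set_integrable lborel {0<..} (r \<kappa>)" for \<kappa>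
  proof (cases "0 < \<kappa>")
    case True then show ?thesis using arctan_rem_moment(1)[OF True n] by (simp add: r_def[abs_def])
  qed (simp add: r_def[abs_def] set_integrable_def)
  have r2: "(LINT x:{0<..}|lborel. r \<kappa> x) = (-1) ^ n * pi * \<kappa> ^ (2 * n) / (4 * real n)" if "0 < \<kappa>" for \<kappa>
    using arctan_rem_moment(2)[OF that n] that by (simp add: r_def)
  have e: "psum \<gamma> (\<lambda>\<kappa>. arctan_rem \<kappa> n x) * x ^ (2 * n - 1) = psum \<gamma> (\<lambda>\<kappa>. r \<kappa> x)" for x
  proof -
    have "psum \<gamma> (\<lambda>\<kappa>. arctan_rem \<kappa> n x) * x ^ (2 * n - 1) = psum \<gamma> (\<lambda>\<kappa>. x ^ (2 * n - 1) * arctan_rem \<kappa> n x)"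
      by (simp add: psum_cmult)
    also have "\<dots> = psum \<gamma> (\<lambda>\<kappa>. r \<kappa> x)" by (rule psum_cong) (simp add: r_def)
    finally show ?thesis .
  qed
  have i: "set_integrable lborel {0<..} (\<lambda>x. \<Sum>\<kappa>\<in>jzeros \<gamma>. r \<kappa> x)" "set_integrable lborel {0<..} (\<lambda>x. if \<gamma> < 0 then r \<bar>\<gamma>\<bar> x else 0)"
  proof -
    show "set_integrable lborel {0<..} (\<lambda>x. \<Sum>\<kappa>\<in>jzeros \<gamma>. r \<kappa> x)"
      using r1 unfolding set_integrable_def by (simp add: sum_distrib_left)
    show "set_integrable lborel {0<..} (\<lambda>x. if \<gamma> < 0 then r \<bar>\<gamma>\<bar> x else 0)"
      by (cases "\<gamma> < 0") (simp_all add: r1, simp add: set_integrable_def)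
  qed
  show "set_integrable lborel {0<..} (\<lambda>x. psum \<gamma> (\<lambda>\<kappa>. arctan_rem \<kappa> n x) * x ^ (2 * n - 1))"
    unfolding e unfolding psum_def using i by (rule set_integral_diff)
  have "(LINT x:{0<..}|lborel. psum \<gamma> (\<lambda>\<kappa>. r \<kappa> x)) = (LINT x:{0<..}|lborel. \<Sum>\<kappa>\<in>jzeros \<gamma>. r \<kappa> x) - (LINT x:{0<..}|lborel. if \<gamma> < 0 then r \<bar>\<gamma>\<bar> x else 0)"
    unfolding psum_def using i by (rule set_integral_diff)
  also have "(LINT x:{0<..}|lborel. \<Sum>\<kappa>\<in>jzeros \<gamma>. r \<kappa> x) = (\<Sum>\<kappa>\<in>jzeros \<gamma>. LINT x:{0<..}|lborel. r \<kappa> x)"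
    using r1 unfolding set_integrable_def set_lebesgue_integral_def by (simp add: sum_distrib_left)
  also have "(LINT x:{0<..}|lborel. if \<gamma> < 0 then r \<bar>\<gamma>\<bar> x else 0) = (if \<gamma> < 0 then LINT x:{0<..}|lborel. r \<bar>\<gamma>\<bar> x else 0)"
    by (simp add: set_lebesgue_integral_def)
  finally have "(LINT x:{0<..}|lborel. psum \<gamma> (\<lambda>\<kappa>. r \<kappa> x)) = psum \<gamma> (\<lambda>\<kappa>. LINT x:{0<..}|lborel. r \<kappa> x)" by (simp add: psum_def)
  also have "\<dots> = psum \<gamma> (\<lambda>\<kappa>. (-1) ^ n * pi * \<kappa> ^ (2 * n) / (4 * real n))" by (rule psum_cong) (rule r2)
  finally show "(LINT x:{0<..}|lborel. psum \<gamma> (\<lambda>\<kappa>. arctan_rem \<kappa> n x) * x ^ (2 * n - 1)) = psum \<gamma> (\<lambda>\<kappa>. (-1) ^ n * pi * \<kappa> ^ (2 * n) / (4 * real n))"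
    unfolding e .
qed

lemma Re_mom:
  assumes x: "0 < x"
  shows "Re (log_moment \<gamma> (2 * n + 1) (of_real x)) = (ln (limit_amplitude V \<gamma> x) - (\<Sum>j=1..n. (-1) ^ j * l_coeff V \<gamma> (2*j) / (2*x) ^ (2*j))) * x ^ (2*n)"
proof -
  let ?T = "\<lambda>j. Re (of_real (log_coeff \<gamma> j) * inverse (2 * \<i> * of_real x) ^ j)"
  have "Re (log_moment \<gamma> (2 * n + 1) (of_real x)) = (Re (jost_log \<gamma> (of_real x)) - (\<Sum>j=1..2*n. ?T j)) * x ^ (2 * n)"
    unfolding log_moment_def of_real_power[symmetric] by (simp add: mult.commute del: of_real_power inverse_mult_distrib)
  also have "(\<Sum>j=1..2*n. ?T j) = (\<Sum>j=1..n. ?T (2 * j))"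
    by (rule sum_odd_zero) (simp only: inverse_2i_power, simp)
  also have "\<dots> = (\<Sum>j=1..n. (-1) ^ j * l_coeff V \<gamma> (2*j) / (2*x) ^ (2*j))"
    by (rule sum.cong[OF refl]) (simp only: inverse_2i_power log_coeff_even of_real_mult[symmetric] Re_complex_of_real, simp)
  finally show ?thesis by (simp add: limit_amplitude_eq[OF x])
qed

text \<open>Case m = 2 n + 1. On the real line the Blaschke factors do not affect ln a; the powers
  of the zeros and of |\<gamma>| enter through \<open>log_coeff\<close> alone. The case n = 0 is
  included, with no subtraction.\<close>

lemma amplitude_trace:
  "set_integrable lborel {0<..} (\<lambda>k. (ln (limit_amplitude V \<gamma> k) - (\<Sum>j=1..n. (-1) ^ j * l_coeff V \<gamma> (2*j) / (2*k) ^ (2*j))) * k ^ (2*n))"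
  "psum \<gamma> (\<lambda>\<kappa>. \<kappa> ^ (2 * n + 1)) + (-1) ^ (n + 1) * ((2 * real n + 1) / pi) *
     (LINT k:{0<..}|lborel. (ln (limit_amplitude V \<gamma> k) - (\<Sum>j=1..n. (-1) ^ j * l_coeff V \<gamma> (2*j) / (2*k) ^ (2*j))) * k ^ (2*n))
   = (2 * real n + 1) / 2 ^ (2 * n + 2) * l_coeff V \<gamma> (2 * n + 1)"
proof -
  let ?q = "\<lambda>k. (ln (limit_amplitude V \<gamma> k) - (\<Sum>j=1..n. (-1) ^ j * l_coeff V \<gamma> (2*j) / (2*k) ^ (2*j))) * k ^ (2*n)"
  have sym: "log_moment \<gamma> (2 * n + 1) (of_real x) + log_moment \<gamma> (2 * n + 1) (- of_real x) = 2 * of_real (?q x)" if "0 < x" for x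
    unfolding log_moment_minus[OF that] Re_mom[OF that, symmetric] by (simp add: complex_add_cnj)
  note M = log_moment_integral[of "2 * n + 1" 2 \<gamma> ?q, OF _ _ sym]
  show "set_integrable lborel {0<..} ?q" by (rule M(1)) auto
  define I where "I = (LINT x:{0<..}|lborel. ?q x)"
  have "2 * complex_of_real I = - (\<i> * of_real pi * (of_real (log_coeff \<gamma> (2 * n + 1)) * inverse (2 * \<i>) ^ (2 * n + 1)))"
    unfolding I_def by (rule M(2)) auto
  also have "inverse (2 * \<i>) ^ (2 * n + 1) = \<i> * of_real ((-1) ^ (n + 1) / 2 ^ (2 * n + 1))"
    using inverse_2i_power(2)[of 1 n] by simp
  also have "- (\<i> * of_real pi * (of_real (log_coeff \<gamma> (2 * n + 1)) * (\<i> * of_real ((-1) ^ (n + 1) / 2 ^ (2 * n + 1)))))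
     = - ((\<i> * \<i>) * (of_real pi * (of_real (log_coeff \<gamma> (2 * n + 1)) * of_real ((-1) ^ (n + 1) / 2 ^ (2 * n + 1)))))"
    by (simp only: mult_ac)
  finally have "complex_of_real (2 * I) = of_real (pi * (log_coeff \<gamma> (2 * n + 1) * ((-1) ^ (n + 1) / 2 ^ (2 * n + 1))))"
    by (simp only: i_squared of_real_mult of_real_numeral) simp
  then have I: "2 * I = pi * (log_coeff \<gamma> (2 * n + 1) * ((-1) ^ (n + 1) / 2 ^ (2 * n + 1)))" by (simp only: of_real_eq_iff)
  have s: "(-1) ^ (n + 1) * (-1) ^ (n + 1) = (1::real)" by (simp add: power_mult_distrib[symmetric])
  have g: "log_coeff \<gamma> (2 * n + 1) = l_coeff V \<gamma> (2 * n + 1) - 2 * 2 ^ (2 * n + 1) / (2 * real n + 1) * psum \<gamma> (\<lambda>\<kappa>. \<kappa> ^ (2 * n + 1))"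
  proof -
    have "psum \<gamma> (\<lambda>\<kappa>. - (2 * (2 * \<kappa>) ^ (2 * n + 1)) / real (2 * n + 1)) = psum \<gamma> (\<lambda>\<kappa>. (- 2 * 2 ^ (2 * n + 1) / (2 * real n + 1)) * \<kappa> ^ (2 * n + 1))"
      by (rule psum_cong) (simp add: power_mult_distrib add.commute)
    then show ?thesis unfolding log_coeff_odd psum_cmult by simp
  qed
  have "(-1) ^ (n + 1) * ((2 * real n + 1) / pi) * I = (2 * real n + 1) / (2 * pi) * ((-1) ^ (n + 1) * (2 * I))" by simp
  also have "\<dots> = (2 * real n + 1) / (2 * pi) * (((-1) ^ (n + 1) * (-1) ^ (n + 1)) * (pi * (log_coeff \<gamma> (2 * n + 1) / 2 ^ (2 * n + 1))))"
    unfolding I by (simp only: mult_ac times_divide_eq_right)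
  also have "\<dots> = (2 * real n + 1) * log_coeff \<gamma> (2 * n + 1) / 2 ^ (2 * n + 2)" unfolding s by simp
  also have "\<dots> = (2 * real n + 1) / 2 ^ (2 * n + 2) * l_coeff V \<gamma> (2 * n + 1) - psum \<gamma> (\<lambda>\<kappa>. \<kappa> ^ (2 * n + 1))"
  proof -
    have "(2 * real n + 1) * (2 * 2 ^ (2 * n + 1) / (2 * real n + 1) * P) / 2 ^ (2 * n + 2) = P" for P
      by (simp add: add_nonneg_eq_0_iff)
    then show ?thesis unfolding g by (simp only: right_diff_distrib diff_divide_distrib times_divide_eq_left)
  qed
  finally show "psum \<gamma> (\<lambda>\<kappa>. \<kappa> ^ (2 * n + 1)) + (-1) ^ (n + 1) * ((2 * real n + 1) / pi) * (LINT k:{0<..}|lborel. ?q k)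
   = (2 * real n + 1) / 2 ^ (2 * n + 2) * l_coeff V \<gamma> (2 * n + 1)"
    unfolding I_def[symmetric] by simp
qed

text \<open>The Blaschke parts of the odd coefficients are exactly the series terms of the
  arctangents separating \<open>limit_phase\<close> from the argument of the outer factor; combined,
  the two give \<open>arctan_rem\<close>.\<close>

lemma Im_mom:
  assumes x: "0 < x" and n: "1 \<le> n"
  shows "Im (log_moment \<gamma> (2 * n) (of_real x)) =
     (limit_phase V \<gamma> x - (\<Sum>j=0..n-1. (-1) ^ (j + 1) * l_coeff V \<gamma> (2*j + 1) / (2*x) ^ (2*j + 1))) * x ^ (2*n - 1)
     + 2 * (psum \<gamma> (\<lambda>\<kappa>. arctan_rem \<kappa> n x) * x ^ (2 * n - 1))"
proof -
  let ?T = "\<lambda>j. Im (of_real (log_coeff \<gamma> j) * inverse (2 * \<i> * of_real x) ^ j)"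
  let ?t = "\<lambda>\<kappa> j. (-1) ^ j * (\<kappa> / x) ^ (2 * j + 1) / real (2 * j + 1)"
  have n1: "2 * n - 1 = 2 * (n - 1) + 1" using n by simp
  have "Im (log_moment \<gamma> (2 * n) (of_real x)) = (Im (jost_log \<gamma> (of_real x)) - (\<Sum>j=1..2*n-1. ?T j)) * x ^ (2 * n - 1)"
    unfolding log_moment_def of_real_power[symmetric] by (simp add: mult.commute del: of_real_power inverse_mult_distrib)
  also have "(\<Sum>j=1..2*n-1. ?T j) = (\<Sum>j=0..n-1. ?T (2 * j + 1))"
    unfolding n1 by (rule sum_even_zero) (simp only: inverse_2i_power of_real_mult[symmetric] Im_complex_of_real)
  also have "\<dots> = (\<Sum>j=0..n-1. (-1) ^ (j + 1) * l_coeff V \<gamma> (2*j + 1) / (2*x) ^ (2*j + 1) + 2 * psum \<gamma> (\<lambda>\<kappa>. ?t \<kappa> j))"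
  proof (rule sum.cong[OF refl])
    fix j
    have "?T (2 * j + 1) = log_coeff \<gamma> (2 * j + 1) * ((-1) ^ (j + 1) / (2*x) ^ (2*j + 1))"
      unfolding inverse_2i_power by simp
    also have "\<dots> = (-1) ^ (j + 1) * l_coeff V \<gamma> (2*j + 1) / (2*x) ^ (2*j + 1)
       + ((-1) ^ (j + 1) / (2*x) ^ (2*j + 1)) * psum \<gamma> (\<lambda>\<kappa>. - (2 * (2 * \<kappa>) ^ (2 * j + 1)) / real (2 * j + 1))"
    proof -
      have "(l + P) * (s / d) = s * l / d + (s / d) * P" for l P s d :: real by (simp add: add_divide_distrib ring_distribs mult.commute)
      then show ?thesis unfolding log_coeff_odd .
    qed
    also have "((-1) ^ (j + 1) / (2*x) ^ (2*j + 1)) * psum \<gamma> (\<lambda>\<kappa>. - (2 * (2 * \<kappa>) ^ (2 * j + 1)) / real (2 * j + 1)) = psum \<gamma> (\<lambda>\<kappa>. 2 * ?t \<kappa> j)"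
      unfolding psum_cmult[symmetric]
    proof (rule psum_cong)
      fix \<kappa> :: real
      have "(\<kappa> / x) ^ (2 * j + 1) = (2 * \<kappa>) ^ (2 * j + 1) / (2 * x) ^ (2 * j + 1)" by (simp only: power_divide[symmetric]) simp
      then show "(-1) ^ (j + 1) / (2*x) ^ (2*j + 1) * (- (2 * (2 * \<kappa>) ^ (2 * j + 1)) / real (2 * j + 1)) = 2 * ?t \<kappa> j"
        by (simp add: field_simps)
    qed
    finally show "?T (2 * j + 1) = (-1) ^ (j + 1) * l_coeff V \<gamma> (2*j + 1) / (2*x) ^ (2*j + 1) + 2 * psum \<gamma> (\<lambda>\<kappa>. ?t \<kappa> j)"
      unfolding psum_cmult .
  qed
  also have "\<dots> = (\<Sum>j=0..n-1. (-1) ^ (j + 1) * l_coeff V \<gamma> (2*j + 1) / (2*x) ^ (2*j + 1)) + 2 * psum \<gamma> (\<lambda>\<kappa>. \<Sum>j<n. ?t \<kappa> j)"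
  proof -
    have "{0..n-1} = {..<n}" using n by auto
    then show ?thesis by (simp only: sum.distrib sum_distrib_left[symmetric] psum_sum[OF finite_lessThan])
  qed
  also have "Im (jost_log \<gamma> (of_real x)) = limit_phase V \<gamma> x + 2 * psum \<gamma> (\<lambda>\<kappa>. arctan (\<kappa> / x))"
    unfolding limit_phase_eq phase_def psum_def using x by (simp add: sum_distrib_left)
  also have "psum \<gamma> (\<lambda>\<kappa>. arctan (\<kappa> / x)) = psum \<gamma> (\<lambda>\<kappa>. arctan_rem \<kappa> n x) + psum \<gamma> (\<lambda>\<kappa>. \<Sum>j<n. ?t \<kappa> j)"
    unfolding psum_add[symmetric] arctan_rem_def by simp
  finally show ?thesis by (simp add: algebra_simps)
qed

text \<open>Case m = 2 n. Cauchy's theorem gives the integral of the phase term together with the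
  arctangent remainders; subtracting the known moment of the latter yields both integrability and
  the power sums.\<close>

lemma phase_trace:
  assumes n: "1 \<le> n"
  shows "set_integrable lborel {0<..} (\<lambda>k. (limit_phase V \<gamma> k - (\<Sum>j=0..n-1. (-1) ^ (j + 1) * l_coeff V \<gamma> (2*j + 1) / (2*k) ^ (2*j + 1))) * k ^ (2*n - 1))"
    "psum \<gamma> (\<lambda>\<kappa>. \<kappa> ^ (2 * n)) + (-1) ^ n * (2 * real n / pi) *
      (LINT k:{0<..}|lborel. (limit_phase V \<gamma> k - (\<Sum>j=0..n-1. (-1) ^ (j + 1) * l_coeff V \<gamma> (2*j + 1) / (2*k) ^ (2*j + 1))) * k ^ (2*n - 1))
     = - (real n / 2 ^ (2*n)) * l_coeff V \<gamma> (2*n)"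
proof -
  let ?p = "\<lambda>k. (limit_phase V \<gamma> k - (\<Sum>j=0..n-1. (-1) ^ (j + 1) * l_coeff V \<gamma> (2*j + 1) / (2*k) ^ (2*j + 1))) * k ^ (2*n - 1)"
  let ?r = "\<lambda>x. psum \<gamma> (\<lambda>\<kappa>. arctan_rem \<kappa> n x) * x ^ (2 * n - 1)"
  let ?q = "\<lambda>x. ?p x + 2 * ?r x"
  have sym: "log_moment \<gamma> (2 * n) (of_real x) + log_moment \<gamma> (2 * n) (- of_real x) = (2 * \<i>) * of_real (?q x)" if "0 < x" for x
  proof -
    have "(-1) ^ (2 * n - 1) = (-1::complex)" using n by simp
    then show ?thesis unfolding log_moment_minus[OF that] Im_mom[OF that n, symmetric] by (simp add: complex_diff_cnj)
  qed
  note M = log_moment_integral[of "2 * n" "2 * \<i>" \<gamma> ?q, OF _ _ sym]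
  have q: "set_integrable lborel {0<..} ?q" by (rule M(1)) (use n in auto)
  define I where "I = (LINT x:{0<..}|lborel. ?q x)"
  have "2 * \<i> * complex_of_real I = - (\<i> * of_real pi * (of_real (log_coeff \<gamma> (2 * n)) * inverse (2 * \<i>) ^ (2 * n)))"
    unfolding I_def by (rule M(2)) (use n in auto)
  also have "inverse (2 * \<i>) ^ (2 * n) = of_real ((-1) ^ n / 2 ^ (2 * n))"
    using inverse_2i_power(1)[of 1 n] by simp
  finally have "\<i> * complex_of_real (2 * I) = \<i> * of_real (- (pi * (log_coeff \<gamma> (2 * n) * ((-1) ^ n / 2 ^ (2 * n)))))"
    by (simp only: of_real_mult of_real_minus of_real_numeral mult_minus_right mult_ac)
  then have "complex_of_real (2 * I) = of_real (- (pi * (log_coeff \<gamma> (2 * n) * ((-1) ^ n / 2 ^ (2 * n)))))"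
    by (simp only: mult_cancel_left complex_i_not_zero simp_thms)
  then have I: "2 * I = - (pi * (l_coeff V \<gamma> (2 * n) * ((-1) ^ n / 2 ^ (2 * n))))" unfolding log_coeff_even by (simp only: of_real_eq_iff)
  have r: "set_integrable lborel {0<..} (\<lambda>x. 2 * ?r x)"
    using psum_arctan_rem_moment(1)[OF n, of \<gamma>] by (rule set_integrable_mult_right)
  have p: "?p = (\<lambda>x. ?q x - 2 * ?r x)" by simp
  show "set_integrable lborel {0<..} ?p" by (subst p) (rule set_integral_diff[OF q r])
  have s: "(-1) ^ n * (-1) ^ n = (1::real)" by (simp add: power_mult_distrib[symmetric])
  have "(LINT x:{0<..}|lborel. ?p x) = I - (LINT x:{0<..}|lborel. 2 * ?r x)"
    unfolding I_def by (subst p) (rule set_integral_diff[OF q r])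
  also have "(LINT x:{0<..}|lborel. 2 * ?r x) = 2 * psum \<gamma> (\<lambda>\<kappa>. (-1) ^ n * pi * \<kappa> ^ (2 * n) / (4 * real n))"
    unfolding psum_arctan_rem_moment(2)[OF n, of \<gamma>, symmetric] by (rule set_integral_mult_right)
  also have "psum \<gamma> (\<lambda>\<kappa>. (-1) ^ n * pi * \<kappa> ^ (2 * n) / (4 * real n)) = psum \<gamma> (\<lambda>\<kappa>. (-1) ^ n * (pi / (4 * real n)) * \<kappa> ^ (2 * n))"
    by (rule psum_cong) simp
  also have "\<dots> = (-1) ^ n * (pi / (4 * real n)) * psum \<gamma> (\<lambda>\<kappa>. \<kappa> ^ (2 * n))" by (rule psum_cmult)
  finally have P: "(LINT x:{0<..}|lborel. ?p x) = I - 2 * ((-1) ^ n * (pi / (4 * real n)) * psum \<gamma> (\<lambda>\<kappa>. \<kappa> ^ (2 * n)))" .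
  have a: "(-1) ^ n * (2 * real n / pi) * I = - (real n / 2 ^ (2*n)) * l_coeff V \<gamma> (2*n)"
  proof -
    have "(-1) ^ n * (2 * real n / pi) * I = real n / pi * ((-1) ^ n * (2 * I))" by simp
    also have "\<dots> = real n / pi * (- (((-1) ^ n * (-1) ^ n) * (pi * (l_coeff V \<gamma> (2 * n) / 2 ^ (2 * n)))))"
      unfolding I by (simp only: mult_ac times_divide_eq_right mult_minus_right)
    finally show ?thesis unfolding s by simp
  qed
  have b: "(-1) ^ n * (2 * real n / pi) * (2 * ((-1) ^ n * (pi / (4 * real n)) * P)) = P" for P
  proof -
    have "(-1) ^ n * (2 * real n / pi) * (2 * ((-1) ^ n * (pi / (4 * real n)) * P)) = ((-1) ^ n * (-1) ^ n) * ((2 * real n / pi) * (2 * (pi / (4 * real n))) * P)"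
      by (simp only: mult_ac)
    also have "\<dots> = P" unfolding s using n by simp
    finally show ?thesis .
  qed
  show "psum \<gamma> (\<lambda>\<kappa>. \<kappa> ^ (2 * n)) + (-1) ^ n * (2 * real n / pi) * (LINT k:{0<..}|lborel. ?p k)
     = - (real n / 2 ^ (2*n)) * l_coeff V \<gamma> (2*n)"
    unfolding P right_diff_distrib a b by simp
qed

section \<open>From zeros of the Jost function to eigenvalue sums\<close>

lemma eigenvalue_sum:
  "finite (neg_eigenvalues V \<gamma>)"
  "(\<Sum>ev\<in>neg_eigenvalues V \<gamma>. h \<bar>ev\<bar>) = (\<Sum>\<kappa>\<in>jzeros \<gamma>. h (\<kappa>\<^sup>2))"
proof -
  have "bounded_class \<rho> 0 V" using rho V_decay[of 0] by (intro decay_0_imp_bounded_0) auto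
  then obtain B where "\<And>x. 0 \<le> x \<Longrightarrow> \<bar>V x\<bar> \<le> B" by auto
  then have e: "neg_eigenvalues V \<gamma> = (\<lambda>\<kappa>. - (\<kappa>\<^sup>2)) ` jzeros \<gamma>" by (rule neg_eigenvalues_eq)
  have inj: "inj_on (\<lambda>\<kappa>. - (\<kappa>\<^sup>2)) (jzeros \<gamma>)"
    by (rule inj_onI) (auto simp: jzeros_def power2_eq_iff)
  show "finite (neg_eigenvalues V \<gamma>)" unfolding e using finite_jzeros by simp
  show "(\<Sum>ev\<in>neg_eigenvalues V \<gamma>. h \<bar>ev\<bar>) = (\<Sum>\<kappa>\<in>jzeros \<gamma>. h (\<kappa>\<^sup>2))"
    unfolding e sum.reindex[OF inj] by simp
qed

lemma trace_psum:
  "(\<Sum>ev\<in>neg_eigenvalues V \<gamma>. \<bar>ev\<bar> ^ n) - M_term (real n) \<gamma> = psum \<gamma> (\<lambda>\<kappa>. \<kappa> ^ (2 * n))"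
  "(\<Sum>ev\<in>neg_eigenvalues V \<gamma>. \<bar>ev\<bar> powr (real n + 1/2)) - M_term (real n + 1/2) \<gamma> = psum \<gamma> (\<lambda>\<kappa>. \<kappa> ^ (2 * n + 1))"
proof -
  have "M_term (real n) \<gamma> = (if \<gamma> < 0 then \<bar>\<gamma>\<bar> ^ (2 * n) else 0)"
    using powr_realpow[of "- \<gamma>" "2 * n"] by (auto simp: M_term_def)
  then show "(\<Sum>ev\<in>neg_eigenvalues V \<gamma>. \<bar>ev\<bar> ^ n) - M_term (real n) \<gamma> = psum \<gamma> (\<lambda>\<kappa>. \<kappa> ^ (2 * n))"
    unfolding eigenvalue_sum(2)[where h = "\<lambda>t. t ^ n"] psum_def by (simp add: power_mult)
  have p: "(\<kappa>\<^sup>2) powr (real n + 1/2) = \<kappa> ^ (2 * n + 1)" if "0 < \<kappa>" for \<kappa> :: real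
  proof -
    have "\<kappa>\<^sup>2 = \<kappa> powr 2" using that powr_realpow[of \<kappa> 2] by simp
    then have "(\<kappa>\<^sup>2) powr (real n + 1/2) = \<kappa> powr (real (2 * n + 1))" by (simp only: powr_powr) (simp add: algebra_simps)
    then show ?thesis using powr_realpow[OF that] by metis
  qed
  have "M_term (real n + 1/2) \<gamma> = (if \<gamma> < 0 then \<bar>\<gamma>\<bar> ^ (2 * n + 1) else 0)"
    using powr_realpow[of "- \<gamma>" "2 * n + 1"] by (auto simp: M_term_def algebra_simps)
  moreover have "(\<Sum>\<kappa>\<in>jzeros \<gamma>. (\<kappa>\<^sup>2) powr (real n + 1/2)) = (\<Sum>\<kappa>\<in>jzeros \<gamma>. \<kappa> ^ (2 * n + 1))"
    by (rule sum.cong[OF refl]) (rule p, simp add: jzeros_def)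
  ultimately show "(\<Sum>ev\<in>neg_eigenvalues V \<gamma>. \<bar>ev\<bar> powr (real n + 1/2)) - M_term (real n + 1/2) \<gamma> = psum \<gamma> (\<lambda>\<kappa>. \<kappa> ^ (2 * n + 1))"
    unfolding eigenvalue_sum(2)[where h = "\<lambda>t. t powr (real n + 1/2)"] psum_def by simp
qed

end

theorem theorem5p3:
  fixes V :: "real \<Rightarrow> real" and \<gamma> \<rho> :: real and C :: "nat \<Rightarrow> real"
  assumes smooth: "smooth_half V"
    and moment: "set_integrable lborel {0..} (\<lambda>x. (1 + x) * \<bar>V x\<bar>)"
    and rho: "1 < \<rho>" "\<rho> \<le> 2"
    and decay: "\<And>j x. 0 \<le> x \<Longrightarrow>
      \<bar>(half_deriv ^^ j) V x\<bar> \<le> C j * (1 + x) powr (- \<rho> - real j)"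
  shows "finite (neg_eigenvalues V \<gamma>) \<and>
    (set_integrable lborel {0<..} (\<lambda>k. ln (limit_amplitude V \<gamma> k)) \<and>
     (\<Sum>ev\<in>neg_eigenvalues V \<gamma>. \<bar>ev\<bar> powr (1/2)) - M_term (1/2) \<gamma>
       - 1 / pi * (LINT k:{0<..}|lborel. ln (limit_amplitude V \<gamma> k))
       = 1 / 4 * l_coeff V \<gamma> 1) \<and>
    (\<forall>n\<ge>1.
      set_integrable lborel {0<..} (\<lambda>k. (limit_phase V \<gamma> k -
        (\<Sum>j=0..n-1. (-1) ^ (j + 1) * l_coeff V \<gamma> (2*j + 1) / (2*k) ^ (2*j + 1))) * k ^ (2*n - 1)) \<and>
      (\<Sum>ev\<in>neg_eigenvalues V \<gamma>. \<bar>ev\<bar> ^ n) - M_term (real n) \<gamma>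
       + (-1) ^ n * (2 * real n / pi) *
         (LINT k:{0<..}|lborel. (limit_phase V \<gamma> k -
           (\<Sum>j=0..n-1. (-1) ^ (j + 1) * l_coeff V \<gamma> (2*j + 1) / (2*k) ^ (2*j + 1))) * k ^ (2*n - 1))
       = - (real n / 2 ^ (2*n)) * l_coeff V \<gamma> (2*n)) \<and>
    (\<forall>n\<ge>1.
      set_integrable lborel {0<..} (\<lambda>k. (ln (limit_amplitude V \<gamma> k) -
        (\<Sum>j=1..n. (-1) ^ j * l_coeff V \<gamma> (2*j) / (2*k) ^ (2*j))) * k ^ (2*n)) \<and>
      (\<Sum>ev\<in>neg_eigenvalues V \<gamma>. \<bar>ev\<bar> powr (real n + 1/2)) - M_term (real n + 1/2) \<gamma>
       + (-1) ^ (n + 1) * ((2 * real n + 1) / pi) *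
         (LINT k:{0<..}|lborel. (ln (limit_amplitude V \<gamma> k) -
           (\<Sum>j=1..n. (-1) ^ j * l_coeff V \<gamma> (2*j) / (2*k) ^ (2*j))) * k ^ (2*n))
       = (2 * real n + 1) / 2 ^ (2*n + 2) * l_coeff V \<gamma> (2*n + 1))"
proof -
  have d: "decay_class \<rho> k V" for k
    using smooth_imp_decay_class[of V C \<rho> k 0] smooth decay by simp
  interpret smooth_potential V \<rho>
  proof
    show "continuous_on {0..} V" using d[of 0] by simp
  qed (use moment rho(1) d in auto)
  \<comment> \<open>The first identity is the amplitude identity at n = 0, where the subtracted sum
    is empty and the power of k is 1.\<close>
  have "psum \<gamma> (\<lambda>\<kappa>. \<kappa> ^ (2 * 0 + 1)) = (\<Sum>ev\<in>neg_eigenvalues V \<gamma>. \<bar>ev\<bar> powr (1/2)) - M_term (1/2) \<gamma>"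
    using trace_psum(2)[where \<gamma> = \<gamma> and n = 0] by simp
  with amplitude_trace[where \<gamma> = \<gamma> and n = 0] have 0: "set_integrable lborel {0<..} (\<lambda>k. ln (limit_amplitude V \<gamma> k)) \<and>
     (\<Sum>ev\<in>neg_eigenvalues V \<gamma>. \<bar>ev\<bar> powr (1/2)) - M_term (1/2) \<gamma>
       - 1 / pi * (LINT k:{0<..}|lborel. ln (limit_amplitude V \<gamma> k)) = 1 / 4 * l_coeff V \<gamma> 1"
    by simp
  show ?thesis
    using eigenvalue_sum(1) 0 phase_trace[where \<gamma> = \<gamma>] amplitude_trace[where \<gamma> = \<gamma>]
    unfolding trace_psum by blast
qed

end
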